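(* Let $d\geq1$, $s\in(0,1)$, $0<\alpha\leq\beta$, $\Omega\subseteq\mathbb{R}^d$ open and bounded, $\mathbf{A}_0\in\mathcal{M}(\alpha,\beta;\mathbb{R}^d)$, and let $(f_n)_{n\in\mathbb{N}}$ be a countable family of nonzero elements dense in $H^{-s}(\Omega)$. For $\mathbf{A},\mathbf{B}\in\mathcal{M}(\alpha,\beta;\Omega,\mathbf{A}_0)$ define $$d_s(\mathbf{A},\mathbf{B})=\sum_{n=1}^\infty 2^{-n}\frac{\|u_n-v_n\|_{L^2(\Omega)}+\|\mathbf{A}\nabla^su_n-\mathbf{B}\nabla^sv_n\|_{H^{-s}(\Omega)}}{\|f_n\|_{H^{-s}(\Omega)}},$$ where $u_n,v_n\in H^s_0(\Omega)$ are the solutions of $-\mathrm{div}^s(\mathbf{A}\nabla^su_n)=f_n$ and $-\mathrm{div}^s(\mathbf{B}\nabla^sv_n)=f_n$. Then $d_s$ is a metric on $\mathcal{M}(\alpha,\beta;\Omega,\mathbf{A}_0)$ generating the $H^s$-topology; that is, for $(\mathbf{A}_m)_m$ in $\mathcal{M}(\alpha,\beta;\Omega,\mathbf{A}_0)$ and $\mathbf{A}\in\mathcal{M}(\alpha,\beta;\Omega,\mathbf{A}_0)$, $d_s(\mathbf{A}_m,\mathbf{A})\to0$ if and only if $(\mathbf{A}_m)_m$ $H^s$-converges to $\mathbf{A}$ in $\Omega$.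
   Context: For an open set $U\subseteq\mathbb{R}^d$, $\mathcal{M}(\alpha,\beta;U)$ denotes the set of $\mathbf{A}\in L^\infty(U;\mathbb{R}^{d\times d})$ such that for every $\xi\in\mathbb{R}^d$ and a.e. $x\in U$: $\mathbf{A}(x)\xi\cdot\xi\geq\alpha|\xi|^2$ and $\mathbf{A}(x)\xi\cdot\xi\geq\frac1\beta|\mathbf{A}(x)\xi|^2$. $\mathcal{M}(\alpha,\beta;\Omega,\mathbf{A}_0)=\{\mathbf{A}\in\mathcal{M}(\alpha,\beta;\mathbb{R}^d):\mathbf{A}=\mathbf{A}_0\text{ a.e. on }\mathbb{R}^d\setminus\Omega\}$. Fractional gradient: for $\varphi\in C_c^\infty(\mathbb{R}^d)$, $\nabla^s\varphi(x)=\mu_s\int_{\mathbb{R}^d}\frac{(\varphi(x)-\varphi(y))(x-y)}{|x-y|^{d+s+1}}\,dy$ with $\mu_s=2^s\pi^{-d/2}\frac{\Gamma((d+s+1)/2)}{\Gamma((1-s)/2)}$. $H^s(\mathbb{R}^d)$ is the completion of $C_c^\infty(\mathbb{R}^d)$ under $\|u\|_s=(\|u\|_{L^2}^2+\|\nabla^s u\|_{L^2}^2)^{1/2}$, with $\nabla^s$ extended continuously to $H^s(\mathbb{R}^d)\to L^2(\mathbb{R}^d;\mathbb{R}^d)$. $H^s_0(\Omega)$ is the closure of $C_c^\infty(\Omega)$ in $H^s(\mathbb{R}^d)$ and $H^{-s}(\Omega)$ its dual (with the dual norm). In the formula for $d_s$, the vector field $\mathbf{A}\nabla^s u_n-\mathbf{B}\nabla^s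 v_n\in L^2(\mathbb{R}^d)^d$ is restricted to $\Omega$ and measured in $H^{-s}(\Omega)^d$ via $L^2(\Omega)\hookrightarrow H^{-s}(\Omega)$. For $\mathbf{B}\in\mathcal{M}(\alpha,\beta;\mathbb{R}^d)$ and $f\in H^{-s}(\Omega)$, $u\in H^s_0(\Omega)$ solves $-\mathrm{div}^s(\mathbf{B}\nabla^s u)=f$ if $\int_{\mathbb{R}^d}\mathbf{B}\nabla^s u\cdot\nabla^s v\,dx=\langle f,v\rangle$ for all $v\in H^s_0(\Omega)$; such $u$ exists uniquely. $H^s$-convergence: $(\mathbf{A}_m)_m$ $H^s$-converges to $\mathbf{A}$ in $\Omega$ if for every $f\in H^{-s}(\Omega)$ the solutions $u_m,u\in H^s_0(\Omega)$ of $-\mathrm{div}^s(\mathbf{A}_m\nabla^su_m)=f$, $-\mathrm{div}^s(\mathbf{A}\nabla^su)=f$ satisfy $u_m\rightharpoonup u$ weakly in $H^s_0(\Omega)$ and $\mathbf{A}_m\nabla^s u_m\rightharpoonup\mathbf{A}\nabla^s u$ weakly in $L^2(\mathbb{R}^d;\mathbb{R}^d)$. *)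

theory Defs
  imports "HOL-Analysis.Analysis"
begin

text \<open>R^d is modelled by a Euclidean space type 'a, with d = DIM('a) \<ge> 1.
  Functions are genuine functions; elements of L^2, H^s etc. are their a.e.-classes,
  all notions below are insensitive to a.e. modification.\<close>

coinductive smooth_fun :: "('a::euclidean_space \<Rightarrow> real) \<Rightarrow> bool" where
  "(\<forall>x. f differentiable (at x)) \<Longrightarrow>
   (\<forall>v. smooth_fun (\<lambda>x. frechet_derivative f (at x) v)) \<Longrightarrow> smooth_fun f"

definition Cc_inf :: "'a::euclidean_space set \<Rightarrow> ('a \<Rightarrow> real) set" where
  "Cc_inf U = {\<phi>. smooth_fun \<phi> \<and> compact (closure {x. \<phi> x \<noteq> 0})
                  \<and> closure {x. \<phi> x \<noteq> 0} \<subseteq> U}"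

definition mu_s :: "real \<Rightarrow> nat \<Rightarrow> real" where
  "mu_s s d = 2 powr s * pi powr (- (real d / 2)) * Gamma ((real d + s + 1) / 2) / Gamma ((1 - s) / 2)"

definition frac_grad :: "real \<Rightarrow> ('a::euclidean_space \<Rightarrow> real) \<Rightarrow> 'a \<Rightarrow> 'a" where
  "frac_grad s \<phi> x = mu_s s DIM('a) *\<^sub>R
     integral\<^sup>L lebesgue (\<lambda>y. ((\<phi> x - \<phi> y) / norm (x - y) powr (real DIM('a) + s + 1)) *\<^sub>R (x - y))"

definition L2 :: "('a::euclidean_space \<Rightarrow> 'b::real_normed_vector) \<Rightarrow> bool" where
  "L2 g \<longleftrightarrow> g \<in> borel_measurable lebesgue \<and> integrable lebesgue (\<lambda>x. norm (g x) ^ 2)"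

definition L2norm :: "('a::euclidean_space \<Rightarrow> 'b::real_normed_vector) \<Rightarrow> real" where
  "L2norm g = sqrt (integral\<^sup>L lebesgue (\<lambda>x. norm (g x) ^ 2))"

definition Hs_approx :: "real \<Rightarrow> 'a::euclidean_space set \<Rightarrow> ('a \<Rightarrow> real) \<Rightarrow> ('a \<Rightarrow> 'a) \<Rightarrow> bool" where
  "Hs_approx s U u g \<longleftrightarrow> L2 u \<and> L2 g \<and>
     (\<exists>\<phi>. (\<forall>k. \<phi> k \<in> Cc_inf U \<and> L2 (\<phi> k) \<and> L2 (frac_grad s (\<phi> k))) \<and>
          (\<lambda>k. L2norm (\<lambda>x. \<phi> k x - u x)) \<longlonglongrightarrow> 0 \<and>
          (\<lambda>k. L2norm (\<lambda>x. frac_grad s (\<phi> k) x - g x)) \<longlonglongrightarrow> 0)"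

definition Hs :: "real \<Rightarrow> ('a::euclidean_space \<Rightarrow> real) set" where
  "Hs s = {u. \<exists>g. Hs_approx s UNIV u g}"

definition H0s :: "real \<Rightarrow> 'a::euclidean_space set \<Rightarrow> ('a \<Rightarrow> real) set" where
  "H0s s \<Omega> = {u. \<exists>g. Hs_approx s \<Omega> u g}"

text \<open>The continuous extension of the fractional gradient to H^s (determined a.e.).\<close>
definition Grad_s :: "real \<Rightarrow> ('a::euclidean_space \<Rightarrow> real) \<Rightarrow> 'a \<Rightarrow> 'a" where
  "Grad_s s u = (SOME g. Hs_approx s UNIV u g)"

definition Hs_norm :: "real \<Rightarrow> ('a::euclidean_space \<Rightarrow> real) \<Rightarrow> real" where
  "Hs_norm s u = sqrt (L2norm u ^ 2 + L2norm (Grad_s s u) ^ 2)"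

definition Hminus :: "real \<Rightarrow> 'a::euclidean_space set \<Rightarrow> (('a \<Rightarrow> real) \<Rightarrow> real) set" where
  "Hminus s \<Omega> = {f.
     (\<forall>u\<in>H0s s \<Omega>. \<forall>v\<in>H0s s \<Omega>. \<forall>c::real.
         f (\<lambda>x. u x + v x) = f u + f v \<and> f (\<lambda>x. c * u x) = c * f u) \<and>
     (\<exists>C. \<forall>v\<in>H0s s \<Omega>. \<bar>f v\<bar> \<le> C * Hs_norm s v)}"

definition dual_norm :: "real \<Rightarrow> 'a::euclidean_space set \<Rightarrow> (('a \<Rightarrow> real) \<Rightarrow> real) \<Rightarrow> real" where
  "dual_norm s \<Omega> f = Sup {\<bar>f v\<bar> | v. v \<in> H0s s \<Omega> \<and> Hs_norm s v \<le> 1}"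

definition L2_functional :: "'a::euclidean_space set \<Rightarrow> ('a \<Rightarrow> real) \<Rightarrow> ('a \<Rightarrow> real) \<Rightarrow> real" where
  "L2_functional \<Omega> g = (\<lambda>v. integral\<^sup>L lebesgue (\<lambda>x. indicator \<Omega> x * g x * v x))"

definition vec_dual_norm :: "real \<Rightarrow> 'a::euclidean_space set \<Rightarrow> ('a \<Rightarrow> 'a) \<Rightarrow> real" where
  "vec_dual_norm s \<Omega> F =
     sqrt (\<Sum>b\<in>Basis. (dual_norm s \<Omega> (L2_functional \<Omega> (\<lambda>x. inner (F x) b))) ^ 2)"

definition Mcoef :: "real \<Rightarrow> real \<Rightarrow> 'a::euclidean_space set \<Rightarrow> ('a \<Rightarrow> ('a \<Rightarrow>\<^sub>L 'a)) set" where
  "Mcoef \<alpha> \<beta> U = {A. A \<in> borel_measurable lebesgue \<and>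
      (\<exists>C. AE x in lebesgue. x \<in> U \<longrightarrow> norm (A x) \<le> C) \<and>
      (\<forall>\<xi>. AE x in lebesgue. x \<in> U \<longrightarrow>
          inner (blinfun_apply (A x) \<xi>) \<xi> \<ge> \<alpha> * (norm \<xi>) ^ 2 \<and>
          inner (blinfun_apply (A x) \<xi>) \<xi> \<ge> (1 / \<beta>) * (norm (blinfun_apply (A x) \<xi>)) ^ 2)}"

definition Mcoef0 :: "real \<Rightarrow> real \<Rightarrow> 'a::euclidean_space set \<Rightarrow> ('a \<Rightarrow> ('a \<Rightarrow>\<^sub>L 'a))
                       \<Rightarrow> ('a \<Rightarrow> ('a \<Rightarrow>\<^sub>L 'a)) set" where
  "Mcoef0 \<alpha> \<beta> \<Omega> A0 = {A \<in> Mcoef \<alpha> \<beta> UNIV. AE x in lebesgue. x \<notin> \<Omega> \<longrightarrow> A x = A0 x}"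

definition solves :: "real \<Rightarrow> 'a::euclidean_space set \<Rightarrow> ('a \<Rightarrow> ('a \<Rightarrow>\<^sub>L 'a))
                       \<Rightarrow> (('a \<Rightarrow> real) \<Rightarrow> real) \<Rightarrow> ('a \<Rightarrow> real) \<Rightarrow> bool" where
  "solves s \<Omega> B f u \<longleftrightarrow> u \<in> H0s s \<Omega> \<and>
     (\<forall>v\<in>H0s s \<Omega>. integral\<^sup>L lebesgue
        (\<lambda>x. inner (blinfun_apply (B x) (Grad_s s u x)) (Grad_s s v x)) = f v)"

definition sol :: "real \<Rightarrow> 'a::euclidean_space set \<Rightarrow> ('a \<Rightarrow> ('a \<Rightarrow>\<^sub>L 'a))
                   \<Rightarrow> (('a \<Rightarrow> real) \<Rightarrow> real) \<Rightarrow> 'a \<Rightarrow> real" where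
  "sol s \<Omega> B f = (SOME u. solves s \<Omega> B f u)"

section \<open>The metric d_s (family indexed from 0, weight 2^{-(n+1)})\<close>

definition d_s :: "real \<Rightarrow> 'a::euclidean_space set \<Rightarrow> (nat \<Rightarrow> (('a \<Rightarrow> real) \<Rightarrow> real))
                   \<Rightarrow> ('a \<Rightarrow> ('a \<Rightarrow>\<^sub>L 'a)) \<Rightarrow> ('a \<Rightarrow> ('a \<Rightarrow>\<^sub>L 'a)) \<Rightarrow> real" where
  "d_s s \<Omega> f A B = (\<Sum>n. (1/2) ^ (Suc n) *
     (let u = sol s \<Omega> A (f n); v = sol s \<Omega> B (f n) in
       (L2norm (\<lambda>x. indicator \<Omega> x * (u x - v x))
        + vec_dual_norm s \<Omega> (\<lambda>x. blinfun_apply (A x) (Grad_s s u x) - blinfun_apply (B x) (Grad_s s v x)))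
       / dual_norm s \<Omega> (f n)))"

definition Hs_converges :: "real \<Rightarrow> 'a::euclidean_space set \<Rightarrow> (nat \<Rightarrow> ('a \<Rightarrow> ('a \<Rightarrow>\<^sub>L 'a)))
                            \<Rightarrow> ('a \<Rightarrow> ('a \<Rightarrow>\<^sub>L 'a)) \<Rightarrow> bool" where
  "Hs_converges s \<Omega> Am A \<longleftrightarrow>
     (\<forall>f\<in>Hminus s \<Omega>.
        let um = (\<lambda>m. sol s \<Omega> (Am m) f); u = sol s \<Omega> A f in
        \<comment> \<open>weak convergence in H^s_0(\<Omega>): tested against its dual H^{-s}(\<Omega>)\<close>
        (\<forall>h\<in>Hminus s \<Omega>. (\<lambda>m. h (um m)) \<longlonglongrightarrow> h u) \<and>
        \<comment> \<open>weak convergence in L^2(R^d;R^d) (Riesz)\<close>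
        (\<forall>w::'a \<Rightarrow> 'a. L2 w \<longrightarrow>
           (\<lambda>m. integral\<^sup>L lebesgue (\<lambda>x. inner (blinfun_apply (Am m x) (Grad_s s (um m) x)) (w x)))
           \<longlonglongrightarrow> integral\<^sup>L lebesgue (\<lambda>x. inner (blinfun_apply (A x) (Grad_s s u x)) (w x))))"

end

theory Submission imports Defs begin

text \<open>
  By the Poincare inequality the weak problem is coercive on the closure of the graphs
  $(\varphi,\nabla^s\varphi)$, so Lax-Milgram bounds solutions and fluxes by the data, uniformly in
  the coefficients. If $\mathbf{A}_m$ converges in the $H^s$-sense, Rellich's theorem makes
  $u_m - u$ strongly null in $L^2$, and the Riesz representatives in $H^s_0(\Omega)$ of the weakly
  null flux differences strongly null in $H^s$; dominated convergence of the series gives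
  $d_s\to 0$. Conversely $d_s\to 0$ forces, for each $f_n$, $u_m\to u$ in $L^2$ and, by boundedness
  and integration by parts, weakly in $H^s$; the fluxes converge weakly inside $\Omega$ by testing
  with bump functions, and outside $\Omega$ because there all coefficients agree with
  $\mathbf{A}_0$, so the flux difference is a fixed linear image of $\nabla^s(u_m-u)$. Density
  gives all right-hand sides. If $d_s(\mathbf{A},\mathbf{B})=0$, then
  $\mathbf{A}\nabla^s\varphi=\mathbf{B}\nabla^s\varphi$ a.e. for every test function, and bumps
  concentrated at $x-\delta e$ have a fractional gradient at $x$ nearly parallel to $e$.

  Poincare and Rellich are obtained by comparing $\varphi$ with its heat evolution
  $\varphi * G_T$: the error is bounded by $T^{s/2}\|\nabla^s\varphi\|\,\|\varphi\|$, since
  $\nabla^s$ pairs $\varphi$ with a kernel that is a mixture of Gaussian gradients.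
\<close>

section \<open>The Hilbert space of square-integrable functions\<close>

text \<open>The definitions select gradients and solutions by choice among functions determined only
  up to null sets. The analysis therefore takes place in the quotient \<open>l2\<close>, where a
  function and its gradient form one element of a product space; integration by parts against bumps
  shows that the first component determines the second. In the heat comparison the decisive fact is
  a sign. Pairing the fractional gradient of \<phi> with the gradient of its heat evolution at time
  u gives, up to sign, an integral of nonnegative energies over all times t + u, weighted by
  t^(-(1+s)/2). Positivity lets this integral be cut down to t \<le> u, where the weight is at least
  u^(-(1+s)/2) and the energies add up to what the heat flow loses between the times u and 2u. The
  resulting loss is of order u^(s/2), hence summable over u = T/2^n. The Gaussian is left
  unnormalised, and its mass is carried through these identities as a positive constant. Compactness
  also enters on the dual side: the representative Y of a flux difference W satisfies |Y|^2 \<le>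
  |W| |val Y|, so its L^2 norm, to which Rellich applies, controls its H^s norm.\<close>

lemma integrable_pointwise_bound:
  fixes f :: "'c \<Rightarrow> 'b::{banach, second_countable_topology}"
    and g :: "'c \<Rightarrow> 'd::{banach, second_countable_topology}"
  assumes "integrable M g" "f \<in> borel_measurable M" "\<And>x. norm (f x) \<le> norm (g x)"
  shows "integrable M f"
  using assms by (intro Bochner_Integration.integrable_bound[of M g f] AE_I2)

lemma L2_measurable: "L2 f \<Longrightarrow> f \<in> borel_measurable lebesgue"
  by (simp add: L2_def)

lemma L2_integrable: "L2 f \<Longrightarrow> integrable lebesgue (\<lambda>x. (norm (f x))\<^sup>2)"
  by (simp add: L2_def)

lemma L2_bound:
  fixes f :: "'a::euclidean_space \<Rightarrow> 'b::real_normed_vector" and g :: "'a \<Rightarrow> 'c::real_normed_vector"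
  assumes "L2 g" "f \<in> borel_measurable lebesgue" "AE x in lebesgue. norm (f x) \<le> C * norm (g x)"
  shows "L2 f"
proof -
  have "integrable lebesgue (\<lambda>x. C\<^sup>2 * (norm (g x))\<^sup>2)"
    using L2_integrable[OF assms(1)] by simp
  moreover have "AE x in lebesgue. norm ((norm (f x))\<^sup>2) \<le> norm (C\<^sup>2 * (norm (g x))\<^sup>2)"
    using assms(3)
  proof eventually_elim
    case (elim x)
    then have "(norm (f x))\<^sup>2 \<le> (C * norm (g x))\<^sup>2"
      by (intro power_mono) auto
    then show ?case by (simp add: power_mult_distrib)
  qed
  moreover have "(\<lambda>x. (norm (f x))\<^sup>2) \<in> borel_measurable lebesgue"
    using assms(2) by measurable
  ultimately have "integrable lebesgue (\<lambda>x. (norm (f x))\<^sup>2)"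
    using Bochner_Integration.integrable_bound by blast
  with assms(2) show ?thesis by (simp add: L2_def)
qed

lemma L2_zero [simp]: "L2 (\<lambda>x. 0)"
  by (simp add: L2_def)

lemma L2_add:
  fixes f g :: "'a::euclidean_space \<Rightarrow> 'b::euclidean_space"
  assumes "L2 f" "L2 g" shows "L2 (\<lambda>x. f x + g x)"
proof -
  have [measurable]: "f \<in> borel_measurable lebesgue" "g \<in> borel_measurable lebesgue"
    using assms by (auto simp: L2_def)
  have 1: "integrable lebesgue (\<lambda>x. 2 * (norm (f x))\<^sup>2 + 2 * (norm (g x))\<^sup>2)"
    using assms by (simp add: L2_def)
  have 2: "norm ((norm (f x + g x))\<^sup>2) \<le> norm (2 * (norm (f x))\<^sup>2 + 2 * (norm (g x))\<^sup>2)" for x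
  proof -
    have "(norm (f x + g x))\<^sup>2 \<le> (norm (f x) + norm (g x))\<^sup>2"
      by (intro power_mono norm_triangle_ineq) auto
    also have "\<dots> \<le> 2 * (norm (f x))\<^sup>2 + 2 * (norm (g x))\<^sup>2"
      using sum_squares_bound[of "norm (f x)" "norm (g x)"] by (simp add: power2_sum)
    finally show ?thesis by simp
  qed
  have "integrable lebesgue (\<lambda>x. (norm (f x + g x))\<^sup>2)"
    by (rule integrable_pointwise_bound[OF 1 _ 2]) measurable
  then show ?thesis by (simp add: L2_def)
qed

lemma L2_scaleR:
  fixes f :: "'a::euclidean_space \<Rightarrow> 'b::euclidean_space"
  assumes "L2 f" shows "L2 (\<lambda>x. c *\<^sub>R f x)"
  using assms by (intro L2_bound[OF assms, of _ "\<bar>c\<bar>"]) (auto simp: L2_def)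

lemma L2_minus:
  fixes f :: "'a::euclidean_space \<Rightarrow> 'b::euclidean_space"
  assumes "L2 f" shows "L2 (\<lambda>x. - f x)"
  using L2_scaleR[OF assms, of "-1"] by simp

lemma L2_diff:
  fixes f g :: "'a::euclidean_space \<Rightarrow> 'b::euclidean_space"
  assumes "L2 f" "L2 g" shows "L2 (\<lambda>x. f x - g x)"
  using L2_add[OF assms(1) L2_minus[OF assms(2)]] by simp

lemma L2_inner_integrable:
  fixes f g :: "'a::euclidean_space \<Rightarrow> 'b::euclidean_space"
  assumes "L2 f" "L2 g" shows "integrable lebesgue (\<lambda>x. inner (f x) (g x))"
proof -
  have [measurable]: "f \<in> borel_measurable lebesgue" "g \<in> borel_measurable lebesgue"
    using assms by (auto simp: L2_def)
  have 1: "integrable lebesgue (\<lambda>x. (norm (f x))\<^sup>2 + (norm (g x))\<^sup>2)"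
    using assms by (simp add: L2_def)
  have 2: "norm (inner (f x) (g x)) \<le> norm ((norm (f x))\<^sup>2 + (norm (g x))\<^sup>2)" for x
  proof -
    have "\<bar>inner (f x) (g x)\<bar> \<le> norm (f x) * norm (g x)"
      by (rule Cauchy_Schwarz_ineq2)
    also have "\<dots> \<le> (norm (f x))\<^sup>2 + (norm (g x))\<^sup>2"
      using sum_squares_bound[of "norm (f x)" "norm (g x)", unfolded mult.assoc]
        mult_nonneg_nonneg[OF norm_ge_zero[of "f x"] norm_ge_zero[of "g x"]] by linarith
    finally show ?thesis by simp
  qed
  show ?thesis
    by (rule integrable_pointwise_bound[OF 1 _ 2]) measurable
qed

lemma L2_cong_AE:
  assumes "L2 f" "g \<in> borel_measurable lebesgue" "AE x in lebesgue. f x = g x"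
  shows "L2 g"
  by (rule L2_bound[OF assms(1,2), of 1]) (use assms(3) in auto)

text \<open>A partial equivalence, reflexive exactly at the square-integrable functions: the
  quotient keeps only these and identifies them up to null sets.\<close>

definition l2_eq :: "('a::euclidean_space \<Rightarrow> 'b::euclidean_space) \<Rightarrow> ('a \<Rightarrow> 'b) \<Rightarrow> bool" where
  "l2_eq f g \<longleftrightarrow> L2 f \<and> L2 g \<and> (AE x in lebesgue. f x = g x)"

lemma part_equivp_l2_eq: "part_equivp l2_eq"
proof (rule part_equivpI)
  show "\<exists>x :: 'a \<Rightarrow> 'b. l2_eq x x"
    by (rule exI[of _ "\<lambda>x. 0"]) (simp add: l2_eq_def)
  show "symp (l2_eq :: ('a \<Rightarrow> 'b) \<Rightarrow> _)"
    by (rule sympI) (simp add: l2_eq_def eq_commute)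
  show "transp (l2_eq :: ('a \<Rightarrow> 'b) \<Rightarrow> _)"
  proof (rule transpI)
    fix f g h :: "'a \<Rightarrow> 'b" assume "l2_eq f g" "l2_eq g h"
    then show "l2_eq f h"
      unfolding l2_eq_def by (auto elim: eventually_elim2)
  qed
qed

quotient_type (overloaded) ('a, 'b) l2 = "'a::euclidean_space \<Rightarrow> 'b::euclidean_space" / partial: l2_eq
  by (rule part_equivp_l2_eq)

instantiation l2 :: (euclidean_space, euclidean_space) real_vector
begin

lift_definition zero_l2 :: "('a, 'b) l2" is "\<lambda>x. 0"
  by (simp add: l2_eq_def)

lift_definition plus_l2 :: "('a, 'b) l2 \<Rightarrow> ('a, 'b) l2 \<Rightarrow> ('a, 'b) l2" is "\<lambda>f g x. f x + g x"
  unfolding l2_eq_def by (auto intro: L2_add elim: eventually_elim2)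

lift_definition minus_l2 :: "('a, 'b) l2 \<Rightarrow> ('a, 'b) l2 \<Rightarrow> ('a, 'b) l2" is "\<lambda>f g x. f x - g x"
  unfolding l2_eq_def by (auto intro: L2_diff elim: eventually_elim2)

lift_definition uminus_l2 :: "('a, 'b) l2 \<Rightarrow> ('a, 'b) l2" is "\<lambda>f x. - f x"
  unfolding l2_eq_def by (auto intro: L2_minus elim: eventually_mono)

lift_definition scaleR_l2 :: "real \<Rightarrow> ('a, 'b) l2 \<Rightarrow> ('a, 'b) l2" is "\<lambda>c f x. c *\<^sub>R f x"
  unfolding l2_eq_def by (auto intro: L2_scaleR elim: eventually_mono)

instance
  by standard (transfer; auto simp: l2_eq_def algebra_simps intro: L2_add L2_diff L2_minus L2_scaleR)+

end

instantiation l2 :: (euclidean_space, euclidean_space) real_inner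
begin

lift_definition inner_l2 :: "('a, 'b) l2 \<Rightarrow> ('a, 'b) l2 \<Rightarrow> real" is
  "\<lambda>f g. integral\<^sup>L lebesgue (\<lambda>x. inner (f x) (g x))"
  unfolding l2_eq_def
  by (intro integral_cong_AE) (auto intro: borel_measurable_inner L2_measurable elim: eventually_elim2)

definition norm_l2 :: "('a, 'b) l2 \<Rightarrow> real" where
  "norm_l2 x = sqrt (inner x x)"

definition sgn_l2 :: "('a, 'b) l2 \<Rightarrow> ('a, 'b) l2" where
  "sgn_l2 x = inverse (norm x) *\<^sub>R x"

definition dist_l2 :: "('a, 'b) l2 \<Rightarrow> ('a, 'b) l2 \<Rightarrow> real" where
  "dist_l2 x y = norm (x - y)"

definition uniformity_l2 :: "(('a, 'b) l2 \<times> ('a, 'b) l2) filter" where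
  "uniformity_l2 = (INF e\<in>{0 <..}. principal {(x, y). dist x y < e})"

definition open_l2 :: "('a, 'b) l2 set \<Rightarrow> bool" where
  "open_l2 U \<longleftrightarrow> (\<forall>x\<in>U. \<forall>\<^sub>F (x', y) in uniformity. x' = x \<longrightarrow> y \<in> U)"

instance
proof
  fix x y z :: "('a, 'b) l2" and r :: real
  show "inner x y = inner y x"
    by transfer (simp add: inner_commute)
  show "inner (x + y) z = inner x z + inner y z"
    by transfer (simp add: inner_add_left l2_eq_def L2_inner_integrable)
  show "inner (r *\<^sub>R x) y = r * inner x y"
    by transfer simp
  show "0 \<le> inner x x"
    by transfer simp
  show "inner x x = 0 \<longleftrightarrow> x = 0"
  proof transfer
    fix f :: "'a \<Rightarrow> 'b" assume "l2_eq f f"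
    then have f: "L2 f" by (simp add: l2_eq_def)
    have "integral\<^sup>L lebesgue (\<lambda>x. inner (f x) (f x)) = 0 \<longleftrightarrow> (AE x in lebesgue. inner (f x) (f x) = 0)"
      by (rule integral_nonneg_eq_0_iff_AE) (auto intro: L2_inner_integrable f)
    then show "(integral\<^sup>L lebesgue (\<lambda>x. inner (f x) (f x)) = 0) = l2_eq f (\<lambda>x. 0)"
      using f by (simp add: l2_eq_def)
  qed
qed (simp_all add: dist_l2_def norm_l2_def sgn_l2_def uniformity_l2_def open_l2_def)

end

text \<open>Names for the quotient maps. \<open>mk f\<close> is meaningful for square-integrable
  \<open>f\<close> only, and \<open>fn\<close> selects one representative, so
  \<open>fn (mk f)\<close> agrees with such an \<open>f\<close> merely almost everywhere.\<close>

definition mk :: "('a::euclidean_space \<Rightarrow> 'b::euclidean_space) \<Rightarrow> ('a, 'b) l2" where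
  "mk = abs_l2"

definition fn :: "('a::euclidean_space, 'b::euclidean_space) l2 \<Rightarrow> 'a \<Rightarrow> 'b" where
  "fn = rep_l2"

lemma l2_eq_refl: "l2_eq f f \<longleftrightarrow> L2 f"
  by (simp add: l2_eq_def)

lemma L2_fn [simp, intro]: "L2 (fn X)"
  using Quotient3_rep_reflp[OF Quotient3_l2, of X] by (simp add: fn_def l2_eq_refl)

lemma mk_fn [simp]: "mk (fn X) = X"
  using Quotient3_abs_rep[OF Quotient3_l2] by (simp add: fn_def mk_def)

lemma mk_eq_iff: "L2 f \<Longrightarrow> L2 g \<Longrightarrow> mk f = mk g \<longleftrightarrow> (AE x in lebesgue. f x = g x)"
  using Quotient3_rel[OF Quotient3_l2, of f g] by (auto simp: mk_def l2_eq_def)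

lemma fn_mk: "L2 f \<Longrightarrow> AE x in lebesgue. fn (mk f) x = f x"
  by (subst mk_eq_iff[symmetric]) auto

lemma fn_measurable [measurable]: "fn X \<in> borel_measurable lebesgue"
  by (rule L2_measurable) simp

lemma mk_add: "L2 f \<Longrightarrow> L2 g \<Longrightarrow> mk (\<lambda>x. f x + g x) = mk f + mk g"
  by (simp add: mk_def plus_l2.abs_eq l2_eq_refl)

lemma mk_diff: "L2 f \<Longrightarrow> L2 g \<Longrightarrow> mk (\<lambda>x. f x - g x) = mk f - mk g"
  by (simp add: mk_def minus_l2.abs_eq l2_eq_refl)

lemma mk_scaleR: "L2 f \<Longrightarrow> mk (\<lambda>x. c *\<^sub>R f x) = c *\<^sub>R mk f"
  by (simp add: mk_def scaleR_l2.abs_eq l2_eq_refl)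

lemma mk_zero: "mk (\<lambda>x. 0) = 0"
  by (simp add: mk_def zero_l2_def)

lemma inner_mk: "L2 f \<Longrightarrow> L2 g \<Longrightarrow> inner (mk f) (mk g) = integral\<^sup>L lebesgue (\<lambda>x. inner (f x) (g x))"
  by (simp add: mk_def inner_l2.abs_eq l2_eq_refl)

lemma norm_mk: "L2 f \<Longrightarrow> norm (mk f) = L2norm f"
  by (simp add: norm_l2_def inner_mk L2norm_def power2_norm_eq_inner)

lemma norm_fn: "norm X = L2norm (fn X)"
  using norm_mk[of "fn X"] by simp

lemma L2norm_mono_AE:
  assumes "L2 f" "L2 g" "C \<ge> 0" "AE x in lebesgue. norm (f x) \<le> C * norm (g x)"
  shows "L2norm f \<le> C * L2norm g"
proof -
  have "integral\<^sup>L lebesgue (\<lambda>x. (norm (f x))\<^sup>2) \<le> integral\<^sup>L lebesgue (\<lambda>x. C\<^sup>2 * (norm (g x))\<^sup>2)"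
  proof (rule integral_mono_AE)
    show "AE x in lebesgue. (norm (f x))\<^sup>2 \<le> C\<^sup>2 * (norm (g x))\<^sup>2"
      using assms(4)
    proof eventually_elim
      case (elim x)
      then have "(norm (f x))\<^sup>2 \<le> (C * norm (g x))\<^sup>2" by (intro power_mono) auto
      then show ?case by (simp add: power_mult_distrib)
    qed
  qed (use assms in \<open>auto simp: L2_def\<close>)
  also have "\<dots> = C\<^sup>2 * integral\<^sup>L lebesgue (\<lambda>x. (norm (g x))\<^sup>2)" by simp
  finally show ?thesis
    unfolding L2norm_def using assms(3)
    by (metis real_sqrt_le_mono real_sqrt_mult real_sqrt_abs abs_of_nonneg)
qed

text \<open>Riesz--Fischer: along a fast Cauchy subsequence the weighted sum
  \<open>\<Sum>k. 2 ^ k * (norm (Y (Suc k) x - Y k x))\<^sup>2\<close> is integrable, hence finite almost everywhere.\<close>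

instance l2 :: (euclidean_space, euclidean_space) complete_space
proof
  fix X :: "nat \<Rightarrow> ('a, 'b) l2" assume C: "Cauchy X"
  have "\<exists>N. \<forall>m\<ge>N. \<forall>n\<ge>N. norm (X m - X n) < (1/2) ^ k" for k
    using CauchyD[OF C, of "(1/2)^k"] by auto
  then obtain N where N: "\<And>k m n. m \<ge> N k \<Longrightarrow> n \<ge> N k \<Longrightarrow> norm (X m - X n) < (1/2) ^ k"
    by metis
  \<comment> \<open>Partial sums make the indices monotone in k while keeping them above
    \<open>N k\<close>.\<close>
  define r where "r k = (\<Sum>j\<le>k. N j)" for k
  have rN: "r k \<ge> N k" for k unfolding r_def by (simp add: member_le_sum)
  have rmono: "r j \<le> r k" if "j \<le> k" for j k
    unfolding r_def using that by (intro sum_mono2) auto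
  define Y where "Y k = fn (X (r k))" for k
  have L2Y: "L2 (Y k)" for k by (simp add: Y_def)
  have [measurable]: "Y k \<in> borel_measurable lebesgue" for k by (simp add: Y_def)
  have dY: "integral\<^sup>L lebesgue (\<lambda>x. (norm (Y j x - Y k x))\<^sup>2) \<le> ((1/2)^k)\<^sup>2" if "k \<le> j" for j k
  proof -
    have "norm (X (r j) - X (r k)) < (1/2)^k"
      using that rN rmono by (intro N) (auto intro: order_trans)
    moreover have "X (r j) - X (r k) = mk (\<lambda>x. Y j x - Y k x)"
      by (simp add: Y_def mk_diff)
    ultimately have "L2norm (\<lambda>x. Y j x - Y k x) \<le> (1/2)^k"
      by (simp add: norm_mk L2_diff L2Y)
    then have "(L2norm (\<lambda>x. Y j x - Y k x))\<^sup>2 \<le> ((1/2)^k)\<^sup>2"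
      by (intro power_mono) (auto simp: L2norm_def)
    then show ?thesis by (simp add: L2norm_def)
  qed
  define S where "S x = (\<Sum>k. ennreal (2^k * (norm (Y (Suc k) x - Y k x))\<^sup>2))" for x
  have [measurable]: "S \<in> borel_measurable lebesgue" unfolding S_def by measurable
  have "integral\<^sup>N lebesgue S = (\<Sum>k. \<integral>\<^sup>+x. ennreal (2^k * (norm (Y (Suc k) x - Y k x))\<^sup>2) \<partial>lebesgue)"
    unfolding S_def by (rule nn_integral_suminf) measurable
  also have "\<dots> \<le> (\<Sum>k. ennreal ((1/2)^k))"
  proof (rule suminf_le)
    fix k
    have "(\<integral>\<^sup>+x. ennreal (2^k * (norm (Y (Suc k) x - Y k x))\<^sup>2) \<partial>lebesgue)
        = ennreal (integral\<^sup>L lebesgue (\<lambda>x. 2^k * (norm (Y (Suc k) x - Y k x))\<^sup>2))"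
      using L2_integrable[OF L2_diff[OF L2Y L2Y]] by (intro nn_integral_eq_integral) auto
    also have "integral\<^sup>L lebesgue (\<lambda>x. 2^k * (norm (Y (Suc k) x - Y k x))\<^sup>2) \<le> 2^k * ((1/2)^k)\<^sup>2"
      using dY[of k "Suc k"] by simp
    also have "2^k * ((1/2)^k)\<^sup>2 = (1/2::real)^k"
      by (simp add: power2_eq_square power_divide)
    finally show "(\<integral>\<^sup>+x. ennreal (2^k * (norm (Y (Suc k) x - Y k x))\<^sup>2) \<partial>lebesgue) \<le> ennreal ((1/2)^k)"
      by (simp add: ennreal_leI)
  qed auto
  also have "\<dots> = ennreal (\<Sum>k. (1/2)^k)"
    by (rule suminf_ennreal2) (auto intro: summable_geometric)
  also have "\<dots> < \<infinity>" by simp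
  finally have "integral\<^sup>N lebesgue S < \<infinity>" .
  then have "AE x in lebesgue. S x \<noteq> \<infinity>"
    by (intro nn_integral_PInf_AE) (simp_all add: less_top[symmetric])
  then have "AE x in lebesgue. convergent (\<lambda>k. Y k x)"
  proof eventually_elim
    case (elim x)
    have *: "ennreal (2^k * (norm (Y (Suc k) x - Y k x))\<^sup>2) \<le> S x" for k
    proof -
      have "sum (\<lambda>k. ennreal (2^k * (norm (Y (Suc k) x - Y k x))\<^sup>2)) {k} \<le> S x"
        unfolding S_def by (rule sum_le_suminf) auto
      then show ?thesis by simp
    qed
    obtain M where M: "S x = ennreal M" "M \<ge> 0"
      using elim by (cases "S x") auto
    have le: "2^k * (norm (Y (Suc k) x - Y k x))\<^sup>2 \<le> M" for k
      using *[of k] unfolding M(1) by (subst (asm) ennreal_le_iff[OF M(2)])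
    \<comment> \<open>The weight 2^k turns finiteness of \<open>S x\<close> into geometric decay of
      the increments with ratio 1 / sqrt 2, so they are absolutely summable.\<close>
    have le2: "norm (Y (Suc k) x - Y k x) \<le> sqrt M * (1 / sqrt 2)^k" for k
    proof -
      have "(norm (Y (Suc k) x - Y k x))\<^sup>2 \<le> M * ((1 / sqrt 2)^k)\<^sup>2"
      proof -
        have "((1 / sqrt 2)^k)\<^sup>2 = ((1 / sqrt 2)\<^sup>2)^k"
          by (simp only: power_mult[symmetric] mult.commute)
        also have "\<dots> = 1 / 2^k" by (simp add: power_divide)
        finally show ?thesis using le[of k] by (simp add: field_simps)
      qed
      also have "\<dots> = (sqrt M * (1 / sqrt 2)^k)\<^sup>2"
        using M by (simp add: power_mult_distrib)
      finally show ?thesis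
        by (rule power2_le_imp_le) (use M in auto)
    qed
    have "summable (\<lambda>k. norm (Y (Suc k) x - Y k x))"
    proof (rule summable_comparison_test')
      show "summable (\<lambda>k. sqrt M * (1 / sqrt 2)^k)"
        by (intro summable_mult summable_geometric) auto
    qed (use le2 in auto)
    then have "summable (\<lambda>k. Y (Suc k) x - Y k x)"
      by (rule summable_norm_cancel)
    then have "convergent (\<lambda>n. \<Sum>k<n. Y (Suc k) x - Y k x)"
      by (simp add: summable_iff_convergent)
    then have "convergent (\<lambda>n. (\<Sum>k<n. Y (Suc k) x - Y k x) + Y 0 x)"
      by (intro convergent_add convergent_const)
    then show ?case by (simp add: sum_lessThan_telescope[of "\<lambda>k. Y k x"])
  qed
  then have conv: "AE x in lebesgue. (\<lambda>k. Y k x) \<longlonglongrightarrow> lim (\<lambda>k. Y k x)"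
    by (simp add: convergent_LIMSEQ_iff)
  define g where "g x = lim (\<lambda>k. Y k x)" for x
  have [measurable]: "g \<in> borel_measurable lebesgue"
    unfolding g_def by measurable
  \<comment> \<open>Only almost everywhere convergence to \<open>g\<close> is known so far; Fatou's
    lemma passes the estimate for \<open>Y j - Y k\<close> to the limit in j.\<close>
  have fatou: "(\<integral>\<^sup>+x. ennreal ((norm (g x - Y k x))\<^sup>2) \<partial>lebesgue) \<le> ennreal (((1/2)^k)\<^sup>2)" for k
  proof -
    have "(\<integral>\<^sup>+x. ennreal ((norm (g x - Y k x))\<^sup>2) \<partial>lebesgue)
       \<le> (\<integral>\<^sup>+x. liminf (\<lambda>j. ennreal ((norm (Y j x - Y k x))\<^sup>2)) \<partial>lebesgue)"
    proof (rule nn_integral_mono_AE, use conv in eventually_elim)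
      fix x assume "(\<lambda>k. Y k x) \<longlonglongrightarrow> lim (\<lambda>k. Y k x)"
      then have "(\<lambda>j. ennreal ((norm (Y j x - Y k x))\<^sup>2)) \<longlonglongrightarrow> ennreal ((norm (g x - Y k x))\<^sup>2)"
        unfolding g_def by (intro tendsto_ennrealI tendsto_intros)
      then show "ennreal ((norm (g x - Y k x))\<^sup>2) \<le> liminf (\<lambda>j. ennreal ((norm (Y j x - Y k x))\<^sup>2))"
          by (metis lim_imp_Liminf order_refl trivial_limit_sequentially)
    qed
    also have "\<dots> \<le> liminf (\<lambda>j. \<integral>\<^sup>+x. ennreal ((norm (Y j x - Y k x))\<^sup>2) \<partial>lebesgue)"
      by (rule nn_integral_liminf) measurable
    also have "\<dots> \<le> ennreal (((1/2)^k)\<^sup>2)"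
    proof (rule Liminf_le)
      show "\<forall>\<^sub>F j in sequentially. (\<integral>\<^sup>+x. ennreal ((norm (Y j x - Y k x))\<^sup>2) \<partial>lebesgue) \<le> ennreal (((1/2)^k)\<^sup>2)"
        using eventually_ge_at_top[of k]
      proof eventually_elim
        case (elim j)
        have "(\<integral>\<^sup>+x. ennreal ((norm (Y j x - Y k x))\<^sup>2) \<partial>lebesgue)
          = ennreal (integral\<^sup>L lebesgue (\<lambda>x. (norm (Y j x - Y k x))\<^sup>2))"
          using L2_integrable[OF L2_diff[OF L2Y L2Y]] by (intro nn_integral_eq_integral) auto
        then show ?case using dY[OF elim] by (simp add: ennreal_leI)
      qed
    qed simp
    finally show ?thesis .
  qed
  have L2gY: "L2 (\<lambda>x. g x - Y k x)" for k
    unfolding L2_def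
  proof
    show "integrable lebesgue (\<lambda>x. (norm (g x - Y k x))\<^sup>2)"
      by (rule integrableI_nonneg) (use fatou[of k] in \<open>auto simp: le_less_trans\<close>)
  qed measurable
  have L2g: "L2 g" using L2_add[OF L2gY[of 0] L2Y[of 0]] by simp
  have gY: "norm (mk g - X (r k)) \<le> (1/2)^k" for k
  proof -
    have "mk g - X (r k) = mk (\<lambda>x. g x - Y k x)" by (simp add: Y_def mk_diff L2g)
    then have "norm (mk g - X (r k)) = L2norm (\<lambda>x. g x - Y k x)" by (simp add: norm_mk L2gY)
    also have "\<dots> \<le> sqrt (((1/2)^k)\<^sup>2)"
      unfolding L2norm_def
    proof (rule real_sqrt_le_mono)
      have "ennreal (integral\<^sup>L lebesgue (\<lambda>x. (norm (g x - Y k x))\<^sup>2)) \<le> ennreal (((1/2)^k)\<^sup>2)"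
        using fatou[of k] L2_integrable[OF L2gY[of k]] by (simp add: nn_integral_eq_integral)
      then show "integral\<^sup>L lebesgue (\<lambda>x. (norm (g x - Y k x))\<^sup>2) \<le> ((1/2)^k)\<^sup>2"
        by (subst (asm) ennreal_le_iff) auto
    qed
    finally show ?thesis by simp
  qed
  have "X \<longlonglongrightarrow> mk g"
  proof (rule LIMSEQ_I)
    fix e :: real assume "e > 0"
    then obtain k where k: "(1/2)^k < e/2"
      using real_arch_pow_inv[of "e/2" "1/2"] by auto
    show "\<exists>no. \<forall>n\<ge>no. norm (X n - mk g) < e"
    proof (intro exI allI impI)
      fix n assume "n \<ge> r k"
      then have "norm (X n - X (r k)) < (1/2)^k" using rN[of k] by (intro N) auto
      moreover have "norm (X n - mk g) \<le> norm (X n - X (r k)) + norm (mk g - X (r k))"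
        using norm_triangle_ineq4[of "X n - X (r k)" "mk g - X (r k)"] by simp
      ultimately show "norm (X n - mk g) < e" using gY[of k] k by linarith
    qed
  qed
  then show "convergent X" by (rule convergentI)
qed

section \<open>Orthogonal projection, Riesz representation and Lax--Milgram\<close>

text \<open>For the optimal multiple t of v the squared norm of z - t v is smaller than that of z by
  (z,v)^2 / |v|^2, which minimality forces to vanish.\<close>

lemma orthogonal_if_minimal:
  fixes z v :: "'h::real_inner"
  assumes "\<And>t. norm z \<le> norm (z - t *\<^sub>R v)"
  shows "inner z v = 0"
proof (cases "v = 0")
  case False
  define t where "t = inner z v / (norm v)\<^sup>2"
  have nz: "norm v \<noteq> 0" using False by simp
  have "(norm z)\<^sup>2 \<le> (norm (z - t *\<^sub>R v))\<^sup>2"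
    using assms by (intro power_mono) auto
  also have "\<dots> = (norm z)\<^sup>2 - 2 * t * inner z v + t\<^sup>2 * (norm v)\<^sup>2"
    unfolding power2_norm_eq_inner by (simp add: inner_diff inner_commute power2_eq_square algebra_simps)
  also have "\<dots> = (norm z)\<^sup>2 - (inner z v)\<^sup>2 / (norm v)\<^sup>2"
    using nz by (simp add: t_def field_simps power2_eq_square)
  finally have "(inner z v)\<^sup>2 / (norm v)\<^sup>2 \<le> 0" by simp
  then show ?thesis using nz
    by (simp add: divide_le_0_iff)
qed simp

text \<open>Midpoints of a minimising sequence stay in V and so are no closer to x than the infimum;
  the parallelogram identity then makes the sequence Cauchy, and its limit is the
  projection.\<close>

lemma closed_subspace_projection:
  fixes x :: "'h::{real_inner,complete_space}"
  assumes V: "subspace V" "closed V"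
  obtains p where "p \<in> V" "\<And>v. v \<in> V \<Longrightarrow> inner (x - p) v = 0"
proof -
  define D where "D = (\<lambda>v. (norm (x - v))\<^sup>2) ` V"
  have ne: "D \<noteq> {}" using subspace_0[OF V(1)] by (auto simp: D_def)
  have bdd: "bdd_below D" by (rule bdd_belowI[of _ 0]) (auto simp: D_def)
  have lower: "Inf D \<le> (norm (x - v))\<^sup>2" if "v \<in> V" for v
    using that by (intro cInf_lower bdd) (auto simp: D_def)
  have "\<exists>v\<in>V. (norm (x - v))\<^sup>2 < Inf D + inverse (real (Suc n))" for n
    using cInf_lessD[OF ne, of "Inf D + inverse (real (Suc n))"] by (auto simp: D_def)
  then obtain w where wV: "\<And>n. w n \<in> V"
    and w: "\<And>n. (norm (x - w n))\<^sup>2 < Inf D + inverse (real (Suc n))" by metis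
  have par: "(norm (w n - w m))\<^sup>2 \<le> 2 * inverse (real (Suc n)) + 2 * inverse (real (Suc m))" for n m
  proof -
    have "(1/2) *\<^sub>R (w n + w m) \<in> V" using wV V(1) by (intro subspace_scale subspace_add) auto
    from lower[OF this] have "4 * Inf D \<le> 4 * (norm (x - (1/2) *\<^sub>R (w n + w m)))\<^sup>2" by simp
    also have "\<dots> = 2 * (norm (x - w n))\<^sup>2 + 2 * (norm (x - w m))\<^sup>2 - (norm (w n - w m))\<^sup>2"
      unfolding power2_norm_eq_inner by (simp add: inner_diff inner_add inner_commute algebra_simps)
    finally show ?thesis using w[of n] w[of m] by linarith
  qed
  have "Cauchy w"
  proof (rule CauchyI)
    fix e :: real assume e: "e > 0"
    then obtain N where N: "inverse (real (Suc N)) < e\<^sup>2 / 4"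
      using reals_Archimedean[of "e\<^sup>2/4"] by auto
    have "norm (w m - w n) < e" if "m \<ge> N" "n \<ge> N" for m n
    proof -
      have "inverse (real (Suc m)) \<le> inverse (real (Suc N))" "inverse (real (Suc n)) \<le> inverse (real (Suc N))"
        using that by (auto intro!: le_imp_inverse_le)
      then have "(norm (w m - w n))\<^sup>2 < e\<^sup>2" using par[of m n] N by linarith
      then show ?thesis using e by (auto intro: power2_less_imp_less)
    qed
    then show "\<exists>M. \<forall>m\<ge>M. \<forall>n\<ge>M. norm (w m - w n) < e" by blast
  qed
  then obtain p where p: "w \<longlonglongrightarrow> p" by (auto simp: Cauchy_convergent_iff convergent_def)
  have pV: "p \<in> V" using closed_sequentially[OF V(2) _ p] wV by auto
  have "(norm (x - p))\<^sup>2 \<le> Inf D"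
  proof (rule LIMSEQ_le)
    show "(\<lambda>n. (norm (x - w n))\<^sup>2) \<longlonglongrightarrow> (norm (x - p))\<^sup>2" by (intro tendsto_intros p)
    show "(\<lambda>n. Inf D + inverse (real (Suc n))) \<longlonglongrightarrow> Inf D"
      using tendsto_add[OF tendsto_const LIMSEQ_inverse_real_of_nat, of "Inf D"] by simp
  qed (use w less_imp_le in blast)
  then have min: "norm (x - p) \<le> norm (x - v)" if "v \<in> V" for v
    using order_trans[OF _ lower[OF that]] by (intro power2_le_imp_le[of "norm (x - p)"]) auto
  show thesis
  proof (rule that[OF pV])
    fix v assume "v \<in> V"
    then have "p + t *\<^sub>R v \<in> V" for t using pV V(1) by (intro subspace_add subspace_scale) auto
    from min[OF this] show "inner (x - p) v = 0"
      by (intro orthogonal_if_minimal) (simp add: algebra_simps)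
  qed
qed

text \<open>The representative is a multiple of the component of some x with f x \<noteq> 0 that is
  orthogonal to the kernel of f in V. Linearity and boundedness are assumed on V only, because the
  functionals used later are controlled nowhere else.\<close>

lemma riesz_representation:
  fixes f :: "'h::{real_inner,complete_space} \<Rightarrow> real"
  assumes V: "subspace V" "closed V"
    and add: "\<And>u v. u \<in> V \<Longrightarrow> v \<in> V \<Longrightarrow> f (u + v) = f u + f v"
    and scale: "\<And>c u. u \<in> V \<Longrightarrow> f (c *\<^sub>R u) = c * f u"
    and bound: "\<And>u. u \<in> V \<Longrightarrow> \<bar>f u\<bar> \<le> C * norm u"
  obtains r where "r \<in> V" "\<And>v. v \<in> V \<Longrightarrow> f v = inner r v"
proof (cases "\<forall>v\<in>V. f v = 0")
  case True
  then show thesis using that[of 0] subspace_0[OF V(1)] by auto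
next
  case False
  then obtain x where x: "x \<in> V" "f x \<noteq> 0" by auto
  have fdiff: "f (u - v) = f u - f v" if "u \<in> V" "v \<in> V" for u v
    using add[OF that(1), of "(-1) *\<^sub>R v"] scale[OF that(2), of "-1"] V(1) that(2)
    by (simp add: subspace_neg)
  define N where "N = {v \<in> V. f v = 0}"
  have f0: "f 0 = 0" using scale[OF x(1), of 0] by simp
  have subN: "subspace N"
    unfolding N_def subspace_def using V(1) f0 add scale by (auto simp: subspace_def)
  have clN: "closed N"
    unfolding closed_sequential_limits
  proof (intro allI impI; elim conjE)
    fix s l assume s: "\<forall>n. s n \<in> N" "s \<longlonglongrightarrow> l"
    have lV: "l \<in> V" using closed_sequentially[OF V(2) _ s(2)] s(1) by (auto simp: N_def)
    have "(\<lambda>n. C * norm (l - s n)) \<longlonglongrightarrow> C * norm (l - l)"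
      by (intro tendsto_intros s)
    moreover have "\<bar>f l\<bar> \<le> C * norm (l - s n)" for n
      using bound[of "l - s n"] fdiff[OF lV, of "s n"] s(1) V(1) lV
      by (auto simp: N_def subspace_diff)
    ultimately have "\<bar>f l\<bar> \<le> C * norm (l - l)"
      by (intro LIMSEQ_le_const) auto
    with lV show "l \<in> N" by (simp add: N_def)
  qed
  obtain p where p: "p \<in> N" "\<And>v. v \<in> N \<Longrightarrow> inner (x - p) v = 0"
    using closed_subspace_projection[OF subN clN] by metis
  define z where "z = x - p"
  have zV: "z \<in> V" using x p V(1) by (auto simp: z_def N_def subspace_diff)
  have fz: "f z \<noteq> 0" using fdiff[OF x(1), of p] p(1) x(2) by (simp add: z_def N_def)
  have z0: "norm z \<noteq> 0" using fz f0 by auto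
  show thesis
  proof (rule that[of "(f z / (norm z)\<^sup>2) *\<^sub>R z"])
    show "(f z / (norm z)\<^sup>2) *\<^sub>R z \<in> V" using zV V(1) by (simp add: subspace_scale)
    fix v assume v: "v \<in> V"
    have "v - (f v / f z) *\<^sub>R z \<in> N"
      unfolding N_def using v zV V(1) fz
      by (auto simp: fdiff scale subspace_diff subspace_scale)
    then have "inner z v = (f v / f z) * (norm z)\<^sup>2"
      using p(2)[of "v - (f v / f z) *\<^sub>R z"] unfolding z_def[symmetric]
      by (simp add: inner_diff_right power2_norm_eq_inner)
    then show "f v = inner ((f z / (norm z)\<^sup>2) *\<^sub>R z) v"
      using fz z0 by simp
  qed
qed

text \<open>With \<open>T u\<close> representing \<open>a u\<close> on V and G representing F, the
  map u - \<rho> (T u - G) is a contraction of V. Its squared factor 1 - 2 \<rho> c + \<rho>^2 M^2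
  is smallest at \<rho> = c / M^2, where it equals 1 - c^2 / M^2.\<close>

lemma lax_milgram:
  fixes a :: "'h::{real_inner,complete_space} \<Rightarrow> 'h \<Rightarrow> real"
  assumes V: "subspace V" "closed V"
    and bil: "bounded_bilinear a"
    and c: "c > 0" "\<And>u. u \<in> V \<Longrightarrow> a u u \<ge> c * (norm u)\<^sup>2"
  obtains u where "u \<in> V" "\<And>v. v \<in> V \<Longrightarrow> a u v = inner F v"
proof -
  interpret bounded_bilinear a by (rule bil)
  obtain M where M: "M > 0" "\<And>u v. norm (a u v) \<le> norm u * norm v * M"
    using pos_bounded by blast
  have "\<exists>r\<in>V. \<forall>v\<in>V. a u v = inner r v" for u
  proof -
    obtain r where "r \<in> V" "\<And>v. v \<in> V \<Longrightarrow> a u v = inner r v"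
      by (rule riesz_representation[OF V, of "a u" "norm u * M"])
        (use M(2)[of u] in \<open>auto simp: add_right scaleR_right mult.commute mult.left_commute\<close>)
    then show ?thesis by blast
  qed
  then obtain T where TV: "\<And>u. T u \<in> V" and T: "\<And>u v. v \<in> V \<Longrightarrow> a u v = inner (T u) v"
    by metis
  obtain G where G: "G \<in> V" "\<And>v. v \<in> V \<Longrightarrow> inner F v = inner G v"
    by (rule riesz_representation[OF V, of "inner F" "norm F"])
      (auto simp: inner_add_right Cauchy_Schwarz_ineq2)
  define \<rho> where "\<rho> = c / M\<^sup>2"
  have \<rho>: "\<rho> > 0" using c M by (simp add: \<rho>_def)
  define \<Phi> where "\<Phi> u = u - \<rho> *\<^sub>R (T u - G)" for u
  \<comment> \<open>The maximum guards the square root: on a trivial V coercivity is vacuous and c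
    may exceed M.\<close>
  define q where "q = max 0 (1 - c\<^sup>2 / M\<^sup>2)"
  have q: "0 \<le> q" "q < 1" using c M by (auto simp: q_def)
  have contr: "dist (\<Phi> u) (\<Phi> u') \<le> sqrt q * dist u u'" if "u \<in> V" "u' \<in> V" for u u'
  proof -
    define w where "w = u - u'"
    define S where "S = T u - T u'"
    have wV: "w \<in> V" and SV: "S \<in> V" using that TV V(1) by (auto simp: w_def S_def subspace_diff)
    have S: "inner S v = a w v" if "v \<in> V" for v
      using T[OF that, of u] T[OF that, of u'] by (simp add: S_def w_def inner_diff_left diff_left)
    have "(norm S)\<^sup>2 \<le> norm w * norm S * M"
      using S[OF SV] M(2)[of w S] by (simp add: power2_norm_eq_inner)
    then have "norm S * norm S \<le> norm S * (M * norm w)" by (simp add: power2_eq_square mult_ac)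
    then have "norm S \<le> M * norm w"
      by (cases "norm S = 0") (use M(1) in auto)
    then have S2: "(norm S)\<^sup>2 \<le> M\<^sup>2 * (norm w)\<^sup>2"
      using power_mono[of "norm S" "M * norm w" 2] by (simp add: power_mult_distrib)
    have "(norm (w - \<rho> *\<^sub>R S))\<^sup>2 = (norm w)\<^sup>2 - 2 * \<rho> * inner S w + \<rho>\<^sup>2 * (norm S)\<^sup>2"
      unfolding power2_norm_eq_inner by (simp add: inner_diff inner_commute power2_eq_square algebra_simps)
    also have "\<dots> \<le> (norm w)\<^sup>2 - 2 * \<rho> * (c * (norm w)\<^sup>2) + \<rho>\<^sup>2 * (M\<^sup>2 * (norm w)\<^sup>2)"
      using S[OF wV] c(2)[OF wV] \<rho> S2 by (intro add_mono diff_mono mult_left_mono) auto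
    also have "\<dots> = (1 - c\<^sup>2 / M\<^sup>2) * (norm w)\<^sup>2"
      using M(1) by (simp add: \<rho>_def field_simps power2_eq_square)
    also have "\<dots> \<le> q * (norm w)\<^sup>2"
      by (intro mult_right_mono) (auto simp: q_def)
    finally have "norm (w - \<rho> *\<^sub>R S) \<le> sqrt (q * (norm w)\<^sup>2)"
      using real_le_rsqrt by blast
    moreover have "\<Phi> u - \<Phi> u' = w - \<rho> *\<^sub>R S"
      by (simp add: \<Phi>_def w_def S_def algebra_simps)
    ultimately show ?thesis by (simp add: dist_norm w_def real_sqrt_mult)
  qed
  have "\<exists>!u. u \<in> V \<and> \<Phi> u = u"
  proof (rule Banach_fix)
    show "complete V" using V(2) by (simp add: complete_eq_closed)
    show "V \<noteq> {}" using subspace_0[OF V(1)] by auto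
    show "0 \<le> sqrt q" "sqrt q < 1" using q by auto
    show "\<Phi> ` V \<subseteq> V"
      using TV G(1) V(1) by (auto simp: \<Phi>_def intro!: subspace_diff subspace_scale)
  qed (rule contr)
  then obtain u where u: "u \<in> V" "\<Phi> u = u" by blast
  have "T u = G" using u(2) \<rho> by (simp add: \<Phi>_def)
  with u(1) show thesis using T G(2) by (intro that) auto
qed

section \<open>Smooth bump functions\<close>

text \<open>The powers of 1/t are included so that the family is closed under differentiation up to
  linear combinations; the case k = 0 is the standard flat function.\<close>

definition flat_exp :: "nat \<Rightarrow> real \<Rightarrow> real" where
  "flat_exp k t = (if t > 0 then exp (- 1 / t) / t ^ k else 0)"

lemma flat_exp_tendsto_0: "(flat_exp k \<longlongrightarrow> 0) (at 0)"
proof -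
  have "((\<lambda>t::real. exp (- 1 / t) / t ^ k) \<longlongrightarrow> 0) (at_right 0)"
  proof -
    have "((\<lambda>t::real. (inverse t) ^ k / exp (inverse t)) \<longlongrightarrow> 0) (at_right 0)"
      by (rule filterlim_compose[OF tendsto_power_div_exp_0 filterlim_inverse_at_top_right])
    then show ?thesis
      by (simp add: exp_minus field_simps power_inverse)
  qed
  then have "(flat_exp k \<longlongrightarrow> 0) (at_right 0)"
    by (rule Lim_transform_eventually) (auto simp: flat_exp_def eventually_at_filter)
  moreover have "(flat_exp k \<longlongrightarrow> 0) (at_left 0)"
    by (rule Lim_transform_eventually[OF tendsto_const]) (auto simp: flat_exp_def eventually_at_filter)
  ultimately show ?thesis by (simp add: filterlim_split_at)
qed

lemma flat_exp_deriv:
  "(flat_exp k has_real_derivative (flat_exp (k + 2) t - real k * flat_exp (k + 1) t)) (at t)"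
proof -
  consider "t > 0" | "t < 0" | "t = 0" by linarith
  then show ?thesis
  proof cases
    case 1
    have "((\<lambda>t. exp (- 1 / t) / t ^ k) has_real_derivative
        (flat_exp (k + 2) t - real k * flat_exp (k + 1) t)) (at t)"
    proof (cases k)
      case 0
      then show ?thesis using 1
        by (auto intro!: derivative_eq_intros simp: flat_exp_def power2_eq_square field_simps)
    next
      case (Suc j)
      show ?thesis using 1 unfolding Suc
        by (auto intro!: derivative_eq_intros simp del: power_Suc simp: flat_exp_def divide_simps)
          (simp_all add: algebra_simps power2_eq_square)
    qed
    then show ?thesis
      by (rule has_field_derivative_transform_within_open[where S="{0<..}"])
        (use 1 in \<open>auto simp: flat_exp_def\<close>)
  next
    case 2
    have "((\<lambda>t. 0) has_real_derivative (flat_exp (k + 2) t - real k * flat_exp (k + 1) t)) (at t)"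
      using 2 by (auto intro!: derivative_eq_intros simp: flat_exp_def)
    then show ?thesis
      by (rule has_field_derivative_transform_within_open[where S="{..<0}"])
        (use 2 in \<open>auto simp: flat_exp_def\<close>)
  next
    case 3
    \<comment> \<open>For h \<noteq> 0 the difference quotient at the origin is
      \<open>flat_exp (Suc k) h\<close>, which tends to zero.\<close>
    have "((\<lambda>h. (flat_exp k (0 + h) - flat_exp k 0) / h) \<longlongrightarrow> 0) (at 0)"
      by (rule Lim_transform_eventually[OF flat_exp_tendsto_0[of "Suc k"]])
        (auto simp: flat_exp_def eventually_at_filter)
    then have "(flat_exp k has_real_derivative 0) (at 0)" by (simp add: DERIV_def)
    then show ?thesis using 3 by (simp add: flat_exp_def)
  qed
qed

lemma flat_exp_0_bounds: "0 \<le> flat_exp 0 t" "flat_exp 0 t \<le> 1" "0 < flat_exp 0 t \<longleftrightarrow> 0 < t"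
  by (auto simp: flat_exp_def)

text \<open>A class of expressions closed under directional derivatives; it serves as the
  coinduction invariant that establishes \<open>smooth_fun\<close> for the bumps.\<close>

inductive smooth_alg :: "('a::euclidean_space \<Rightarrow> real) \<Rightarrow> bool" where
  const: "smooth_alg (\<lambda>x. c)"
| lin: "smooth_alg (\<lambda>x. inner x v)"
| add: "smooth_alg f \<Longrightarrow> smooth_alg g \<Longrightarrow> smooth_alg (\<lambda>x. f x + g x)"
| mult: "smooth_alg f \<Longrightarrow> smooth_alg g \<Longrightarrow> smooth_alg (\<lambda>x. f x * g x)"
| flat: "smooth_alg f \<Longrightarrow> smooth_alg (\<lambda>x. flat_exp k (f x))"

lemma smooth_alg_derivative:
  assumes "smooth_alg f"
  shows "\<exists>D. (\<forall>x. (f has_derivative D x) (at x)) \<and> (\<forall>v. smooth_alg (\<lambda>x. D x v))"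
  using assms
proof induction
  case (const c)
  show ?case by (intro exI[of _ "\<lambda>x v. 0"]) (auto intro: smooth_alg.intros)
next
  case (lin w)
  show ?case by (intro exI[of _ "\<lambda>x v. inner v w"])
    (auto intro!: smooth_alg.intros derivative_eq_intros)
next
  case (add f g)
  then obtain D E where "\<forall>x. (f has_derivative D x) (at x)" "\<forall>v. smooth_alg (\<lambda>x. D x v)"
    "\<forall>x. (g has_derivative E x) (at x)" "\<forall>v. smooth_alg (\<lambda>x. E x v)" by auto
  then show ?case
    by (intro exI[of _ "\<lambda>x v. D x v + E x v"]) (auto intro: smooth_alg.intros has_derivative_add)
next
  case (mult f g)
  then obtain D E where "\<forall>x. (f has_derivative D x) (at x)" "\<forall>v. smooth_alg (\<lambda>x. D x v)"
    "\<forall>x. (g has_derivative E x) (at x)" "\<forall>v. smooth_alg (\<lambda>x. E x v)" by auto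
  with mult.hyps show ?case
    by (intro exI[of _ "\<lambda>x v. f x * E x v + D x v * g x"])
      (auto intro!: has_derivative_mult smooth_alg.add smooth_alg.mult[where f=f]
        smooth_alg.mult[where g=g])
next
  case (flat f k)
  then obtain D where D: "\<forall>x. (f has_derivative D x) (at x)" "\<forall>v. smooth_alg (\<lambda>x. D x v)" by auto
  have "((\<lambda>x. flat_exp k (f x)) has_derivative
      (\<lambda>v. D x v * (flat_exp (k + 2) (f x) + - real k * flat_exp (k + 1) (f x)))) (at x)" for x
    using DERIV_compose_FDERIV[OF flat_exp_deriv D(1)[rule_format], of k x] by simp
  moreover have "smooth_alg (\<lambda>x. D x v * (flat_exp (k + 2) (f x) + - real k * flat_exp (k + 1) (f x)))" for v
    using D(2) flat.hyps by (intro smooth_alg.intros) auto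
  ultimately show ?case
    by (intro exI[of _ "\<lambda>x v. D x v * (flat_exp (k + 2) (f x) + - real k * flat_exp (k + 1) (f x))"]) blast
qed

lemma smooth_alg_smooth_fun:
  assumes "smooth_alg f" shows "smooth_fun f"
  using assms
proof (coinduction arbitrary: f)
  case (smooth_fun f)
  then obtain D where D: "\<forall>x. (f has_derivative D x) (at x)" "\<forall>v. smooth_alg (\<lambda>x. D x v)"
    using smooth_alg_derivative by blast
  then have "frechet_derivative f (at x) = D x" for x
    by (metis frechet_derivative_at)
  with D show ?case by (auto simp: differentiable_def)
qed

lemma smooth_fun_differentiable: "smooth_fun f \<Longrightarrow> f differentiable (at x)"
  by (auto elim: smooth_fun.cases)

lemma smooth_fun_derivative: "smooth_fun f \<Longrightarrow> smooth_fun (\<lambda>x. frechet_derivative f (at x) v)"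
  by (auto elim: smooth_fun.cases)

lemma smooth_fun_continuous: "smooth_fun f \<Longrightarrow> continuous_on UNIV f"
  by (simp add: continuous_at_imp_continuous_on differentiable_imp_continuous_within smooth_fun_differentiable)

text \<open>A separate coinduction, over pairs of smooth functions, since an arbitrary test function
  need not lie in \<open>smooth_alg\<close>.\<close>

lemma smooth_fun_lincomb:
  assumes "smooth_fun f" "smooth_fun g"
  shows "smooth_fun (\<lambda>x. c * f x + e * g x)"
  using assms
proof (coinduction arbitrary: f g)
  case (smooth_fun f g)
  let ?D = "\<lambda>h x. frechet_derivative h (at x)"
  have D: "((\<lambda>x. c * f x + e * g x) has_derivative (\<lambda>v. c * ?D f x v + e * ?D g x v)) (at x)" for x
    using smooth_fun by (intro derivative_intros) (auto simp: frechet_derivative_works[symmetric] smooth_fun_differentiable)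
  then have eq: "?D (\<lambda>x. c * f x + e * g x) x = (\<lambda>v. c * ?D f x v + e * ?D g x v)" for x
    by (metis frechet_derivative_at)
  show ?case
    using D smooth_fun by (auto simp: eq differentiable_def intro!: exI smooth_fun_derivative)
qed

text \<open>As \<open>n\<close> tends to infinity these increase to the indicator function of \<open>box a b\<close>.\<close>

definition bump :: "'a::euclidean_space \<Rightarrow> 'a \<Rightarrow> real \<Rightarrow> 'a \<Rightarrow> real" where
  "bump a b n x = (\<Prod>i\<in>Basis. flat_exp 0 (n * (inner x i - inner a i)) * flat_exp 0 (n * (inner b i - inner x i)))"

lemma smooth_alg_prod:
  assumes "finite I" "\<And>i. i \<in> I \<Longrightarrow> smooth_alg (f i)"
  shows "smooth_alg (\<lambda>x. \<Prod>i\<in>I. f i x)"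
  using assms by (induction I) (auto intro: smooth_alg.intros)

lemma smooth_alg_affine:
  assumes "smooth_alg f" shows "smooth_alg (\<lambda>x. n * (c + e * f x))"
  using assms by (intro smooth_alg.intros)

lemma smooth_fun_bump: "smooth_fun (bump a b n)"
proof -
  have "smooth_alg (\<lambda>x. n * (inner x i - inner a i))" "smooth_alg (\<lambda>x. n * (inner b i - inner x i))" for i
    using smooth_alg_affine[OF smooth_alg.lin, of n "- inner a i" 1 i]
      smooth_alg_affine[OF smooth_alg.lin, of n "inner b i" "-1" i] by simp_all
  then have "smooth_alg (\<lambda>x. bump a b n x)"
    unfolding bump_def by (intro smooth_alg_prod smooth_alg.mult[OF smooth_alg.flat smooth_alg.flat]) auto
  then show ?thesis by (simp add: smooth_alg_smooth_fun)
qed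

lemma bump_nonneg: "0 \<le> bump a b n x"
  unfolding bump_def by (intro prod_nonneg) (auto simp: flat_exp_0_bounds)

lemma bump_le_1: "bump a b n x \<le> 1"
  unfolding bump_def by (intro prod_le_1) (auto simp: flat_exp_0_bounds mult_le_one)

lemma bump_pos: "n > 0 \<Longrightarrow> x \<in> box a b \<Longrightarrow> 0 < bump a b n x"
  unfolding bump_def by (intro prod_pos) (auto simp: flat_exp_0_bounds mem_box)

lemma bump_outside: "n > 0 \<Longrightarrow> x \<notin> box a b \<Longrightarrow> bump a b n x = 0"
  by (auto simp: bump_def mem_box flat_exp_def zero_less_mult_iff not_less intro!: bexI)

lemma bump_tendsto:
  assumes "x \<in> box a b" shows "(\<lambda>n. bump a b (real (Suc n)) x) \<longlonglongrightarrow> 1"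
proof -
  have lim: "(\<lambda>n. flat_exp 0 (real (Suc n) * t)) \<longlonglongrightarrow> 1" if "t > 0" for t
  proof -
    have "(\<lambda>n. exp (- (inverse (real (Suc n)) * inverse t))) \<longlonglongrightarrow> exp (- (0 * inverse t))"
      by (intro tendsto_intros LIMSEQ_inverse_real_of_nat)
    moreover have "flat_exp 0 (real (Suc n) * t) = exp (- (inverse (real (Suc n)) * inverse t))" for n
      using that by (simp add: flat_exp_def zero_less_mult_iff del: of_nat_Suc) (simp add: field_simps)
    ultimately show ?thesis by simp
  qed
  have "(\<lambda>n. bump a b (real (Suc n)) x) \<longlonglongrightarrow> (\<Prod>i\<in>(Basis::'a set). 1 * 1)"
    unfolding bump_def using assms by (intro tendsto_intros lim) (auto simp: mem_box)
  then show ?thesis by simp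
qed

lemma bump_Cc_inf:
  assumes "n > 0" "cbox a b \<subseteq> U" shows "bump a b n \<in> Cc_inf U"
proof -
  have "{x. bump a b n x \<noteq> 0} \<subseteq> cbox a b"
    using bump_outside[OF assms(1)] box_subset_cbox by blast
  then have "closure {x. bump a b n x \<noteq> 0} \<subseteq> cbox a b"
    by (intro closure_minimal) auto
  moreover from this have "compact (closure {x. bump a b n x \<noteq> 0})"
    by (meson bounded_cbox bounded_subset closed_closure compact_eq_bounded_closed)
  ultimately show ?thesis using assms smooth_fun_bump by (auto simp: Cc_inf_def)
qed

text \<open>The class on which the singular integral is studied: it contains the test functions and
  is closed under linear combinations and absolute values.\<close>

definition lipc :: "('a::euclidean_space \<Rightarrow> real) \<Rightarrow> bool" where
  "lipc \<phi> \<longleftrightarrow> (\<exists>L. \<forall>x y. \<bar>\<phi> x - \<phi> y\<bar> \<le> L * norm (x - y)) \<and> (\<exists>R. \<forall>x. norm x > R \<longrightarrow> \<phi> x = 0)"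

text \<open>Each directional derivative is continuous and vanishes off the compact support, hence is
  bounded. Expanding a direction in the basis bounds the operator norm of the derivative by L, and
  the mean value inequality applies.\<close>

lemma Cc_inf_lipc:
  assumes "\<phi> \<in> Cc_inf U" shows "lipc \<phi>"
proof -
  define S where "S = closure {x. \<phi> x \<noteq> 0}"
  have sm: "smooth_fun \<phi>" and cS: "compact S" using assms by (auto simp: Cc_inf_def S_def)
  have out: "\<phi> x = 0" if "x \<notin> S" for x
    using that closure_subset[of "{x. \<phi> x \<noteq> 0}"] by (auto simp: S_def)
  obtain R where R: "\<And>x. x \<in> S \<Longrightarrow> norm x \<le> R"
    using compact_imp_bounded[OF cS] by (auto simp: bounded_iff)
  let ?D = "\<lambda>x. frechet_derivative \<phi> (at x)"
  have hd: "(\<phi> has_derivative ?D x) (at x)" for x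
    using smooth_fun_differentiable[OF sm] frechet_derivative_works by blast
  have zero: "?D x v = 0" if "x \<notin> S" for x v
  proof -
    have "((\<lambda>x. 0) has_derivative (\<lambda>v. 0)) (at x)" by simp
    then have "(\<phi> has_derivative (\<lambda>v. 0)) (at x)"
      by (rule has_derivative_transform_within_open[where s="- S"])
        (use that out cS in \<open>auto simp: compact_imp_closed\<close>)
    then show ?thesis using frechet_derivative_at by metis
  qed
  have "\<exists>B. \<forall>x. \<bar>?D x v\<bar> \<le> B" for v
  proof -
    have "continuous_on S (\<lambda>x. ?D x v)"
      using smooth_fun_continuous[OF smooth_fun_derivative[OF sm]] continuous_on_subset by blast
    then have "bounded ((\<lambda>x. ?D x v) ` S)"
      by (intro compact_imp_bounded compact_continuous_image cS)
    then obtain B where "\<And>x. x \<in> S \<Longrightarrow> \<bar>?D x v\<bar> \<le> B" by (auto simp: bounded_iff)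
    then have "\<bar>?D x v\<bar> \<le> max B 0" for x using zero[of x v] by (cases "x \<in> S") force+
    then show ?thesis by blast
  qed
  then obtain B where B: "\<And>x v. \<bar>?D x v\<bar> \<le> B v" by metis
  define L where "L = (\<Sum>i\<in>Basis. B i)"
  have on: "onorm (?D x) \<le> L" for x
  proof (rule onorm_le)
    fix v
    interpret bounded_linear "?D x" using hd has_derivative_bounded_linear by blast
    have "?D x v = (\<Sum>i\<in>Basis. inner v i * ?D x i)"
      by (subst (1) euclidean_representation[of v, symmetric]) (simp add: sum scaleR)
    also have "norm \<dots> \<le> (\<Sum>i\<in>Basis. norm (inner v i * ?D x i))" by (rule norm_sum)
    also have "\<dots> \<le> (\<Sum>i\<in>Basis. norm v * B i)"
      using B by (intro sum_mono) (auto simp: abs_mult intro!: mult_mono Basis_le_norm)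
    finally show "norm (?D x v) \<le> L * norm v" by (simp add: L_def sum_distrib_left mult.commute)
  qed
  have "norm (\<phi> x - \<phi> y) \<le> L * norm (x - y)" for x y
    by (rule differentiable_bound[of UNIV \<phi> ?D]) (use hd on in auto)
  moreover have "\<phi> x = 0" if "norm x > R" for x using R[of x] that out by force
  ultimately show ?thesis unfolding lipc_def by (auto simp del: real_norm_def simp: real_norm_def[symmetric])
qed

section \<open>Integrals of powers\<close>

lemma nn_integral_lborel_affine:
  fixes f :: "'a::euclidean_space \<Rightarrow> ennreal"
  assumes [measurable]: "f \<in> borel_measurable borel" and c: "c \<noteq> 0"
  shows "(\<integral>\<^sup>+x. f x \<partial>lborel) = ennreal (\<bar>c\<bar> ^ DIM('a)) * (\<integral>\<^sup>+x. f (t + c *\<^sub>R x) \<partial>lborel)"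
  by (subst lborel_affine[OF c, of t])
     (simp add: nn_integral_density nn_integral_distr nn_integral_cmult)

lemma lborel_integrable_affine:
  fixes f :: "'a::euclidean_space \<Rightarrow> 'b::{banach, second_countable_topology}"
  assumes f: "integrable lborel f" and c: "c \<noteq> 0"
  shows "integrable lborel (\<lambda>x. f (t + c *\<^sub>R x))"
proof -
  have [measurable]: "f \<in> borel_measurable borel" using f by auto
  have "integrable (density (distr lborel borel (\<lambda>x. t + c *\<^sub>R x)) (\<lambda>_. \<bar>c\<bar> ^ DIM('a))) f"
    using f lborel_affine[OF c, of t] by simp
  then have "integrable lborel (\<lambda>x. (\<bar>c\<bar> ^ DIM('a)) *\<^sub>R f (t + c *\<^sub>R x))"
    by (simp add: integrable_density integrable_distr_eq)
  then have "integrable lborel (\<lambda>x. (1 / \<bar>c\<bar> ^ DIM('a)) *\<^sub>R (\<bar>c\<bar> ^ DIM('a)) *\<^sub>R f (t + c *\<^sub>R x))"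
    by (rule integrable_scaleR_right)
  then show ?thesis using c by simp
qed

lemma lborel_integral_affine:
  fixes f :: "'a::euclidean_space \<Rightarrow> 'b::{banach, second_countable_topology}"
  assumes [measurable]: "f \<in> borel_measurable borel" and c: "c \<noteq> 0"
  shows "integral\<^sup>L lborel f = (\<bar>c\<bar> ^ DIM('a)) *\<^sub>R integral\<^sup>L lborel (\<lambda>x. f (t + c *\<^sub>R x))"
  by (subst lborel_affine[OF c, of t])
     (simp add: integral_density integral_distr)

lemma lborel_integral_reflect:
  fixes f :: "'a::euclidean_space \<Rightarrow> 'b::{banach, second_countable_topology}"
  assumes "f \<in> borel_measurable borel"
  shows "integral\<^sup>L lborel (\<lambda>z. f (t - z)) = integral\<^sup>L lborel f"
  using lborel_integral_affine[OF assms, of "-1" t] by simp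

lemma lborel_integral_translate:
  fixes f :: "'a::euclidean_space \<Rightarrow> 'b::{banach, second_countable_topology}"
  assumes "f \<in> borel_measurable borel"
  shows "integral\<^sup>L lborel (\<lambda>z. f (z - t)) = integral\<^sup>L lborel f"
  using lborel_integral_affine[OF assms, of 1 "- t"] by simp

lemma nn_integral_lborel_translate:
  fixes f :: "'a::euclidean_space \<Rightarrow> ennreal"
  assumes "f \<in> borel_measurable borel"
  shows "(\<integral>\<^sup>+z. f (z - t) \<partial>lborel) = (\<integral>\<^sup>+z. f z \<partial>lborel)"
  using nn_integral_lborel_affine[OF assms, of 1 "- t"] by simp

lemma odd_integral_zero:
  fixes f :: "'a::euclidean_space \<Rightarrow> 'b::{banach, second_countable_topology}"
  assumes [measurable]: "f \<in> borel_measurable borel" and "\<And>z. f (- z) = - f z"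
  shows "integral\<^sup>L lborel f = 0"
proof -
  have "integral\<^sup>L lborel f = integral\<^sup>L lborel (\<lambda>z. f (0 - z))"
    by (rule lborel_integral_reflect[symmetric]) simp
  also have "\<dots> = - integral\<^sup>L lborel f" using assms(2) by simp
  finally have "integral\<^sup>L lborel f + integral\<^sup>L lborel f = 0"
    using add.left_inverse[of "integral\<^sup>L lborel f"] by metis
  then have "2 *\<^sub>R integral\<^sup>L lborel f = 0" by (simp add: scaleR_2)
  then show ?thesis by simp
qed

section \<open>Powers of the norm on dyadic annuli\<close>

definition annulus :: "real \<Rightarrow> 'a::euclidean_space set" where
  "annulus c = {z. c \<le> norm z \<and> norm z < 2 * c}"

lemma annulus_measurable [measurable]: "annulus c \<in> sets borel"
  unfolding annulus_def by measurable

definition annulus_mass :: "'a::euclidean_space itself \<Rightarrow> real \<Rightarrow> ennreal" where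
  "annulus_mass TYPE('a) p = (\<integral>\<^sup>+z. ennreal (norm z powr - p) * indicator (annulus 1) (z::'a) \<partial>lborel)"

lemma annulus_mass_finite: "annulus_mass TYPE('a::euclidean_space) p < \<infinity>"
proof -
  have "annulus_mass TYPE('a) p \<le> (\<integral>\<^sup>+z. ennreal (max 1 (2 powr - p)) * indicator (ball 0 2) (z::'a) \<partial>lborel)"
    unfolding annulus_mass_def
  proof (rule nn_integral_mono)
    fix z :: 'a
    have "norm z powr - p \<le> max 1 (2 powr - p)" if "1 \<le> norm z" "norm z < 2"
    proof (cases "p \<ge> 0")
      case True
      then have "norm z powr - p \<le> norm z powr 0" using that by (intro powr_mono) auto
      then show ?thesis using that by (auto simp: split: if_splits)
    next
      case False
      then have "norm z powr - p \<le> 2 powr - p" using that by (intro powr_mono2) auto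
      then show ?thesis by simp
    qed
    then show "ennreal (norm z powr - p) * indicator (annulus 1) z \<le> ennreal (max 1 (2 powr - p)) * indicator (ball 0 2) z"
      by (auto simp: annulus_def indicator_def intro!: ennreal_leI)
  qed
  also have "\<dots> = ennreal (max 1 (2 powr - p)) * emeasure lborel (ball (0::'a) 2)"
    by (rule nn_integral_cmult_indicator) simp
  also have "\<dots> < \<infinity>"
    using emeasure_lborel_ball_finite[of "0::'a" 2] by (simp add: ennreal_mult_less_top)
  finally show ?thesis .
qed

lemma annulus_scaling:
  assumes c: "c > 0"
  shows "(\<integral>\<^sup>+z. ennreal (norm z powr - p) * indicator (annulus c) (z::'a::euclidean_space) \<partial>lborel)
    = ennreal (c powr (real DIM('a) - p)) * annulus_mass TYPE('a) p"
proof -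
  have "(\<integral>\<^sup>+z. ennreal (norm z powr - p) * indicator (annulus c) (z::'a) \<partial>lborel)
    = ennreal (\<bar>c\<bar> ^ DIM('a)) * (\<integral>\<^sup>+z. ennreal (norm (0 + c *\<^sub>R z) powr - p) * indicator (annulus c) (0 + c *\<^sub>R z::'a) \<partial>lborel)"
    using c by (intro nn_integral_lborel_affine) auto
  also have "(\<integral>\<^sup>+z. ennreal (norm (0 + c *\<^sub>R z) powr - p) * indicator (annulus c) (0 + c *\<^sub>R z::'a) \<partial>lborel)
     = (\<integral>\<^sup>+z. ennreal (c powr - p) * (ennreal (norm z powr - p) * indicator (annulus 1) (z::'a)) \<partial>lborel)"
    using c by (intro nn_integral_cong)
      (auto simp: annulus_def indicator_def powr_mult ennreal_mult)
  also have "\<dots> = ennreal (c powr - p) * annulus_mass TYPE('a) p"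
    unfolding annulus_mass_def by (rule nn_integral_cmult) measurable
  finally show ?thesis using c
    by (simp add: powr_diff powr_minus powr_realpow[symmetric] ennreal_mult[symmetric] mult.assoc[symmetric] divide_inverse)
qed

lemma dyadic_power_sum_finite:
  assumes "0 < r" "r < 1" "C < \<infinity>"
  shows "(\<Sum>k. ennreal (r ^ k) * C) < \<infinity>"
proof -
  have "(\<Sum>k. ennreal (r ^ k) * C) = (\<Sum>k. ennreal (r ^ k)) * C" by simp
  also have "(\<Sum>k. ennreal (r ^ k)) = ennreal (\<Sum>k. r ^ k)"
    using assms by (intro suminf_ennreal2 summable_geometric) auto
  finally show ?thesis using assms by (simp add: ennreal_mult_less_top)
qed

text \<open>The annuli from 2^k to 2^(k+1) cover the region. By scaling, the k-th one contributes
  2^(k(d-p)) times the mass of the unit annulus, and these form a convergent geometric series for p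
  > d.\<close>

lemma powr_integral_far:
  assumes p: "p > real DIM('a::euclidean_space)"
  shows "(\<integral>\<^sup>+z. ennreal (norm z powr - p) * indicator {z. 1 \<le> norm z} (z::'a) \<partial>lborel) < \<infinity>"
proof -
  have "(\<integral>\<^sup>+z. ennreal (norm z powr - p) * indicator {z. 1 \<le> norm z} (z::'a) \<partial>lborel)
    \<le> (\<integral>\<^sup>+z. (\<Sum>k. ennreal (norm z powr - p) * indicator (annulus (2^k)) (z::'a)) \<partial>lborel)"
  proof (rule nn_integral_mono)
    fix z :: 'a
    show "ennreal (norm z powr - p) * indicator {z. 1 \<le> norm z} z
      \<le> (\<Sum>k. ennreal (norm z powr - p) * indicator (annulus (2^k)) z)"
    proof (cases "1 \<le> norm z")
      case True
      obtain N where N: "norm z < 2 ^ N" using real_arch_pow[of 2 "norm z"] by auto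
      define k where "k = (LEAST k. norm z < 2 ^ Suc k)"
      have "norm z < 2 ^ Suc N" using N norm_ge_zero[of z] unfolding power_Suc by linarith
      then have k: "norm z < 2 ^ Suc k" unfolding k_def by (rule LeastI)
      have "2 ^ k \<le> norm z"
      proof (cases k)
        case (Suc j)
        then have "\<not> norm z < 2 ^ Suc j" using not_less_Least[of j "\<lambda>k. norm z < 2 ^ Suc k"] by (auto simp: k_def)
        then show ?thesis using Suc by simp
      qed (use True in simp)
      with k have "z \<in> annulus (2^k)" by (simp add: annulus_def)
      then have "ennreal (norm z powr - p) = (\<Sum>k\<in>{k}. ennreal (norm z powr - p) * indicator (annulus (2^k)) z)" by simp
      also have "\<dots> \<le> (\<Sum>k. ennreal (norm z powr - p) * indicator (annulus (2^k)) z)"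
        by (rule sum_le_suminf) auto
      finally show ?thesis using True by simp
    qed simp
  qed
  also have "\<dots> = (\<Sum>k. \<integral>\<^sup>+z. ennreal (norm z powr - p) * indicator (annulus (2^k)) (z::'a) \<partial>lborel)"
    by (rule nn_integral_suminf) measurable
  also have "\<dots> = (\<Sum>k. ennreal ((2 powr (real DIM('a) - p)) ^ k) * annulus_mass TYPE('a) p)"
    by (simp add: annulus_scaling powr_realpow[symmetric] powr_powr powr_power mult.commute)
  also have "\<dots> < \<infinity>"
    using p annulus_mass_finite[where 'a='a] by (intro dyadic_power_sum_finite) (auto simp: powr_less_one)
  finally show ?thesis .
qed

text \<open>The dyadic decomposition towards the origin. The index is \<open>Suc k\<close> because
  \<open>annulus c\<close> reaches up to 2c and the outermost one has to end at 1. The origin lies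
  in no annulus, but there the integrand is zero by the convention for \<open>powr\<close>.\<close>

lemma powr_integral_near:
  assumes p: "p < real DIM('a::euclidean_space)"
  shows "(\<integral>\<^sup>+z. ennreal (norm z powr - p) * indicator {z. norm z < 1} (z::'a) \<partial>lborel) < \<infinity>"
proof -
  have "(\<integral>\<^sup>+z. ennreal (norm z powr - p) * indicator {z. norm z < 1} (z::'a) \<partial>lborel)
    \<le> (\<integral>\<^sup>+z. (\<Sum>k. ennreal (norm z powr - p) * indicator (annulus ((1/2)^Suc k)) (z::'a)) \<partial>lborel)"
  proof (rule nn_integral_mono)
    fix z :: 'a
    show "ennreal (norm z powr - p) * indicator {z. norm z < 1} z
      \<le> (\<Sum>k. ennreal (norm z powr - p) * indicator (annulus ((1/2)^Suc k)) z)"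
    proof (cases "norm z < 1 \<and> z \<noteq> 0")
      case True
      then obtain N where N: "(1/2) ^ N < norm z" using real_arch_pow_inv[of "norm z" "1/2"] by auto
      define k where "k = (LEAST k. (1/2) ^ Suc k \<le> norm z)"
      have "(1/2) ^ Suc N \<le> norm z" using N norm_ge_zero[of z] unfolding power_Suc by linarith
      then have k: "(1/2) ^ Suc k \<le> norm z" unfolding k_def by (rule LeastI)
      have "norm z < (1/2) ^ k"
      proof (cases k)
        case (Suc j)
        then have "\<not> (1/2) ^ Suc j \<le> norm z" using not_less_Least[of j "\<lambda>k. (1/2) ^ Suc k \<le> norm z"] by (auto simp: k_def)
        then show ?thesis using Suc by simp
      qed (use True in simp)
      with k have "z \<in> annulus ((1/2)^Suc k)" by (simp add: annulus_def)
      then have "ennreal (norm z powr - p) = (\<Sum>k\<in>{k}. ennreal (norm z powr - p) * indicator (annulus ((1/2)^Suc k)) z)" by simp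
      also have "\<dots> \<le> (\<Sum>k. ennreal (norm z powr - p) * indicator (annulus ((1/2)^Suc k)) z)"
        by (rule sum_le_suminf) auto
      finally show ?thesis using True by simp
    qed auto
  qed
  also have "\<dots> = (\<Sum>k. \<integral>\<^sup>+z. ennreal (norm z powr - p) * indicator (annulus ((1/2)^Suc k)) (z::'a) \<partial>lborel)"
    by (rule nn_integral_suminf) measurable
  also have "\<dots> = (\<Sum>k. ennreal (((1/2) powr (real DIM('a) - p)) ^ Suc k) * annulus_mass TYPE('a) p)"
    by (simp add: annulus_scaling powr_realpow[symmetric] powr_powr powr_power mult.commute del: power_Suc)
  also have "\<dots> = (\<Sum>k. ennreal (((1/2) powr (real DIM('a) - p)) ^ k) * (ennreal ((1/2) powr (real DIM('a) - p)) * annulus_mass TYPE('a) p))"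
    by (simp add: ennreal_mult mult_ac)
  also have "\<dots> < \<infinity>"
  proof (rule dyadic_power_sum_finite)
    have "(1/2::real) powr (real DIM('a) - p) = 1 / 2 powr (real DIM('a) - p)" by (simp add: powr_divide)
    also have "\<dots> < 1" using p by simp
    finally show "(1/2::real) powr (real DIM('a) - p) < 1" .
    show "ennreal ((1 / 2) powr (real DIM('a) - p)) * annulus_mass TYPE('a) p < \<infinity>"
      using annulus_mass_finite[where 'a='a] by (simp add: ennreal_mult_less_top)
  qed auto
  finally show ?thesis .
qed

section \<open>The fractional gradient of Lipschitz functions\<close>

lemma integrable_decay:
  fixes g :: "'a::euclidean_space \<Rightarrow> 'b::{banach, second_countable_topology}"
  assumes [measurable]: "g \<in> borel_measurable borel" and p: "p > real DIM('a)"
    and C: "\<And>x. norm (g x) \<le> C" "\<And>x. norm x \<ge> 1 \<Longrightarrow> norm (g x) \<le> C * norm x powr - p"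
  shows "integrable lborel g"
proof (rule integrableI_bounded)
  have C0: "C \<ge> 0" using C(1)[of 0] norm_ge_zero order_trans by blast
  have "(\<integral>\<^sup>+x. ennreal (norm (g x)) \<partial>lborel)
    \<le> (\<integral>\<^sup>+x. ennreal C * indicator (ball (0::'a) 1) x + ennreal C * (ennreal (norm x powr - p) * indicator {z. 1 \<le> norm z} x) \<partial>lborel)"
  proof (rule nn_integral_mono)
    fix x :: 'a
    show "ennreal (norm (g x)) \<le> ennreal C * indicator (ball 0 1) x + ennreal C * (ennreal (norm x powr - p) * indicator {z. 1 \<le> norm z} x)"
      using C(1)[of x] C(2)[of x] C0
      by (cases "norm x < 1") (auto simp: ennreal_mult[symmetric] intro!: ennreal_leI)
  qed
  also have "\<dots> = ennreal C * emeasure lborel (ball (0::'a) 1)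
      + ennreal C * (\<integral>\<^sup>+z. ennreal (norm z powr - p) * indicator {z. 1 \<le> norm z} (z::'a) \<partial>lborel)"
  proof -
    have [measurable]: "ball (0::'a) 1 \<in> sets borel" by simp
    have "(\<lambda>x::'a. ennreal C * indicator (ball 0 1) x) \<in> borel_measurable lborel" by measurable
    then show ?thesis
      by (subst nn_integral_add) (auto simp: nn_integral_cmult nn_integral_cmult_indicator)
  qed
  also have "\<dots> < \<infinity>"
    using powr_integral_far[OF p] emeasure_lborel_ball_finite[of "0::'a" 1] by (simp add: ennreal_mult_less_top)
  finally show "(\<integral>\<^sup>+x. ennreal (norm (g x)) \<partial>lborel) < \<infinity>" .
qed simp

definition frac_kernel :: "real \<Rightarrow> 'a::euclidean_space \<Rightarrow> 'a" where
  "frac_kernel s z = (1 / norm z powr (real DIM('a) + s + 1)) *\<^sub>R z"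

lemma frac_kernel_measurable [measurable]: "frac_kernel s \<in> borel_measurable borel"
  unfolding frac_kernel_def by measurable

lemma frac_kernel_minus: "frac_kernel s (- z) = - frac_kernel s z"
  by (simp add: frac_kernel_def)

lemma norm_frac_kernel: "norm (frac_kernel s (z::'a::euclidean_space)) = norm z powr - (real DIM('a) + s)"
proof (cases "z = 0")
  case False
  have "norm z powr (real DIM('a) + s + 1) = norm z powr (real DIM('a) + s) * norm z"
    using powr_add[of "norm z" "real DIM('a) + s" 1] by simp
  then have "norm (frac_kernel s z) = 1 / norm z powr (real DIM('a) + s)"
    using False by (simp add: frac_kernel_def)
  then show ?thesis by (simp only: powr_minus divide_inverse mult_1)
qed (simp add: frac_kernel_def)

text \<open>The factor \<open>min (norm z) 1\<close> stands for the size of an increment \<phi> x -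
  \<phi> (x - z). Near the origin it lowers the exponent to d + s - 1 < d, at infinity it leaves d +
  s > d; both bounds on s are used.\<close>

lemma frac_kernel_integrable:
  assumes "0 < s" "s < 1"
  shows "integrable lborel (\<lambda>z::'a::euclidean_space. min (norm z) 1 * norm (frac_kernel s z))"
proof (rule integrableI_bounded)
  let ?d = "real DIM('a)"
  have "(\<integral>\<^sup>+z. ennreal (norm (min (norm z) 1 * norm (frac_kernel s z))) \<partial>(lborel :: 'a measure))
    \<le> (\<integral>\<^sup>+z. ennreal (norm z powr - (?d + s - 1)) * indicator {z. norm z < 1} (z::'a)
          + ennreal (norm z powr - (?d + s)) * indicator {z. 1 \<le> norm z} z \<partial>lborel)"
  proof (rule nn_integral_mono)
    fix z :: 'a
    show "ennreal (norm (min (norm z) 1 * norm (frac_kernel s z)))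
      \<le> ennreal (norm z powr - (?d + s - 1)) * indicator {z. norm z < 1} (z::'a)
          + ennreal (norm z powr - (?d + s)) * indicator {z. 1 \<le> norm z} z"
    proof (cases "z = 0 \<or> norm z \<ge> 1")
      case False
      then have "norm z * norm z powr - (?d + s) = norm z powr 1 * norm z powr - (?d + s)" by simp
      also have "\<dots> = norm z powr - (?d + s - 1)" by (simp only: powr_add[symmetric]) (simp add: algebra_simps)
      finally show ?thesis using False by (auto simp: norm_frac_kernel)
    qed (auto simp: norm_frac_kernel)
  qed
  also have "\<dots> = (\<integral>\<^sup>+z. ennreal (norm z powr - (?d + s - 1)) * indicator {z. norm z < 1} (z::'a) \<partial>lborel)
      + (\<integral>\<^sup>+z. ennreal (norm z powr - (?d + s)) * indicator {z. 1 \<le> norm z} (z::'a) \<partial>lborel)"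
    by (rule nn_integral_add) auto
  also have "\<dots> < \<infinity>"
    using powr_integral_far[where 'a='a, of "?d + s"] powr_integral_near[where 'a='a, of "?d + s - 1"] assms by simp
  finally show "(\<integral>\<^sup>+z. ennreal (norm (min (norm z) 1 * norm (frac_kernel s z))) \<partial>(lborel :: 'a measure)) < \<infinity>" .
qed simp

lemma lipcE:
  assumes "lipc \<phi>"
  obtains L R M where "L \<ge> 0" "R \<ge> 0" "M \<ge> 0" "\<And>x y. \<bar>\<phi> x - \<phi> y\<bar> \<le> L * norm (x - y)"
    "\<And>x. norm x > R \<Longrightarrow> \<phi> x = 0" "\<And>x. \<bar>\<phi> x\<bar> \<le> M"
proof -
  obtain L R where L: "\<And>x y. \<bar>\<phi> x - \<phi> y\<bar> \<le> L * norm (x - y)" and R: "\<And>x. norm x > R \<Longrightarrow> \<phi> x = 0"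
    using assms by (auto simp: lipc_def)
  define L' where "L' = \<bar>L\<bar>"
  define R' where "R' = \<bar>R\<bar>"
  have L': "\<bar>\<phi> x - \<phi> y\<bar> \<le> L' * norm (x - y)" for x y
    using L[of x y] mult_right_mono[OF abs_ge_self[of L] norm_ge_zero[of "x - y"]] by (simp add: L'_def)
  have R': "\<phi> x = 0" if "norm x > R'" for x using R[of x] that by (auto simp: R'_def)
  have M: "\<bar>\<phi> x\<bar> \<le> \<bar>\<phi> 0\<bar> + L' * R'" for x
  proof (cases "norm x > R'")
    case False
    have "\<bar>\<phi> x\<bar> \<le> \<bar>\<phi> 0\<bar> + L' * norm x" using L'[of x 0] by simp
    moreover have "L' * norm x \<le> L' * R'" using False by (intro mult_left_mono) (auto simp: L'_def)
    ultimately show ?thesis by simp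
  qed (auto simp: R' L'_def R'_def)
  show thesis
    by (rule that[of L' R' "\<bar>\<phi> 0\<bar> + L' * R'"]) (use L' R' M in \<open>auto simp: L'_def R'_def\<close>)
qed

lemma lipc_continuous:
  assumes "lipc \<phi>" shows "continuous_on UNIV \<phi>"
proof -
  obtain L where "L \<ge> 0" "\<And>x y. \<bar>\<phi> x - \<phi> y\<bar> \<le> L * norm (x - y)" using lipcE[OF assms] by metis
  then have "L-lipschitz_on UNIV \<phi>" by (auto simp: lipschitz_on_def dist_norm)
  then show ?thesis by (rule lipschitz_on_continuous_on)
qed

lemma lipc_measurable: "lipc \<phi> \<Longrightarrow> \<phi> \<in> borel_measurable borel"
  by (simp add: borel_measurable_continuous_onI lipc_continuous)

lemma integrable_bounded_support:
  fixes g :: "'a::euclidean_space \<Rightarrow> 'b::{banach, second_countable_topology}"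
  assumes [measurable]: "g \<in> borel_measurable borel" and "\<And>x. norm (g x) \<le> M" "\<And>x. norm x > R \<Longrightarrow> g x = 0"
  shows "integrable lborel g"
proof (rule integrable_pointwise_bound)
  show "integrable lborel (\<lambda>x. M * indicator (cball (0::'a) R) x :: real)"
    using emeasure_lborel_cball_finite[of "0::'a" R]
    by (intro integrable_mult_right integrable_real_indicator) auto
  show "norm (g x) \<le> norm (M * indicator (cball 0 R) x :: real)" for x
    using assms(2)[of x] assms(3)[of x] by (cases "norm x > R") auto
qed simp

lemma lipc_integrable: "lipc \<phi> \<Longrightarrow> integrable lborel \<phi>"
  by (erule lipcE) (rule integrable_bounded_support, auto simp: lipc_def intro: lipc_measurable[unfolded lipc_def])

text \<open>One modulus serves both for the supremum norm and for the L^1 norm of an increment. The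
  first makes the fractional integral bounded, the second makes it integrable and justifies
  exchanging the order of integration.\<close>

lemma lipc_diff_bounds:
  assumes "lipc \<phi>"
  obtains C where "C \<ge> 0" "\<And>x z. \<bar>\<phi> x - \<phi> (x - z)\<bar> \<le> C * min (norm z) 1"
    "\<And>z. (\<integral>\<^sup>+x. ennreal \<bar>\<phi> x - \<phi> (x - z)\<bar> \<partial>lborel) \<le> ennreal (C * min (norm z) 1)"
proof -
  obtain L R M where *: "L \<ge> 0" "R \<ge> 0" "M \<ge> 0" "\<And>x y. \<bar>\<phi> x - \<phi> y\<bar> \<le> L * norm (x - y)"
    "\<And>x. norm x > R \<Longrightarrow> \<phi> x = 0" "\<And>x. \<bar>\<phi> x\<bar> \<le> M" using lipcE[OF assms] by metis
  note [measurable] = lipc_measurable[OF assms]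
  \<comment> \<open>For shifts of length at most 1 both \<phi> and its translate vanish outside the
    ball of radius R + 1.\<close>
  define V where "V = measure lborel (cball (0::'a) (R + 1))"
  define I where "I = integral\<^sup>L lborel (\<lambda>x. \<bar>\<phi> x\<bar>)"
  define C where "C = L + 2 * M + L * V + 2 * I"
  have I0: "I \<ge> 0" by (simp add: I_def)
  have V0: "V \<ge> 0" by (simp add: V_def)
  have C: "L \<le> C" "2 * M \<le> C" "L * V \<le> C" "2 * I \<le> C" "0 \<le> C"
    using * V0 I0 mult_nonneg_nonneg[OF *(1) V0] by (auto simp: C_def)
  have 1: "\<bar>\<phi> x - \<phi> (x - z)\<bar> \<le> C * min (norm z) 1" for x z
  proof (cases "norm z \<le> 1")
    case True
    have "\<bar>\<phi> x - \<phi> (x - z)\<bar> \<le> L * norm z" using *(4)[of x "x - z"] by simp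
    also have "\<dots> \<le> C * norm z" using C by (intro mult_right_mono) auto
    finally show ?thesis using True by simp
  next
    case False
    have "\<bar>\<phi> x - \<phi> (x - z)\<bar> \<le> 2 * M" using *(6)[of x] *(6)[of "x - z"] by linarith
    then show ?thesis using False C by simp
  qed
  have 2: "(\<integral>\<^sup>+x. ennreal \<bar>\<phi> x - \<phi> (x - z)\<bar> \<partial>lborel) \<le> ennreal (C * min (norm z) 1)" for z
  proof (cases "norm z \<le> 1")
    case True
    have "(\<integral>\<^sup>+x. ennreal \<bar>\<phi> x - \<phi> (x - z)\<bar> \<partial>lborel)
      \<le> (\<integral>\<^sup>+x. ennreal (L * norm z) * indicator (cball (0::'a) (R + 1)) x \<partial>lborel)"
    proof (rule nn_integral_mono)
      fix x
      show "ennreal \<bar>\<phi> x - \<phi> (x - z)\<bar> \<le> ennreal (L * norm z) * indicator (cball 0 (R + 1)) x"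
      proof (cases "norm x \<le> R + 1")
        case True
        then show ?thesis using *(4)[of x "x - z"] by (simp add: ennreal_leI)
      next
        case F: False
        have "norm x - norm z \<le> norm (x - z)" by (rule norm_triangle_ineq2)
        then have "\<phi> x = 0" "\<phi> (x - z) = 0" using F True *(5)[of x] *(5)[of "x - z"] by auto
        then show ?thesis by simp
      qed
    qed
    also have "\<dots> = ennreal (L * norm z) * emeasure lborel (cball (0::'a) (R + 1))"
      by (rule nn_integral_cmult_indicator) simp
    also have "\<dots> = ennreal (L * V * norm z)"
      using *(1) V0 emeasure_eq_ennreal_measure[of lborel "cball (0::'a) (R + 1)"]
        emeasure_lborel_cball_finite[of "0::'a" "R + 1"]
      by (simp add: V_def ennreal_mult[symmetric] less_imp_neq mult_ac)
    also have "\<dots> \<le> ennreal (C * min (norm z) 1)"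
      using True C by (intro ennreal_leI) (simp add: mult_right_mono)
    finally show ?thesis .
  next
    case False
    have I: "(\<integral>\<^sup>+x. ennreal \<bar>\<phi> x\<bar> \<partial>lborel) = ennreal I"
      unfolding I_def using lipc_integrable[OF assms] by (intro nn_integral_eq_integral) auto
    have "(\<integral>\<^sup>+x. ennreal \<bar>\<phi> x - \<phi> (x - z)\<bar> \<partial>lborel)
      \<le> (\<integral>\<^sup>+x. ennreal \<bar>\<phi> x\<bar> + ennreal \<bar>\<phi> (x - z)\<bar> \<partial>lborel)"
      by (intro nn_integral_mono) (simp add: ennreal_plus[symmetric] ennreal_leI del: ennreal_plus)
    also have "\<dots> = (\<integral>\<^sup>+x. ennreal \<bar>\<phi> x\<bar> \<partial>lborel) + (\<integral>\<^sup>+x. ennreal \<bar>\<phi> (x - z)\<bar> \<partial>lborel)"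
      by (rule nn_integral_add) auto
    also have "(\<integral>\<^sup>+x. ennreal \<bar>\<phi> (x - z)\<bar> \<partial>lborel) = (\<integral>\<^sup>+x. ennreal \<bar>\<phi> x\<bar> \<partial>lborel)"
      by (rule nn_integral_lborel_translate) simp
    also have "(\<integral>\<^sup>+x. ennreal \<bar>\<phi> x\<bar> \<partial>lborel) + (\<integral>\<^sup>+x. ennreal \<bar>\<phi> x\<bar> \<partial>lborel) = ennreal (2 * I)"
      using I0 by (simp add: I ennreal_plus[symmetric] del: ennreal_plus)
    also have "\<dots> \<le> ennreal (C * min (norm z) 1)" using False C by (intro ennreal_leI) simp
    finally show ?thesis .
  qed
  show thesis using that[OF C(5) 1 2] .
qed

text \<open>The integral defining \<open>frac_grad\<close> in the variable \<open>z = x - y\<close>, without the constant.\<close>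

definition frac_int :: "real \<Rightarrow> ('a::euclidean_space \<Rightarrow> real) \<Rightarrow> 'a \<Rightarrow> 'a" where
  "frac_int s \<phi> x = integral\<^sup>L lborel (\<lambda>z. (\<phi> x - \<phi> (x - z)) *\<^sub>R frac_kernel s z)"

lemma frac_grad_eq_frac_int:
  fixes \<phi> :: "'a::euclidean_space \<Rightarrow> real"
  assumes "lipc \<phi>"
  shows "frac_grad s \<phi> x = mu_s s DIM('a) *\<^sub>R frac_int s \<phi> x"
proof -
  note [measurable] = lipc_measurable[OF assms]
  define g where "g y = ((\<phi> x - \<phi> y) / norm (x - y) powr (real DIM('a) + s + 1)) *\<^sub>R (x - y)" for y
  have [measurable]: "g \<in> borel_measurable borel" unfolding g_def by measurable
  have "integral\<^sup>L lebesgue g = integral\<^sup>L lborel g"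
    by (rule integral_completion) simp
  also have "\<dots> = integral\<^sup>L lborel (\<lambda>z. g (x - z))"
    by (rule lborel_integral_reflect[symmetric]) simp
  also have "\<dots> = frac_int s \<phi> x"
    unfolding frac_int_def by (intro Bochner_Integration.integral_cong) (auto simp: g_def frac_kernel_def)
  finally show ?thesis unfolding frac_grad_def g_def[symmetric] by simp
qed

lemma integrable_bounded_imp_L2:
  fixes g :: "'a::euclidean_space \<Rightarrow> 'b::euclidean_space"
  assumes "integrable lborel g" "\<And>x. norm (g x) \<le> B"
  shows "L2 g"
proof -
  have [measurable]: "g \<in> borel_measurable borel" using assms(1) by auto
  have "integrable lborel (\<lambda>x. (norm (g x))\<^sup>2)"
  proof (rule integrable_pointwise_bound)
    show "integrable lborel (\<lambda>x. B * norm (g x))" using assms(1) by simp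
    show "norm ((norm (g x))\<^sup>2) \<le> norm (B * norm (g x))" for x
      using mult_right_mono[OF assms(2)[of x], of "norm (g x)"]
      by (simp add: power2_eq_square abs_mult order_trans[OF _ mult_right_mono[OF abs_ge_self]])
  qed simp
  then show ?thesis unfolding L2_def
    by (auto intro: integrable_completion[THEN iffD2] measurable_completion)
qed

lemma lipc_shift_product_integrable:
  fixes \<phi> \<psi> :: "'a::euclidean_space \<Rightarrow> real"
  assumes \<phi>: "lipc \<phi>" and [measurable]: "\<psi> \<in> borel_measurable borel" and B: "\<And>x. \<bar>\<psi> x\<bar> \<le> B"
  shows "integrable lborel (\<lambda>x. \<psi> x * \<phi> (x - z))"
proof -
  note [measurable] = lipc_measurable[OF \<phi>]
  have "integrable lborel (\<lambda>x. \<phi> (x - z))"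
    using lborel_integrable_affine[OF lipc_integrable[OF \<phi>], of 1 "- z"] by simp
  then have "integrable lborel (\<lambda>x. B * \<phi> (x - z))" by simp
  then show ?thesis
  proof (rule integrable_pointwise_bound)
    show "norm (\<psi> x * \<phi> (x - z)) \<le> norm (B * \<phi> (x - z))" for x
      using B[of x] by (auto simp: abs_mult intro!: mult_right_mono)
  qed simp
qed

context
  fixes s :: real
  assumes s: "0 < s" "s < 1"
begin

lemma frac_int_integrand_integrable:
  assumes "lipc \<phi>"
  shows "integrable lborel (\<lambda>z. (\<phi> x - \<phi> (x - z)) *\<^sub>R frac_kernel s z)"
proof -
  note [measurable] = lipc_measurable[OF assms]
  obtain C where C: "C \<ge> 0" "\<And>x z. \<bar>\<phi> x - \<phi> (x - z)\<bar> \<le> C * min (norm z) 1" using lipc_diff_bounds[OF assms] by metis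
  show ?thesis
  proof (rule integrable_pointwise_bound)
    show "integrable lborel (\<lambda>z::'a. C * (min (norm z) 1 * norm (frac_kernel s z)))"
      by (intro integrable_mult_right frac_kernel_integrable s)
    show "norm ((\<phi> x - \<phi> (x - z)) *\<^sub>R frac_kernel s z) \<le> norm (C * (min (norm z) 1 * norm (frac_kernel s z)))" for z
      using mult_right_mono[OF C(2)[of x z], of "norm (frac_kernel s z)"] C(1) by (simp add: mult.assoc)
  qed simp
qed

lemma frac_int_measurable [measurable (raw)]:
  fixes \<phi> :: "'a::euclidean_space \<Rightarrow> real"
  assumes "lipc \<phi>" shows "frac_int s \<phi> \<in> borel_measurable borel"
proof -
  note [measurable] = lipc_measurable[OF assms]
  have "frac_int s \<phi> \<in> borel_measurable lborel"
    unfolding frac_int_def by (rule lborel.borel_measurable_lebesgue_integral) measurable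
  then show ?thesis by simp
qed

lemma frac_int_bounded:
  fixes \<phi> :: "'a::euclidean_space \<Rightarrow> real"
  assumes "lipc \<phi>" obtains B where "\<And>x. norm (frac_int s \<phi> x) \<le> B"
proof -
  obtain C where C: "C \<ge> 0" "\<And>x z. \<bar>\<phi> x - \<phi> (x - z)\<bar> \<le> C * min (norm z) 1" using lipc_diff_bounds[OF assms] by metis
  have "norm (frac_int s \<phi> x) \<le> integral\<^sup>L lborel (\<lambda>z::'a. C * (min (norm z) 1 * norm (frac_kernel s z)))" for x
    unfolding frac_int_def
  proof (rule order_trans[OF integral_norm_bound], rule integral_mono)
    show "integrable lborel (\<lambda>z. norm ((\<phi> x - \<phi> (x - z)) *\<^sub>R frac_kernel s z))"
      using frac_int_integrand_integrable[OF assms] by (rule integrable_norm)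
    show "integrable lborel (\<lambda>z::'a. C * (min (norm z) 1 * norm (frac_kernel s z)))"
      by (intro integrable_mult_right frac_kernel_integrable s)
    show "norm ((\<phi> x - \<phi> (x - z)) *\<^sub>R frac_kernel s z) \<le> C * (min (norm z) 1 * norm (frac_kernel s z))" for z
      using mult_right_mono[OF C(2)[of x z], of "norm (frac_kernel s z)"] by (simp add: mult.assoc)
  qed
  then show thesis by (rule that)
qed

text \<open>Integrating in x first turns the increment into its L^1 modulus, which compensates the
  singularity of the kernel at z = 0.\<close>

lemma frac_int_double_integrable:
  fixes \<phi> :: "'a::euclidean_space \<Rightarrow> real"
  assumes "lipc \<phi>"
  shows "integrable (lborel \<Otimes>\<^sub>M lborel) (\<lambda>(z, x). (\<phi> x - \<phi> (x - z)) *\<^sub>R frac_kernel s z)"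
proof (rule integrableI_bounded)
  note [measurable] = lipc_measurable[OF assms]
  obtain C where C: "C \<ge> 0" "\<And>z. (\<integral>\<^sup>+x. ennreal \<bar>\<phi> x - \<phi> (x - z)\<bar> \<partial>lborel) \<le> ennreal (C * min (norm z) 1)"
    using lipc_diff_bounds[OF assms] by metis
  have "(\<integral>\<^sup>+p. ennreal (norm (case p of (z, x) \<Rightarrow> (\<phi> x - \<phi> (x - z)) *\<^sub>R frac_kernel s z)) \<partial>(lborel \<Otimes>\<^sub>M lborel))
     = (\<integral>\<^sup>+z. \<integral>\<^sup>+x. ennreal (norm ((\<phi> x - \<phi> (x - z)) *\<^sub>R frac_kernel s z)) \<partial>lborel \<partial>lborel)"
    by (subst lborel.nn_integral_fst[symmetric]) auto
  also have "\<dots> \<le> (\<integral>\<^sup>+z. ennreal (norm (C * (min (norm z) 1 * norm (frac_kernel s (z::'a))))) \<partial>lborel)"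
  proof (rule nn_integral_mono)
    fix z :: 'a
    have "(\<integral>\<^sup>+x. ennreal (norm ((\<phi> x - \<phi> (x - z)) *\<^sub>R frac_kernel s z)) \<partial>lborel)
        = (\<integral>\<^sup>+x. ennreal (norm (frac_kernel s z)) * ennreal \<bar>\<phi> x - \<phi> (x - z)\<bar> \<partial>lborel)"
      by (simp add: ennreal_mult[symmetric] mult.commute)
    also have "\<dots> = ennreal (norm (frac_kernel s z)) * (\<integral>\<^sup>+x. ennreal \<bar>\<phi> x - \<phi> (x - z)\<bar> \<partial>lborel)"
      by (rule nn_integral_cmult) simp
    also have "\<dots> \<le> ennreal (norm (frac_kernel s z)) * ennreal (C * min (norm z) 1)"
      using C(2) by (rule mult_left_mono) simp
    also have "\<dots> = ennreal (norm (C * (min (norm z) 1 * norm (frac_kernel s z))))"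
      using C(1) by (simp add: ennreal_mult[symmetric] mult_ac)
    finally show "(\<integral>\<^sup>+x. ennreal (norm ((\<phi> x - \<phi> (x - z)) *\<^sub>R frac_kernel s z)) \<partial>lborel)
      \<le> ennreal (norm (C * (min (norm z) 1 * norm (frac_kernel s z))))" .
  qed
  also have "\<dots> < \<infinity>"
    using integrable_mult_right[OF frac_kernel_integrable[OF s, where 'a='a], of C]
    unfolding integrable_iff_bounded by simp
  finally show "(\<integral>\<^sup>+p. ennreal (norm (case p of (z, x) \<Rightarrow> (\<phi> x - \<phi> (x - z)) *\<^sub>R frac_kernel s z)) \<partial>(lborel \<Otimes>\<^sub>M lborel)) < \<infinity>" .
next
  note [measurable] = lipc_measurable[OF assms]
  show "(\<lambda>(z, x). (\<phi> x - \<phi> (x - z)) *\<^sub>R frac_kernel s z) \<in> borel_measurable (lborel \<Otimes>\<^sub>M lborel)"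
    by measurable
qed

lemma frac_int_integrable:
  fixes \<phi> :: "'a::euclidean_space \<Rightarrow> real"
  assumes "lipc \<phi>" shows "integrable lborel (frac_int s \<phi>)"
  using lborel_pair.integrable_snd[OF frac_int_double_integrable[OF assms]]
  unfolding frac_int_def by simp

lemma frac_grad_L2:
  fixes \<phi> :: "'a::euclidean_space \<Rightarrow> real"
  assumes "lipc \<phi>" shows "L2 (frac_grad s \<phi>)" "L2 \<phi>"
proof -
  obtain B where B: "\<And>x. norm (frac_int s \<phi> x) \<le> B" using frac_int_bounded[OF assms] by metis
  have "L2 (frac_int s \<phi>)" by (rule integrable_bounded_imp_L2[OF frac_int_integrable[OF assms] B])
  then have "L2 (\<lambda>x. mu_s s DIM('a) *\<^sub>R frac_int s \<phi> x)" by (rule L2_scaleR)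
  then show "L2 (frac_grad s \<phi>)" using frac_grad_eq_frac_int[OF assms, of s] by presburger
  obtain M where "\<And>x. \<bar>\<phi> x\<bar> \<le> M" using lipcE[OF assms] by metis
  then show "L2 \<phi>" by (intro integrable_bounded_imp_L2[OF lipc_integrable[OF assms], of M]) simp
qed

lemma frac_int_pairing:
  fixes \<phi> \<psi> :: "'a::euclidean_space \<Rightarrow> real"
  assumes \<phi>: "lipc \<phi>" and [measurable]: "\<psi> \<in> borel_measurable borel" and B: "\<And>x. \<bar>\<psi> x\<bar> \<le> B"
  shows "integral\<^sup>L lborel (\<lambda>x. \<psi> x *\<^sub>R frac_int s \<phi> x)
    = integral\<^sup>L lborel (\<lambda>z. integral\<^sup>L lborel (\<lambda>x. \<psi> x * (\<phi> x - \<phi> (x - z))) *\<^sub>R frac_kernel s z)"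
proof -
  note [measurable] = lipc_measurable[OF \<phi>]
  have int: "integrable (lborel \<Otimes>\<^sub>M lborel) (\<lambda>(z, x). \<psi> x *\<^sub>R (\<phi> x - \<phi> (x - z)) *\<^sub>R frac_kernel s z)"
  proof (rule integrable_pointwise_bound)
    show "integrable (lborel \<Otimes>\<^sub>M lborel) (\<lambda>p. B *\<^sub>R (case p of (z, x) \<Rightarrow> (\<phi> x - \<phi> (x - z)) *\<^sub>R frac_kernel s z))"
      by (intro integrable_scaleR_right frac_int_double_integrable \<phi>)
    show "norm (case p of (z, x) \<Rightarrow> \<psi> x *\<^sub>R (\<phi> x - \<phi> (x - z)) *\<^sub>R frac_kernel s z)
      \<le> norm (B *\<^sub>R (case p of (z, x) \<Rightarrow> (\<phi> x - \<phi> (x - z)) *\<^sub>R frac_kernel s z))" for p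
      using B[of "snd p"] by (auto split: prod.splits simp: abs_mult mult.assoc intro!: mult_right_mono)
  qed measurable
  have "integral\<^sup>L lborel (\<lambda>x. \<psi> x *\<^sub>R frac_int s \<phi> x)
     = integral\<^sup>L lborel (\<lambda>x. integral\<^sup>L lborel (\<lambda>z. \<psi> x *\<^sub>R (\<phi> x - \<phi> (x - z)) *\<^sub>R frac_kernel s z))"
    unfolding frac_int_def by (simp del: scaleR_scaleR)
  also have "\<dots> = integral\<^sup>L lborel (\<lambda>z. integral\<^sup>L lborel (\<lambda>x. \<psi> x *\<^sub>R (\<phi> x - \<phi> (x - z)) *\<^sub>R frac_kernel s z))"
    by (rule lborel_pair.Fubini_integral[OF int])
  also have "\<dots> = integral\<^sup>L lborel (\<lambda>z. integral\<^sup>L lborel (\<lambda>x. \<psi> x * (\<phi> x - \<phi> (x - z))) *\<^sub>R frac_kernel s z)"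
  proof (rule Bochner_Integration.integral_cong[OF refl])
    fix z :: 'a
    have "integrable lborel (\<lambda>x. \<phi> x - \<phi> (x - z))"
      using lborel_integrable_affine[OF lipc_integrable[OF \<phi>], of 1 "- z"] lipc_integrable[OF \<phi>] by simp
    then have "integrable lborel (\<lambda>x. B * (\<phi> x - \<phi> (x - z)))" by simp
    then have "integrable lborel (\<lambda>x. \<psi> x * (\<phi> x - \<phi> (x - z)))"
    proof (rule integrable_pointwise_bound)
      show "norm (\<psi> x * (\<phi> x - \<phi> (x - z))) \<le> norm (B * (\<phi> x - \<phi> (x - z)))" for x
        using B[of x] by (auto simp: abs_mult intro!: mult_right_mono)
    qed simp
    then show "integral\<^sup>L lborel (\<lambda>x. \<psi> x *\<^sub>R (\<phi> x - \<phi> (x - z)) *\<^sub>R frac_kernel s z)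
      = integral\<^sup>L lborel (\<lambda>x. \<psi> x * (\<phi> x - \<phi> (x - z))) *\<^sub>R frac_kernel s z"
      by simp
  qed
  finally show ?thesis .
qed

text \<open>With c the cross-correlation of \<psi> and \<phi>, the two sides are integrals of c 0 -
  c z and c 0 - c (-z) against the kernel. The reflection z to -z and the oddness of the kernel
  produce the sign.\<close>

lemma frac_int_by_parts:
  fixes \<phi> \<psi> :: "'a::euclidean_space \<Rightarrow> real"
  assumes \<phi>: "lipc \<phi>" and \<psi>: "lipc \<psi>"
  shows "integral\<^sup>L lborel (\<lambda>x. \<psi> x *\<^sub>R frac_int s \<phi> x) = - integral\<^sup>L lborel (\<lambda>x. \<phi> x *\<^sub>R frac_int s \<psi> x)"
proof -
  note [measurable] = lipc_measurable[OF \<phi>] lipc_measurable[OF \<psi>]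
  obtain M N where M: "\<And>x. \<bar>\<phi> x\<bar> \<le> M" and N: "\<And>x. \<bar>\<psi> x\<bar> \<le> N"
    using lipcE[OF \<phi>] lipcE[OF \<psi>] by metis
  have i1: "integrable lborel (\<lambda>x. \<psi> x * \<phi> (x - z))" "integrable lborel (\<lambda>x. \<phi> x * \<psi> (x - z))" for z
    by (rule lipc_shift_product_integrable[OF \<phi> _ N], simp) (rule lipc_shift_product_integrable[OF \<psi> _ M], simp)
  define c where "c z = integral\<^sup>L lborel (\<lambda>x. \<psi> x * \<phi> (x - z))" for z
  have [measurable]: "c \<in> borel_measurable borel"
  proof -
    have "c \<in> borel_measurable lborel"
      unfolding c_def by (rule lborel.borel_measurable_lebesgue_integral) measurable
    then show ?thesis by simp
  qed
  have c_minus: "integral\<^sup>L lborel (\<lambda>x. \<phi> x * \<psi> (x - z)) = c (- z)" for z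
  proof -
    have "c (- z) = integral\<^sup>L lborel (\<lambda>x. (\<lambda>x. \<psi> x * \<phi> (x + z)) (x - z))"
      unfolding c_def by (subst lborel_integral_translate) auto
    then show ?thesis by (simp add: mult.commute)
  qed
  have "integral\<^sup>L lborel (\<lambda>x. \<psi> x *\<^sub>R frac_int s \<phi> x) = integral\<^sup>L lborel (\<lambda>z. (c 0 - c z) *\<^sub>R frac_kernel s z)"
    using i1(1)[of 0] i1(1)
    by (subst frac_int_pairing[OF \<phi> _ N]) (auto simp: c_def right_diff_distrib)
  moreover have "integral\<^sup>L lborel (\<lambda>x. \<phi> x *\<^sub>R frac_int s \<psi> x) = integral\<^sup>L lborel (\<lambda>z. (c 0 - c (- z)) *\<^sub>R frac_kernel s z)"
    using i1(2)[of 0] i1(2) c_minus[of 0]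
    by (subst frac_int_pairing[OF \<psi> _ M]) (auto simp: c_minus right_diff_distrib)
  moreover have "integral\<^sup>L lborel (\<lambda>z. (c 0 - c (- z)) *\<^sub>R frac_kernel s z)
    = integral\<^sup>L lborel (\<lambda>z. - ((\<lambda>z. (c 0 - c z) *\<^sub>R frac_kernel s z) (0 - z)))"
    by (simp add: frac_kernel_minus)
  moreover have "integral\<^sup>L lborel (\<lambda>z. (\<lambda>z. (c 0 - c z) *\<^sub>R frac_kernel s z) (0 - z))
    = integral\<^sup>L lborel (\<lambda>z. (c 0 - c z) *\<^sub>R frac_kernel s z)"
    by (rule lborel_integral_reflect) measurable
  ultimately show ?thesis by simp
qed

lemma frac_int_lincomb:
  assumes "lipc \<phi>" "lipc \<psi>"
  shows "frac_int s (\<lambda>x. a * \<phi> x + b * \<psi> x) x = a *\<^sub>R frac_int s \<phi> x + b *\<^sub>R frac_int s \<psi> x"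
proof -
  have "frac_int s (\<lambda>x. a * \<phi> x + b * \<psi> x) x
    = integral\<^sup>L lborel (\<lambda>z. a *\<^sub>R ((\<phi> x - \<phi> (x - z)) *\<^sub>R frac_kernel s z) + b *\<^sub>R ((\<psi> x - \<psi> (x - z)) *\<^sub>R frac_kernel s z))"
    unfolding frac_int_def by (intro Bochner_Integration.integral_cong) (auto simp: algebra_simps)
  also have "\<dots> = a *\<^sub>R frac_int s \<phi> x + b *\<^sub>R frac_int s \<psi> x"
    using frac_int_integrand_integrable[OF assms(1)] frac_int_integrand_integrable[OF assms(2)]
    unfolding frac_int_def
    by (subst Bochner_Integration.integral_add) (auto intro!: integrable_scaleR_right simp del: scaleR_scaleR)
  finally show ?thesis .
qed

end

lemma lipc_lincomb:
  assumes "lipc \<phi>" "lipc \<psi>" shows "lipc (\<lambda>x. a * \<phi> x + b * \<psi> x)"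
proof -
  obtain L R where 1: "L \<ge> 0" "\<And>x y. \<bar>\<phi> x - \<phi> y\<bar> \<le> L * norm (x - y)" "\<And>x. norm x > R \<Longrightarrow> \<phi> x = 0"
    using lipcE[OF assms(1)] by metis
  obtain L' R' where 2: "L' \<ge> 0" "\<And>x y. \<bar>\<psi> x - \<psi> y\<bar> \<le> L' * norm (x - y)" "\<And>x. norm x > R' \<Longrightarrow> \<psi> x = 0"
    using lipcE[OF assms(2)] by metis
  have "\<bar>(a * \<phi> x + b * \<psi> x) - (a * \<phi> y + b * \<psi> y)\<bar> \<le> (\<bar>a\<bar> * L + \<bar>b\<bar> * L') * norm (x - y)" for x y
  proof -
    have "\<bar>(a * \<phi> x + b * \<psi> x) - (a * \<phi> y + b * \<psi> y)\<bar> = \<bar>a * (\<phi> x - \<phi> y) + b * (\<psi> x - \<psi> y)\<bar>"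
      by (simp add: algebra_simps)
    also have "\<dots> \<le> \<bar>a\<bar> * \<bar>\<phi> x - \<phi> y\<bar> + \<bar>b\<bar> * \<bar>\<psi> x - \<psi> y\<bar>"
      by (metis abs_mult abs_triangle_ineq)
    also have "\<dots> \<le> \<bar>a\<bar> * (L * norm (x - y)) + \<bar>b\<bar> * (L' * norm (x - y))"
      using 1(2)[of x y] 2(2)[of x y] by (intro add_mono mult_left_mono) auto
    finally show ?thesis by (simp add: algebra_simps)
  qed
  moreover have "\<forall>x. norm x > max R R' \<longrightarrow> a * \<phi> x + b * \<psi> x = 0"
    using 1(3) 2(3) by auto
  ultimately show ?thesis unfolding lipc_def by blast
qed

section \<open>The Gaussian kernel\<close>

lemma power_times_exp_le_fact:
  fixes y :: real assumes "y \<ge> 0" shows "y ^ n * exp (- y) \<le> fact n"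
proof -
  have "y ^ n /\<^sub>R fact n \<le> exp y"
    using sum_le_suminf[OF summable_exp_generic, of "{n}" y] assms by (simp add: exp_def)
  then have "y ^ n \<le> fact n * exp y" by (simp add: field_simps)
  then show ?thesis by (simp add: exp_minus field_simps)
qed

text \<open>The heat kernel up to the factor (4 pi)^(-d/2): its total mass is the same positive
  number \<open>heat_mass\<close> at every time.\<close>

definition heat :: "real \<Rightarrow> 'a::euclidean_space \<Rightarrow> real" where
  "heat t x = t powr (- (real DIM('a) / 2)) * exp (- ((norm x)\<^sup>2 / (4 * t)))"

text \<open>\<open>heat_field\<close> is the negative gradient of \<open>heat\<close> in space,
  \<open>heat_rate\<close> its negative derivative in time.\<close>

definition heat_field :: "real \<Rightarrow> 'a::euclidean_space \<Rightarrow> 'a" where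
  "heat_field t x = (heat t x / (2 * t)) *\<^sub>R x"

definition heat_rate :: "real \<Rightarrow> 'a::euclidean_space \<Rightarrow> real" where
  "heat_rate t x = (real DIM('a) / (2 * t) - (norm x)\<^sup>2 / (4 * t\<^sup>2)) * heat t x"

lemma heat_measurable2 [measurable]: "(\<lambda>(t, x). heat t x) \<in> borel_measurable (borel \<Otimes>\<^sub>M borel)"
  unfolding heat_def by measurable

lemma heat_field_measurable2 [measurable]: "(\<lambda>(t, x). heat_field t x) \<in> borel_measurable (borel \<Otimes>\<^sub>M borel)"
  unfolding heat_field_def heat_def by measurable

lemma heat_rate_measurable2 [measurable]: "(\<lambda>(t, x). heat_rate t x) \<in> borel_measurable (borel \<Otimes>\<^sub>M borel)"
  unfolding heat_rate_def heat_def by measurable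

lemma heat_nonneg: "heat t x \<ge> 0"
  by (simp add: heat_def)

lemma heat_field_minus: "heat_field t (- x) = - heat_field t x"
  by (simp add: heat_field_def heat_def)

lemma norm_power_heat_bounded:
  assumes t: "t > 0"
  obtains C where "C \<ge> 0" "\<And>x::'a::euclidean_space. norm x ^ m * heat t x \<le> C"
proof -
  define A where "A = t powr (- (real DIM('a) / 2))"
  have "norm x ^ m * heat t x \<le> A * (1 + (4 * t) ^ m * fact m)" for x :: 'a
  proof -
    define y where "y = (norm x)\<^sup>2 / (4 * t)"
    have y: "y \<ge> 0" using t by (simp add: y_def)
    \<comment> \<open>Passing to the square makes the exponent even, so that only natural powers of
      y = |x|^2 / (4t) meet exp(-y).\<close>
    have "norm x ^ m \<le> 1 + (norm x ^ m)\<^sup>2"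
      using zero_le_power2[of "norm x ^ m - 1"] zero_le_power[OF norm_ge_zero, of x m]
      unfolding power2_diff by (simp only: power_one mult_1_right)
    also have "(norm x ^ m)\<^sup>2 = (4 * t) ^ m * y ^ m"
    proof -
      have "(norm x ^ m)\<^sup>2 = ((norm x)\<^sup>2) ^ m" by (simp only: power_mult[symmetric] mult.commute)
      also have "(norm x)\<^sup>2 = (4 * t) * y" using t by (simp add: y_def)
      finally show ?thesis by (simp only: power_mult_distrib)
    qed
    finally have "norm x ^ m * exp (- y) \<le> (1 + (4 * t) ^ m * y ^ m) * exp (- y)"
      by (rule mult_right_mono) simp
    also have "\<dots> = exp (- y) + (4 * t) ^ m * (y ^ m * exp (- y))" by (simp add: algebra_simps)
    also have "\<dots> \<le> 1 + (4 * t) ^ m * fact m"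
      using t y by (intro add_mono mult_left_mono power_times_exp_le_fact) auto
    finally have "A * (norm x ^ m * exp (- y)) \<le> A * (1 + (4 * t) ^ m * fact m)"
      by (rule mult_left_mono) (simp add: A_def)
    then show ?thesis by (simp add: heat_def A_def y_def mult_ac)
  qed
  moreover have "0 \<le> A * (1 + (4 * t) ^ m * fact m)" using t by (simp add: A_def)
  ultimately show thesis by (rule that[rotated])
qed

lemma norm_power_heat_integrable:
  assumes t: "t > 0"
  shows "integrable lborel (\<lambda>x::'a::euclidean_space. norm x ^ m * heat t x)"
proof -
  let ?n = "m + DIM('a) + 1"
  obtain C where C: "\<And>x::'a. norm x ^ m * heat t x \<le> C" using norm_power_heat_bounded[OF t] by metis
  obtain D where D: "\<And>x::'a. norm x ^ ?n * heat t x \<le> D" using norm_power_heat_bounded[OF t] by metis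
  show ?thesis
  proof (rule integrable_decay[where p="real DIM('a) + 1" and C="max C D"])
    fix x :: 'a
    show "norm (norm x ^ m * heat t x) \<le> max C D" using C[of x] by (simp add: heat_nonneg)
    assume x: "norm x \<ge> 1"
    have "norm x powr (real DIM('a) + 1) = norm x ^ (DIM('a) + 1)"
      using powr_realpow[of "norm x" "DIM('a) + 1"] order_less_le_trans[OF zero_less_one x]
      by (simp add: add.commute)
    then have "norm x ^ m * heat t x * norm x powr (real DIM('a) + 1) \<le> D"
      using D[of x] by (simp add: power_add mult_ac)
    then have "norm x ^ m * heat t x \<le> D * norm x powr - (real DIM('a) + 1)"
      using order_less_le_trans[OF zero_less_one x]
      by (simp add: powr_minus_divide pos_le_divide_eq del: minus_add_distrib)
    also have "\<dots> \<le> max C D * norm x powr - (real DIM('a) + 1)" by (rule mult_right_mono) auto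
    finally show "norm (norm x ^ m * heat t x) \<le> max C D * norm x powr - (real DIM('a) + 1)"
      by (simp add: heat_nonneg)
  qed simp_all
qed

lemma heat_integrable: "t > 0 \<Longrightarrow> integrable lborel (heat t :: 'a::euclidean_space \<Rightarrow> real)"
  using norm_power_heat_integrable[of t 0, where 'a='a] by simp

lemma norm_heat_field: "t > 0 \<Longrightarrow> norm (heat_field t x) = norm x ^ 1 * heat t x / (2 * t)"
  by (simp add: heat_field_def heat_nonneg)

lemma heat_field_integrable:
  assumes t: "t > 0" shows "integrable lborel (heat_field t :: 'a::euclidean_space \<Rightarrow> 'a)"
proof (rule integrable_pointwise_bound)
  show "integrable lborel (\<lambda>x::'a. (1 / (2 * t)) * (norm x ^ 1 * heat t x))"
    by (intro integrable_mult_right norm_power_heat_integrable t)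
qed (use t in \<open>auto simp: norm_heat_field heat_nonneg\<close>)

lemma abs_heat_rate_le:
  assumes "t > 0"
  shows "\<bar>heat_rate t (x::'a::euclidean_space)\<bar> \<le> real DIM('a) / (2 * t) * heat t x + (norm x)\<^sup>2 * heat t x / (4 * t\<^sup>2)"
proof -
  have "\<bar>heat_rate t x\<bar> \<le> (real DIM('a) / (2 * t) + (norm x)\<^sup>2 / (4 * t\<^sup>2)) * heat t x"
    unfolding heat_rate_def abs_mult using assms heat_nonneg[of t x]
    by (intro mult_mono) (auto simp: abs_le_iff algebra_simps)
  then show ?thesis by (simp add: algebra_simps)
qed

text \<open>Substitution by sqrt t, whose Jacobian cancels the prefactor t^(-d/2); it reduces
  masses, moments and the limit at time zero to the fixed Gaussian at time 1.\<close>

lemma heat_scaling: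
  assumes t: "t > 0" and [measurable]: "f \<in> borel_measurable borel"
  shows "integral\<^sup>L lborel (\<lambda>x::'a::euclidean_space. f x * heat t x) = integral\<^sup>L lborel (\<lambda>x. f (sqrt t *\<^sub>R x) * heat 1 x)"
proof -
  have *: "sqrt t ^ DIM('a) * t powr (- (real DIM('a) / 2)) = 1"
  proof -
    have "sqrt t ^ DIM('a) = t powr (real DIM('a) / 2)"
      using t by (simp add: powr_half_sqrt[symmetric] powr_power)
    then show ?thesis using t by (simp add: powr_add[symmetric])
  qed
  have "integral\<^sup>L lborel (\<lambda>x. f x * heat t x)
      = (\<bar>sqrt t\<bar> ^ DIM('a)) *\<^sub>R integral\<^sup>L lborel (\<lambda>x. f (0 + sqrt t *\<^sub>R x) * heat t (0 + sqrt t *\<^sub>R x))"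
    using t by (intro lborel_integral_affine) auto
  also have "\<dots> = integral\<^sup>L lborel (\<lambda>x. sqrt t ^ DIM('a) * (f (sqrt t *\<^sub>R x) * heat t (sqrt t *\<^sub>R x)))"
    using t by simp
  also have "\<dots> = integral\<^sup>L lborel (\<lambda>x. f (sqrt t *\<^sub>R x) * heat 1 x)"
  proof (rule Bochner_Integration.integral_cong[OF refl])
    fix x :: 'a
    have "sqrt t ^ DIM('a) * (f (sqrt t *\<^sub>R x) * heat t (sqrt t *\<^sub>R x))
      = (sqrt t ^ DIM('a) * t powr (- (real DIM('a) / 2))) * (f (sqrt t *\<^sub>R x) * exp (- ((norm (sqrt t *\<^sub>R x))\<^sup>2 / (4 * t))))"
      by (simp add: heat_def)
    also have "(norm (sqrt t *\<^sub>R x))\<^sup>2 / (4 * t) = (norm x)\<^sup>2 / (4 * 1)"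
      using t by (simp add: power_mult_distrib)
    finally show "sqrt t ^ DIM('a) * (f (sqrt t *\<^sub>R x) * heat t (sqrt t *\<^sub>R x)) = f (sqrt t *\<^sub>R x) * heat 1 x"
      by (simp add: * heat_def)
  qed
  finally show ?thesis .
qed

definition heat_mass :: "'a::euclidean_space itself \<Rightarrow> real" where
  "heat_mass TYPE('a) = integral\<^sup>L lborel (heat 1 :: 'a \<Rightarrow> real)"

definition heat_moment :: "'a::euclidean_space itself \<Rightarrow> real" where
  "heat_moment TYPE('a) = integral\<^sup>L lborel (\<lambda>x::'a. (norm x)\<^sup>2 * heat 1 x)"

lemma heat_integral: "t > 0 \<Longrightarrow> integral\<^sup>L lborel (heat t :: 'a::euclidean_space \<Rightarrow> real) = heat_mass TYPE('a)"
  using heat_scaling[of t "\<lambda>x::'a. 1"] by (simp add: heat_mass_def)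

lemma heat_integral_moment:
  assumes "t > 0"
  shows "integral\<^sup>L lborel (\<lambda>x::'a::euclidean_space. (norm x)\<^sup>2 * heat t x) = t * heat_moment TYPE('a)"
proof -
  have "integral\<^sup>L lborel (\<lambda>x::'a. (norm x)\<^sup>2 * heat t x) = integral\<^sup>L lborel (\<lambda>x::'a. t * ((norm x)\<^sup>2 * heat 1 x))"
    using assms by (subst heat_scaling) (auto simp: power_mult_distrib mult.assoc)
  then show ?thesis by (simp add: heat_moment_def)
qed

lemma heat_rate_integral:
  assumes "t > 0"
  shows "integral\<^sup>L lborel (heat_rate t :: 'a::euclidean_space \<Rightarrow> real)
    = (real DIM('a) / 2 * heat_mass TYPE('a) - heat_moment TYPE('a) / 4) / t"
proof -
  have "integral\<^sup>L lborel (heat_rate t :: 'a \<Rightarrow> real)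
    = integral\<^sup>L lborel (\<lambda>x::'a. real DIM('a) / (2 * t) * heat t x - (1 / (4 * t\<^sup>2)) * ((norm x)\<^sup>2 * heat t x))"
    by (intro Bochner_Integration.integral_cong) (auto simp: heat_rate_def algebra_simps)
  also have "\<dots> = real DIM('a) / (2 * t) * heat_mass TYPE('a) - (1 / (4 * t\<^sup>2)) * (t * heat_moment TYPE('a))"
    using heat_integrable[OF assms, where 'a='a] norm_power_heat_integrable[OF assms, of 2, where 'a='a]
    by (subst Bochner_Integration.integral_diff)
      (auto simp: heat_integral[OF assms] heat_integral_moment[OF assms])
  also have "\<dots> = (real DIM('a) / 2 * heat_mass TYPE('a) - heat_moment TYPE('a) / 4) / t"
    using assms by (simp add: field_simps power2_eq_square)
  finally show ?thesis .
qed

lemma heat_deriv: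
  assumes "t > 0"
  shows "((\<lambda>t. heat t (x::'a::euclidean_space)) has_real_derivative - heat_rate t x) (at t)"
proof -
  define p where "p = - (real DIM('a) / 2)"
  define N where "N = (norm x)\<^sup>2"
  have 1: "((\<lambda>t. t powr p) has_real_derivative p * (t powr p / t)) (at t)"
    using has_real_derivative_powr[OF assms, of p] assms by (simp add: powr_diff)
  have 2: "((\<lambda>t. exp (- (N / (4 * t)))) has_real_derivative exp (- (N / (4 * t))) * (N / (4 * t\<^sup>2))) (at t)"
    using assms by (auto intro!: derivative_eq_intros simp: field_simps power2_eq_square)
  have "((\<lambda>t. t powr p * exp (- (N / (4 * t)))) has_real_derivative - heat_rate t x) (at t)"
    by (rule DERIV_cong[OF DERIV_mult[OF 1 2]])
      (use assms in \<open>simp add: heat_rate_def heat_def p_def[symmetric] N_def[symmetric];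
        simp add: p_def field_simps\<close>)
  then show ?thesis by (simp add: heat_def p_def N_def)
qed

section \<open>Integrability of products and convolutions; the evolution in time\<close>

lemma integrable_product:
  fixes f :: "'a::euclidean_space \<Rightarrow> real" and g :: "'b::euclidean_space \<Rightarrow> real"
  assumes f: "integrable lborel f" and g: "integrable lborel g"
  shows "integrable (lborel \<Otimes>\<^sub>M lborel) (\<lambda>(x, y). f x * g y)"
proof (rule integrableI_bounded)
  note [measurable] = borel_measurable_integrable[OF f] borel_measurable_integrable[OF g]
  show "(\<lambda>(x, y). f x * g y) \<in> borel_measurable (lborel \<Otimes>\<^sub>M lborel)" by measurable
  have "(\<integral>\<^sup>+p. ennreal (norm (case p of (x, y) \<Rightarrow> f x * g y)) \<partial>(lborel \<Otimes>\<^sub>M lborel))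
     = (\<integral>\<^sup>+x. \<integral>\<^sup>+y. ennreal (norm (f x)) * ennreal (norm (g y)) \<partial>lborel \<partial>lborel)"
    by (subst lborel.nn_integral_fst[symmetric]) (auto simp: abs_mult ennreal_mult)
  also have "\<dots> = (\<integral>\<^sup>+x. ennreal (norm (f x)) \<partial>lborel) * (\<integral>\<^sup>+y. ennreal (norm (g y)) \<partial>lborel)"
    by (simp add: nn_integral_cmult nn_integral_multc)
  also have "\<dots> < \<infinity>"
    using f g by (simp add: integrable_iff_bounded ennreal_mult_less_top)
  finally show "(\<integral>\<^sup>+p. ennreal (norm (case p of (x, y) \<Rightarrow> f x * g y)) \<partial>(lborel \<Otimes>\<^sub>M lborel)) < \<infinity>" .
qed

lemma integrable_convolution:
  fixes f g :: "'a::euclidean_space \<Rightarrow> real"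
  assumes f: "integrable lborel f" and g: "integrable lborel g"
  shows "integrable (lborel \<Otimes>\<^sub>M lborel) (\<lambda>(z, x). f (x - z) * g z)"
proof (rule integrableI_bounded)
  note [measurable] = borel_measurable_integrable[OF f] borel_measurable_integrable[OF g]
  show "(\<lambda>(z, x). f (x - z) * g z) \<in> borel_measurable (lborel \<Otimes>\<^sub>M lborel)" by measurable
  have "(\<integral>\<^sup>+p. ennreal (norm (case p of (z, x) \<Rightarrow> f (x - z) * g z)) \<partial>(lborel \<Otimes>\<^sub>M lborel))
     = (\<integral>\<^sup>+z. \<integral>\<^sup>+x. ennreal (norm (f (x - z))) * ennreal (norm (g z)) \<partial>lborel \<partial>lborel)"
    by (subst lborel.nn_integral_fst[symmetric]) (auto simp: abs_mult ennreal_mult)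
  also have "\<dots> = (\<integral>\<^sup>+z. (\<integral>\<^sup>+x. ennreal (norm (f (x - z))) \<partial>lborel) * ennreal (norm (g z)) \<partial>lborel)"
    by (simp add: nn_integral_multc)
  also have "\<dots> = (\<integral>\<^sup>+z. (\<integral>\<^sup>+x. ennreal (norm (f x)) \<partial>lborel) * ennreal (norm (g z)) \<partial>lborel)"
    using nn_integral_lborel_translate[of "\<lambda>x. ennreal (norm (f x))"] by simp
  also have "\<dots> = (\<integral>\<^sup>+x. ennreal (norm (f x)) \<partial>lborel) * (\<integral>\<^sup>+z. ennreal (norm (g z)) \<partial>lborel)"
    by (simp add: nn_integral_cmult)
  also have "\<dots> < \<infinity>"
    using f g by (simp add: integrable_iff_bounded ennreal_mult_less_top)
  finally show "(\<integral>\<^sup>+p. ennreal (norm (case p of (z, x) \<Rightarrow> f (x - z) * g z)) \<partial>(lborel \<Otimes>\<^sub>M lborel)) < \<infinity>" .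
qed

text \<open>The fundamental theorem of calculus in time, applied for each x to \<open>heat\<close>
  on the window from t to 2t, followed by an exchange of integrals. The window is one dyadic step of
  the later summation.\<close>

lemma heat_rate_fubini:
  fixes g :: "'a::euclidean_space \<Rightarrow> real"
  assumes t: "t > 0" and [measurable]: "g \<in> borel_measurable borel" and B: "\<And>x. \<bar>g x\<bar> \<le> B"
  shows "integrable lborel (\<lambda>r. indicator {t..2*t} r * integral\<^sup>L lborel (\<lambda>x. g x * heat_rate r x))"
    and "integral\<^sup>L lborel (\<lambda>x. g x * heat t x) - integral\<^sup>L lborel (\<lambda>x. g x * heat (2 * t) x)
      = integral\<^sup>L lborel (\<lambda>r. indicator {t..2*t} r * integral\<^sup>L lborel (\<lambda>x. g x * heat_rate r x))"
proof -
  have B0: "B \<ge> 0" using B[of 0] by linarith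
  \<comment> \<open>A majorant valid for all r between t and 2t: the exponential is largest at 2t
    and the negative powers of r at t. Rewriting the prefactor t^(-d/2) at time 2t costs the factor
    2^(d/2).\<close>
  define w where "w x = B * (2 powr (real DIM('a) / 2)) * (real DIM('a) / (2 * t) * heat (2 * t) x + (1 / (4 * t\<^sup>2)) * ((norm x)\<^sup>2 * heat (2 * t) x))" for x :: 'a
  have w0: "w x \<ge> 0" for x using t B0 by (simp add: w_def heat_nonneg)
  have wint: "integrable lborel w"
    unfolding w_def using t heat_integrable[of "2 * t", where 'a='a] norm_power_heat_integrable[of "2 * t" 2, where 'a='a]
    by auto
  have bound: "\<bar>g x * heat_rate r x\<bar> \<le> w x" if r: "r \<in> {t..2*t}" for r x
  proof -
    have r0: "r > 0" using r t by auto
    have "heat r x \<le> 2 powr (real DIM('a) / 2) * heat (2 * t) x"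
    proof -
      have "r powr (- (real DIM('a) / 2)) \<le> t powr (- (real DIM('a) / 2))"
        using r t by (intro powr_mono2') auto
      also have "\<dots> = 2 powr (real DIM('a) / 2) * (2 * t) powr (- (real DIM('a) / 2))"
        using t by (simp add: powr_mult powr_minus)
      finally have 1: "r powr (- (real DIM('a) / 2)) \<le> 2 powr (real DIM('a) / 2) * (2 * t) powr (- (real DIM('a) / 2))" .
      have 2: "exp (- ((norm x)\<^sup>2 / (4 * r))) \<le> exp (- ((norm x)\<^sup>2 / (4 * (2 * t))))"
        using r r0 t by (auto intro!: divide_left_mono)
      show ?thesis
        using mult_mono[OF 1 2] by (simp add: heat_def mult_ac)
    qed
    moreover have "\<bar>real DIM('a) / (2 * r) - (norm x)\<^sup>2 / (4 * r\<^sup>2)\<bar> \<le> real DIM('a) / (2 * t) + (norm x)\<^sup>2 / (4 * t\<^sup>2)"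
    proof -
      have "real DIM('a) / (2 * r) \<le> real DIM('a) / (2 * t)" "(norm x)\<^sup>2 / (4 * r\<^sup>2) \<le> (norm x)\<^sup>2 / (4 * t\<^sup>2)"
        using r t r0 by (auto intro!: divide_left_mono power_mono)
      moreover have "0 \<le> real DIM('a) / (2 * r)" "0 \<le> (norm x)\<^sup>2 / (4 * r\<^sup>2)" using r0 by auto
      ultimately show ?thesis by linarith
    qed
    ultimately have "\<bar>heat_rate r x\<bar> \<le> (real DIM('a) / (2 * t) + (norm x)\<^sup>2 / (4 * t\<^sup>2)) * (2 powr (real DIM('a) / 2) * heat (2 * t) x)"
      unfolding heat_rate_def abs_mult using t heat_nonneg[of r x]
      by (intro mult_mono) (auto simp: heat_nonneg)
    then have "\<bar>g x\<bar> * \<bar>heat_rate r x\<bar> \<le> B * ((real DIM('a) / (2 * t) + (norm x)\<^sup>2 / (4 * t\<^sup>2)) * (2 powr (real DIM('a) / 2) * heat (2 * t) x))"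
      using B by (intro mult_mono B0) auto
    then show ?thesis by (simp add: w_def abs_mult algebra_simps)
  qed
  have int: "integrable (lborel \<Otimes>\<^sub>M lborel) (\<lambda>(r, x). indicator {t..2*t} r * (g x * heat_rate r x))"
  proof (rule integrable_pointwise_bound)
    show "integrable (lborel \<Otimes>\<^sub>M lborel) (\<lambda>(r::real, x). indicator {t..2*t} r * w x)"
      by (rule integrable_product[OF integrable_real_indicator wint]) (use t in auto)
    show "norm (case p of (r, x) \<Rightarrow> indicator {t..2*t} r * (g x * heat_rate r x))
      \<le> norm (case p of (r::real, x) \<Rightarrow> indicator {t..2*t} r * w x)" for p
      using bound w0 by (auto split: prod.splits simp: indicator_def)
  qed measurable
  show "integrable lborel (\<lambda>r. indicator {t..2*t} r * integral\<^sup>L lborel (\<lambda>x. g x * heat_rate r x))"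
    using lborel_pair.integrable_fst[OF int] by simp
  have ftc: "integral\<^sup>L lborel (\<lambda>r. indicator {t..2*t} r * (g x * heat_rate r x)) = g x * heat t x - g x * heat (2 * t) x" for x
  proof -
    have "has_bochner_integral lborel (\<lambda>r. indicator {t..2*t} r *\<^sub>R (g x * heat_rate r x)) (- g x * heat (2 * t) x - - g x * heat t x)"
    proof (rule has_bochner_integral_FTC_Icc)
      fix r assume r: "t \<le> r" "r \<le> 2 * t"
      show "((\<lambda>r. - g x * heat r x) has_vector_derivative g x * heat_rate r x) (at r within {t..2 * t})"
        using DERIV_cmult[OF heat_deriv[of r x], of "- g x"] r t
        by (auto simp: has_real_derivative_iff_has_vector_derivative[symmetric] intro: has_field_derivative_at_within)
    next
      show "continuous_on {t..2*t} (\<lambda>r. g x * heat_rate r x)"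
        unfolding heat_rate_def heat_def using t by (intro continuous_intros) auto
    qed (use t in auto)
    then show ?thesis by (simp add: has_bochner_integral_integral_eq)
  qed
  have gint: "integrable lborel (\<lambda>x. g x * heat r x)" if "r > 0" for r
  proof (rule integrable_pointwise_bound)
    show "integrable lborel (\<lambda>x::'a. B * heat r x)" using heat_integrable[OF that, where 'a='a] by simp
    show "norm (g x * heat r x) \<le> norm (B * heat r x)" for x
      using B[of x] B0 by (auto simp: abs_mult heat_nonneg intro!: mult_right_mono)
  qed measurable
  have "integral\<^sup>L lborel (\<lambda>x. g x * heat t x) - integral\<^sup>L lborel (\<lambda>x. g x * heat (2 * t) x)
    = integral\<^sup>L lborel (\<lambda>x. integral\<^sup>L lborel (\<lambda>r. indicator {t..2*t} r * (g x * heat_rate r x)))"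
    using gint[of t] gint[of "2 * t"] t by (simp add: ftc)
  also have "\<dots> = integral\<^sup>L lborel (\<lambda>r. integral\<^sup>L lborel (\<lambda>x. indicator {t..2*t} r * (g x * heat_rate r x)))"
    using lborel_pair.Fubini_integral[OF int] by simp
  finally show "integral\<^sup>L lborel (\<lambda>x. g x * heat t x) - integral\<^sup>L lborel (\<lambda>x. g x * heat (2 * t) x)
      = integral\<^sup>L lborel (\<lambda>r. indicator {t..2*t} r * integral\<^sup>L lborel (\<lambda>x. g x * heat_rate r x))"
    by simp
qed

text \<open>Conservation of mass determines the second moment.\<close>

lemma heat_moment_eq: "heat_moment TYPE('a::euclidean_space) = 2 * real DIM('a) * heat_mass TYPE('a)"
proof -
  \<comment> \<open>The integral of \<open>heat_rate r\<close> over space is c / r, while the mass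
    at time 1 equals that at time 2; hence c ln 2 = 0.\<close>
  define c where "c = real DIM('a) / 2 * heat_mass TYPE('a) - heat_moment TYPE('a) / 4"
  have "(0::real) = integral\<^sup>L lborel (\<lambda>x::'a. 1 * heat 1 x) - integral\<^sup>L lborel (\<lambda>x::'a. 1 * heat (2 * 1) x)"
    by (simp add: heat_integral)
  also have "\<dots> = integral\<^sup>L lborel (\<lambda>r. indicator {1..2*1} r * integral\<^sup>L lborel (\<lambda>x::'a. 1 * heat_rate r x))"
    by (rule heat_rate_fubini(2)[of _ _ 1]) auto
  also have "\<dots> = integral\<^sup>L lborel (\<lambda>r. indicator {1..2} r *\<^sub>R (c / r))"
    by (intro Bochner_Integration.integral_cong) (auto simp: heat_rate_integral c_def indicator_def)
  also have "\<dots> = c * ln 2 - c * ln 1"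
  proof (intro has_bochner_integral_integral_eq has_bochner_integral_FTC_Icc)
    fix r :: real assume "1 \<le> r" "r \<le> 2"
    then have "((\<lambda>r. c * ln r) has_real_derivative c * (1 / r)) (at r within {1..2})"
      by (intro DERIV_cmult has_field_derivative_at_within[OF DERIV_ln_divide]) simp
    then show "((\<lambda>r. c * ln r) has_vector_derivative c / r) (at r within {1..2})"
      by (simp add: has_real_derivative_iff_has_vector_derivative)
  next
    show "continuous_on {1..2::real} (\<lambda>r. c / r)" by (intro continuous_intros) auto
  qed simp
  finally have "c = 0" by simp
  then show ?thesis by (simp add: c_def field_simps)
qed

text \<open>Completing the square in y. As with variances of independent Gaussians, the times add up
  to r in v, and \<sigma> is the time of the conditional distribution of y given v, centred at
  \<theta> v.\<close>

lemma heat_product: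
  fixes y v :: "'a::euclidean_space"
  assumes "t > 0" "u > 0"
  defines "r \<equiv> t + u" and "\<theta> \<equiv> t / (t + u)" and "\<sigma> \<equiv> t * u / (t + u)"
  shows "heat t y * heat u (v - y) = heat r v * heat \<sigma> (y - \<theta> *\<^sub>R v)"
proof -
  have pos: "r > 0" "\<sigma> > 0" "t * u = r * \<sigma>" using assms by (auto simp: r_def \<sigma>_def add_pos_pos)
  have pre: "t powr (- (real DIM('a) / 2)) * u powr (- (real DIM('a) / 2)) = r powr (- (real DIM('a) / 2)) * \<sigma> powr (- (real DIM('a) / 2))"
    using assms(1,2) pos by (simp add: powr_mult[symmetric])
  have "(norm y)\<^sup>2 / (4 * t) + (norm (v - y))\<^sup>2 / (4 * u) = (norm v)\<^sup>2 / (4 * r) + (norm (y - \<theta> *\<^sub>R v))\<^sup>2 / (4 * \<sigma>)"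
  proof -
    define a b c where "a = inner y y" and "b = inner v y" and "c = inner v v"
    have n: "(norm y)\<^sup>2 = a" "(norm v)\<^sup>2 = c" "(norm (v - y))\<^sup>2 = c - 2 * b + a"
      "(norm (y - \<theta> *\<^sub>R v))\<^sup>2 = a - 2 * \<theta> * b + \<theta>\<^sup>2 * c"
      unfolding power2_norm_eq_inner a_def b_def c_def
      by (simp_all add: inner_diff inner_commute power2_eq_square algebra_simps)
    have tu: "t + u \<noteq> 0" "t \<noteq> 0" "u \<noteq> 0" using assms(1,2) by auto
    show ?thesis unfolding n unfolding r_def \<theta>_def \<sigma>_def using tu
      by (simp add: divide_simps power2_eq_square) (simp add: algebra_simps)
  qed
  then have E: "exp (- ((norm y)\<^sup>2 / (4 * t))) * exp (- ((norm (v - y))\<^sup>2 / (4 * u)))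
     = exp (- ((norm v)\<^sup>2 / (4 * r))) * exp (- ((norm (y - \<theta> *\<^sub>R v))\<^sup>2 / (4 * \<sigma>)))"
    by (simp add: exp_add[symmetric] algebra_simps)
  have "heat t y * heat u (v - y) = (t powr (- (real DIM('a) / 2)) * u powr (- (real DIM('a) / 2)))
     * (exp (- ((norm y)\<^sup>2 / (4 * t))) * exp (- ((norm (v - y))\<^sup>2 / (4 * u))))"
    unfolding heat_def by (simp only: mult.assoc mult.left_commute)
  also have "\<dots> = heat r v * heat \<sigma> (y - \<theta> *\<^sub>R v)"
    unfolding pre E heat_def by (simp only: mult.assoc mult.left_commute)
  finally show ?thesis .
qed

text \<open>The convolution of two Gaussian gradients is the Laplacian of the Gaussian at time t +
  u, times the mass, and by the heat equation this is a time derivative. After centring at \<theta>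
  v the linear term is odd and drops out, and the quadratic one is given by the second
  moment.\<close>

lemma heat_field_convolution:
  fixes v :: "'a::euclidean_space"
  assumes "t > 0" "u > 0"
  shows "integral\<^sup>L lborel (\<lambda>y. inner (heat_field t y) (heat_field u (v - y))) = - heat_mass TYPE('a) * heat_rate (t + u) v"
proof -
  define r where "r = t + u"
  define \<theta> where "\<theta> = t / (t + u)"
  define \<sigma> where "\<sigma> = t * u / (t + u)"
  have pos: "r > 0" "\<sigma> > 0" using assms by (auto simp: r_def \<sigma>_def add_pos_pos)
  define A where "A = heat r v / (4 * t * u)"
  define F where "F w = A * (\<theta> * (1 - \<theta>) * (norm v)\<^sup>2 * heat \<sigma> w) + (A * (1 - 2 * \<theta>)) * inner v (heat \<sigma> w *\<^sub>R w) - A * ((norm w)\<^sup>2 * heat \<sigma> w)" for w :: 'a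
  have [measurable]: "F \<in> borel_measurable borel" unfolding F_def by measurable
  have int1: "integrable lborel (heat \<sigma> :: 'a \<Rightarrow> real)" by (rule heat_integrable[OF pos(2)])
  have int2: "integrable lborel (\<lambda>w::'a. heat \<sigma> w *\<^sub>R w)"
  proof -
    have "integrable lborel (\<lambda>w::'a. (2 * \<sigma>) *\<^sub>R heat_field \<sigma> w)"
      by (intro integrable_scaleR_right heat_field_integrable pos)
    then show ?thesis using pos by (simp add: heat_field_def)
  qed
  have int3: "integrable lborel (\<lambda>w::'a. (norm w)\<^sup>2 * heat \<sigma> w)" by (rule norm_power_heat_integrable[OF pos(2)])
  have zero: "integral\<^sup>L lborel (\<lambda>w::'a. heat \<sigma> w *\<^sub>R w) = 0"
    by (rule odd_integral_zero) (auto simp: heat_def)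
  define f2 where "f2 w = inner v (heat \<sigma> w *\<^sub>R w)" for w
  have f2: "integrable lborel f2" "integral\<^sup>L lborel f2 = 0"
    unfolding f2_def using integrable_inner_right[OF int2, of v] integral_inner_right[OF int2, of v] zero
    by (simp_all del: inner_scaleR_right)
  define f3 where "f3 w = (norm w)\<^sup>2 * heat \<sigma> w" for w :: 'a
  have f3: "integrable lborel f3" "integral\<^sup>L lborel f3 = \<sigma> * heat_moment TYPE('a)"
    unfolding f3_def using int3 heat_integral_moment[OF pos(2), where 'a='a] by simp_all
  have "integral\<^sup>L lborel (\<lambda>y. inner (heat_field t y) (heat_field u (v - y))) = integral\<^sup>L lborel (\<lambda>y. F (y - \<theta> *\<^sub>R v))"
  proof (rule Bochner_Integration.integral_cong[OF refl])
    fix y :: 'a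
    define w where "w = y - \<theta> *\<^sub>R v"
    have y: "y = w + \<theta> *\<^sub>R v" by (simp add: w_def)
    have "inner (heat_field t y) (heat_field u (v - y)) = heat t y * heat u (v - y) * inner y (v - y) / (4 * t * u)"
      by (simp add: heat_field_def mult_ac)
    also have "heat t y * heat u (v - y) = heat r v * heat \<sigma> w"
      unfolding w_def r_def \<theta>_def \<sigma>_def by (rule heat_product[OF assms])
    also have "inner y (v - y) = \<theta> * (1 - \<theta>) * (norm v)\<^sup>2 + (1 - 2 * \<theta>) * inner v w - (norm w)\<^sup>2"
      unfolding y power2_norm_eq_inner by (simp add: inner_diff inner_add inner_commute algebra_simps)
    finally show "inner (heat_field t y) (heat_field u (v - y)) = F (y - \<theta> *\<^sub>R v)"
      unfolding w_def[symmetric] by (simp add: F_def A_def diff_divide_distrib add_divide_distrib algebra_simps)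
  qed
  also have "\<dots> = integral\<^sup>L lborel F" by (rule lborel_integral_translate) simp
  also have "\<dots> = A * (\<theta> * (1 - \<theta>) * (norm v)\<^sup>2 * heat_mass TYPE('a)) - A * (\<sigma> * heat_moment TYPE('a))"
    unfolding F_def f2_def[symmetric] f3_def[symmetric] using int1 f2 f3
    by (simp add: heat_integral[OF pos(2)])
  also have "\<dots> = - heat_mass TYPE('a) * heat_rate (t + u) v"
  proof -
    have tu: "t + u \<noteq> 0" "t \<noteq> 0" "u \<noteq> 0" using assms by auto
    have th: "\<theta> * (1 - \<theta>) = t * u / (t + u)\<^sup>2"
      using tu by (simp add: \<theta>_def field_simps power2_eq_square)
    have 1: "A * (t * u) = heat r v / 4" using tu by (simp add: A_def)
    have "A * (\<theta> * (1 - \<theta>) * (norm v)\<^sup>2 * heat_mass TYPE('a)) - A * (\<sigma> * heat_moment TYPE('a))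
      = (A * (t * u)) * ((norm v)\<^sup>2 / (t + u)\<^sup>2 * heat_mass TYPE('a)) - (A * (t * u)) * (heat_moment TYPE('a) / (t + u))"
      unfolding th \<sigma>_def by simp
    also have "\<dots> = - heat_mass TYPE('a) * heat_rate (t + u) v"
      unfolding 1 heat_moment_eq heat_rate_def r_def by (simp add: algebra_simps)
    finally show ?thesis .
  qed
  finally show ?thesis .
qed

section \<open>Heat energies\<close>

text \<open>Minus the spatial gradient of the heat evolution of \<phi> at time t.\<close>

definition smear :: "('a::euclidean_space \<Rightarrow> real) \<Rightarrow> real \<Rightarrow> 'a \<Rightarrow> 'a" where
  "smear \<phi> t x = integral\<^sup>L lborel (\<lambda>y. \<phi> (x - y) *\<^sub>R heat_field t y)"

text \<open>Turns quadratic expressions in \<phi> into integrals of one function against explicit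
  kernels; that function is dominated by its value at 0, the squared L^2 norm of \<phi>.\<close>

definition autocorr :: "('a::euclidean_space \<Rightarrow> real) \<Rightarrow> 'a \<Rightarrow> real" where
  "autocorr \<phi> v = integral\<^sup>L lborel (\<lambda>x. \<phi> x * \<phi> (x - v))"

context
  fixes \<phi> :: "'a::euclidean_space \<Rightarrow> real"
  assumes \<phi>: "lipc \<phi>"
begin

lemma autocorr_measurable [measurable]: "autocorr \<phi> \<in> borel_measurable borel"
proof -
  note [measurable] = lipc_measurable[OF \<phi>]
  have "autocorr \<phi> \<in> borel_measurable lborel"
    unfolding autocorr_def by (rule lborel.borel_measurable_lebesgue_integral) measurable
  then show ?thesis by simp
qed

lemma lipc_square_integrable: "integrable lborel (\<lambda>x. (\<phi> x)\<^sup>2)"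
proof -
  obtain M where "\<And>x. \<bar>\<phi> x\<bar> \<le> M" using lipcE[OF \<phi>] by metis
  from lipc_shift_product_integrable[OF \<phi> lipc_measurable[OF \<phi>] this, of 0] show ?thesis
    by (simp add: power2_eq_square)
qed

lemma autocorr_product_integrable: "integrable lborel (\<lambda>x. \<phi> x * \<phi> (x - v))"
proof -
  obtain M where "\<And>x. \<bar>\<phi> x\<bar> \<le> M" using lipcE[OF \<phi>] by metis
  from lipc_shift_product_integrable[OF \<phi> lipc_measurable[OF \<phi>] this] show ?thesis .
qed

lemma autocorr_0: "autocorr \<phi> 0 = integral\<^sup>L lborel (\<lambda>x. (\<phi> x)\<^sup>2)"
  by (simp add: autocorr_def power2_eq_square)

lemma autocorr_0_nonneg: "autocorr \<phi> 0 \<ge> 0"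
  by (simp add: autocorr_0)

lemma abs_autocorr_le: "\<bar>autocorr \<phi> v\<bar> \<le> autocorr \<phi> 0"
proof -
  note [measurable] = lipc_measurable[OF \<phi>]
  have i: "integrable lborel (\<lambda>x. (\<phi> (x - v))\<^sup>2)"
    using lborel_integrable_affine[OF lipc_square_integrable, of 1 "- v"] by simp
  have "\<bar>autocorr \<phi> v\<bar> \<le> integral\<^sup>L lborel (\<lambda>x. \<bar>\<phi> x * \<phi> (x - v)\<bar>)"
    unfolding autocorr_def by (rule integral_abs_bound)
  also have "\<dots> \<le> integral\<^sup>L lborel (\<lambda>x. (1/2) * (\<phi> x)\<^sup>2 + (1/2) * (\<phi> (x - v))\<^sup>2)"
  proof (rule integral_mono)
    show "\<bar>\<phi> x * \<phi> (x - v)\<bar> \<le> (1/2) * (\<phi> x)\<^sup>2 + (1/2) * (\<phi> (x - v))\<^sup>2" for x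
      using sum_squares_bound[of "\<bar>\<phi> x\<bar>" "\<bar>\<phi> (x - v)\<bar>"] by (simp add: abs_mult)
  qed (use i lipc_square_integrable autocorr_product_integrable in auto)
  also have "\<dots> = (1/2) * autocorr \<phi> 0 + (1/2) * integral\<^sup>L lborel (\<lambda>x. (\<phi> (x - v))\<^sup>2)"
    using i lipc_square_integrable by (simp add: autocorr_0)
  also have "integral\<^sup>L lborel (\<lambda>x. (\<phi> (x - v))\<^sup>2) = autocorr \<phi> 0"
    unfolding autocorr_0 by (rule lborel_integral_translate) simp
  finally show ?thesis by simp
qed

lemma autocorr_tendsto:
  assumes "r \<longlonglongrightarrow> 0" shows "(\<lambda>n. autocorr \<phi> (r n)) \<longlonglongrightarrow> autocorr \<phi> 0"
proof -
  note [measurable] = lipc_measurable[OF \<phi>]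
  obtain M where M: "\<And>x. \<bar>\<phi> x\<bar> \<le> M" using lipcE[OF \<phi>] by metis
  have cont: "continuous (at x) \<phi>" for x
    using lipc_continuous[OF \<phi>] by (simp add: continuous_on_eq_continuous_at)
  have "(\<lambda>n. integral\<^sup>L lborel (\<lambda>x. \<phi> x * \<phi> (x - r n))) \<longlonglongrightarrow> integral\<^sup>L lborel (\<lambda>x. \<phi> x * \<phi> (x - 0))"
  proof (rule integral_dominated_convergence[where w="\<lambda>x. M * \<bar>\<phi> x\<bar>"])
    show "integrable lborel (\<lambda>x. M * \<bar>\<phi> x\<bar>)" using lipc_integrable[OF \<phi>] by simp
    show "AE x in lborel. (\<lambda>n. \<phi> x * \<phi> (x - r n)) \<longlonglongrightarrow> \<phi> x * \<phi> (x - 0)"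
    proof (rule AE_I2)
      fix x
      have "(\<lambda>n. x - r n) \<longlonglongrightarrow> x - 0" by (intro tendsto_intros assms)
      then show "(\<lambda>n. \<phi> x * \<phi> (x - r n)) \<longlonglongrightarrow> \<phi> x * \<phi> (x - 0)"
        using cont[of x] by (intro tendsto_intros) (auto intro: isCont_tendsto_compose)
    qed
    show "AE x in lborel. norm (\<phi> x * \<phi> (x - r n)) \<le> M * \<bar>\<phi> x\<bar>" for n
    proof (rule AE_I2)
      fix x show "norm (\<phi> x * \<phi> (x - r n)) \<le> M * \<bar>\<phi> x\<bar>"
        using mult_right_mono[OF M[of "x - r n"], of "\<bar>\<phi> x\<bar>"] by (simp add: abs_mult mult.commute)
    qed
  qed simp_all
  then show ?thesis by (simp add: autocorr_def)
qed

lemma smear_measurable [measurable]: "smear \<phi> t \<in> borel_measurable borel"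
proof -
  note [measurable] = lipc_measurable[OF \<phi>]
  have "smear \<phi> t \<in> borel_measurable lborel"
    unfolding smear_def by (rule lborel.borel_measurable_lebesgue_integral) measurable
  then show ?thesis by simp
qed

lemma smear_double_integrable:
  assumes "t > 0"
  shows "integrable (lborel \<Otimes>\<^sub>M lborel) (\<lambda>(y, x). \<phi> (x - y) *\<^sub>R heat_field t y)"
proof (rule integrable_pointwise_bound)
  note [measurable] = lipc_measurable[OF \<phi>]
  show "integrable (lborel \<Otimes>\<^sub>M lborel) (\<lambda>(y, x). \<bar>\<phi> (x - y)\<bar> * norm (heat_field t y))"
    using lipc_integrable[OF \<phi>] heat_field_integrable[OF assms] by (intro integrable_convolution) auto
  show "(\<lambda>(y, x). \<phi> (x - y) *\<^sub>R heat_field t y) \<in> borel_measurable (lborel \<Otimes>\<^sub>M lborel)" by measurable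
qed auto

lemma smear_integrable: "t > 0 \<Longrightarrow> integrable lborel (smear \<phi> t)"
  using lborel_pair.integrable_snd[OF smear_double_integrable] unfolding smear_def by simp

lemma smear_bounded:
  assumes "t > 0" obtains B where "B \<ge> 0" "\<And>x. norm (smear \<phi> t x) \<le> B"
proof -
  obtain M where M: "M \<ge> 0" "\<And>x. \<bar>\<phi> x\<bar> \<le> M" using lipcE[OF \<phi>] by metis
  note [measurable] = lipc_measurable[OF \<phi>]
  have i: "integrable lborel (\<lambda>y::'a. M * norm (heat_field t y))"
    using heat_field_integrable[OF assms, where 'a='a] by simp
  have "norm (smear \<phi> t x) \<le> integral\<^sup>L lborel (\<lambda>y::'a. M * norm (heat_field t y))" for x
    unfolding smear_def
  proof (rule order_trans[OF integral_norm_bound], rule integral_mono)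
    show le: "norm (\<phi> (x - y) *\<^sub>R heat_field t y) \<le> M * norm (heat_field t y)" for y
      using M by (auto intro!: mult_right_mono)
    show "integrable lborel (\<lambda>y. norm (\<phi> (x - y) *\<^sub>R heat_field t y))"
    proof (rule integrable_pointwise_bound[OF i])
      show "norm (norm (\<phi> (x - y) *\<^sub>R heat_field t y)) \<le> norm (M * norm (heat_field t y))" for y
        using le[of y] M(1) by simp
    qed measurable
  qed (rule i)
  moreover have "0 \<le> integral\<^sup>L lborel (\<lambda>y::'a. M * norm (heat_field t y))" using M by simp
  ultimately show thesis by (rule that[rotated])
qed

lemma smear_shift_pairing:
  assumes "u > 0"
  shows "integral\<^sup>L lborel (\<lambda>x. \<phi> (x - z) *\<^sub>R smear \<phi> u x) = integral\<^sup>L lborel (\<lambda>w. autocorr \<phi> (w - z) *\<^sub>R heat_field u w)"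
proof -
  note [measurable] = lipc_measurable[OF \<phi>]
  obtain M where M: "M \<ge> 0" "\<And>x. \<bar>\<phi> x\<bar> \<le> M" using lipcE[OF \<phi>] by metis
  have int: "integrable (lborel \<Otimes>\<^sub>M lborel) (\<lambda>(w, x). \<phi> (x - z) *\<^sub>R (\<phi> (x - w) *\<^sub>R heat_field u w))"
  proof (rule integrable_pointwise_bound)
    show "integrable (lborel \<Otimes>\<^sub>M lborel) (\<lambda>p. M *\<^sub>R (case p of (w, x) \<Rightarrow> \<phi> (x - w) *\<^sub>R heat_field u w))"
      by (intro integrable_scaleR_right smear_double_integrable assms)
    show "norm (case p of (w, x) \<Rightarrow> \<phi> (x - z) *\<^sub>R \<phi> (x - w) *\<^sub>R heat_field u w)
      \<le> norm (M *\<^sub>R (case p of (w, x) \<Rightarrow> \<phi> (x - w) *\<^sub>R heat_field u w))" for p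
      using M(2)[of "snd p - z"] by (auto split: prod.splits simp: abs_mult mult.assoc intro!: mult_right_mono)
  qed measurable
  have "integral\<^sup>L lborel (\<lambda>x. \<phi> (x - z) *\<^sub>R smear \<phi> u x)
    = integral\<^sup>L lborel (\<lambda>x. integral\<^sup>L lborel (\<lambda>w. \<phi> (x - z) *\<^sub>R (\<phi> (x - w) *\<^sub>R heat_field u w)))"
    unfolding smear_def by (simp del: scaleR_scaleR)
  also have "\<dots> = integral\<^sup>L lborel (\<lambda>w. integral\<^sup>L lborel (\<lambda>x. \<phi> (x - z) *\<^sub>R (\<phi> (x - w) *\<^sub>R heat_field u w)))"
    by (rule lborel_pair.Fubini_integral[OF int])
  also have "\<dots> = integral\<^sup>L lborel (\<lambda>w. autocorr \<phi> (w - z) *\<^sub>R heat_field u w)"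
  proof (rule Bochner_Integration.integral_cong[OF refl])
    fix w
    have "autocorr \<phi> (w - z) = integral\<^sup>L lborel (\<lambda>x. (\<lambda>x. \<phi> x * \<phi> (x - (w - z))) (x - z))"
      unfolding autocorr_def by (rule lborel_integral_translate[symmetric]) simp
    also have "\<dots> = integral\<^sup>L lborel (\<lambda>x. \<phi> (x - z) * \<phi> (x - w))" by (simp add: algebra_simps)
    finally have eq: "autocorr \<phi> (w - z) = integral\<^sup>L lborel (\<lambda>x. \<phi> (x - z) * \<phi> (x - w))" .
    have "integrable lborel (\<lambda>x. (\<lambda>x. \<phi> x * \<phi> (x - (w - z))) (- z + 1 *\<^sub>R x))"
      by (rule lborel_integrable_affine[OF autocorr_product_integrable]) simp
    then have "integrable lborel (\<lambda>x. \<phi> (x - z) * \<phi> (x - w))" by (simp add: algebra_simps)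
    then show "integral\<^sup>L lborel (\<lambda>x. \<phi> (x - z) *\<^sub>R (\<phi> (x - w) *\<^sub>R heat_field u w)) = autocorr \<phi> (w - z) *\<^sub>R heat_field u w"
      unfolding eq by simp
  qed
  finally show ?thesis .
qed

text \<open>The mass times the rate at which \<open>heat_form\<close> decreases in time; by
  \<open>smear_pairing\<close> it is also a Dirichlet energy of the heat evolution.\<close>

definition heat_energy :: "real \<Rightarrow> real" where
  "heat_energy r = heat_mass TYPE('a) * integral\<^sup>L lborel (\<lambda>v. autocorr \<phi> v * heat_rate r v)"

text \<open>The x-integral is the autocorrelation tested with a heat field. Exchanging the remaining
  integrals leaves two heat fields with arguments z and v + z; reflecting z makes this the
  convolution of \<open>heat_field_convolution\<close>.\<close>

lemma shift_pairing_energy: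
  assumes t: "t > 0" and u: "u > 0"
  shows "integral\<^sup>L lborel (\<lambda>z. inner (heat_field t z) (integral\<^sup>L lborel (\<lambda>x. \<phi> (x - z) *\<^sub>R smear \<phi> u x)))
    = heat_energy (t + u)"
proof -
  let ?B = "autocorr \<phi> 0"
  have shift: "integral\<^sup>L lborel (\<lambda>w. autocorr \<phi> (w - z) *\<^sub>R heat_field u w)
      = integral\<^sup>L lborel (\<lambda>v. autocorr \<phi> v *\<^sub>R heat_field u (v + z))" for z
    using lborel_integral_translate[of "\<lambda>v. autocorr \<phi> v *\<^sub>R heat_field u (v + z)" z] by simp
  have i1: "integrable lborel (\<lambda>v. autocorr \<phi> v *\<^sub>R heat_field u (v + z))" for z
  proof (rule integrable_pointwise_bound)
    show "integrable lborel (\<lambda>v. ?B *\<^sub>R heat_field u (z + 1 *\<^sub>R v))"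
      by (intro integrable_scaleR_right lborel_integrable_affine heat_field_integrable u) simp
    show "norm (autocorr \<phi> v *\<^sub>R heat_field u (v + z)) \<le> norm (?B *\<^sub>R heat_field u (z + 1 *\<^sub>R v))" for v
      using abs_autocorr_le[of v] by (auto simp: add.commute intro!: mult_right_mono)
  qed measurable
  have int: "integrable (lborel \<Otimes>\<^sub>M lborel) (\<lambda>(z, v). autocorr \<phi> v * inner (heat_field t z) (heat_field u (v + z)))"
  proof -
    have "integrable (lborel \<Otimes>\<^sub>M lborel) (\<lambda>(z::'a, v). ?B * (norm (heat_field u (v + z)) * norm (heat_field t z)))"
    proof (rule integrableI_bounded)
      have "(\<integral>\<^sup>+p. ennreal (norm (case p of (z, v) \<Rightarrow> ?B * (norm (heat_field u (v + z)) * norm (heat_field t z)))) \<partial>((lborel :: 'a measure) \<Otimes>\<^sub>M lborel))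
        = (\<integral>\<^sup>+z. \<integral>\<^sup>+v. ennreal (?B * norm (heat_field t z)) * ennreal (norm (heat_field u (v - (- z :: 'a)))) \<partial>lborel \<partial>lborel)"
        using autocorr_0_nonneg
        by (subst lborel.nn_integral_fst[symmetric]) (auto simp: ennreal_mult[symmetric] mult_ac)
      also have "\<dots> = (\<integral>\<^sup>+z. ennreal (?B * norm (heat_field t (z::'a))) * (\<integral>\<^sup>+v. ennreal (norm (heat_field u (v::'a))) \<partial>lborel) \<partial>lborel)"
      proof (rule nn_integral_cong)
        fix z :: 'a
        have "(\<integral>\<^sup>+v. ennreal (norm (heat_field u (v - (- z)))) \<partial>lborel) = (\<integral>\<^sup>+v. ennreal (norm (heat_field u (v::'a))) \<partial>lborel)"
          by (rule nn_integral_lborel_translate) simp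
        then show "(\<integral>\<^sup>+v. ennreal (?B * norm (heat_field t z)) * ennreal (norm (heat_field u (v - (- z)))) \<partial>lborel)
          = ennreal (?B * norm (heat_field t z)) * (\<integral>\<^sup>+v. ennreal (norm (heat_field u (v::'a))) \<partial>lborel)"
          by (subst nn_integral_cmult) auto
      qed
      also have "\<dots> = (\<integral>\<^sup>+z. ennreal (norm (?B * norm (heat_field t (z::'a)))) \<partial>lborel) * (\<integral>\<^sup>+v. ennreal (norm (heat_field u (v::'a))) \<partial>lborel)"
        using autocorr_0_nonneg by (subst nn_integral_multc) auto
      also have "\<dots> < \<infinity>"
      proof -
        have "integrable lborel (\<lambda>z::'a. ?B * norm (heat_field t z))"
          using heat_field_integrable[OF t, where 'a='a] by simp
        then show ?thesis using heat_field_integrable[OF u, where 'a='a]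
          unfolding integrable_iff_bounded by (simp add: ennreal_mult_less_top)
      qed
      finally show "(\<integral>\<^sup>+p. ennreal (norm (case p of (z, v) \<Rightarrow> ?B * (norm (heat_field u (v + z)) * norm (heat_field t z)))) \<partial>((lborel :: 'a measure) \<Otimes>\<^sub>M lborel)) < \<infinity>" .
    qed measurable
    then show ?thesis
    proof (rule integrable_pointwise_bound)
      show "norm (case p of (z, v) \<Rightarrow> autocorr \<phi> v * inner (heat_field t z) (heat_field u (v + z)))
        \<le> norm (case p of (z, v) \<Rightarrow> ?B * (norm (heat_field u (v + z)) * norm (heat_field t z)))" for p
        using abs_autocorr_le[of "snd p"] Cauchy_Schwarz_ineq2[of "heat_field t (fst p)" "heat_field u (snd p + fst p)"] autocorr_0_nonneg
        by (auto split: prod.splits simp: abs_mult mult.commute intro!: mult_mono)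
    qed measurable
  qed
  have "integral\<^sup>L lborel (\<lambda>z. inner (heat_field t z) (integral\<^sup>L lborel (\<lambda>x. \<phi> (x - z) *\<^sub>R smear \<phi> u x)))
    = integral\<^sup>L lborel (\<lambda>z. integral\<^sup>L lborel (\<lambda>v. autocorr \<phi> v * inner (heat_field t z) (heat_field u (v + z))))"
    unfolding smear_shift_pairing[OF u] shift
    by (intro Bochner_Integration.integral_cong refl)
      (subst integral_inner_right[symmetric], auto simp: i1)
  also have "\<dots> = integral\<^sup>L lborel (\<lambda>v. integral\<^sup>L lborel (\<lambda>z. autocorr \<phi> v * inner (heat_field t z) (heat_field u (v + z))))"
    by (rule lborel_pair.Fubini_integral[OF int, symmetric])
  also have "\<dots> = integral\<^sup>L lborel (\<lambda>v. heat_mass TYPE('a) * (autocorr \<phi> v * heat_rate (t + u) v))"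
  proof (rule Bochner_Integration.integral_cong[OF refl])
    fix v :: 'a
    have "integral\<^sup>L lborel (\<lambda>z. inner (heat_field t z) (heat_field u (v + z)))
      = integral\<^sup>L lborel (\<lambda>z. inner (heat_field t (0 - z)) (heat_field u (v + (0 - z))))"
      by (rule lborel_integral_reflect[symmetric]) measurable
    also have "\<dots> = - integral\<^sup>L lborel (\<lambda>z. inner (heat_field t z) (heat_field u (v - z)))"
      by (simp add: heat_field_minus)
    also have "\<dots> = heat_mass TYPE('a) * heat_rate (t + u) v"
      by (simp add: heat_field_convolution[OF t u])
    finally show "integral\<^sup>L lborel (\<lambda>z. autocorr \<phi> v * inner (heat_field t z) (heat_field u (v + z)))
      = heat_mass TYPE('a) * (autocorr \<phi> v * heat_rate (t + u) v)" by simp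
  qed
  finally show ?thesis by (simp add: heat_energy_def)
qed

text \<open>The semigroup law seen through gradients: the product of the evolutions at times t and u
  depends on t + u only.\<close>

lemma smear_pairing:
  assumes t: "t > 0" and u: "u > 0"
  shows "integral\<^sup>L lborel (\<lambda>x. inner (smear \<phi> t x) (smear \<phi> u x)) = heat_energy (t + u)"
proof -
  note [measurable] = lipc_measurable[OF \<phi>]
  obtain B where B: "B \<ge> 0" "\<And>x. norm (smear \<phi> u x) \<le> B" using smear_bounded[OF u] by metis
  obtain M where M: "M \<ge> 0" "\<And>x. \<bar>\<phi> x\<bar> \<le> M" using lipcE[OF \<phi>] by metis
  have int: "integrable (lborel \<Otimes>\<^sub>M lborel) (\<lambda>(z, x). inner (\<phi> (x - z) *\<^sub>R heat_field t z) (smear \<phi> u x))"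
  proof (rule integrable_pointwise_bound)
    show "integrable (lborel \<Otimes>\<^sub>M lborel) (\<lambda>p. B *\<^sub>R (case p of (z, x) \<Rightarrow> \<phi> (x - z) *\<^sub>R heat_field t z))"
      by (intro integrable_scaleR_right smear_double_integrable t)
    show "norm (case p of (z, x) \<Rightarrow> inner (\<phi> (x - z) *\<^sub>R heat_field t z) (smear \<phi> u x))
      \<le> norm (B *\<^sub>R (case p of (z, x) \<Rightarrow> \<phi> (x - z) *\<^sub>R heat_field t z))" for p
    proof (cases p)
      case (Pair z x)
      have "\<bar>inner (\<phi> (x - z) *\<^sub>R heat_field t z) (smear \<phi> u x)\<bar> \<le> norm (\<phi> (x - z) *\<^sub>R heat_field t z) * norm (smear \<phi> u x)"
        by (rule Cauchy_Schwarz_ineq2)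
      also have "\<dots> \<le> norm (\<phi> (x - z) *\<^sub>R heat_field t z) * B"
        by (intro mult_left_mono B) simp
      finally show ?thesis using B(1) by (simp add: Pair abs_mult mult_ac)
    qed
  qed measurable
  have i1: "integrable lborel (\<lambda>z. \<phi> (x - z) *\<^sub>R heat_field t z)" for x
  proof (rule integrable_pointwise_bound)
    show "integrable lborel (\<lambda>z::'a. M *\<^sub>R heat_field t z)"
      by (intro integrable_scaleR_right heat_field_integrable t)
    show "norm (\<phi> (x - z) *\<^sub>R heat_field t z) \<le> norm (M *\<^sub>R heat_field t z)" for z
      using M by (auto intro!: mult_right_mono)
  qed measurable
  have i2: "integrable lborel (\<lambda>x. \<phi> (x - z) *\<^sub>R smear \<phi> u x)" for z
  proof (rule integrable_pointwise_bound)
    show "integrable lborel (\<lambda>x. M *\<^sub>R smear \<phi> u x)"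
      by (intro integrable_scaleR_right smear_integrable u)
    show "norm (\<phi> (x - z) *\<^sub>R smear \<phi> u x) \<le> norm (M *\<^sub>R smear \<phi> u x)" for x
      using M by (auto intro!: mult_right_mono)
  qed measurable
  have "integral\<^sup>L lborel (\<lambda>x. inner (smear \<phi> t x) (smear \<phi> u x))
     = integral\<^sup>L lborel (\<lambda>x. integral\<^sup>L lborel (\<lambda>z. inner (\<phi> (x - z) *\<^sub>R heat_field t z) (smear \<phi> u x)))"
    unfolding smear_def[of \<phi> t]
    by (intro Bochner_Integration.integral_cong refl) (subst integral_inner_left, auto simp: i1 simp del: inner_scaleR_left)
  also have "\<dots> = integral\<^sup>L lborel (\<lambda>z. integral\<^sup>L lborel (\<lambda>x. inner (\<phi> (x - z) *\<^sub>R heat_field t z) (smear \<phi> u x)))"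
    by (rule lborel_pair.Fubini_integral[OF int])
  also have "\<dots> = integral\<^sup>L lborel (\<lambda>z. inner (heat_field t z) (integral\<^sup>L lborel (\<lambda>x. \<phi> (x - z) *\<^sub>R smear \<phi> u x)))"
  proof (rule Bochner_Integration.integral_cong[OF refl])
    fix z :: 'a
    have "integral\<^sup>L lborel (\<lambda>x. inner (heat_field t z) (\<phi> (x - z) *\<^sub>R smear \<phi> u x))
       = inner (heat_field t z) (integral\<^sup>L lborel (\<lambda>x. \<phi> (x - z) *\<^sub>R smear \<phi> u x))"
      by (rule integral_inner_right) (use i2 in auto)
    then show "integral\<^sup>L lborel (\<lambda>x. inner (\<phi> (x - z) *\<^sub>R heat_field t z) (smear \<phi> u x))
       = inner (heat_field t z) (integral\<^sup>L lborel (\<lambda>x. \<phi> (x - z) *\<^sub>R smear \<phi> u x))" by simp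
  qed
  finally show ?thesis by (simp add: shift_pairing_energy[OF t u])
qed

text \<open>Splitting r into two equal times makes the energy a squared norm. This sign is what
  allows integrals of energies over all times to be cut down to a window.\<close>

lemma heat_energy_nonneg: assumes "r > 0" shows "heat_energy r \<ge> 0"
proof -
  have "heat_energy (r/2 + r/2) = integral\<^sup>L lborel (\<lambda>x. inner (smear \<phi> (r/2) x) (smear \<phi> (r/2) x))"
    using assms by (intro smear_pairing[symmetric]) auto
  then show ?thesis by simp
qed

lemma heat_mass_pos: "heat_mass TYPE('a) > 0"
proof -
  have "heat_mass TYPE('a) \<noteq> 0"
  proof
    assume "heat_mass TYPE('a) = 0"
    then have "AE x in lborel. heat 1 (x::'a) = 0"
      unfolding heat_mass_def
      by (subst (asm) integral_nonneg_eq_0_iff_AE) (auto simp: heat_nonneg intro: heat_integrable)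
    then have "AE x in (lborel :: 'a measure). False" by (simp add: heat_def)
    then show False using AE_iff_measurable[of "UNIV::'a set" lborel "\<lambda>x. False"] by (simp add: emeasure_lborel_UNIV)
  qed
  moreover have "heat_mass TYPE('a) \<ge> 0" unfolding heat_mass_def by (simp add: heat_nonneg)
  ultimately show ?thesis by simp
qed

text \<open>The two parts of \<open>heat_rate\<close> contribute d Z / (2r) each, Z being the mass:
  the first directly, the second through the second moment 2 d Z r.\<close>

lemma heat_energy_le:
  assumes r: "r > 0"
  shows "heat_energy r \<le> (heat_mass TYPE('a))\<^sup>2 * autocorr \<phi> 0 * (real DIM('a) / r)"
proof -
  let ?Z = "heat_mass TYPE('a)"
  have int: "integrable lborel (\<lambda>x::'a. real DIM('a) / (2 * r) * heat r x + (norm x)\<^sup>2 * heat r x / (4 * r\<^sup>2))"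
    using norm_power_heat_integrable[OF r, of 2, where 'a='a] heat_integrable[OF r, where 'a='a] by auto
  have "integral\<^sup>L lborel (\<lambda>v. autocorr \<phi> v * heat_rate r v)
    \<le> integral\<^sup>L lborel (\<lambda>v::'a. autocorr \<phi> 0 * (real DIM('a) / (2 * r) * heat r v + (norm v)\<^sup>2 * heat r v / (4 * r\<^sup>2)))"
  proof (rule integral_mono)
    have le: "\<bar>autocorr \<phi> v * heat_rate r v\<bar> \<le> autocorr \<phi> 0 * (real DIM('a) / (2 * r) * heat r v + (norm v)\<^sup>2 * heat r v / (4 * r\<^sup>2))" for v
      unfolding abs_mult using abs_autocorr_le[of v] abs_heat_rate_le[OF r, of v] autocorr_0_nonneg
      by (intro mult_mono) auto
    show "autocorr \<phi> v * heat_rate r v \<le> autocorr \<phi> 0 * (real DIM('a) / (2 * r) * heat r v + (norm v)\<^sup>2 * heat r v / (4 * r\<^sup>2))" for v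
      using le[of v] by linarith
    show "integrable lborel (\<lambda>v. autocorr \<phi> v * heat_rate r v)"
    proof (rule integrable_pointwise_bound)
      show "integrable lborel (\<lambda>v::'a. autocorr \<phi> 0 * (real DIM('a) / (2 * r) * heat r v + (norm v)\<^sup>2 * heat r v / (4 * r\<^sup>2)))"
        by (intro integrable_mult_right int)
      show "norm (autocorr \<phi> v * heat_rate r v) \<le> norm (autocorr \<phi> 0 * (real DIM('a) / (2 * r) * heat r v + (norm v)\<^sup>2 * heat r v / (4 * r\<^sup>2)))" for v
        using le[of v] by (simp only: real_norm_def)
    qed measurable
  qed (intro integrable_mult_right int)
  also have "\<dots> = autocorr \<phi> 0 * (real DIM('a) / (2 * r) * ?Z + (r * heat_moment TYPE('a)) / (4 * r\<^sup>2))"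
    using norm_power_heat_integrable[OF r, of 2, where 'a='a] heat_integrable[OF r, where 'a='a]
    by (subst integral_mult_right_zero, subst Bochner_Integration.integral_add)
      (auto simp: heat_integral[OF r] heat_integral_moment[OF r])
  also have "\<dots> = autocorr \<phi> 0 * (?Z * (real DIM('a) / r))"
    using r by (simp add: heat_moment_eq field_simps power2_eq_square)
  finally have "heat_energy r \<le> ?Z * (autocorr \<phi> 0 * (?Z * (real DIM('a) / r)))"
    unfolding heat_energy_def by (rule mult_left_mono) (use heat_mass_pos in simp)
  then show ?thesis by (simp add: power2_eq_square mult_ac)
qed

end

section \<open>Subordination\<close>

text \<open>The profile of \<open>subord_density s z\<close> for |z| = 1, to which other z reduce by
  scaling t with |z|^2. The exponent (d + s + 3) / 2 collects d / 2 from the Gaussian, 1 from its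
  gradient and (1 + s) / 2 from the weight in t.\<close>

definition subord_weight :: "real \<Rightarrow> 'a::euclidean_space itself \<Rightarrow> real \<Rightarrow> real" where
  "subord_weight s TYPE('a) t = indicator {0<..} t * (t powr - ((real DIM('a) + s + 3) / 2) * exp (- (1 / (4 * t))) / 2)"

definition subord_const :: "real \<Rightarrow> 'a::euclidean_space itself \<Rightarrow> real" where
  "subord_const s TYPE('a) = integral\<^sup>L lborel (subord_weight s TYPE('a))"

lemma subord_weight_measurable [measurable]: "subord_weight s TYPE('a::euclidean_space) \<in> borel_measurable borel"
  unfolding subord_weight_def by measurable

lemma subord_weight_nonneg: "subord_weight s TYPE('a::euclidean_space) t \<ge> 0"
  by (simp add: subord_weight_def)

text \<open>Near t = 0 the factor exp(-1/(4t)) beats the power, as seen in the variable y = 1/(4t);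
  at infinity the power t^(-p) with p > 1 decays fast enough.\<close>

lemma subord_weight_integrable:
  assumes s: "0 < s"
  shows "integrable lborel (subord_weight s TYPE('a::euclidean_space))"
proof -
  define p where "p = (real DIM('a) + s + 3) / 2"
  have p: "p > 1" using s by (simp add: p_def)
  define N where "N = nat \<lceil>p\<rceil>"
  have N: "p \<le> real N" unfolding N_def by linarith
  define C where "C = 1 + 4 powr p * (1 + fact N)"
  have C: "C \<ge> 1" by (simp add: C_def)
  have w: "subord_weight s TYPE('a) t = t powr - p * exp (- (1 / (4 * t))) / 2" if "t > 0" for t
    using that by (simp add: subord_weight_def p_def)
  have b1: "subord_weight s TYPE('a) t \<le> C" for t
  proof (cases "t > 0")
    case True
    define y where "y = 1 / (4 * t)"
    have y: "y > 0" "t = 1 / (4 * y)" using True by (auto simp: y_def)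
    have tp: "t powr - p = 4 powr p * y powr p"
      using y by (simp add: powr_divide powr_mult powr_minus_divide)
    have "y powr p \<le> 1 + y ^ N"
    proof (cases "y \<le> 1")
      case T: True
      then have "y powr p \<le> 1 powr p" using y p by (intro powr_mono2) auto
      then show ?thesis using y by (simp add: add_increasing2)
    next
      case False
      then have "y powr p \<le> y powr real N" using N by (intro powr_mono) auto
      then show ?thesis using y by (simp add: powr_realpow)
    qed
    then have 1: "y powr p * exp (- y) \<le> (1 + y ^ N) * exp (- y)" by (rule mult_right_mono) simp
    have 2: "(1 + y ^ N) * exp (- y) \<le> 1 + fact N"
      using power_times_exp_le_fact[of y N] y by (simp add: distrib_right add_mono)
    have "4 powr p * (y powr p * exp (- y)) \<le> 4 powr p * (1 + fact N)"
      by (rule mult_left_mono[OF order_trans[OF 1 2]]) simp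
    then have "t powr - p * exp (- y) \<le> 4 powr p * (1 + fact N)"
      unfolding tp by (simp only: mult.assoc)
    moreover have "0 \<le> t powr - p * exp (- y)" by simp
    ultimately show ?thesis unfolding w[OF True] C_def y_def[symmetric] by linarith
  qed (use C in \<open>auto simp: subord_weight_def\<close>)
  have b2: "subord_weight s TYPE('a) t \<le> C * norm t powr - p" if "norm t \<ge> 1" for t
  proof (cases "t > 0")
    case True
    have "subord_weight s TYPE('a) t \<le> t powr - p * 1 / 2"
      unfolding w[OF True] using True by (intro divide_right_mono mult_left_mono) auto
    also have "\<dots> \<le> C * t powr - p"
    proof -
      have "t powr - p \<le> C * t powr - p" using C mult_right_mono[of 1 C "t powr - p"] by simp
      moreover have "0 \<le> t powr - p" by simp
      ultimately show ?thesis by linarith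
    qed
    finally show ?thesis using True by simp
  qed (use C in \<open>auto simp: subord_weight_def\<close>)
  show ?thesis
    by (rule integrable_decay[where p=p and C=C]) (use b1 b2 p subord_weight_nonneg[where 'a='a] in auto)
qed

lemma subord_const_pos:
  assumes s: "0 < s"
  shows "subord_const s TYPE('a::euclidean_space) > 0"
proof -
  have "subord_const s TYPE('a) \<noteq> 0"
  proof
    assume "subord_const s TYPE('a) = 0"
    then have "AE t in lborel. subord_weight s TYPE('a) t = 0"
      unfolding subord_const_def
      by (subst (asm) integral_nonneg_eq_0_iff_AE) (auto simp: subord_weight_nonneg intro: subord_weight_integrable s)
    then have "AE t in lborel. t \<notin> {0<..<1::real}"
      by eventually_elim (auto simp: subord_weight_def)
    then have "emeasure lborel {0<..<1::real} = 0"
      by (subst (asm) AE_iff_measurable[of "{0<..<1}"]) auto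
    then show False by simp
  qed
  moreover have "subord_const s TYPE('a) \<ge> 0"
    unfolding subord_const_def by (simp add: subord_weight_nonneg)
  ultimately show ?thesis by simp
qed

text \<open>The kernel is a superposition of heat fields; this replaces the Fourier representation
  of the fractional gradient as a composition of the gradient and a Riesz potential.\<close>

definition subord_density :: "real \<Rightarrow> 'a::euclidean_space \<Rightarrow> real \<Rightarrow> real" where
  "subord_density s z t = indicator {0<..} t * (t powr ((1 - s) / 2 - 1) * (heat t z / (2 * t)))"

lemma subord_density_heat_field:
  "subord_density s z t *\<^sub>R z = (indicator {0<..} t * t powr ((1 - s) / 2 - 1)) *\<^sub>R heat_field t z"
  by (simp add: subord_density_def heat_field_def)

lemma subord_density_nonneg: "subord_density s z t \<ge> 0"
  by (auto simp: subord_density_def heat_nonneg indicator_def)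

lemma subord_density_eq:
  fixes z :: "'a::euclidean_space"
  assumes z: "z \<noteq> 0"
  shows "subord_density s z t = (norm z)\<^sup>2 powr - ((real DIM('a) + s + 3) / 2) * subord_weight s TYPE('a) (1 / (norm z)\<^sup>2 * t)"
proof (cases "t > 0")
  case True
  define c where "c = (norm z)\<^sup>2"
  define p where "p = (real DIM('a) + s + 3) / 2"
  have c: "c > 0" using z by (simp add: c_def)
  have "t powr - p = t powr (((1 - s) / 2 - 1) + (- (real DIM('a) / 2)) + (- 1))"
  proof -
    have "- p = ((1 - s) / 2 - 1) + (- (real DIM('a) / 2)) + (- 1)" by (simp add: p_def field_simps)
    then show ?thesis by simp
  qed
  also have "\<dots> = t powr ((1 - s) / 2 - 1) * t powr (- (real DIM('a) / 2)) / t"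
  proof -
    have "t powr (- 1) = 1 / t" using True powr_minus_divide[of t 1] by simp
    then show ?thesis by (simp only: powr_add times_divide_eq_right mult_1_right)
  qed
  finally have p1: "t powr ((1 - s) / 2 - 1) * t powr (- (real DIM('a) / 2)) / t = t powr - p" ..
  have "c powr - p * (1 / c * t) powr - p = (c * (1 / c * t)) powr - p"
    using c True by (intro powr_mult[symmetric])
  also have "c * (1 / c * t) = t" using c by simp
  finally have p2: "c powr - p * (1 / c * t) powr - p = t powr - p" .
  have "subord_density s z t = (t powr ((1 - s) / 2 - 1) * t powr (- (real DIM('a) / 2)) / t) * exp (- (c / (4 * t))) / 2"
    using True by (simp add: subord_density_def heat_def c_def)
  also have "\<dots> = (c powr - p * (1 / c * t) powr - p) * exp (- (c / (4 * t))) / 2"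
    by (simp only: p1 p2)
  also have "c / (4 * t) = 1 / (4 * (1 / c * t))" by simp
  also have "(c powr - p * (1 / c * t) powr - p) * exp (- (1 / (4 * (1 / c * t)))) / 2
    = c powr - p * ((1 / c * t) powr - p * exp (- (1 / (4 * (1 / c * t)))) / 2)"
    by (simp only: mult.assoc times_divide_eq_right)
  also have "\<dots> = c powr - p * subord_weight s TYPE('a) (1 / c * t)"
    using True c by (simp add: subord_weight_def p_def)
  finally show ?thesis by (simp add: c_def p_def)
next
  case False
  then have "\<not> 0 < 1 / (norm z)\<^sup>2 * t" using z by (simp add: zero_less_mult_iff zero_less_divide_iff)
  with False show ?thesis by (simp add: subord_density_def subord_weight_def)
qed

text \<open>Multiplied by z, this writes \<open>subord_const\<close> times the kernel
  \<open>frac_kernel s z\<close> as an integral of heat fields in t. The substitution t = |z|^2 r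
  produces the power of |z|.\<close>

lemma subord_density_integral:
  fixes z :: "'a::euclidean_space"
  assumes z: "z \<noteq> 0" and s: "0 < s"
  shows "integrable lborel (subord_density s z)"
    and "integral\<^sup>L lborel (subord_density s z) = subord_const s TYPE('a) / norm z powr (real DIM('a) + s + 1)"
proof -
  define c where "c = (norm z)\<^sup>2"
  define p where "p = (real DIM('a) + s + 3) / 2"
  have c: "c > 0" using z by (simp add: c_def)
  have eq: "subord_density s z = (\<lambda>t. c powr - p * subord_weight s TYPE('a) (0 + (1 / c) *\<^sub>R t))"
    using subord_density_eq[OF z] by (auto simp: c_def p_def)
  show "integrable lborel (subord_density s z)"
    unfolding eq using c by (intro integrable_mult_right lborel_integrable_affine subord_weight_integrable s) auto
  have "subord_const s TYPE('a) = (\<bar>1 / c\<bar> ^ DIM(real)) *\<^sub>R integral\<^sup>L lborel (\<lambda>t. subord_weight s TYPE('a) (0 + (1 / c) *\<^sub>R t))"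
    unfolding subord_const_def using c by (intro lborel_integral_affine) auto
  then have "integral\<^sup>L lborel (\<lambda>t. subord_weight s TYPE('a) (0 + (1 / c) *\<^sub>R t)) = c * subord_const s TYPE('a)"
    using c by simp
  then have "integral\<^sup>L lborel (subord_density s z) = (c powr - p * c) * subord_const s TYPE('a)"
    unfolding eq by simp
  also have "c powr - p * c = c powr (1 - p)" using c by (simp add: powr_diff powr_minus_divide)
  also have "c powr (1 - p) = norm z powr (2 * (1 - p))"
    using z by (simp add: c_def powr_power powr_powr[symmetric] power2_eq_square powr_mult[symmetric])
      (simp add: powr_add[symmetric] powr_mult)
  also have "2 * (1 - p) = - (real DIM('a) + s + 1)" by (simp add: p_def field_simps)
  finally show "integral\<^sup>L lborel (subord_density s z) = subord_const s TYPE('a) / norm z powr (real DIM('a) + s + 1)"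
    unfolding powr_minus_divide by simp
qed

text \<open>The L^2 product of \<phi> with its heat evolution at time r. As r tends to zero it tends
  to the mass times the squared norm of \<phi>.\<close>

definition heat_form :: "('a::euclidean_space \<Rightarrow> real) \<Rightarrow> real \<Rightarrow> real" where
  "heat_form \<phi> r = integral\<^sup>L lborel (\<lambda>v. autocorr \<phi> v * heat r v)"

context
  fixes s :: real and \<phi> :: "'a::euclidean_space \<Rightarrow> real"
  assumes s: "0 < s" "s < 1" and \<phi>: "lipc \<phi>"
begin

text \<open>Writing the kernel as a mixture of heat fields reduces the pairing to energies at the
  times t + u. The increment \<phi> x - \<phi> (x - z) is kept until the integrals have been
  exchanged, since it compensates the singularity at z = 0; afterwards, for fixed t, its part
  \<open>N 0\<close> integrates to zero against the odd heat field.\<close>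

lemma frac_int_smear_pairing:
  assumes u: "u > 0"
  defines "e \<equiv> (1 - s) / 2 - 1"
  shows "integrable lborel (\<lambda>t. indicator {0<..} t * t powr e * heat_energy \<phi> (t + u))"
    and "subord_const s TYPE('a) * integral\<^sup>L lborel (\<lambda>x. inner (frac_int s \<phi> x) (smear \<phi> u x))
      = - integral\<^sup>L lborel (\<lambda>t. indicator {0<..} t * t powr e * heat_energy \<phi> (t + u))"
proof -
  note [measurable] = lipc_measurable[OF \<phi>] smear_measurable[OF \<phi>]
  let ?\<kappa> = "subord_const s TYPE('a)"
  have \<kappa>: "?\<kappa> > 0" by (rule subord_const_pos[OF s(1)])
  obtain B where B: "B \<ge> 0" "\<And>x. norm (smear \<phi> u x) \<le> B" using smear_bounded[OF \<phi> u] by metis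
  obtain M where M: "M \<ge> 0" "\<And>x. \<bar>\<phi> x\<bar> \<le> M" using lipcE[OF \<phi>] by metis
  obtain C where C: "C \<ge> 0" "\<And>z. (\<integral>\<^sup>+x. ennreal \<bar>\<phi> x - \<phi> (x - z)\<bar> \<partial>lborel) \<le> ennreal (C * min (norm z) 1)"
    using lipc_diff_bounds[OF \<phi>] by metis
  have i\<phi>: "integrable lborel (\<lambda>x. \<phi> (x - z) *\<^sub>R smear \<phi> u x)" for z
  proof (rule integrable_pointwise_bound)
    show "integrable lborel (\<lambda>x. M *\<^sub>R smear \<phi> u x)"
      by (intro integrable_scaleR_right smear_integrable \<phi> u)
    show "norm (\<phi> (x - z) *\<^sub>R smear \<phi> u x) \<le> norm (M *\<^sub>R smear \<phi> u x)" for x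
      using M by (auto intro!: mult_right_mono)
  qed measurable
  define N where "N z = integral\<^sup>L lborel (\<lambda>x. \<phi> (x - z) *\<^sub>R smear \<phi> u x)" for z
  define g where "g z = integral\<^sup>L lborel (\<lambda>x. (\<phi> x - \<phi> (x - z)) *\<^sub>R smear \<phi> u x)" for z
  have [measurable]: "g \<in> borel_measurable borel" "N \<in> borel_measurable borel"
  proof -
    have "g \<in> borel_measurable lborel"
      unfolding g_def by (rule lborel.borel_measurable_lebesgue_integral) measurable
    moreover have "N \<in> borel_measurable lborel"
      unfolding N_def by (rule lborel.borel_measurable_lebesgue_integral) measurable
    ultimately show "g \<in> borel_measurable borel" "N \<in> borel_measurable borel" by simp_all
  qed
  have gN: "g z = N 0 - N z" for z
    unfolding g_def N_def using i\<phi>[of 0] i\<phi>[of z] by (simp add: scaleR_diff_left)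
  have ig: "integrable lborel (\<lambda>x. (\<phi> x - \<phi> (x - z)) *\<^sub>R smear \<phi> u x)" for z
    using i\<phi>[of 0] i\<phi>[of z] by (simp add: scaleR_diff_left)
  have gbound: "norm (g z) \<le> B * (C * min (norm z) 1)" for z
  proof -
    have "ennreal (norm (g z)) \<le> (\<integral>\<^sup>+x. ennreal (norm ((\<phi> x - \<phi> (x - z)) *\<^sub>R smear \<phi> u x)) \<partial>lborel)"
      unfolding g_def by (rule integral_norm_bound_ennreal[OF ig])
    also have "\<dots> \<le> (\<integral>\<^sup>+x. ennreal B * ennreal \<bar>\<phi> x - \<phi> (x - z)\<bar> \<partial>lborel)"
      using B by (intro nn_integral_mono) (auto simp: ennreal_mult[symmetric] mult.commute[of B] intro!: ennreal_leI mult_left_mono)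
    also have "\<dots> = ennreal B * (\<integral>\<^sup>+x. ennreal \<bar>\<phi> x - \<phi> (x - z)\<bar> \<partial>lborel)"
      by (rule nn_integral_cmult) simp
    also have "\<dots> \<le> ennreal B * ennreal (C * min (norm z) 1)" using C(2) by (rule mult_left_mono) simp
    also have "\<dots> = ennreal (B * (C * min (norm z) 1))" using B(1) C(1) by (simp add: ennreal_mult)
    finally show ?thesis using B(1) C(1) by (subst (asm) ennreal_le_iff) auto
  qed
  have X: "integral\<^sup>L lborel (\<lambda>x. inner (frac_int s \<phi> x) (smear \<phi> u x)) = integral\<^sup>L lborel (\<lambda>z. inner (frac_kernel s z) (g z))"
  proof -
    have int: "integrable (lborel \<Otimes>\<^sub>M lborel) (\<lambda>(z, x). inner ((\<phi> x - \<phi> (x - z)) *\<^sub>R frac_kernel s z) (smear \<phi> u x))"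
    proof (rule integrable_pointwise_bound)
      show "integrable (lborel \<Otimes>\<^sub>M lborel) (\<lambda>p. B *\<^sub>R (case p of (z, x) \<Rightarrow> (\<phi> x - \<phi> (x - z)) *\<^sub>R frac_kernel s z))"
        by (intro integrable_scaleR_right frac_int_double_integrable \<phi> s)
      show "norm (case p of (z, x) \<Rightarrow> inner ((\<phi> x - \<phi> (x - z)) *\<^sub>R frac_kernel s z) (smear \<phi> u x))
        \<le> norm (B *\<^sub>R (case p of (z, x) \<Rightarrow> (\<phi> x - \<phi> (x - z)) *\<^sub>R frac_kernel s z))" for p
      proof (cases p)
        case (Pair z x)
        let ?k = "(\<phi> x - \<phi> (x - z)) *\<^sub>R frac_kernel s z"
        have "\<bar>inner ?k (smear \<phi> u x)\<bar> \<le> norm ?k * norm (smear \<phi> u x)" by (rule Cauchy_Schwarz_ineq2)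
        also have "\<dots> \<le> norm ?k * B" by (intro mult_left_mono B) simp
        finally show ?thesis using B(1) by (simp add: Pair abs_mult mult_ac)
      qed
    qed measurable
    have "integral\<^sup>L lborel (\<lambda>x. inner (frac_int s \<phi> x) (smear \<phi> u x))
      = integral\<^sup>L lborel (\<lambda>x. integral\<^sup>L lborel (\<lambda>z. inner ((\<phi> x - \<phi> (x - z)) *\<^sub>R frac_kernel s z) (smear \<phi> u x)))"
      unfolding frac_int_def
      by (intro Bochner_Integration.integral_cong refl)
        (subst integral_inner_left, auto simp: frac_int_integrand_integrable[OF s \<phi>] simp del: inner_scaleR_left)
    also have "\<dots> = integral\<^sup>L lborel (\<lambda>z. integral\<^sup>L lborel (\<lambda>x. inner ((\<phi> x - \<phi> (x - z)) *\<^sub>R frac_kernel s z) (smear \<phi> u x)))"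
      by (rule lborel_pair.Fubini_integral[OF int])
    also have "\<dots> = integral\<^sup>L lborel (\<lambda>z. inner (frac_kernel s z) (g z))"
    proof (rule Bochner_Integration.integral_cong[OF refl])
      fix z :: 'a
      have "integral\<^sup>L lborel (\<lambda>x. inner (frac_kernel s z) ((\<phi> x - \<phi> (x - z)) *\<^sub>R smear \<phi> u x)) = inner (frac_kernel s z) (g z)"
        unfolding g_def by (rule integral_inner_right) (use ig in auto)
      then show "integral\<^sup>L lborel (\<lambda>x. inner ((\<phi> x - \<phi> (x - z)) *\<^sub>R frac_kernel s z) (smear \<phi> u x)) = inner (frac_kernel s z) (g z)"
        by simp
    qed
    finally show ?thesis .
  qed
  define F where "F z t = subord_density s z t * inner z (g z)" for z t
  have F_alt: "F z t = indicator {0<..} t * t powr e * inner (heat_field t z) (g z)" for z t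
  proof -
    have "F z t = inner (subord_density s z t *\<^sub>R z) (g z)" by (simp add: F_def)
    then show ?thesis unfolding subord_density_heat_field by (simp add: e_def)
  qed
  have F_meas: "(\<lambda>(z, t). F z t) \<in> borel_measurable (lborel \<Otimes>\<^sub>M lborel)"
    unfolding F_def subord_density_def heat_def by measurable
  have Fint1: "integrable lborel (F z)" for z
    unfolding F_def using subord_density_integral(1)[OF _ s(1), of z] by (cases "z = 0") auto
  have Fnorm: "integral\<^sup>L lborel (\<lambda>t. \<bar>F z t\<bar>) = ?\<kappa> * \<bar>inner (frac_kernel s z) (g z)\<bar>" for z
  proof (cases "z = 0")
    case False
    have "integral\<^sup>L lborel (\<lambda>t. \<bar>F z t\<bar>) = integral\<^sup>L lborel (\<lambda>t. subord_density s z t * \<bar>inner z (g z)\<bar>)"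
      unfolding F_def by (simp add: abs_mult subord_density_nonneg)
    also have "\<dots> = ?\<kappa> * (\<bar>inner z (g z)\<bar> / norm z powr (real DIM('a) + s + 1))"
      using subord_density_integral[OF False s(1)] by simp
    finally show ?thesis by (simp add: frac_kernel_def abs_mult)
  qed (simp add: F_def[abs_def] frac_kernel_def)
  have Fval: "integral\<^sup>L lborel (F z) = ?\<kappa> * inner (frac_kernel s z) (g z)" for z
  proof (cases "z = 0")
    case False
    then show ?thesis unfolding F_def using subord_density_integral[OF False s(1)] by (simp add: frac_kernel_def)
  qed (simp add: F_def[abs_def] frac_kernel_def)
  have Fint: "integrable (lborel \<Otimes>\<^sub>M lborel) (\<lambda>(z, t). F z t)"
  proof (rule lborel_pair.Fubini_integrable[OF F_meas])
    show "integrable lborel (\<lambda>z. integral\<^sup>L lborel (\<lambda>t. norm (case (z, t) of (z, t) \<Rightarrow> F z t)))"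
    proof (rule integrable_pointwise_bound)
      show "integrable lborel (\<lambda>z::'a. ?\<kappa> * (B * C) * (min (norm z) 1 * norm (frac_kernel s z)))"
        by (intro integrable_mult_right frac_kernel_integrable s)
      show "norm (integral\<^sup>L lborel (\<lambda>t. norm (case (z, t) of (z, t) \<Rightarrow> F z t)))
        \<le> norm (?\<kappa> * (B * C) * (min (norm z) 1 * norm (frac_kernel s z)))" for z
      proof -
        have "\<bar>inner (frac_kernel s z) (g z)\<bar> \<le> norm (frac_kernel s z) * norm (g z)" by (rule Cauchy_Schwarz_ineq2)
        also have "\<dots> \<le> norm (frac_kernel s z) * (B * (C * min (norm z) 1))"
          by (intro mult_left_mono gbound) simp
        finally have "?\<kappa> * \<bar>inner (frac_kernel s z) (g z)\<bar> \<le> ?\<kappa> * (norm (frac_kernel s z) * (B * (C * min (norm z) 1)))"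
          using \<kappa> by (intro mult_left_mono) auto
        then show ?thesis using \<kappa> B(1) C(1) by (simp add: Fnorm abs_mult mult_ac)
      qed
    qed (simp add: Fnorm)
    show "AE z in lborel. integrable lborel (\<lambda>t. case (z, t) of (z, t) \<Rightarrow> F z t)"
      using Fint1 by simp
  qed
  have inner_int: "integral\<^sup>L lborel (\<lambda>z. F z t) = - (indicator {0<..} t * t powr e * heat_energy \<phi> (t + u))" for t
  proof (cases "t > 0")
    case True
    have bN: "norm (N z) \<le> integral\<^sup>L lborel (\<lambda>x. M * norm (smear \<phi> u x))" for z
      unfolding N_def
    proof (rule order_trans[OF integral_norm_bound], rule integral_mono)
      show "integrable lborel (\<lambda>x. norm (\<phi> (x - z) *\<^sub>R smear \<phi> u x))" using i\<phi> by (rule integrable_norm)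
      show "integrable lborel (\<lambda>x. M * norm (smear \<phi> u x))" using smear_integrable[OF \<phi> u] by simp
      show "norm (\<phi> (x - z) *\<^sub>R smear \<phi> u x) \<le> M * norm (smear \<phi> u x)" for x
        using M by (auto intro!: mult_right_mono)
    qed
    have iN: "integrable lborel (\<lambda>z. inner (heat_field t z) (N z))"
    proof (rule integrable_pointwise_bound)
      show "integrable lborel (\<lambda>z::'a. integral\<^sup>L lborel (\<lambda>x. M * norm (smear \<phi> u x)) * norm (heat_field t z))"
        using heat_field_integrable[OF True, where 'a='a] by simp
      show "norm (inner (heat_field t z) (N z)) \<le> norm (integral\<^sup>L lborel (\<lambda>x. M * norm (smear \<phi> u x)) * norm (heat_field t z))" for z
      proof -
        have "\<bar>inner (heat_field t z) (N z)\<bar> \<le> norm (heat_field t z) * norm (N z)" by (rule Cauchy_Schwarz_ineq2)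
        also have "\<dots> \<le> norm (heat_field t z) * integral\<^sup>L lborel (\<lambda>x. M * norm (smear \<phi> u x))"
          by (intro mult_left_mono bN) simp
        finally show ?thesis using M(1) by (simp add: abs_mult mult.commute)
      qed
    qed measurable
    have i0: "integrable lborel (\<lambda>z. inner (heat_field t z) (N 0))"
      using heat_field_integrable[OF True, where 'a='a] by simp
    have z0: "integral\<^sup>L lborel (\<lambda>z::'a. heat_field t z) = 0"
      by (rule odd_integral_zero) (auto simp: heat_field_minus)
    have "integral\<^sup>L lborel (\<lambda>z. inner (heat_field t z) (g z))
      = integral\<^sup>L lborel (\<lambda>z. inner (heat_field t z) (N 0) - inner (heat_field t z) (N z))"
      by (simp add: gN inner_diff_right)
    also have "\<dots> = inner (integral\<^sup>L lborel (\<lambda>z::'a. heat_field t z)) (N 0) - integral\<^sup>L lborel (\<lambda>z. inner (heat_field t z) (N z))"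
      using i0 iN heat_field_integrable[OF True, where 'a='a] by simp
    also have "\<dots> = - heat_energy \<phi> (t + u)"
      unfolding z0 N_def shift_pairing_energy[OF \<phi> True u] by simp
    finally show ?thesis unfolding F_alt by simp
  qed (simp add: F_alt)
  have "integrable lborel (\<lambda>t. integral\<^sup>L lborel (\<lambda>z. F z t))"
    using lborel_pair.integrable_snd[OF Fint] by simp
  then show "integrable lborel (\<lambda>t. indicator {0<..} t * t powr e * heat_energy \<phi> (t + u))"
    unfolding inner_int by simp
  have "?\<kappa> * integral\<^sup>L lborel (\<lambda>x. inner (frac_int s \<phi> x) (smear \<phi> u x)) = integral\<^sup>L lborel (\<lambda>z. integral\<^sup>L lborel (F z))"
    unfolding X Fval by simp
  also have "\<dots> = integral\<^sup>L lborel (\<lambda>t. integral\<^sup>L lborel (\<lambda>z. F z t))"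
    using lborel_pair.Fubini_integral[OF Fint] by simp
  finally show "?\<kappa> * integral\<^sup>L lborel (\<lambda>x. inner (frac_int s \<phi> x) (smear \<phi> u x))
      = - integral\<^sup>L lborel (\<lambda>t. indicator {0<..} t * t powr e * heat_energy \<phi> (t + u))"
    unfolding inner_int by simp
qed

lemma heat_form_diff:
  assumes u: "u > 0"
  shows "integrable lborel (\<lambda>t. indicator {0..u} t * heat_energy \<phi> (t + u))"
    and "heat_mass TYPE('a) * (heat_form \<phi> u - heat_form \<phi> (2 * u)) = integral\<^sup>L lborel (\<lambda>t. indicator {0..u} t * heat_energy \<phi> (t + u))"
proof -
  define J where "J r = indicator {u..2*u} r * integral\<^sup>L lborel (\<lambda>x. autocorr \<phi> x * heat_rate r x)" for r :: real
  have J: "integrable lborel J" "heat_form \<phi> u - heat_form \<phi> (2 * u) = integral\<^sup>L lborel J"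
    unfolding J_def heat_form_def
    using heat_rate_fubini[OF u autocorr_measurable[OF \<phi>] abs_autocorr_le[OF \<phi>]] by auto
  have eq: "(\<lambda>t. indicator {0..u} t * heat_energy \<phi> (t + u)) = (\<lambda>t. heat_mass TYPE('a) * J (u + 1 *\<^sub>R t))"
    by (auto simp: J_def heat_energy_def[OF \<phi>] indicator_def add.commute)
  show "integrable lborel (\<lambda>t. indicator {0..u} t * heat_energy \<phi> (t + u))"
    unfolding eq by (intro integrable_mult_right lborel_integrable_affine J) simp
  have "integral\<^sup>L lborel J = (\<bar>1\<bar> ^ DIM(real)) *\<^sub>R integral\<^sup>L lborel (\<lambda>t. J (u + 1 *\<^sub>R t))"
    by (rule lborel_integral_affine) (use J in auto)
  then show "heat_mass TYPE('a) * (heat_form \<phi> u - heat_form \<phi> (2 * u)) = integral\<^sup>L lborel (\<lambda>t. indicator {0..u} t * heat_energy \<phi> (t + u))"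
    unfolding eq J(2) by simp
qed

text \<open>Since e < 0, the weight t^e is at least u^e for t \<le> u; energies being nonnegative,
  the pairing dominates u^e times the loss of \<open>heat_form\<close> from u to 2u. Cauchy-Schwarz
  and \<open>heat_energy_le\<close> at time 2u bound the pairing, and the exponents combine to -e -
  1/2 = s/2.\<close>

lemma heat_form_diff_le:
  assumes u: "u > 0"
  shows "heat_form \<phi> u - heat_form \<phi> (2 * u)
    \<le> subord_const s TYPE('a) * sqrt (real DIM('a) / 2) * u powr (s / 2) * (L2norm (frac_int s \<phi>) * L2norm \<phi>)"
proof -
  let ?\<kappa> = "subord_const s TYPE('a)" and ?Z = "heat_mass TYPE('a)"
  define e where "e = (1 - s) / 2 - 1"
  note [measurable] = lipc_measurable[OF \<phi>] smear_measurable[OF \<phi>] frac_int_measurable[OF s \<phi>]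
  have \<kappa>: "?\<kappa> > 0" by (rule subord_const_pos[OF s(1)])
  have Z: "?Z > 0" by (rule heat_mass_pos[OF \<phi>])
  define X where "X = integral\<^sup>L lborel (\<lambda>x. inner (frac_int s \<phi> x) (smear \<phi> u x))"
  have "u powr e * (?Z * (heat_form \<phi> u - heat_form \<phi> (2 * u)))
    = integral\<^sup>L lborel (\<lambda>t. u powr e * (indicator {0..u} t * heat_energy \<phi> (t + u)))"
    unfolding heat_form_diff(2)[OF u] by simp
  also have "\<dots> \<le> integral\<^sup>L lborel (\<lambda>t. indicator {0<..} t * t powr e * heat_energy \<phi> (t + u))"
  proof (rule integral_mono_AE)
    show "integrable lborel (\<lambda>t. u powr e * (indicator {0..u} t * heat_energy \<phi> (t + u)))"
      by (intro integrable_mult_right heat_form_diff u)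
    show "integrable lborel (\<lambda>t. indicator {0<..} t * t powr e * heat_energy \<phi> (t + u))"
      unfolding e_def by (rule frac_int_smear_pairing(1)[OF u])
    \<comment> \<open>The window on the left contains t = 0 while the half-line on the right does
      not, so the comparison is made off this null set.\<close>
    have "AE t in lborel. t \<noteq> (0::real)" by (rule AE_lborel_singleton)
    then show "AE t in lborel. u powr e * (indicator {0..u} t * heat_energy \<phi> (t + u)) \<le> indicator {0<..} t * t powr e * heat_energy \<phi> (t + u)"
    proof eventually_elim
      case (elim t)
      show ?case
      proof (cases "0 < t")
        case True
        have E: "heat_energy \<phi> (t + u) \<ge> 0" using True u by (intro heat_energy_nonneg \<phi>) simp
        show ?thesis
        proof (cases "t \<le> u")
          case tu: True
          have "u powr e \<le> t powr e" using True tu s by (intro powr_mono2') (auto simp: e_def)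
          then show ?thesis using True tu E by (simp add: mult_right_mono)
        qed (use True E in auto)
      qed (use elim in auto)
    qed
  qed
  also have "\<dots> = - (?\<kappa> * X)"
    using frac_int_smear_pairing(2)[OF u] unfolding X_def e_def by simp
  also have "\<dots> \<le> ?\<kappa> * \<bar>X\<bar>" using \<kappa> by (simp add: abs_mult[symmetric] abs_if mult_less_0_iff)
  finally have 1: "u powr e * (?Z * (heat_form \<phi> u - heat_form \<phi> (2 * u))) \<le> ?\<kappa> * \<bar>X\<bar>" .
  obtain B1 where B1: "\<And>x. norm (frac_int s \<phi> x) \<le> B1" using frac_int_bounded[OF s \<phi>] by metis
  obtain B2 where B2: "\<And>x. norm (smear \<phi> u x) \<le> B2" using smear_bounded[OF \<phi> u] by metis
  have L2f: "L2 (frac_int s \<phi>)" by (rule integrable_bounded_imp_L2[OF frac_int_integrable[OF s \<phi>] B1])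
  have L2s: "L2 (smear \<phi> u)" by (rule integrable_bounded_imp_L2[OF smear_integrable[OF \<phi> u] B2])
  have "X = inner (mk (frac_int s \<phi>)) (mk (smear \<phi> u))"
    unfolding X_def inner_mk[OF L2f L2s] by (rule integral_completion[symmetric]) measurable
  then have X: "\<bar>X\<bar> \<le> L2norm (frac_int s \<phi>) * L2norm (smear \<phi> u)"
    using Cauchy_Schwarz_ineq2[of "mk (frac_int s \<phi>)" "mk (smear \<phi> u)"] by (simp add: norm_mk L2f L2s)
  have Lphi: "(L2norm \<phi>)\<^sup>2 = autocorr \<phi> 0"
    unfolding L2norm_def autocorr_0[OF \<phi>] by (simp add: integral_completion)
  have "(L2norm (smear \<phi> u))\<^sup>2 = integral\<^sup>L lborel (\<lambda>x. inner (smear \<phi> u x) (smear \<phi> u x))"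
    unfolding L2norm_def by (simp add: integral_completion power2_norm_eq_inner)
  also have "\<dots> = heat_energy \<phi> (u + u)" by (rule smear_pairing[OF \<phi> u u])
  also have "\<dots> \<le> ?Z\<^sup>2 * (L2norm \<phi>)\<^sup>2 * (real DIM('a) / (u + u))"
    unfolding Lphi using u by (intro heat_energy_le \<phi>) auto
  also have "\<dots> = (?Z * L2norm \<phi> * sqrt (real DIM('a) / (2 * u)))\<^sup>2"
    using u by (simp add: power_mult_distrib)
  finally have "L2norm (smear \<phi> u) \<le> ?Z * L2norm \<phi> * sqrt (real DIM('a) / (2 * u))"
    by (rule power2_le_imp_le) (use Z u in \<open>auto simp: L2norm_def\<close>)
  also have "\<dots> = ?Z * L2norm \<phi> * (sqrt (real DIM('a) / 2) * u powr - (1 / 2))"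
    using u by (simp add: real_sqrt_divide real_sqrt_mult powr_minus_divide powr_half_sqrt)
  finally have S: "L2norm (smear \<phi> u) \<le> ?Z * L2norm \<phi> * (sqrt (real DIM('a) / 2) * u powr - (1 / 2))" .
  have "\<bar>X\<bar> \<le> L2norm (frac_int s \<phi>) * (?Z * L2norm \<phi> * (sqrt (real DIM('a) / 2) * u powr - (1 / 2)))"
    using X mult_left_mono[OF S, of "L2norm (frac_int s \<phi>)"] by (simp add: L2norm_def)
  then have "?\<kappa> * \<bar>X\<bar> \<le> ?\<kappa> * (L2norm (frac_int s \<phi>) * (?Z * L2norm \<phi> * (sqrt (real DIM('a) / 2) * u powr - (1 / 2))))"
    using \<kappa> by (intro mult_left_mono) auto
  with 1 have "?Z * (u powr e * (heat_form \<phi> u - heat_form \<phi> (2 * u)))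
    \<le> ?Z * (?\<kappa> * (L2norm (frac_int s \<phi>) * (L2norm \<phi> * (sqrt (real DIM('a) / 2) * u powr - (1 / 2)))))"
    by (simp add: mult_ac)
  then have 2: "u powr e * (heat_form \<phi> u - heat_form \<phi> (2 * u))
    \<le> ?\<kappa> * (L2norm (frac_int s \<phi>) * (L2norm \<phi> * (sqrt (real DIM('a) / 2) * u powr - (1 / 2))))"
    using Z by (simp only: mult_le_cancel_left_pos)
  have "heat_form \<phi> u - heat_form \<phi> (2 * u) = u powr - e * (u powr e * (heat_form \<phi> u - heat_form \<phi> (2 * u)))"
    using u by (simp add: powr_minus_divide)
  also have "\<dots> \<le> u powr - e * (?\<kappa> * (L2norm (frac_int s \<phi>) * (L2norm \<phi> * (sqrt (real DIM('a) / 2) * u powr - (1 / 2)))))"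
    using 2 by (rule mult_left_mono) simp
  also have "\<dots> = ?\<kappa> * sqrt (real DIM('a) / 2) * (u powr - e * u powr - (1 / 2)) * (L2norm (frac_int s \<phi>) * L2norm \<phi>)"
    by (simp add: mult_ac)
  also have "u powr - e * u powr - (1 / 2) = u powr (s / 2)"
    unfolding powr_add[symmetric] by (rule arg_cong[where f="\<lambda>e. u powr e"]) (simp add: e_def field_simps)
  finally show ?thesis .
qed

lemma heat_form_tendsto:
  assumes r: "\<And>n. r n > 0" "r \<longlonglongrightarrow> 0"
  shows "(\<lambda>n. heat_form \<phi> (r n)) \<longlonglongrightarrow> heat_mass TYPE('a) * (L2norm \<phi>)\<^sup>2"
proof -
  note [measurable] = autocorr_measurable[OF \<phi>]
  have Lphi: "(L2norm \<phi>)\<^sup>2 = autocorr \<phi> 0"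
    using lipc_measurable[OF \<phi>] unfolding L2norm_def autocorr_0[OF \<phi>] by (simp add: integral_completion)
  have "(\<lambda>n. integral\<^sup>L lborel (\<lambda>x. autocorr \<phi> (sqrt (r n) *\<^sub>R x) * heat 1 x)) \<longlonglongrightarrow> integral\<^sup>L lborel (\<lambda>x::'a. autocorr \<phi> 0 * heat 1 x)"
  proof (rule integral_dominated_convergence[where w="\<lambda>x. autocorr \<phi> 0 * heat 1 x"])
    show "integrable lborel (\<lambda>x::'a. autocorr \<phi> 0 * heat 1 x)"
      by (intro integrable_mult_right heat_integrable) simp
    show "AE x in lborel. (\<lambda>n. autocorr \<phi> (sqrt (r n) *\<^sub>R x) * heat 1 x) \<longlonglongrightarrow> autocorr \<phi> 0 * heat 1 x"
    proof (rule AE_I2)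
      fix x :: 'a
      have "(\<lambda>n. sqrt (r n) *\<^sub>R x) \<longlonglongrightarrow> sqrt 0 *\<^sub>R x" by (intro tendsto_intros r)
      then show "(\<lambda>n. autocorr \<phi> (sqrt (r n) *\<^sub>R x) * heat 1 x) \<longlonglongrightarrow> autocorr \<phi> 0 * heat 1 x"
        by (intro tendsto_intros autocorr_tendsto \<phi>) simp
    qed
    show "AE x in lborel. norm (autocorr \<phi> (sqrt (r n) *\<^sub>R x) * heat 1 x) \<le> autocorr \<phi> 0 * heat 1 x" for n
      using abs_autocorr_le[OF \<phi>] by (auto simp: abs_mult heat_nonneg intro!: mult_right_mono)
  qed measurable
  moreover have "heat_form \<phi> (r n) = integral\<^sup>L lborel (\<lambda>x. autocorr \<phi> (sqrt (r n) *\<^sub>R x) * heat 1 x)" for n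
    unfolding heat_form_def by (rule heat_scaling[OF r(1)]) simp
  ultimately show ?thesis by (simp add: Lphi heat_mass_def mult.commute)
qed

text \<open>Telescoping over the times T / 2^n down to zero. The losses form a geometric series of
  ratio \<rho> = 2^(-s/2), whose sum \<rho> / (1 - \<rho>) is the denominator 2^(s/2) - 1 of the
  constant.\<close>

theorem heat_form_bound:
  assumes T: "T > 0"
  shows "heat_mass TYPE('a) * (L2norm \<phi>)\<^sup>2 \<le>
    subord_const s TYPE('a) * sqrt (real DIM('a) / 2) / (2 powr (s / 2) - 1) * T powr (s / 2)
      * (L2norm (frac_int s \<phi>) * L2norm \<phi>) + heat_form \<phi> T"
proof -
  define \<rho> where "\<rho> = (1/2::real) powr (s / 2)"
  have \<rho>: "0 < \<rho>" "\<rho> < 1"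
    unfolding \<rho>_def using s powr_less_mono2[of "s / 2" "1/2" 1] by auto
  define A where "A = subord_const s TYPE('a) * sqrt (real DIM('a) / 2) * T powr (s / 2) * (L2norm (frac_int s \<phi>) * L2norm \<phi>)"
  have A: "A \<ge> 0" unfolding A_def using subord_const_pos[OF s(1), where 'a='a] by (simp add: L2norm_def)
  define r where "r n = T * (1/2) ^ n" for n
  have r0: "r n > 0" for n using T by (simp add: r_def)
  have step: "heat_form \<phi> (r (Suc n)) - heat_form \<phi> (r n) \<le> A * \<rho> ^ Suc n" for n
  proof -
    have "heat_form \<phi> (r (Suc n)) - heat_form \<phi> (2 * r (Suc n))
      \<le> subord_const s TYPE('a) * sqrt (real DIM('a) / 2) * r (Suc n) powr (s / 2) * (L2norm (frac_int s \<phi>) * L2norm \<phi>)"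
      by (rule heat_form_diff_le[OF r0])
    moreover have "2 * r (Suc n) = r n" by (simp add: r_def)
    moreover have "r (Suc n) powr (s / 2) = T powr (s / 2) * \<rho> ^ Suc n"
    proof -
      have "((1/2::real) ^ k) powr (s / 2) = \<rho> ^ k" for k
        unfolding \<rho>_def by (induction k) (simp, simp only: power_Suc powr_mult)
      then show ?thesis unfolding r_def using T by (simp only: powr_mult)
    qed
    ultimately show ?thesis by (simp add: A_def mult_ac)
  qed
  have "heat_form \<phi> (r n) - heat_form \<phi> T \<le> A * (\<rho> / (1 - \<rho>))" for n
  proof -
    have "heat_form \<phi> (r n) - heat_form \<phi> (r 0) = (\<Sum>k<n. heat_form \<phi> (r (Suc k)) - heat_form \<phi> (r k))"
      by (rule sum_lessThan_telescope[of "\<lambda>k. heat_form \<phi> (r k)", symmetric])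
    also have "\<dots> \<le> (\<Sum>k<n. A * \<rho> ^ Suc k)" by (intro sum_mono step)
    also have "\<dots> = A * \<rho> * (\<Sum>k<n. \<rho> ^ k)" by (simp add: sum_distrib_left mult.assoc)
    also have "\<dots> \<le> A * \<rho> * (1 / (1 - \<rho>))"
    proof (rule mult_left_mono)
      show "(\<Sum>k<n. \<rho> ^ k) \<le> 1 / (1 - \<rho>)"
        using sum_le_suminf[OF summable_geometric, of \<rho> "{..<n}"] \<rho> suminf_geometric[of \<rho>] by auto
    qed (use A \<rho> in auto)
    finally show ?thesis by (simp add: r_def)
  qed
  moreover have "(\<lambda>n. heat_form \<phi> (r n) - heat_form \<phi> T) \<longlonglongrightarrow> heat_mass TYPE('a) * (L2norm \<phi>)\<^sup>2 - heat_form \<phi> T"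
  proof (intro tendsto_intros heat_form_tendsto r0)
    have "(\<lambda>n. T * (1/2) ^ n) \<longlonglongrightarrow> T * 0" by (intro tendsto_intros LIMSEQ_realpow_zero) auto
    then show "r \<longlonglongrightarrow> 0" by (simp add: r_def[abs_def])
  qed
  ultimately have "heat_mass TYPE('a) * (L2norm \<phi>)\<^sup>2 - heat_form \<phi> T \<le> A * (\<rho> / (1 - \<rho>))"
    by (intro LIMSEQ_le_const2) auto
  moreover have "\<rho> / (1 - \<rho>) = 1 / (2 powr (s / 2) - 1)"
  proof -
    define w where "w = (2::real) powr (s / 2)"
    have \<rho>w: "\<rho> = 1 / w" by (simp add: \<rho>_def w_def powr_divide)
    have "w > 1" using s by (simp add: w_def)
    then have "\<rho> / (1 - \<rho>) = 1 / (w - 1)" unfolding \<rho>w by (simp add: divide_simps)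
    then show ?thesis by (simp add: w_def)
  qed
  ultimately show ?thesis by (simp add: A_def algebra_simps)
qed

end

section \<open>Graphs of the fractional gradient\<close>

lemma L2_Pair:
  fixes u :: "'a::euclidean_space \<Rightarrow> 'b::euclidean_space" and g :: "'a \<Rightarrow> 'c::euclidean_space"
  assumes "L2 u" "L2 g" shows "L2 (\<lambda>x. (u x, g x))"
proof -
  have [measurable]: "u \<in> borel_measurable lebesgue" "g \<in> borel_measurable lebesgue"
    using assms by (auto simp: L2_def)
  have "integrable lebesgue (\<lambda>x. (norm (u x))\<^sup>2 + (norm (g x))\<^sup>2)"
    using assms by (simp add: L2_def)
  then show ?thesis by (simp add: L2_def norm_Pair)
qed

lemma L2_bounded_linear:
  fixes f :: "'a::euclidean_space \<Rightarrow> 'b::euclidean_space" and h :: "'b \<Rightarrow> 'c::euclidean_space"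
  assumes "L2 f" "bounded_linear h" shows "L2 (\<lambda>x. h (f x))"
proof -
  obtain K where K: "\<forall>x. norm (h x) \<le> norm x * K"
    using bounded_linear.nonneg_bounded[OF assms(2)] by blast
  have hm: "h \<in> borel_measurable borel"
    by (rule borel_measurable_continuous_onI[OF linear_continuous_on[OF assms(2)]])
  show ?thesis
  proof (rule L2_bound[OF assms(1), of _ K])
    show "(\<lambda>x. h (f x)) \<in> borel_measurable lebesgue"
      by (rule measurable_compose[OF L2_measurable[OF assms(1)] hm])
    show "AE x in lebesgue. norm (h (f x)) \<le> K * norm (f x)"
      by (rule AE_I2) (simp only: K mult.commute[of K])
  qed
qed

lemma L2_fst:
  fixes f :: "'a::euclidean_space \<Rightarrow> 'b::euclidean_space \<times> 'c::euclidean_space"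
  shows "L2 f \<Longrightarrow> L2 (\<lambda>x. fst (f x))"
  by (rule L2_bounded_linear[OF _ bounded_linear_fst])

lemma L2_snd:
  fixes f :: "'a::euclidean_space \<Rightarrow> 'b::euclidean_space \<times> 'c::euclidean_space"
  shows "L2 f \<Longrightarrow> L2 (\<lambda>x. snd (f x))"
  by (rule L2_bounded_linear[OF _ bounded_linear_snd])

lemma mk_AE_cong: "L2 f \<Longrightarrow> L2 g \<Longrightarrow> AE x in lebesgue. f x = g x \<Longrightarrow> mk f = mk g"
  by (simp add: mk_eq_iff)

lemma bounded_linear_l2I:
  fixes F :: "('a::euclidean_space, 'b::euclidean_space) l2 \<Rightarrow> ('c::euclidean_space, 'd::euclidean_space) l2"
  assumes "\<And>f g. L2 f \<Longrightarrow> L2 g \<Longrightarrow> F (mk (\<lambda>x. f x + g x)) = F (mk f) + F (mk g)"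
    and "\<And>c f. L2 f \<Longrightarrow> F (mk (\<lambda>x. c *\<^sub>R f x)) = c *\<^sub>R F (mk f)"
    and "\<And>f. L2 f \<Longrightarrow> norm (F (mk f)) \<le> L2norm f * K"
  shows "bounded_linear F"
proof (rule bounded_linear_intro[where K=K])
  fix X Y :: "('a, 'b) l2" and c :: real
  show "F (X + Y) = F X + F Y"
    using assms(1)[of "fn X" "fn Y"] by (simp add: mk_add)
  show "F (c *\<^sub>R X) = c *\<^sub>R F X"
    using assms(2)[of "fn X" c] by (simp add: mk_scaleR)
  show "norm (F X) \<le> norm X * K"
    using assms(3)[of "fn X"] by (simp add: norm_fn)
qed

text \<open>A pair of a function and its gradient is stored as one \<open>l2\<close> element with
  values in a product. Its squared norm is the sum of the two squared norms, so the
  \<open>l2\<close> norm of a graph is its H^s norm.\<close>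

definition val :: "('a::euclidean_space, real \<times> 'a) l2 \<Rightarrow> ('a, real) l2" where
  "val X = mk (\<lambda>x. fst (fn X x))"

definition grad :: "('a::euclidean_space, real \<times> 'a) l2 \<Rightarrow> ('a, 'a) l2" where
  "grad X = mk (\<lambda>x. snd (fn X x))"

lemma val_mk:
  assumes "L2 u" "L2 g" shows "val (mk (\<lambda>x. (u x, g x))) = mk u"
  unfolding val_def
proof (rule mk_AE_cong)
  show "AE x in lebesgue. fst (fn (mk (\<lambda>x. (u x, g x))) x) = u x"
    using fn_mk[OF L2_Pair[OF assms]] by eventually_elim simp
qed (simp_all add: assms L2_fst)

lemma grad_mk:
  assumes "L2 u" "L2 g" shows "grad (mk (\<lambda>x. (u x, g x))) = mk g"
  unfolding grad_def
proof (rule mk_AE_cong)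
  show "AE x in lebesgue. snd (fn (mk (\<lambda>x. (u x, g x))) x) = g x"
    using fn_mk[OF L2_Pair[OF assms]] by eventually_elim simp
qed (simp_all add: assms L2_snd)

lemma graph_cases:
  obtains u g where "L2 u" "L2 g" "X = mk (\<lambda>x. (u x, g x))"
proof (rule that)
  show "L2 (\<lambda>x. fst (fn X x))" "L2 (\<lambda>x. snd (fn X x))" by (simp_all add: L2_fst L2_snd)
qed simp

lemma graph_inner: "inner X Y = inner (val X) (val Y) + inner (grad X) (grad Y)"
proof -
  obtain u g where X: "L2 u" "L2 g" "X = mk (\<lambda>x. (u x, g x))" by (rule graph_cases)
  obtain v h where Y: "L2 v" "L2 h" "Y = mk (\<lambda>x. (v x, h x))" by (rule graph_cases)
  show ?thesis
    using X(1,2) Y(1,2) unfolding X(3) Y(3)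
    by (simp add: val_mk grad_mk inner_mk L2_Pair L2_inner_integrable[of u v, simplified] L2_inner_integrable)
qed

lemma graph_norm: "(norm X)\<^sup>2 = (norm (val X))\<^sup>2 + (norm (grad X))\<^sup>2"
  by (simp add: power2_norm_eq_inner graph_inner)

lemma norm_val_le: "norm (val X) \<le> norm X"
  by (rule power2_le_imp_le) (auto simp: graph_norm)

lemma norm_grad_le: "norm (grad X) \<le> norm X"
  by (rule power2_le_imp_le) (auto simp: graph_norm)

lemma graph_eqI:
  assumes "val X = val Y" "grad X = grad Y" shows "X = Y"
proof -
  obtain u g where X: "L2 u" "L2 g" "X = mk (\<lambda>x. (u x, g x))" by (rule graph_cases)
  obtain v h where Y: "L2 v" "L2 h" "Y = mk (\<lambda>x. (v x, h x))" by (rule graph_cases)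
  have "AE x in lebesgue. u x = v x" "AE x in lebesgue. g x = h x"
    using assms X(1,2) Y(1,2) unfolding X(3) Y(3) by (simp_all add: val_mk grad_mk mk_eq_iff)
  then have "AE x in lebesgue. (u x, g x) = (v x, h x)" by eventually_elim simp
  then show ?thesis unfolding X(3) Y(3) by (rule mk_AE_cong[rotated 2]) (simp_all add: L2_Pair X Y)
qed

lemma bounded_linear_val: "bounded_linear val"
proof (rule bounded_linear_l2I[where K=1])
  fix f g :: "'a \<Rightarrow> real \<times> 'a" and c :: real
  assume f: "L2 f"
  have v: "val (mk h) = mk (\<lambda>x. fst (h x))" if "L2 h" for h :: "'a \<Rightarrow> real \<times> 'a"
    using val_mk[OF L2_fst[OF that] L2_snd[OF that]] by simp
  show "val (mk (\<lambda>x. c *\<^sub>R f x)) = c *\<^sub>R val (mk f)"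
    using f mk_scaleR[OF L2_fst[OF f], of c] by (simp add: v L2_scaleR)
  show "norm (val (mk f)) \<le> L2norm f * 1" using norm_val_le[of "mk f"] f by (simp add: norm_mk)
  assume g: "L2 g"
  show "val (mk (\<lambda>x. f x + g x)) = val (mk f) + val (mk g)"
    using v[OF L2_add[OF f g]] mk_add[OF L2_fst[OF f] L2_fst[OF g]] by (simp add: v f g)
qed

lemma bounded_linear_grad: "bounded_linear grad"
proof (rule bounded_linear_l2I[where K=1])
  fix f g :: "'a \<Rightarrow> real \<times> 'a" and c :: real
  assume f: "L2 f"
  have v: "grad (mk h) = mk (\<lambda>x. snd (h x))" if "L2 h" for h :: "'a \<Rightarrow> real \<times> 'a"
    using grad_mk[OF L2_fst[OF that] L2_snd[OF that]] by simp
  show "grad (mk (\<lambda>x. c *\<^sub>R f x)) = c *\<^sub>R grad (mk f)"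
    using f mk_scaleR[OF L2_snd[OF f], of c] by (simp add: v L2_scaleR)
  show "norm (grad (mk f)) \<le> L2norm f * 1" using norm_grad_le[of "mk f"] f by (simp add: norm_mk)
  assume g: "L2 g"
  show "grad (mk (\<lambda>x. f x + g x)) = grad (mk f) + grad (mk g)"
    using v[OF L2_add[OF f g]] mk_add[OF L2_snd[OF f] L2_snd[OF g]] by (simp add: v f g)
qed

lemmas val_simps = bounded_linear.linear[OF bounded_linear_val, THEN linear_add]
  bounded_linear.linear[OF bounded_linear_val, THEN linear_diff]
  bounded_linear.linear[OF bounded_linear_val, THEN linear_scale]
  bounded_linear.linear[OF bounded_linear_val, THEN linear_0]

lemmas grad_simps = bounded_linear.linear[OF bounded_linear_grad, THEN linear_add]
  bounded_linear.linear[OF bounded_linear_grad, THEN linear_diff]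
  bounded_linear.linear[OF bounded_linear_grad, THEN linear_scale]
  bounded_linear.linear[OF bounded_linear_grad, THEN linear_0]

text \<open>The positive and negative parts of v are densities of two finite measures that agree on
  boxes. Boxes are stable under intersection and generate the Borel sets, so the measures and hence
  the densities coincide.\<close>

lemma integral_zero_on_boxes_imp_zero:
  fixes v :: "'a::euclidean_space \<Rightarrow> real"
  assumes v: "integrable lborel v" and z: "\<And>a b. integral\<^sup>L lborel (\<lambda>x. indicator (box a b) x * v x) = 0"
  shows "AE x in lborel. v x = 0"
proof -
  have [measurable]: "v \<in> borel_measurable borel" using v by auto
  define p where "p x = ennreal (max 0 (v x))" for x
  define n where "n x = ennreal (max 0 (- v x))" for x
  have [measurable]: "p \<in> borel_measurable borel" "n \<in> borel_measurable borel"
    unfolding p_def n_def by measurable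
  have ip: "integrable lborel (\<lambda>x. max 0 (v x))" and im: "integrable lborel (\<lambda>x. max 0 (- v x))"
    using v by auto
  have fin: "integral\<^sup>N lborel p \<noteq> \<infinity>" "integral\<^sup>N lborel n \<noteq> \<infinity>"
    using ip im unfolding p_def n_def by (auto simp: nn_integral_eq_integral)
  have box: "emeasure (density lborel p) (box a b) = emeasure (density lborel n) (box a b)" for a b
  proof -
    have i1: "integrable lborel (\<lambda>x. indicator (box a b) x * max 0 (v x))"
      "integrable lborel (\<lambda>x. indicator (box a b) x * max 0 (- v x))"
      using integrable_real_mult_indicator[OF _ ip, of "box a b"] integrable_real_mult_indicator[OF _ im, of "box a b"]
      by (auto simp: mult.commute)
    have "integral\<^sup>L lborel (\<lambda>x. indicator (box a b) x * max 0 (v x)) - integral\<^sup>L lborel (\<lambda>x. indicator (box a b) x * max 0 (- v x))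
      = integral\<^sup>L lborel (\<lambda>x. indicator (box a b) x * v x)"
    proof -
      have "(\<lambda>x. indicator (box a b) x * v x) = (\<lambda>x. indicator (box a b) x * max 0 (v x) - indicator (box a b) x * max 0 (- v x))"
        by (rule ext) (simp add: max_def)
      then show ?thesis by (simp only: Bochner_Integration.integral_diff[OF i1])
    qed
    then have eq: "integral\<^sup>L lborel (\<lambda>x. indicator (box a b) x * max 0 (v x)) = integral\<^sup>L lborel (\<lambda>x. indicator (box a b) x * max 0 (- v x))"
      using z[of a b] by simp
    have "emeasure (density lborel p) (box a b) = (\<integral>\<^sup>+x. ennreal (indicator (box a b) x * max 0 (v x)) \<partial>lborel)"
      by (subst emeasure_density) (auto intro!: nn_integral_cong simp: p_def indicator_def)
    also have "\<dots> = (\<integral>\<^sup>+x. ennreal (indicator (box a b) x * max 0 (- v x)) \<partial>lborel)"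
      using i1 eq by (simp add: nn_integral_eq_integral)
    also have "\<dots> = emeasure (density lborel n) (box a b)"
      by (subst emeasure_density) (auto intro!: nn_integral_cong simp: n_def indicator_def)
    finally show ?thesis .
  qed
  let ?E = "range (\<lambda>(a, b). box a b::'a set)"
  have "density lborel p = density lborel n"
  proof (rule measure_eqI_generator_eq)
    show "Int_stable ?E" by (auto simp: Int_stable_def box_Int_box)
    show "?E \<subseteq> Pow UNIV" "sets (density lborel p) = sigma_sets UNIV ?E" "sets (density lborel n) = sigma_sets UNIV ?E"
      by (simp_all add: borel_eq_box)
    let ?A = "\<lambda>n::nat. box (- (real n *\<^sub>R One)) (real n *\<^sub>R One) :: 'a set"
    show "range ?A \<subseteq> ?E" "(\<Union>i. ?A i) = UNIV" unfolding UN_box_eq_UNIV by auto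
    show "emeasure (density lborel p) (?A i) \<noteq> \<infinity>" for i
    proof -
      have "emeasure (density lborel p) (?A i) \<le> emeasure (density lborel p) (space (density lborel p))"
        by (rule emeasure_space)
      also have "\<dots> = integral\<^sup>N lborel p" by (simp add: emeasure_density)
      finally show ?thesis using fin by (auto simp: top_unique)
    qed
    show "emeasure (density lborel p) X = emeasure (density lborel n) X" if "X \<in> ?E" for X
      using that box by auto
  qed
  then have "AE x in lborel. p x = n x"
    using finite_density_unique[of p lborel n] fin by simp
  then show ?thesis
    by eventually_elim (auto simp: p_def n_def max_def split: if_splits)
qed

text \<open>Bumps increase to indicators of boxes, so w has integral zero over every box whose
  closed box lies in \<Omega>. As w is integrable only locally, the conclusion is drawn on one
  closed box at a time, and countably many of them exhaust \<Omega>.\<close>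

lemma bump_orthogonal_imp_zero:
  fixes w :: "'a::euclidean_space \<Rightarrow> real"
  assumes w: "L2 w" and \<Omega>: "open \<Omega>"
    and orth: "\<And>a b n. cbox a b \<subseteq> \<Omega> \<Longrightarrow> n > 0 \<Longrightarrow> integral\<^sup>L lebesgue (\<lambda>x. bump a b n x * w x) = 0"
  shows "AE x in lebesgue. x \<in> \<Omega> \<longrightarrow> w x = 0"
proof -
  have [measurable]: "w \<in> borel_measurable lebesgue" using w by (simp add: L2_def)
  \<comment> \<open>A Borel representative, so that the argument can be carried out for
    \<open>lborel\<close>.\<close>
  obtain h where h: "h \<in> borel_measurable lborel" "AE x in lborel. w x = h x"
    using completion_ex_borel_measurable_real[of w lborel] by auto
  have [measurable]: "h \<in> borel_measurable borel" using h(1) by simp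
  have wh: "AE x in lebesgue. w x = h x" using h(2) by (rule AE_completion)
  have hL: "L2 h" by (rule L2_cong_AE[OF w _ wh]) (rule measurable_completion[OF h(1)])
  have bound_int: "integrable lborel (\<lambda>x. indicator (cbox a b) x * h x)" for a b :: 'a
  proof -
    have i1: "integrable lborel (\<lambda>x. (h x)\<^sup>2)"
    proof -
      have "(\<lambda>x. (h x)\<^sup>2) \<in> borel_measurable lborel" by measurable
      moreover have "integrable lebesgue (\<lambda>x. (h x)\<^sup>2)"
        using L2_integrable[OF hL] unfolding real_norm_def power2_abs .
      ultimately show ?thesis using integrable_completion by blast
    qed
    have i2: "integrable lborel (indicator (cbox a b) :: 'a \<Rightarrow> real)"
      by (rule integrable_real_indicator) (simp, rule emeasure_bounded_finite[OF bounded_cbox, unfolded infinity_ennreal_def[symmetric]])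
    show ?thesis
    proof (rule integrable_pointwise_bound[OF Bochner_Integration.integrable_add[OF i2 i1]])
      fix x
      have "2 * \<bar>h x\<bar> \<le> 1 + (h x)\<^sup>2" using sum_squares_bound[of 1 "\<bar>h x\<bar>"] unfolding power2_abs by (simp only: power_one mult_1_right)
      then have "\<bar>h x\<bar> \<le> 1 + (h x)\<^sup>2" using abs_ge_zero[of "h x"] by linarith
      then show "norm (indicator (cbox a b) x * h x) \<le> norm (indicator (cbox a b) x + (h x)\<^sup>2)"
        by (cases "x \<in> cbox a b") simp_all
    qed measurable
  qed
  have box0: "integral\<^sup>L lborel (\<lambda>x. indicator (box a b) x * h x) = 0" if ab: "cbox a b \<subseteq> \<Omega>" for a b
  proof -
    have bump_meas [measurable]: "bump a b n \<in> borel_measurable borel" for n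
      by (rule borel_measurable_continuous_onI[OF smooth_fun_continuous[OF smooth_fun_bump]])
    have "(\<lambda>n. integral\<^sup>L lborel (\<lambda>x. bump a b (real (Suc n)) x * h x)) \<longlonglongrightarrow> integral\<^sup>L lborel (\<lambda>x. indicator (box a b) x * h x)"
    proof (rule integral_dominated_convergence[where w="\<lambda>x. \<bar>indicator (cbox a b) x * h x\<bar>"])
      show "integrable lborel (\<lambda>x. \<bar>indicator (cbox a b) x * h x\<bar>)" by (rule integrable_abs[OF bound_int])
      show "AE x in lborel. (\<lambda>n. bump a b (real (Suc n)) x * h x) \<longlonglongrightarrow> indicator (box a b) x * h x"
      proof (rule AE_I2)
        fix x
        have "(\<lambda>n. bump a b (real (Suc n)) x) \<longlonglongrightarrow> indicator (box a b) x"
          using bump_tendsto[of x a b] by (cases "x \<in> box a b") (auto simp: bump_outside)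
        then show "(\<lambda>n. bump a b (real (Suc n)) x * h x) \<longlonglongrightarrow> indicator (box a b) x * h x"
          by (intro tendsto_intros)
      qed
      show "AE x in lborel. norm (bump a b (real (Suc n)) x * h x) \<le> \<bar>indicator (cbox a b) x * h x\<bar>" for n
      proof (rule AE_I2)
        fix x
        show "norm (bump a b (real (Suc n)) x * h x) \<le> \<bar>indicator (cbox a b) x * h x\<bar>"
        proof (cases "x \<in> box a b")
          case True
          then have "x \<in> cbox a b" using box_subset_cbox by blast
          then show ?thesis using bump_nonneg[of a b "real (Suc n)" x] bump_le_1[of a b "real (Suc n)" x]
            by (simp add: abs_mult mult_left_le_one_le)
        qed (simp add: bump_outside)
      qed
    qed measurable
    moreover have "integral\<^sup>L lborel (\<lambda>x. bump a b (real (Suc n)) x * h x) = 0" for n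
    proof -
      have "integral\<^sup>L lborel (\<lambda>x. bump a b (real (Suc n)) x * h x) = integral\<^sup>L lebesgue (\<lambda>x. bump a b (real (Suc n)) x * h x)"
        by (rule integral_completion[symmetric]) simp
      also have "\<dots> = integral\<^sup>L lebesgue (\<lambda>x. bump a b (real (Suc n)) x * w x)"
      proof (rule integral_cong_AE)
        show "AE x in lebesgue. bump a b (real (Suc n)) x * h x = bump a b (real (Suc n)) x * w x"
          using wh by eventually_elim simp
        have "bump a b (real (Suc n)) \<in> borel_measurable lebesgue" "h \<in> borel_measurable lebesgue"
          by (auto intro!: measurable_completion)
        then show "(\<lambda>x. bump a b (real (Suc n)) x * h x) \<in> borel_measurable lebesgue"
          "(\<lambda>x. bump a b (real (Suc n)) x * w x) \<in> borel_measurable lebesgue" by auto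
      qed
      also have "\<dots> = 0" by (rule orth[OF ab]) simp
      finally show ?thesis .
    qed
    ultimately have "(\<lambda>n::nat. 0::real) \<longlonglongrightarrow> integral\<^sup>L lborel (\<lambda>x. indicator (box a b) x * h x)"
      by simp
    then show ?thesis using LIMSEQ_unique[OF _ tendsto_const] by metis
  qed
  have cb: "AE x in lborel. x \<in> cbox c d \<longrightarrow> h x = 0" if cd: "cbox c d \<subseteq> \<Omega>" for c d
  proof -
    define v where "v x = indicator (box c d) x * h x" for x
    have "integrable lborel (\<lambda>x. (indicator (cbox c d) x * h x) * indicator (box c d) x)"
      by (rule integrable_real_mult_indicator[OF _ bound_int]) simp
    moreover have "(\<lambda>x. (indicator (cbox c d) x * h x) * indicator (box c d) x) = v"
    proof (rule ext)
      fix x show "(indicator (cbox c d) x * h x) * indicator (box c d) x = v x"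
        using box_subset_cbox[of c d] by (cases "x \<in> box c d") (auto simp: v_def)
    qed
    ultimately have vint: "integrable lborel v" by simp
    have "AE x in lborel. v x = 0"
    proof (rule integral_zero_on_boxes_imp_zero[OF vint])
      fix a b :: 'a
      obtain e g where eg: "box a b \<inter> box c d = box e g" using box_Int_box by blast
      have "(\<lambda>x. indicator (box a b) x * v x) = (\<lambda>x. indicator (box e g) x * h x)"
        by (rule ext) (simp only: eg[symmetric] v_def indicator_inter_arith mult.assoc)
      moreover have "integral\<^sup>L lborel (\<lambda>x. indicator (box e g) x * h x) = 0"
      \<comment> \<open>When \<open>box e g\<close> is empty, \<open>cbox e g\<close> may be a
        nonempty degenerate box that leaves \<Omega>; the integral is then trivially zero.\<close>
      proof (cases "box e g = {}")
        case False
        then have "cbox e g = closure (box e g)" by simp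
        also have "\<dots> \<subseteq> closure (cbox c d)" using eg box_subset_cbox[of c d] by (intro closure_mono) blast
        finally show ?thesis using cd by (intro box0) auto
      qed simp
      ultimately show "integral\<^sup>L lborel (\<lambda>x. indicator (box a b) x * v x) = 0" by simp
    qed
    moreover have "AE x in lborel. x \<notin> cbox c d - box c d"
    proof (rule AE_not_in)
      have "emeasure lborel (cbox c d - box c d) = emeasure lborel (cbox c d) - emeasure lborel (box c d)"
        by (rule emeasure_Diff) (auto simp: box_subset_cbox emeasure_lborel_box_eq)
      then show "cbox c d - box c d \<in> null_sets lborel"
        by (auto simp: null_sets_def emeasure_lborel_cbox_eq emeasure_lborel_box_eq)
    qed
    ultimately show ?thesis by eventually_elim (auto simp: v_def)
  qed
  obtain D where D: "countable D" "D \<subseteq> Pow \<Omega>" "\<And>X. X \<in> D \<Longrightarrow> \<exists>a b. X = cbox a b" "\<Union>D = \<Omega>"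
    using open_countable_Union_open_cbox[OF \<Omega>] by metis
  have "AE x in lborel. \<forall>X\<in>D. x \<in> X \<longrightarrow> h x = 0"
  proof (rule AE_ball_countable'[OF _ D(1)])
    fix X assume X: "X \<in> D"
    then obtain a b where "X = cbox a b" using D(3) by blast
    then show "AE x in lborel. x \<in> X \<longrightarrow> h x = 0" using cb[of a b] D(2) X by auto
  qed
  then have "AE x in lebesgue. \<forall>X\<in>D. x \<in> X \<longrightarrow> h x = 0" by (rule AE_completion)
  with wh show ?thesis
    by eventually_elim (use D(4) in auto)
qed

lemma subspace_closureI:
  fixes S :: "'h::real_normed_vector set"
  assumes S: "subspace S" shows "subspace (closure S)"
  unfolding subspace_def
proof (intro conjI ballI allI)
  show "0 \<in> closure S" using subspace_0[OF S] closure_subset by blast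
  fix x y c assume x: "x \<in> closure S"
  then obtain u where u: "\<And>n. u n \<in> S" "u \<longlonglongrightarrow> x" unfolding closure_sequential by blast
  show "c *\<^sub>R x \<in> closure S"
    unfolding closure_sequential
    by (rule exI[of _ "\<lambda>n. c *\<^sub>R u n"]) (use u S in \<open>auto intro: subspace_scale tendsto_intros\<close>)
  assume y: "y \<in> closure S"
  then obtain v where v: "\<And>n. v n \<in> S" "v \<longlonglongrightarrow> y" unfolding closure_sequential by blast
  show "x + y \<in> closure S"
    unfolding closure_sequential
    by (rule exI[of _ "\<lambda>n. u n + v n"]) (use u v S in \<open>auto intro: subspace_add tendsto_intros\<close>)
qed

lemma Cc_inf_lincomb:
  assumes "\<phi> \<in> Cc_inf U" "\<psi> \<in> Cc_inf U" shows "(\<lambda>x. a * \<phi> x + b * \<psi> x) \<in> Cc_inf U"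
proof -
  let ?S = "\<lambda>f::'a \<Rightarrow> real. closure {x. f x \<noteq> 0}"
  have "?S (\<lambda>x. a * \<phi> x + b * \<psi> x) \<subseteq> closure ({x. \<phi> x \<noteq> 0} \<union> {x. \<psi> x \<noteq> 0})"
    by (rule closure_mono) auto
  then have sub: "?S (\<lambda>x. a * \<phi> x + b * \<psi> x) \<subseteq> ?S \<phi> \<union> ?S \<psi>" by simp
  moreover have "compact (?S \<phi> \<union> ?S \<psi>)" using assms by (auto simp: Cc_inf_def)
  ultimately have "compact (?S (\<lambda>x. a * \<phi> x + b * \<psi> x))"
    by (meson closed_closure bounded_subset compact_eq_bounded_closed)
  then show ?thesis using sub assms smooth_fun_lincomb by (auto simp: Cc_inf_def)
qed

lemma Cc_inf_zero: "(\<lambda>x. 0) \<in> Cc_inf U"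
  by (auto simp: Cc_inf_def intro: smooth_alg_smooth_fun smooth_alg.const)

lemma Cc_inf_outside:
  assumes "\<phi> \<in> Cc_inf U" "x \<notin> U" shows "\<phi> x = 0"
  using assms closure_subset[of "{x. \<phi> x \<noteq> 0}"] by (auto simp: Cc_inf_def)

section \<open>Restriction of fields to a set\<close>

definition restr :: "'a::euclidean_space set \<Rightarrow> ('a, 'b::euclidean_space) l2 \<Rightarrow> ('a, 'b) l2" where
  "restr U W = mk (\<lambda>x. indicator U x *\<^sub>R fn W x)"

lemma L2_indicator:
  fixes f :: "'a::euclidean_space \<Rightarrow> 'b::euclidean_space"
  assumes "U \<in> sets lebesgue" "L2 f" shows "L2 (\<lambda>x. indicator U x *\<^sub>R f x)"
proof (rule L2_bound[OF assms(2), of _ 1])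
  show "(\<lambda>x. indicator U x *\<^sub>R f x) \<in> borel_measurable lebesgue"
    by (rule borel_measurable_scaleR[OF borel_measurable_indicator[OF assms(1)] L2_measurable[OF assms(2)]])
qed (auto simp: indicator_def)

lemma restr_mk:
  assumes "U \<in> sets lebesgue" "L2 f" shows "restr U (mk f) = mk (\<lambda>x. indicator U x *\<^sub>R f x)"
  unfolding restr_def
proof (rule mk_AE_cong)
  show "AE x in lebesgue. indicator U x *\<^sub>R fn (mk f) x = indicator U x *\<^sub>R f x"
    using fn_mk[OF assms(2)] by eventually_elim simp
qed (simp_all add: assms L2_indicator)

lemma bounded_linear_restr:
  assumes U: "U \<in> sets lebesgue" shows "bounded_linear (restr U)"
proof (rule bounded_linear_l2I[where K=1])
  fix f g :: "'a \<Rightarrow> 'b" and c :: real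
  assume f: "L2 f"
  show "restr U (mk (\<lambda>x. c *\<^sub>R f x)) = c *\<^sub>R restr U (mk f)"
    using f by (simp add: restr_mk U L2_scaleR mk_scaleR[symmetric] L2_indicator del: scaleR_scaleR)
      (simp add: mult.commute)
  have "L2norm (\<lambda>x. indicator U x *\<^sub>R f x) \<le> 1 * L2norm f"
    by (rule L2norm_mono_AE[OF L2_indicator[OF U f] f]) (auto simp: indicator_def)
  then show "norm (restr U (mk f)) \<le> L2norm f * 1"
    using f by (simp add: restr_mk U norm_mk L2_indicator)
  assume g: "L2 g"
  show "restr U (mk (\<lambda>x. f x + g x)) = restr U (mk f) + restr U (mk g)"
    using f g by (simp add: restr_mk U L2_add mk_add[symmetric] L2_indicator scaleR_add_right)
qed

section \<open>The closed space of graphs\<close>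

definition graph :: "real \<Rightarrow> ('a::euclidean_space \<Rightarrow> real) \<Rightarrow> ('a, real \<times> 'a) l2" where
  "graph s \<phi> = mk (\<lambda>x. (\<phi> x, frac_grad s \<phi> x))"

text \<open>The space H^s_0(U), and H^s for the whole space, as a closed subspace of pairs. The
  gradient is continuous on it by construction; that it is determined by the function is
  \<open>graph_space_val_inj\<close>.\<close>

definition graph_space :: "real \<Rightarrow> 'a::euclidean_space set \<Rightarrow> ('a, real \<times> 'a) l2 set" where
  "graph_space s U = closure (graph s ` Cc_inf U)"

definition test_field :: "('a::euclidean_space \<Rightarrow> real) \<Rightarrow> 'a \<Rightarrow> ('a, 'a) l2" where
  "test_field \<psi> b = mk (\<lambda>x. \<psi> x *\<^sub>R b)"

definition emb :: "real \<Rightarrow> ('a::euclidean_space \<Rightarrow> real) \<Rightarrow> ('a, real \<times> 'a) l2" where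
  "emb s u = mk (\<lambda>x. (u x, Grad_s s u x))"

text \<open>Chooses a function for a graph. On graph spaces \<open>emb s (rep X)\<close> is X,
  whereas \<open>rep (emb s u)\<close> agrees with u only almost everywhere.\<close>

definition rep :: "('a::euclidean_space, real \<times> 'a) l2 \<Rightarrow> 'a \<Rightarrow> real" where
  "rep X = (\<lambda>x. fst (fn X x))"

lemma graph_space_mono: "U \<subseteq> U' \<Longrightarrow> graph_space s U \<subseteq> graph_space s U'"
  unfolding graph_space_def by (intro closure_mono image_mono) (auto simp: Cc_inf_def)

lemma closed_graph_space: "closed (graph_space s U)"
  by (simp add: graph_space_def)

lemma L2_completion_integral:
  fixes f :: "'a::euclidean_space \<Rightarrow> 'b::{banach, second_countable_topology}"
  shows "f \<in> borel_measurable borel \<Longrightarrow> integral\<^sup>L lebesgue f = integral\<^sup>L lborel f"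
  by (rule integral_completion) simp

context
  fixes s :: real
  assumes s: "0 < s" "s < 1"
begin

lemma mu_s_pos: "mu_s s DIM('a::euclidean_space) > 0"
  unfolding mu_s_def using s
  by (intro divide_pos_pos mult_pos_pos Gamma_real_pos) auto

lemma Cc_inf_L2: "\<phi> \<in> Cc_inf U \<Longrightarrow> L2 \<phi>" "\<phi> \<in> Cc_inf U \<Longrightarrow> L2 (frac_grad s \<phi>)"
  using frac_grad_L2[OF s Cc_inf_lipc] by blast+

lemma val_graph: "\<phi> \<in> Cc_inf U \<Longrightarrow> val (graph s \<phi>) = mk \<phi>"
  and grad_graph: "\<phi> \<in> Cc_inf U \<Longrightarrow> grad (graph s \<phi>) = mk (frac_grad s \<phi>)"
  by (simp_all add: graph_def val_mk grad_mk Cc_inf_L2)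

lemma graph_lincomb:
  assumes "\<phi> \<in> Cc_inf U" "\<psi> \<in> Cc_inf U"
  shows "graph s (\<lambda>x. a * \<phi> x + b * \<psi> x) = a *\<^sub>R graph s \<phi> + b *\<^sub>R graph s \<psi>"
proof -
  note l = Cc_inf_lipc[OF assms(1)] Cc_inf_lipc[OF assms(2)]
  note p = L2_Pair[OF Cc_inf_L2[OF assms(1)]] and q = L2_Pair[OF Cc_inf_L2[OF assms(2)]]
  have "frac_grad s (\<lambda>x. a * \<phi> x + b * \<psi> x) x = a *\<^sub>R frac_grad s \<phi> x + b *\<^sub>R frac_grad s \<psi> x" for x
    by (simp add: frac_grad_eq_frac_int l lipc_lincomb frac_int_lincomb[OF s] scaleR_add_right mult.commute)
  then have "graph s (\<lambda>x. a * \<phi> x + b * \<psi> x)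
    = mk (\<lambda>x. a *\<^sub>R (\<phi> x, frac_grad s \<phi> x) + b *\<^sub>R (\<psi> x, frac_grad s \<psi> x))"
    by (simp add: graph_def)
  also have "\<dots> = a *\<^sub>R graph s \<phi> + b *\<^sub>R graph s \<psi>"
    unfolding graph_def
    by (simp only: mk_add[OF L2_scaleR[OF p] L2_scaleR[OF q]] mk_scaleR[OF p] mk_scaleR[OF q])
  finally show ?thesis .
qed

lemma subspace_graph_space: "subspace (graph_space s U)"
  unfolding graph_space_def
proof (rule subspace_closureI)
  have z: "graph s (\<lambda>x. 0) = 0"
    using graph_lincomb[OF Cc_inf_zero Cc_inf_zero, of 0 0] by simp
  show "subspace (graph s ` Cc_inf U)"
    unfolding subspace_def
  proof (intro conjI ballI allI)
    show "0 \<in> graph s ` Cc_inf U" using z Cc_inf_zero by (metis imageI)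
    fix X Y c assume "X \<in> graph s ` Cc_inf U"
    then obtain \<phi> where \<phi>: "\<phi> \<in> Cc_inf U" "X = graph s \<phi>" by auto
    show "c *\<^sub>R X \<in> graph s ` Cc_inf U"
      using graph_lincomb[OF \<phi>(1) \<phi>(1), of c 0] Cc_inf_lincomb[OF \<phi>(1) \<phi>(1), of c 0] \<phi>(2)
      by (auto intro!: image_eqI)
    assume "Y \<in> graph s ` Cc_inf U"
    then obtain \<psi> where \<psi>: "\<psi> \<in> Cc_inf U" "Y = graph s \<psi>" by auto
    show "X + Y \<in> graph s ` Cc_inf U"
      using graph_lincomb[OF \<phi>(1) \<psi>(1), of 1 1] Cc_inf_lincomb[OF \<phi>(1) \<psi>(1), of 1 1] \<phi>(2) \<psi>(2)
      by (auto intro!: image_eqI)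
  qed
qed

text \<open>The bridge from the sequence-based definitions: convergence of both components in L^2
  norm is convergence in the product space, and membership in a closure is sequential.\<close>

lemma Hs_approx_iff:
  "Hs_approx s U u g \<longleftrightarrow> L2 u \<and> L2 g \<and> mk (\<lambda>x. (u x, g x)) \<in> graph_space s U"
proof (cases "L2 u \<and> L2 g")
  case True
  then have u: "L2 u" and g: "L2 g" by auto
  define X where "X = mk (\<lambda>x. (u x, g x))"
  have d: "L2norm (\<lambda>x. \<phi> x - u x) = norm (val (graph s \<phi> - X))"
    "L2norm (\<lambda>x. frac_grad s \<phi> x - g x) = norm (grad (graph s \<phi> - X))" if "\<phi> \<in> Cc_inf U" for \<phi>
  proof -
    note L = Cc_inf_L2[OF that]
    have "val (graph s \<phi> - X) = mk \<phi> - mk u" "grad (graph s \<phi> - X) = mk (frac_grad s \<phi>) - mk g"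
      by (simp_all only: val_simps(2) grad_simps(2) val_graph[OF that] grad_graph[OF that] X_def val_mk[OF u g] grad_mk[OF u g])
    then show "L2norm (\<lambda>x. \<phi> x - u x) = norm (val (graph s \<phi> - X))"
      "L2norm (\<lambda>x. frac_grad s \<phi> x - g x) = norm (grad (graph s \<phi> - X))"
      unfolding norm_mk[OF L2_diff[OF L(1) u], symmetric] norm_mk[OF L2_diff[OF L(2) g], symmetric]
        mk_diff[OF L(1) u] mk_diff[OF L(2) g] by simp_all
  qed
  have lim: "(\<lambda>k. norm (val (graph s (\<phi> k) - X))) \<longlonglongrightarrow> 0 \<and> (\<lambda>k. norm (grad (graph s (\<phi> k) - X))) \<longlonglongrightarrow> 0
     \<longleftrightarrow> (\<lambda>k. graph s (\<phi> k)) \<longlonglongrightarrow> X" for \<phi>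
  proof
    assume "(\<lambda>k. norm (val (graph s (\<phi> k) - X))) \<longlonglongrightarrow> 0 \<and> (\<lambda>k. norm (grad (graph s (\<phi> k) - X))) \<longlonglongrightarrow> 0"
    then have A: "(\<lambda>k. norm (val (graph s (\<phi> k) - X))) \<longlonglongrightarrow> 0" and B: "(\<lambda>k. norm (grad (graph s (\<phi> k) - X))) \<longlonglongrightarrow> 0"
      by blast+
    have "(\<lambda>k. sqrt ((norm (val (graph s (\<phi> k) - X)))\<^sup>2 + (norm (grad (graph s (\<phi> k) - X)))\<^sup>2)) \<longlonglongrightarrow> sqrt (0\<^sup>2 + 0\<^sup>2)"
      by (rule tendsto_real_sqrt[OF tendsto_add[OF tendsto_power[OF A] tendsto_power[OF B]]])
    then have "(\<lambda>k. norm (graph s (\<phi> k) - X)) \<longlonglongrightarrow> sqrt (0\<^sup>2 + 0\<^sup>2)"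
      unfolding graph_norm[symmetric] real_sqrt_abs abs_norm_cancel .
    also have "sqrt (0\<^sup>2 + 0\<^sup>2) = (0::real)" by simp
    finally have "(\<lambda>k. norm (graph s (\<phi> k) - X)) \<longlonglongrightarrow> 0" .
    then show "(\<lambda>k. graph s (\<phi> k)) \<longlonglongrightarrow> X" by (rule LIM_zero_cancel[OF tendsto_norm_zero_cancel])
  next
    assume "(\<lambda>k. graph s (\<phi> k)) \<longlonglongrightarrow> X"
    then have n: "(\<lambda>k. norm (graph s (\<phi> k) - X)) \<longlonglongrightarrow> 0" by (rule tendsto_norm_zero[OF LIM_zero])
    show "(\<lambda>k. norm (val (graph s (\<phi> k) - X))) \<longlonglongrightarrow> 0 \<and> (\<lambda>k. norm (grad (graph s (\<phi> k) - X))) \<longlonglongrightarrow> 0"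
      by (intro conjI; rule Lim_null_comparison[OF _ n];
          rule always_eventually; simp only: real_norm_def abs_norm_cancel norm_val_le norm_grad_le simp_thms)
  qed
  have "Hs_approx s U u g \<longleftrightarrow> (\<exists>\<phi>. (\<forall>k. \<phi> k \<in> Cc_inf U) \<and> (\<lambda>k. graph s (\<phi> k)) \<longlonglongrightarrow> X)"
  proof -
    have "(\<forall>k. \<phi> k \<in> Cc_inf U \<and> L2 (\<phi> k) \<and> L2 (frac_grad s (\<phi> k))) \<and>
          (\<lambda>k. L2norm (\<lambda>x. \<phi> k x - u x)) \<longlonglongrightarrow> 0 \<and> (\<lambda>k. L2norm (\<lambda>x. frac_grad s (\<phi> k) x - g x)) \<longlonglongrightarrow> 0
      \<longleftrightarrow> (\<forall>k. \<phi> k \<in> Cc_inf U) \<and> (\<lambda>k. graph s (\<phi> k)) \<longlonglongrightarrow> X" for \<phi>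
    proof (cases "\<forall>k. \<phi> k \<in> Cc_inf U")
      case True
      then have e: "(\<lambda>k. L2norm (\<lambda>x. \<phi> k x - u x)) = (\<lambda>k. norm (val (graph s (\<phi> k) - X)))"
        "(\<lambda>k. L2norm (\<lambda>x. frac_grad s (\<phi> k) x - g x)) = (\<lambda>k. norm (grad (graph s (\<phi> k) - X)))"
        by (simp_all only: d)
      have "\<forall>k. L2 (\<phi> k) \<and> L2 (frac_grad s (\<phi> k))" using True Cc_inf_L2 by blast
      then show ?thesis unfolding e lim using True by blast
    qed blast
    then show ?thesis unfolding Hs_approx_def by (simp only: u g simp_thms)
  qed
  also have "\<dots> \<longleftrightarrow> X \<in> graph_space s U"
    unfolding graph_space_def closure_sequential
  proof
    assume "\<exists>\<phi>. (\<forall>k. \<phi> k \<in> Cc_inf U) \<and> (\<lambda>k. graph s (\<phi> k)) \<longlonglongrightarrow> X"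
    then obtain \<phi> where "\<forall>k. \<phi> k \<in> Cc_inf U" "(\<lambda>k. graph s (\<phi> k)) \<longlonglongrightarrow> X" by (elim exE conjE)
    then show "\<exists>x. (\<forall>n. x n \<in> graph s ` Cc_inf U) \<and> x \<longlonglongrightarrow> X"
      by (intro exI[of _ "\<lambda>k. graph s (\<phi> k)"]) simp
  next
    assume "\<exists>x. (\<forall>n. x n \<in> graph s ` Cc_inf U) \<and> x \<longlonglongrightarrow> X"
    then obtain x where x0: "\<forall>n. x n \<in> graph s ` Cc_inf U" and x: "x \<longlonglongrightarrow> X" by (elim exE conjE)
    have "\<forall>n. \<exists>\<phi>. \<phi> \<in> Cc_inf U \<and> x n = graph s \<phi>" using x0 by (simp add: image_iff Bex_def)
    from choice[OF this] obtain \<phi> where \<phi>: "\<forall>n. \<phi> n \<in> Cc_inf U \<and> x n = graph s (\<phi> n)" ..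
    show "\<exists>\<phi>. (\<forall>k. \<phi> k \<in> Cc_inf U) \<and> (\<lambda>k. graph s (\<phi> k)) \<longlonglongrightarrow> X"
    proof -
      have "x = (\<lambda>k. graph s (\<phi> k))" by (rule ext) (simp only: \<phi>)
      then show ?thesis using x \<phi> by (intro exI[of _ \<phi>]) simp
    qed
  qed
  finally show ?thesis using u g by (simp add: X_def)
qed (auto simp: Hs_approx_def)

lemma L2_test_field:
  fixes b :: "'a::euclidean_space"
  assumes "lipc \<psi>" shows "L2 (\<lambda>x. \<psi> x *\<^sub>R b)"
  by (rule L2_bounded_linear[OF frac_grad_L2(2)[OF s assms] bounded_linear_scaleR_left])

lemma L2_frac_div:
  assumes "lipc \<psi>" shows "L2 (\<lambda>x. inner (frac_grad s \<psi> x) b)"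
  by (rule L2_bounded_linear[OF frac_grad_L2(1)[OF s assms] bounded_linear_inner_left])

text \<open>For test functions this is \<open>frac_int_by_parts\<close>, the inner product of the
  fractional gradient of \<psi> with b being the fractional divergence of the field \<psi> b. Both
  sides are continuous in X, so the identity passes to the closure.\<close>

lemma graph_space_by_parts:
  fixes \<psi> :: "'a::euclidean_space \<Rightarrow> real"
  assumes \<psi>: "lipc \<psi>" and X: "X \<in> graph_space s U"
  shows "inner (grad X) (test_field \<psi> b) = - inner (val X) (mk (\<lambda>x. inner (frac_grad s \<psi> x) b))"
proof -
  let ?P = "\<lambda>X. inner (grad X) (test_field \<psi> b) + inner (val X) (mk (\<lambda>x. inner (frac_grad s \<psi> x) b))"
  have "closed {X. ?P X = 0}"
    by (intro closed_Collect_eq continuous_intros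
        bounded_linear.continuous_on[OF bounded_linear_grad] bounded_linear.continuous_on[OF bounded_linear_val])
  moreover have "graph s ` Cc_inf U \<subseteq> {X. ?P X = 0}"
  proof clarify
    fix \<phi> :: "'a \<Rightarrow> real" assume \<phi>U: "\<phi> \<in> Cc_inf U"
    note \<phi> = Cc_inf_lipc[OF \<phi>U]
    note [measurable] = lipc_measurable[OF \<phi>] lipc_measurable[OF \<psi>] frac_int_measurable[OF s \<phi>] frac_int_measurable[OF s \<psi>]
    let ?m = "mu_s s DIM('a)"
    have int: "integrable lborel (\<lambda>x. f x *\<^sub>R frac_int s g x)" if f: "lipc f" and g: "lipc g" for f g :: "'a \<Rightarrow> real"
    proof -
      note [measurable] = lipc_measurable[OF f] frac_int_measurable[OF s g]
      obtain M where M: "\<And>x. \<bar>f x\<bar> \<le> M" using lipcE[OF f] by metis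
      have "integrable lborel (\<lambda>x. M *\<^sub>R frac_int s g x)"
        by (intro integrable_scaleR_right frac_int_integrable s g)
      then show ?thesis
      proof (rule integrable_pointwise_bound)
        show "norm (f x *\<^sub>R frac_int s g x) \<le> norm (M *\<^sub>R frac_int s g x)" for x
          using order_trans[OF M[of x] abs_ge_self[of M]] by (simp add: mult_right_mono)
      qed measurable
    qed
    have "inner (grad (graph s \<phi>)) (test_field \<psi> b) = integral\<^sup>L lebesgue (\<lambda>x. inner (frac_grad s \<phi> x) (\<psi> x *\<^sub>R b))"
      by (simp add: grad_graph[OF \<phi>U] test_field_def inner_mk Cc_inf_L2[OF \<phi>U] L2_test_field \<psi> del: inner_scaleR_right)
    also have "\<dots> = integral\<^sup>L lborel (\<lambda>x. ?m * inner (\<psi> x *\<^sub>R frac_int s \<phi> x) b)"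
      by (subst L2_completion_integral) (simp_all add: frac_grad_eq_frac_int[OF \<phi>] mult_ac)
    also have "\<dots> = ?m * inner (integral\<^sup>L lborel (\<lambda>x. \<psi> x *\<^sub>R frac_int s \<phi> x)) b"
      using int[OF \<psi> \<phi>] by (simp add: integral_inner_left del: inner_scaleR_left)
    also have "\<dots> = - (?m * inner (integral\<^sup>L lborel (\<lambda>x. \<phi> x *\<^sub>R frac_int s \<psi> x)) b)"
      by (simp add: frac_int_by_parts[OF s \<phi> \<psi>])
    also have "\<dots> = - integral\<^sup>L lborel (\<lambda>x. ?m * inner (\<phi> x *\<^sub>R frac_int s \<psi> x) b)"
      using int[OF \<phi> \<psi>] by (simp add: integral_inner_left del: inner_scaleR_left)
    also have "\<dots> = - integral\<^sup>L lebesgue (\<lambda>x. inner (\<phi> x) (inner (frac_grad s \<psi> x) b))"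
      by (subst L2_completion_integral) (simp_all add: frac_grad_eq_frac_int[OF \<psi>] mult_ac)
    also have "\<dots> = - inner (val (graph s \<phi>)) (mk (\<lambda>x. inner (frac_grad s \<psi> x) b))"
      by (simp add: val_graph[OF \<phi>U] inner_mk Cc_inf_L2[OF \<phi>U] L2_frac_div[OF \<psi>] del: inner_real_def)
    finally show "?P (graph s \<phi>) = 0" by simp
  qed
  ultimately have "graph_space s U \<subseteq> {X. ?P X = 0}"
    unfolding graph_space_def by (rule closure_minimal[rotated])
  with X show ?thesis by auto
qed

end

text \<open>The bumps supported in \<open>U\<close>, in all coordinate directions, span a dense subspace of the
  fields that vanish outside \<open>U\<close>.\<close>

lemma test_fields_orthogonal_imp_zero:
  fixes W :: "('a::euclidean_space, 'a) l2"
  assumes U: "open U"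
    and orth: "\<And>a b n i. cbox a b \<subseteq> U \<Longrightarrow> n > 0 \<Longrightarrow> i \<in> Basis \<Longrightarrow> inner W (mk (\<lambda>x. bump a b n x *\<^sub>R i)) = 0"
  shows "AE x in lebesgue. x \<in> U \<longrightarrow> fn W x = 0"
proof -
  have "AE x in lebesgue. x \<in> U \<longrightarrow> inner (fn W x) i = 0" if i: "i \<in> Basis" for i
  proof (rule bump_orthogonal_imp_zero[OF _ U])
    show "L2 (\<lambda>x. inner (fn W x) i)"
      by (rule L2_bounded_linear[OF L2_fn]) (rule bounded_linear_inner_left)
    fix a b :: 'a and n :: real assume ab: "cbox a b \<subseteq> U" "n > 0"
    \<comment> \<open>Square integrability of a bump involves no fractional order; the value 1/2 is
      an arbitrary admissible one.\<close>
    have "L2 (bump a b n)"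
      using bump_Cc_inf[OF ab(2), of a b UNIV] frac_grad_L2(2)[of "1/2", OF _ _ Cc_inf_lipc] by simp
    then have "L2 (\<lambda>x. bump a b n x *\<^sub>R i)"
      by (rule L2_bounded_linear) (auto intro: bounded_linear_scaleR_left)
    then have "inner W (mk (\<lambda>x. bump a b n x *\<^sub>R i)) = integral\<^sup>L lebesgue (\<lambda>x. bump a b n x * inner (fn W x) i)"
      using inner_mk[of "fn W" "\<lambda>x. bump a b n x *\<^sub>R i"] by simp
    then show "integral\<^sup>L lebesgue (\<lambda>x. bump a b n x * inner (fn W x) i) = 0"
      using orth[OF ab i] by simp
  qed
  then have "AE x in lebesgue. \<forall>i\<in>Basis. x \<in> U \<longrightarrow> inner (fn W x) i = 0"
    by (intro AE_finite_allI) auto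
  then show ?thesis by eventually_elim (auto intro: euclidean_eqI)
qed

lemma l2_zeroI: "AE x in lebesgue. fn W x = 0 \<Longrightarrow> W = 0"
  using mk_eq_iff[of "fn W" "\<lambda>x. 0"] by (simp add: mk_zero)

context
  fixes s :: real
  assumes s: "0 < s" "s < 1"
begin

text \<open>Closability of the fractional gradient: if the function part vanishes, integration by
  parts makes the gradient part orthogonal to every bump field.\<close>

lemma graph_space_val_zero:
  assumes X: "X \<in> graph_space s U" and "val X = 0" shows "X = 0"
proof -
  have "AE x in lebesgue. x \<in> UNIV \<longrightarrow> fn (grad X) x = 0"
  proof (rule test_fields_orthogonal_imp_zero)
    fix a b i :: 'a and n :: real assume "n > 0"
    then have "lipc (bump a b n)" by (intro Cc_inf_lipc[of _ UNIV] bump_Cc_inf) auto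
    then show "inner (grad X) (mk (\<lambda>x. bump a b n x *\<^sub>R i)) = 0"
      using graph_space_by_parts[OF s _ X, of "bump a b n" i] assms(2) by (simp add: test_field_def)
  qed simp
  then have "grad X = 0" by (intro l2_zeroI) simp
  then show ?thesis using assms(2) by (intro graph_eqI) (simp_all add: val_simps grad_simps)
qed

lemma graph_space_val_inj:
  assumes "X \<in> graph_space s U" "Y \<in> graph_space s U'" "val X = val Y" shows "X = Y"
proof -
  have "X \<in> graph_space s UNIV" "Y \<in> graph_space s UNIV"
    using assms(1,2) graph_space_mono[of _ UNIV s] by auto
  then have "X - Y \<in> graph_space s UNIV" by (rule subspace_diff[OF subspace_graph_space[OF s]])
  then show ?thesis using graph_space_val_zero[of "X - Y"] assms(3) by (simp add: val_simps)
qed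

text \<open>\<open>Grad_s\<close> is chosen with respect to approximation in the whole space.
  Injectivity of \<open>val\<close> identifies it with any gradient obtained by approximation inside
  U.\<close>

lemma Hs_emb:
  assumes "Hs_approx s U u g"
  shows "L2 u" "L2 (Grad_s s u)" "emb s u = mk (\<lambda>x. (u x, g x))" "emb s u \<in> graph_space s U"
proof -
  have 1: "L2 u" "L2 g" "mk (\<lambda>x. (u x, g x)) \<in> graph_space s U"
    using assms by (auto simp: Hs_approx_iff[OF s])
  then have "Hs_approx s UNIV u g" using graph_space_mono[of U UNIV s] by (auto simp: Hs_approx_iff[OF s])
  then have "Hs_approx s UNIV u (Grad_s s u)" unfolding Grad_s_def using someI[of "Hs_approx s UNIV u"] by blast
  then have 2: "L2 (Grad_s s u)" "emb s u \<in> graph_space s UNIV"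
    by (auto simp: Hs_approx_iff[OF s] emb_def)
  show "L2 u" "L2 (Grad_s s u)" by fact+
  show eq: "emb s u = mk (\<lambda>x. (u x, g x))"
    by (rule graph_space_val_inj[OF 2(2) 1(3)]) (simp add: emb_def val_mk 1 2)
  show "emb s u \<in> graph_space s U" using 1(3) eq by simp
qed

lemma H0s_emb:
  assumes "u \<in> H0s s U"
  shows "L2 u" "L2 (Grad_s s u)" "emb s u \<in> graph_space s U" "val (emb s u) = mk u" "grad (emb s u) = mk (Grad_s s u)"
proof -
  obtain g where g: "Hs_approx s U u g" using assms by (auto simp: H0s_def)
  show "L2 u" "L2 (Grad_s s u)" "emb s u \<in> graph_space s U" by (rule Hs_emb[OF g])+
  then show "val (emb s u) = mk u" "grad (emb s u) = mk (Grad_s s u)"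
    unfolding emb_def by (simp_all add: val_mk grad_mk)
qed

lemma graph_space_H0s:
  assumes "L2 u" "L2 g" "mk (\<lambda>x. (u x, g x)) \<in> graph_space s U"
  shows "u \<in> H0s s U" "emb s u = mk (\<lambda>x. (u x, g x))"
proof -
  have "Hs_approx s U u g" using assms by (simp add: Hs_approx_iff[OF s])
  then show "u \<in> H0s s U" "emb s u = mk (\<lambda>x. (u x, g x))" using Hs_emb(3) by (auto simp: H0s_def)
qed

lemma rep_H0s:
  assumes "X \<in> graph_space s U" shows "rep X \<in> H0s s U" "emb s (rep X) = X"
  using graph_space_H0s[of "rep X" "\<lambda>x. snd (fn X x)" U] assms
  by (simp_all add: rep_def L2_fst L2_snd)

lemma H0s_lincomb:
  assumes u: "u \<in> H0s s U" and v: "v \<in> H0s s U"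
  shows "(\<lambda>x. a * u x + b * v x) \<in> H0s s U" "emb s (\<lambda>x. a * u x + b * v x) = a *\<^sub>R emb s u + b *\<^sub>R emb s v"
proof -
  note U = H0s_emb[OF u] and V = H0s_emb[OF v]
  have m: "mk (\<lambda>x. (a * u x + b * v x, a *\<^sub>R Grad_s s u x + b *\<^sub>R Grad_s s v x)) = a *\<^sub>R emb s u + b *\<^sub>R emb s v"
  proof -
    have "a *\<^sub>R emb s u + b *\<^sub>R emb s v
      = mk (\<lambda>x. a *\<^sub>R (u x, Grad_s s u x) + b *\<^sub>R (v x, Grad_s s v x))"
      unfolding emb_def using U(1,2) V(1,2) by (simp add: mk_add mk_scaleR L2_scaleR L2_Pair del: scaleR_Pair)
    then show ?thesis by simp
  qed
  have "a *\<^sub>R emb s u + b *\<^sub>R emb s v \<in> graph_space s U"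
    using U(3) V(3) subspace_graph_space[OF s, of U] by (simp add: subspace_add subspace_scale)
  then have "mk (\<lambda>x. (a * u x + b * v x, a *\<^sub>R Grad_s s u x + b *\<^sub>R Grad_s s v x)) \<in> graph_space s U"
    using m by simp
  moreover have "L2 (\<lambda>x. a * u x + b * v x)"
    using L2_add[OF L2_scaleR[OF U(1), of a] L2_scaleR[OF V(1), of b]] by simp
  moreover have "L2 (\<lambda>x. a *\<^sub>R Grad_s s u x + b *\<^sub>R Grad_s s v x)"
    by (intro L2_add L2_scaleR U V)
  ultimately have *: "L2 (\<lambda>x. a * u x + b * v x)" "L2 (\<lambda>x. a *\<^sub>R Grad_s s u x + b *\<^sub>R Grad_s s v x)"
    "mk (\<lambda>x. (a * u x + b * v x, a *\<^sub>R Grad_s s u x + b *\<^sub>R Grad_s s v x)) \<in> graph_space s U"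
    by blast+
  show "(\<lambda>x. a * u x + b * v x) \<in> H0s s U" by (rule graph_space_H0s(1)[OF *])
  show "emb s (\<lambda>x. a * u x + b * v x) = a *\<^sub>R emb s u + b *\<^sub>R emb s v"
    using graph_space_H0s(2)[OF *] m by (rule trans)
qed

lemma Hs_norm_emb:
  assumes "u \<in> H0s s U" shows "Hs_norm s u = norm (emb s u)"
proof -
  note e = H0s_emb[OF assms]
  have "(norm (emb s u))\<^sup>2 = (L2norm u)\<^sup>2 + (L2norm (Grad_s s u))\<^sup>2"
    unfolding graph_norm e(4,5) norm_mk[OF e(1)] norm_mk[OF e(2)] ..
  then have "Hs_norm s u = sqrt ((norm (emb s u))\<^sup>2)" by (simp only: Hs_norm_def)
  then show ?thesis by simp
qed

lemma Cc_inf_H0s: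
  assumes "\<phi> \<in> Cc_inf U" shows "\<phi> \<in> H0s s U" "emb s \<phi> = graph s \<phi>"
proof -
  have "graph s \<phi> \<in> graph_space s U"
    unfolding graph_space_def by (rule subsetD[OF closure_subset imageI[OF assms]])
  then have g: "mk (\<lambda>x. (\<phi> x, frac_grad s \<phi> x)) \<in> graph_space s U" by (simp only: graph_def)
  show "\<phi> \<in> H0s s U" by (rule graph_space_H0s(1)[OF Cc_inf_L2[OF s assms] g])
  show "emb s \<phi> = graph s \<phi>" unfolding graph_def by (rule graph_space_H0s(2)[OF Cc_inf_L2[OF s assms] g])
qed

text \<open>Test functions of U vanish off U, and vanishing off U is a closed condition. Hence the
  norm over \<Omega> in the metric is the full L^2 norm.\<close>

lemma graph_space_val_outside:
  assumes X: "X \<in> graph_space s U" and U: "open U"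
  shows "restr U (val X) = val X"
proof -
  have U': "U \<in> sets lebesgue" using U by (simp add: borel_open)
  have "closed {X. restr U (val X) = val X}"
    by (intro closed_Collect_eq linear_continuous_on bounded_linear_val
        bounded_linear_compose[OF bounded_linear_restr[OF U'] bounded_linear_val])
  moreover have "graph s ` Cc_inf U \<subseteq> {X. restr U (val X) = val X}"
  proof clarify
    fix \<phi> :: "'a \<Rightarrow> real" assume \<phi>: "\<phi> \<in> Cc_inf U"
    have "(\<lambda>x. indicator U x *\<^sub>R \<phi> x) = \<phi>"
    proof (rule ext)
      fix x show "indicator U x *\<^sub>R \<phi> x = \<phi> x" using Cc_inf_outside[OF \<phi>, of x] by (cases "x \<in> U") auto
    qed
    then show "restr U (val (graph s \<phi>)) = val (graph s \<phi>)"
      by (simp add: val_graph[OF s \<phi>] restr_mk[OF U' Cc_inf_L2(1)[OF s \<phi>]])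
  qed
  ultimately have "graph_space s U \<subseteq> {X. restr U (val X) = val X}"
    unfolding graph_space_def by (rule closure_minimal[rotated])
  with X show ?thesis by blast
qed

end

section \<open>Poincare inequality and Rellich compactness\<close>

lemma lipc_heat_integrable:
  fixes \<phi> :: "'a::euclidean_space \<Rightarrow> real"
  assumes \<phi>: "lipc \<phi>" and T: "T > 0"
  shows "integrable lborel (\<lambda>y. \<phi> y * heat T (x - y))"
proof -
  note [measurable] = lipc_measurable[OF \<phi>]
  obtain M where M: "\<And>x. \<bar>\<phi> x\<bar> \<le> M" using lipcE[OF \<phi>] by metis
  have "integrable lborel (\<lambda>y. M * heat T (x + (- 1) *\<^sub>R y))"
    by (intro integrable_mult_right lborel_integrable_affine heat_integrable T) simp
  then show ?thesis
  proof (rule integrable_pointwise_bound)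
    show "norm (\<phi> y * heat T (x - y)) \<le> norm (M * heat T (x + (- 1) *\<^sub>R y))" for y
      using order_trans[OF M[of y] abs_ge_self[of M]] by (simp add: abs_mult heat_nonneg mult_right_mono)
  qed measurable
qed

lemma heat_form_eq:
  fixes \<phi> :: "'a::euclidean_space \<Rightarrow> real"
  assumes \<phi>: "lipc \<phi>" and T: "T > 0"
  shows "heat_form \<phi> T = integral\<^sup>L lborel (\<lambda>x. \<phi> x * integral\<^sup>L lborel (\<lambda>y. \<phi> y * heat T (x - y)))"
proof -
  note [measurable] = lipc_measurable[OF \<phi>]
  obtain M where M: "\<And>x. \<bar>\<phi> x\<bar> \<le> M" using lipcE[OF \<phi>] by metis
  have int: "integrable (lborel \<Otimes>\<^sub>M lborel) (\<lambda>(v, x). \<phi> x * (\<phi> (x - v) * heat T v))"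
  proof (rule integrable_pointwise_bound)
    show "integrable (lborel \<Otimes>\<^sub>M lborel) (\<lambda>p. M * (case p of (v, x) \<Rightarrow> \<phi> (x - v) * heat T v))"
      by (intro integrable_mult_right integrable_convolution lipc_integrable heat_integrable \<phi> T)
    show "norm (case p of (v, x) \<Rightarrow> \<phi> x * (\<phi> (x - v) * heat T v)) \<le> norm (M * (case p of (v, x) \<Rightarrow> \<phi> (x - v) * heat T v))" for p
    proof (cases p)
      case (Pair v x)
      show ?thesis using order_trans[OF M[of x] abs_ge_self[of M]] by (simp add: Pair abs_mult mult_right_mono)
    qed
  qed measurable
  have "heat_form \<phi> T = integral\<^sup>L lborel (\<lambda>v. integral\<^sup>L lborel (\<lambda>x. \<phi> x * (\<phi> (x - v) * heat T v)))"
    unfolding heat_form_def autocorr_def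
  proof (rule Bochner_Integration.integral_cong[OF refl])
    fix v
    have "integral\<^sup>L lborel (\<lambda>x. \<phi> x * (\<phi> (x - v) * heat T v)) = integral\<^sup>L lborel (\<lambda>x. (\<phi> x * \<phi> (x - v)) * heat T v)"
      by (simp only: mult.assoc)
    then show "integral\<^sup>L lborel (\<lambda>x. \<phi> x * \<phi> (x - v)) * heat T v = integral\<^sup>L lborel (\<lambda>x. \<phi> x * (\<phi> (x - v) * heat T v))"
      by (simp only: integral_mult_left_zero)
  qed
  also have "\<dots> = integral\<^sup>L lborel (\<lambda>x. integral\<^sup>L lborel (\<lambda>v. \<phi> x * (\<phi> (x - v) * heat T v)))"
    by (rule lborel_pair.Fubini_integral[OF int, symmetric])
  also have "\<dots> = integral\<^sup>L lborel (\<lambda>x. \<phi> x * integral\<^sup>L lborel (\<lambda>y. \<phi> y * heat T (x - y)))"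
  proof (rule Bochner_Integration.integral_cong[OF refl])
    fix x
    have "integral\<^sup>L lborel (\<lambda>v. \<phi> (x - v) * heat T v) = integral\<^sup>L lborel (\<lambda>y. (\<lambda>y. \<phi> y * heat T (x - y)) (x - y))"
      by simp
    also have "\<dots> = integral\<^sup>L lborel (\<lambda>y. \<phi> y * heat T (x - y))"
      by (rule lborel_integral_reflect) measurable
    finally show "integral\<^sup>L lborel (\<lambda>v. \<phi> x * (\<phi> (x - v) * heat T v)) = \<phi> x * integral\<^sup>L lborel (\<lambda>y. \<phi> y * heat T (x - y))"
      by simp
  qed
  finally show ?thesis .
qed

lemma heat_le: "T > 0 \<Longrightarrow> heat T (x::'a::euclidean_space) \<le> T powr (- (real DIM('a) / 2))"
  by (simp add: heat_def mult_left_le)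

lemma L2_lipc: "lipc \<phi> \<Longrightarrow> L2 \<phi>"
  by (rule frac_grad_L2(2)[of "1/2"]) auto

lemma L2_heat_translate:
  assumes T: "T > 0" shows "L2 (\<lambda>y. heat T (x - y::'a::euclidean_space))"
proof (rule integrable_bounded_imp_L2)
  have "integrable lborel (\<lambda>y. heat T (x + (- 1) *\<^sub>R y))"
    by (intro lborel_integrable_affine heat_integrable T) simp
  then show "integrable lborel (\<lambda>y. heat T (x - y))" by simp
  show "norm (heat T (x - y)) \<le> T powr (- (real DIM('a) / 2))" for y
    using heat_le[OF T, of "x - y"] by (simp add: heat_nonneg)
qed

lemma L2_indicator_set:
  assumes "U \<in> sets borel" "bounded U" shows "L2 (indicator U :: 'a::euclidean_space \<Rightarrow> real)"
proof (rule integrable_bounded_imp_L2)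
  show "integrable lborel (indicator U :: 'a \<Rightarrow> real)"
    using assms emeasure_bounded_finite[OF assms(2)] by (intro integrable_real_indicator) auto
qed (auto simp: indicator_def)

lemma L2norm_nonneg: "0 \<le> L2norm f"
  by (simp add: L2norm_def)

lemma lipc_abs:
  assumes "lipc \<phi>" shows "lipc (\<lambda>x. \<bar>\<phi> x\<bar>)"
proof -
  obtain L R where *: "\<And>x y. \<bar>\<phi> x - \<phi> y\<bar> \<le> L * norm (x - y)" "\<And>x. norm x > R \<Longrightarrow> \<phi> x = 0"
    using lipcE[OF assms] by metis
  have "\<bar>\<bar>\<phi> x\<bar> - \<bar>\<phi> y\<bar>\<bar> \<le> L * norm (x - y)" for x y
    using *(1)[of x y] abs_triangle_ineq3[of "\<phi> x" "\<phi> y"] by linarith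
  moreover have "\<forall>x. norm x > R \<longrightarrow> \<bar>\<phi> x\<bar> = 0" using *(2) by simp
  ultimately show ?thesis unfolding lipc_def by blast
qed

lemma L2norm_lborel:
  "f \<in> borel_measurable borel \<Longrightarrow> L2norm f = sqrt (integral\<^sup>L lborel (\<lambda>x. (norm (f x))\<^sup>2))"
  unfolding L2norm_def by (subst L2_completion_integral) auto

context
  fixes s :: real and \<Omega> :: "'a::euclidean_space set"
  assumes s: "0 < s" "s < 1" and \<Omega>: "open \<Omega>" "bounded \<Omega>"
begin

text \<open>Boundedness of \<Omega> enters the Poincare inequality here: Cauchy-Schwarz against the
  indicator, whose L^2 norm is finite.\<close>

lemma Cc_inf_L1_le:
  assumes \<phi>: "\<phi> \<in> Cc_inf \<Omega>"
  shows "integral\<^sup>L lborel (\<lambda>x. \<bar>\<phi> x\<bar>) \<le> L2norm (indicator \<Omega> :: 'a \<Rightarrow> real) * L2norm \<phi>"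
proof -
  note l = Cc_inf_lipc[OF \<phi>]
  note [measurable] = lipc_measurable[OF l]
  have L: "L2 (\<lambda>x. \<bar>\<phi> x\<bar>)" "L2 (indicator \<Omega> :: 'a \<Rightarrow> real)"
    using L2_lipc[OF lipc_abs[OF l]] L2_indicator_set[of \<Omega>] \<Omega> by auto
  have [measurable]: "\<Omega> \<in> sets borel" using \<Omega> by simp
  have "integral\<^sup>L lborel (\<lambda>x. \<bar>\<phi> x\<bar>) = integral\<^sup>L lebesgue (\<lambda>x. inner (indicator \<Omega> x) \<bar>\<phi> x\<bar>)"
    by (subst L2_completion_integral) (auto intro!: Bochner_Integration.integral_cong simp: indicator_def Cc_inf_outside[OF \<phi>])
  also have "\<dots> = inner (mk (indicator \<Omega>)) (mk (\<lambda>x. \<bar>\<phi> x\<bar>))" by (rule inner_mk[OF L(2,1), symmetric])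
  also have "\<dots> \<le> norm (mk (indicator \<Omega> :: 'a \<Rightarrow> real)) * norm (mk (\<lambda>x. \<bar>\<phi> x\<bar>))" by (rule norm_cauchy_schwarz)
  also have "\<dots> = L2norm (indicator \<Omega> :: 'a \<Rightarrow> real) * L2norm \<phi>"
    using L by (simp add: norm_mk) (simp add: L2norm_def)
  finally show ?thesis .
qed

text \<open>The constant of \<open>heat_form_bound\<close>, divided by \<open>mu_s\<close> to pass
  from \<open>frac_int\<close> to the normalised gradient.\<close>

definition smoothing_const :: real where
  "smoothing_const = subord_const s TYPE('a) * sqrt (real DIM('a) / 2) / (2 powr (s / 2) - 1) / mu_s s DIM('a)"

lemma smoothing_const_nonneg: "smoothing_const \<ge> 0"
proof -
  have "2 powr (s / 2) \<ge> (2::real) powr 0" using s by (intro powr_mono) auto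
  then show ?thesis
    unfolding smoothing_const_def using subord_const_pos[OF s(1), where 'a='a] mu_s_pos[OF s, where 'a='a] by simp
qed

lemma Cc_inf_smoothing:
  fixes U :: "'a set"
  assumes \<phi>: "\<phi> \<in> Cc_inf U" and T: "T > 0"
  shows "heat_mass TYPE('a) * (L2norm \<phi>)\<^sup>2 \<le> smoothing_const * T powr (s / 2) * (L2norm (frac_grad s \<phi>) * L2norm \<phi>) + heat_form \<phi> T"
proof -
  note l = Cc_inf_lipc[OF \<phi>]
  let ?m = "mu_s s DIM('a)"
  have m: "?m > 0" by (rule mu_s_pos[OF s])
  obtain B where B: "\<And>x. norm (frac_int s \<phi> x) \<le> B" using frac_int_bounded[OF s l] by metis
  have L2f: "L2 (frac_int s \<phi>)" by (rule integrable_bounded_imp_L2[OF frac_int_integrable[OF s l] B])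
  have "frac_grad s \<phi> = (\<lambda>x. ?m *\<^sub>R frac_int s \<phi> x)" by (rule ext) (rule frac_grad_eq_frac_int[OF l])
  then have "L2norm (frac_grad s \<phi>) = norm (?m *\<^sub>R mk (frac_int s \<phi>))"
    using L2f by (simp add: norm_mk[symmetric] mk_scaleR L2_scaleR)
  also have "\<dots> = ?m * L2norm (frac_int s \<phi>)" using m L2f by (simp add: norm_mk)
  finally have "L2norm (frac_int s \<phi>) = L2norm (frac_grad s \<phi>) / ?m" using m by simp
  then show ?thesis
    using heat_form_bound[OF s l T] by (simp add: smoothing_const_def mult_ac)
qed

text \<open>The Gaussian at time T is at most T^(-d/2), so the heat form is at most T^(-d/2) times
  the squared L^1 norm, hence at most T^(-d/2) |\<Omega>| times the squared L^2 norm. For large T it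
  is absorbed into the left side of the smoothing estimate.\<close>

lemma poincare_Cc_inf:
  obtains C where "C > 0" "\<And>\<phi>. \<phi> \<in> Cc_inf \<Omega> \<Longrightarrow> L2norm \<phi> \<le> C * L2norm (frac_grad s \<phi>)"
proof -
  let ?Z = "heat_mass TYPE('a)"
  \<comment> \<open>Positivity of the mass was proved in a context that carries a test function; the
    zero function is supplied.\<close>
  have "lipc (\<lambda>x::'a. 0)" by (auto simp: lipc_def intro!: exI[of _ 0])
  then have Z: "?Z > 0" by (rule heat_mass_pos)
  define W where "W = (L2norm (indicator \<Omega> :: 'a \<Rightarrow> real))\<^sup>2"
  have W: "W \<ge> 0" by (simp add: W_def)
  \<comment> \<open>Solves T^(-d/2) (W + 1) = Z / 2, so that the heat form takes at most half of the
    left side. Using W + 1 keeps T positive when \<Omega> is empty.\<close>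
  define T where "T = (2 * (W + 1) / ?Z) powr (2 / real DIM('a))"
  have T: "T > 0" unfolding T_def using W Z by (intro powr_gt_zero[THEN iffD2]) auto
  have "T powr (- (real DIM('a) / 2)) = (2 * (W + 1) / ?Z) powr (- 1)"
    unfolding T_def powr_powr by simp
  also have "\<dots> = ?Z / (2 * (W + 1))" using W Z by (simp add: powr_minus_divide)
  finally have P: "T powr (- (real DIM('a) / 2)) = ?Z / (2 * (W + 1))" .
  have "z / (2 * w) * w = z / 2" if "w > 0" for z w :: real using that by simp
  from this[of "W + 1" ?Z] have "T powr (- (real DIM('a) / 2)) * (W + 1) = ?Z / 2" unfolding P using W by linarith
  moreover have "T powr (- (real DIM('a) / 2)) * W \<le> T powr (- (real DIM('a) / 2)) * (W + 1)"
    by (rule mult_left_mono) auto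
  ultimately have Td: "T powr (- (real DIM('a) / 2)) * W \<le> ?Z / 2" by linarith
  define C where "C = 2 * smoothing_const * T powr (s / 2) / ?Z + 1"
  have "L2norm \<phi> \<le> C * L2norm (frac_grad s \<phi>)" if \<phi>: "\<phi> \<in> Cc_inf \<Omega>" for \<phi>
  proof -
    note l = Cc_inf_lipc[OF \<phi>]
    note [measurable] = lipc_measurable[OF l]
    define I where "I = integral\<^sup>L lborel (\<lambda>x. \<bar>\<phi> x\<bar>)"
    define P where "P = T powr (- (real DIM('a) / 2))"
    have I0: "I \<ge> 0" by (simp add: I_def)
    have P0: "P \<ge> 0" by (simp add: P_def)
    have iabs: "integrable lborel (\<lambda>x. \<bar>\<phi> x\<bar>)" using lipc_integrable[OF l] by simp
    have h: "\<bar>integral\<^sup>L lborel (\<lambda>y. \<phi> y * heat T (x - y))\<bar> \<le> P * I" for x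
    proof -
      have "\<bar>integral\<^sup>L lborel (\<lambda>y. \<phi> y * heat T (x - y))\<bar> \<le> integral\<^sup>L lborel (\<lambda>y. \<bar>\<phi> y * heat T (x - y)\<bar>)"
        by (rule integral_abs_bound)
      also have "\<dots> \<le> integral\<^sup>L lborel (\<lambda>y. P * \<bar>\<phi> y\<bar>)"
      proof (rule integral_mono)
        show "integrable lborel (\<lambda>y. \<bar>\<phi> y * heat T (x - y)\<bar>)" using lipc_heat_integrable[OF l T] by simp
        show "integrable lborel (\<lambda>y. P * \<bar>\<phi> y\<bar>)" using iabs by simp
        show "\<bar>\<phi> y * heat T (x - y)\<bar> \<le> P * \<bar>\<phi> y\<bar>" for y
          using mult_left_mono[OF heat_le[OF T, of "x - y"], of "\<bar>\<phi> y\<bar>"]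
          by (simp add: abs_mult heat_nonneg P_def mult.commute)
      qed
      finally show ?thesis by (simp add: I_def)
    qed
    have "heat_form \<phi> T \<le> integral\<^sup>L lborel (\<lambda>x. (P * I) * \<bar>\<phi> x\<bar>)"
      unfolding heat_form_eq[OF l T]
    proof (rule integral_mono')
      show "integrable lborel (\<lambda>x. (P * I) * \<bar>\<phi> x\<bar>)" using iabs by simp
      show "\<phi> x * integral\<^sup>L lborel (\<lambda>y. \<phi> y * heat T (x - y)) \<le> (P * I) * \<bar>\<phi> x\<bar>" for x
      proof -
        have "\<phi> x * integral\<^sup>L lborel (\<lambda>y. \<phi> y * heat T (x - y)) \<le> \<bar>\<phi> x\<bar> * \<bar>integral\<^sup>L lborel (\<lambda>y. \<phi> y * heat T (x - y))\<bar>"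
          by (metis abs_ge_self abs_mult)
        also have "\<dots> \<le> \<bar>\<phi> x\<bar> * (P * I)" by (intro mult_left_mono h) simp
        finally show ?thesis by (simp add: mult.commute)
      qed
      show "0 \<le> (P * I) * \<bar>\<phi> x\<bar>" for x using P0 I0 by simp
    qed
    also have "\<dots> = P * I\<^sup>2" by (simp add: I_def power2_eq_square)
    also have "\<dots> \<le> P * (L2norm (indicator \<Omega> :: 'a \<Rightarrow> real) * L2norm \<phi>)\<^sup>2"
      using Cc_inf_L1_le[OF \<phi>] I0 P0 by (intro mult_left_mono power_mono) (auto simp: I_def)
    also have "\<dots> = (P * W) * (L2norm \<phi>)\<^sup>2" by (simp add: W_def power_mult_distrib)
    also have "\<dots> \<le> ?Z / 2 * (L2norm \<phi>)\<^sup>2" using Td by (intro mult_right_mono) (auto simp: P_def)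
    finally have "?Z * (L2norm \<phi>)\<^sup>2 \<le> smoothing_const * T powr (s / 2) * (L2norm (frac_grad s \<phi>) * L2norm \<phi>) + ?Z / 2 * (L2norm \<phi>)\<^sup>2"
      using Cc_inf_smoothing[OF \<phi> T] by linarith
    then have "L2norm \<phi> * (?Z / 2 * L2norm \<phi>) \<le> L2norm \<phi> * (smoothing_const * T powr (s / 2) * L2norm (frac_grad s \<phi>))"
      by (simp add: power2_eq_square algebra_simps)
    moreover have n0: "L2norm \<phi> \<ge> 0" "L2norm (frac_grad s \<phi>) \<ge> 0" by (simp_all add: L2norm_def)
    ultimately have "?Z / 2 * L2norm \<phi> \<le> smoothing_const * T powr (s / 2) * L2norm (frac_grad s \<phi>) \<or> L2norm \<phi> = 0"
      by (metis mult_le_cancel_left_pos order_le_less)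
    then show ?thesis
    proof
      assume "?Z / 2 * L2norm \<phi> \<le> smoothing_const * T powr (s / 2) * L2norm (frac_grad s \<phi>)"
      then have "L2norm \<phi> \<le> 2 * smoothing_const * T powr (s / 2) / ?Z * L2norm (frac_grad s \<phi>)"
        using Z by (simp add: field_simps)
      then show ?thesis using n0 by (simp add: C_def distrib_right)
    qed (use n0 smoothing_const_nonneg Z in \<open>simp add: C_def\<close>)
  qed
  moreover have "C > 0" unfolding C_def using smoothing_const_nonneg Z by (simp add: add_nonneg_pos)
  ultimately show thesis by (rule that[rotated])
qed

lemma poincare:
  obtains C where "C > 0" "\<And>X. X \<in> graph_space s \<Omega> \<Longrightarrow> norm (val X) \<le> C * norm (grad X)"
proof -
  obtain C where C: "C > 0" "\<And>\<phi>. \<phi> \<in> Cc_inf \<Omega> \<Longrightarrow> L2norm \<phi> \<le> C * L2norm (frac_grad s \<phi>)"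
    using poincare_Cc_inf by metis
  have "closed {X. norm (val X) \<le> C * norm (grad X)}"
    by (intro closed_Collect_le continuous_intros
        bounded_linear.continuous_on[OF bounded_linear_grad] bounded_linear.continuous_on[OF bounded_linear_val])
  moreover have "graph s ` Cc_inf \<Omega> \<subseteq> {X. norm (val X) \<le> C * norm (grad X)}"
    using C(2) by (auto simp: val_graph[OF s] grad_graph[OF s] norm_mk Cc_inf_L2[OF s])
  ultimately have "graph_space s \<Omega> \<subseteq> {X. norm (val X) \<le> C * norm (grad X)}"
    unfolding graph_space_def by (rule closure_minimal[rotated])
  with that[OF C(1)] show thesis by blast
qed

text \<open>At each point the heat evolution of \<phi> n is a product with a fixed Gaussian, so weak
  convergence gives pointwise convergence to zero under the uniform bound H. Dominated convergence
  on the bounded set \<Omega> makes it strong in L^2(\<Omega>).\<close>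

lemma heat_form_weak_null:
  assumes \<phi>: "\<And>n. \<phi> n \<in> Cc_inf \<Omega>" and M: "\<And>n. L2norm (\<phi> n) \<le> M"
    and weak: "\<And>Y. (\<lambda>n. inner (mk (\<phi> n)) Y) \<longlonglongrightarrow> 0" and T: "T > 0"
  shows "(\<lambda>n. heat_form (\<phi> n) T) \<longlonglongrightarrow> 0"
proof -
  note l = Cc_inf_lipc[OF \<phi>]
  note [measurable] = lipc_measurable[OF l]
  have [measurable]: "\<Omega> \<in> sets borel" using \<Omega> by simp
  have M0: "M \<ge> 0" using M[of 0] L2norm_nonneg[of "\<phi> 0"] by linarith
  define h where "h n x = integral\<^sup>L lborel (\<lambda>y. \<phi> n y * heat T (x - y))" for n x
  have [measurable]: "h n \<in> borel_measurable borel" for n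
  proof -
    have "h n \<in> borel_measurable lborel"
      unfolding h_def by (rule lborel.borel_measurable_lebesgue_integral) measurable
    then show ?thesis by simp
  qed
  have h_inner: "h n x = inner (mk (\<phi> n)) (mk (\<lambda>y. heat T (x - y)))" for n x
    unfolding h_def by (simp add: inner_mk L2_lipc[OF l] L2_heat_translate[OF T] L2_completion_integral)
  define H where "H = M * L2norm (heat T :: 'a \<Rightarrow> real)"
  have Hn: "norm (mk (\<lambda>y. heat T (x - y))) = L2norm (heat T :: 'a \<Rightarrow> real)" for x :: 'a
  proof -
    have "integral\<^sup>L lborel (\<lambda>y. (\<lambda>y. (norm (heat T y))\<^sup>2) (x - y)) = integral\<^sup>L lborel (\<lambda>y::'a. (norm (heat T y))\<^sup>2)"
      by (rule lborel_integral_reflect) measurable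
    then show ?thesis by (simp add: norm_mk L2_heat_translate[OF T] L2norm_lborel)
  qed
  have hH: "\<bar>h n x\<bar> \<le> H" for n x
  proof -
    have "\<bar>h n x\<bar> \<le> norm (mk (\<phi> n)) * norm (mk (\<lambda>y. heat T (x - y)))"
      unfolding h_inner by (rule Cauchy_Schwarz_ineq2)
    also have "\<dots> \<le> H" unfolding Hn H_def using M[of n]
      by (intro mult_right_mono) (auto simp: norm_mk L2_lipc[OF l] L2norm_def)
    finally show ?thesis .
  qed
  define g where "g n x = indicator \<Omega> x * h n x" for n x
  have [measurable]: "g n \<in> borel_measurable borel" for n unfolding g_def by measurable
  have gL2: "L2 (g n)" for n
  proof (rule L2_bound[OF L2_indicator_set[of \<Omega>], of _ H])
    show "g n \<in> borel_measurable lebesgue" by (intro measurable_completion) simp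
    show "AE x in lebesgue. norm (g n x) \<le> H * norm (indicator \<Omega> x :: real)"
      using hH by (auto simp: g_def indicator_def)
  qed (use \<Omega> in auto)
  have "(\<lambda>n. integral\<^sup>L lborel (\<lambda>x. (norm (g n x))\<^sup>2)) \<longlonglongrightarrow> integral\<^sup>L lborel (\<lambda>x::'a. 0)"
  proof (rule integral_dominated_convergence[where w="\<lambda>x. H\<^sup>2 * indicator \<Omega> x"])
    show "integrable lborel (\<lambda>x. H\<^sup>2 * indicator \<Omega> x)"
      using \<Omega> emeasure_bounded_finite[OF \<Omega>(2)] by (intro integrable_mult_right integrable_real_indicator) auto
    show "AE x in lborel. (\<lambda>n. (norm (g n x))\<^sup>2) \<longlonglongrightarrow> 0"
    proof (rule AE_I2)
      fix x :: 'a
      have "(\<lambda>n. h n x) \<longlonglongrightarrow> 0" unfolding h_inner by (rule weak)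
      then have "(\<lambda>n. (norm (indicator \<Omega> x * h n x))\<^sup>2) \<longlonglongrightarrow> (norm (indicator \<Omega> x * 0 :: real))\<^sup>2"
        by (intro tendsto_intros)
      then show "(\<lambda>n. (norm (g n x))\<^sup>2) \<longlonglongrightarrow> 0" by (simp add: g_def)
    qed
    show "AE x in lborel. norm ((norm (g n x))\<^sup>2) \<le> H\<^sup>2 * indicator \<Omega> x" for n
    proof (rule AE_I2)
      fix x show "norm ((norm (g n x))\<^sup>2) \<le> H\<^sup>2 * indicator \<Omega> x"
        using power_mono[OF hH[of n x], of 2] by (auto simp: g_def indicator_def)
    qed
  qed measurable
  then have "(\<lambda>n. sqrt (integral\<^sup>L lborel (\<lambda>x. (norm (g n x))\<^sup>2))) \<longlonglongrightarrow> sqrt 0"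
    by (intro tendsto_intros) simp
  then have g0: "(\<lambda>n. L2norm (g n)) \<longlonglongrightarrow> 0" by (simp add: L2norm_lborel)
  have "\<bar>heat_form (\<phi> n) T\<bar> \<le> M * L2norm (g n)" for n
  proof -
    have "heat_form (\<phi> n) T = integral\<^sup>L lborel (\<lambda>x. \<phi> n x * g n x)"
      unfolding heat_form_eq[OF l T] h_def[symmetric]
    proof (rule Bochner_Integration.integral_cong)
      fix x show "\<phi> n x * h n x = \<phi> n x * g n x"
        using Cc_inf_outside[OF \<phi>, of x n] by (cases "x \<in> \<Omega>") (simp_all add: g_def)
    qed simp
    also have "\<dots> = inner (mk (\<phi> n)) (mk (g n))"
      by (simp add: inner_mk L2_lipc[OF l] gL2 L2_completion_integral)
    finally have "\<bar>heat_form (\<phi> n) T\<bar> \<le> norm (mk (\<phi> n)) * norm (mk (g n))"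
      by (simp only: Cauchy_Schwarz_ineq2)
    also have "\<dots> \<le> M * L2norm (g n)"
      using M[of n] by (intro mult_mono) (auto simp: norm_mk L2_lipc[OF l] gL2 M0 L2norm_nonneg)
    finally show ?thesis .
  qed
  moreover have "(\<lambda>n. M * L2norm (g n)) \<longlonglongrightarrow> 0"
    using tendsto_mult_right_zero[OF g0, of M] .
  ultimately show ?thesis
    using Lim_null_comparison[OF always_eventually, of "\<lambda>n. heat_form (\<phi> n) T" "\<lambda>n. M * L2norm (g n)"]
    unfolding real_norm_def by blast
qed

text \<open>A small time T makes the smoothing error small uniformly in n; for this fixed T the heat
  form tends to zero.\<close>

lemma rellich_Cc_inf:
  assumes \<phi>: "\<And>n. \<phi> n \<in> Cc_inf \<Omega>" and M: "\<And>n. norm (graph s (\<phi> n)) \<le> M"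
    and weak: "\<And>Y. (\<lambda>n. inner (graph s (\<phi> n)) Y) \<longlonglongrightarrow> 0"
  shows "(\<lambda>n. L2norm (\<phi> n)) \<longlonglongrightarrow> 0"
proof -
  let ?Z = "heat_mass TYPE('a)"
  have "lipc (\<lambda>x::'a. 0)" by (auto simp: lipc_def intro!: exI[of _ 0])
  then have Z: "?Z > 0" by (rule heat_mass_pos)
  have M0: "M \<ge> 0" using M[of 0] norm_ge_zero[of "graph s (\<phi> 0)"] by linarith
  have M1: "L2norm (\<phi> n) \<le> M" "L2norm (frac_grad s (\<phi> n)) \<le> M" for n
    using M[of n] norm_val_le[of "graph s (\<phi> n)"] norm_grad_le[of "graph s (\<phi> n)"]
    by (simp_all add: val_graph[OF s \<phi>] grad_graph[OF s \<phi>] norm_mk Cc_inf_L2[OF s \<phi>])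
  have weak': "(\<lambda>n. inner (mk (\<phi> n)) Y) \<longlonglongrightarrow> 0" for Y
  proof -
    \<comment> \<open>Pairing with (Y, 0) isolates the function component.\<close>
    define W where "W = mk (\<lambda>x. (fn Y x, 0::'a))"
    have "inner (graph s (\<phi> n)) W = inner (mk (\<phi> n)) Y" for n
      using val_mk[of "fn Y" "\<lambda>x. 0::'a"] grad_mk[of "fn Y" "\<lambda>x. 0::'a"]
      by (simp add: graph_inner W_def val_graph[OF s \<phi>] mk_zero)
    then show ?thesis using weak[of W] by simp
  qed
  have "\<exists>N. \<forall>n\<ge>N. L2norm (\<phi> n) < e" if e: "e > 0" for e
  proof -
    define A where "A = smoothing_const * M\<^sup>2"
    have A: "A \<ge> 0" using smoothing_const_nonneg by (simp add: A_def)
    define q where "q = ?Z * e\<^sup>2 / 2"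
    have q: "q > 0" using Z e by (simp add: q_def)
    \<comment> \<open>Solves (A + 1) T^(s/2) = q, so the smoothing error stays below q, which is
      half of the target Z e^2; using A + 1 avoids a division by zero.\<close>
    define T where "T = (q / (A + 1)) powr (2 / s)"
    have T: "T > 0" using q A by (simp add: T_def)
    have "T powr (s / 2) = q / (A + 1)" unfolding T_def powr_powr using s q A by simp
    then have "(A + 1) * T powr (s / 2) = q" using A by simp
    moreover have "T powr (s / 2) > 0" using T by simp
    ultimately have AT: "A * T powr (s / 2) < q" unfolding distrib_right by linarith
    have "(\<lambda>n. heat_form (\<phi> n) T) \<longlonglongrightarrow> 0" by (rule heat_form_weak_null[OF \<phi> M1(1) weak' T])
    then have "\<forall>\<^sub>F n in sequentially. heat_form (\<phi> n) T < q" using q by (rule order_tendstoD)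
    then obtain N where N: "\<And>n. n \<ge> N \<Longrightarrow> heat_form (\<phi> n) T < q" by (auto simp: eventually_sequentially)
    have "L2norm (\<phi> n) < e" if "n \<ge> N" for n
    proof -
      have "smoothing_const * T powr (s / 2) * (L2norm (frac_grad s (\<phi> n)) * L2norm (\<phi> n)) \<le> smoothing_const * T powr (s / 2) * (M * M)"
        using M1[of n] M0 smoothing_const_nonneg by (intro mult_left_mono mult_mono) (auto simp: L2norm_def)
      also have "\<dots> = A * T powr (s / 2)" by (simp add: A_def power2_eq_square)
      finally have "?Z * (L2norm (\<phi> n))\<^sup>2 < q + q"
        using Cc_inf_smoothing[OF \<phi>[of n] T] AT N[OF that] by linarith
      then have "?Z * (L2norm (\<phi> n))\<^sup>2 < ?Z * e\<^sup>2" by (simp add: q_def)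
      then have "(L2norm (\<phi> n))\<^sup>2 < e\<^sup>2" using Z by simp
      then show ?thesis using e by (auto intro: power2_less_imp_less)
    qed
    then show ?thesis by blast
  qed
  then show ?thesis by (intro LIMSEQ_I) (auto simp: L2norm_def)
qed

text \<open>Each X n is replaced by the graph of a test function within 1/(n+1), which changes
  neither weak nullity nor the strong limit. As the weak limit is prescribed, the whole sequence
  converges and no subsequence is extracted.\<close>

lemma rellich:
  assumes X: "\<And>n. X n \<in> graph_space s \<Omega>" and M: "\<And>n. norm (X n) \<le> M"
    and weak: "\<And>Y. (\<lambda>n. inner (X n) Y) \<longlonglongrightarrow> 0"
  shows "(\<lambda>n. norm (val (X n))) \<longlonglongrightarrow> 0"
proof -
  have "\<exists>\<phi>. \<phi> \<in> Cc_inf \<Omega> \<and> norm (graph s \<phi> - X n) < inverse (real (Suc n))" for n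
    proof -
    have "\<forall>e>0. \<exists>Y\<in>graph s ` Cc_inf \<Omega>. norm (Y - X n) < e"
      using X[of n] unfolding graph_space_def closure_approachable dist_norm .
    moreover have "inverse (real (Suc n)) > 0" by simp
    ultimately show ?thesis by blast
  qed
  then obtain \<phi> where \<phi>: "\<And>n. \<phi> n \<in> Cc_inf \<Omega>" "\<And>n. norm (graph s (\<phi> n) - X n) < inverse (real (Suc n))" by metis
  have d: "(\<lambda>n. norm (graph s (\<phi> n) - X n)) \<longlonglongrightarrow> 0"
  proof (rule tendsto_sandwich[OF _ _ tendsto_const LIMSEQ_inverse_real_of_nat])
    show "\<forall>\<^sub>F n in sequentially. norm (graph s (\<phi> n) - X n) \<le> inverse (real (Suc n))"
      by (rule always_eventually) (use less_imp_le[OF \<phi>(2)] in blast)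
  qed simp
  have "(\<lambda>n. L2norm (\<phi> n)) \<longlonglongrightarrow> 0"
  proof (rule rellich_Cc_inf[OF \<phi>(1)])
    show "norm (graph s (\<phi> n)) \<le> M + 1" for n
    proof -
      have "inverse (real (Suc n)) \<le> 1" by (simp add: inverse_eq_divide)
      then show ?thesis using M[of n] \<phi>(2)[of n] norm_triangle_sub[of "graph s (\<phi> n)" "X n"] by linarith
    qed
    fix Y
    have "(\<lambda>n. inner (graph s (\<phi> n) - X n) Y) \<longlonglongrightarrow> 0"
      using tendsto_inner[OF tendsto_norm_zero_cancel[OF d] tendsto_const, of Y] by simp
    from tendsto_add[OF this weak[of Y]] show "(\<lambda>n. inner (graph s (\<phi> n)) Y) \<longlonglongrightarrow> 0"
      by (simp add: inner_diff_left)
  qed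
  then have "(\<lambda>n. L2norm (\<phi> n) + norm (graph s (\<phi> n) - X n)) \<longlonglongrightarrow> 0 + 0" by (intro tendsto_intros d)
  moreover have "norm (val (X n)) \<le> L2norm (\<phi> n) + norm (graph s (\<phi> n) - X n)" for n
  proof -
    have "val (X n) = mk (\<phi> n) - val (graph s (\<phi> n) - X n)"
      by (simp add: val_simps val_graph[OF s \<phi>(1)])
    then have "norm (val (X n)) \<le> norm (mk (\<phi> n)) + norm (val (graph s (\<phi> n) - X n))"
      by (simp only: norm_triangle_ineq4)
    then show ?thesis using norm_val_le[of "graph s (\<phi> n) - X n"] by (simp add: norm_mk Cc_inf_L2[OF s \<phi>(1)])
  qed
  ultimately show ?thesis
    using Lim_null_comparison[OF always_eventually, of "\<lambda>n. norm (val (X n))" "\<lambda>n. L2norm (\<phi> n) + norm (graph s (\<phi> n) - X n)"]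
    unfolding real_norm_def abs_norm_cancel add_0 by blast
qed

end

section \<open>Weak null sequences and multiplication by coefficients\<close>

lemma lipc_bump: "n > 0 \<Longrightarrow> lipc (bump a b n)"
  by (rule Cc_inf_lipc[OF bump_Cc_inf[OF _ subset_UNIV]])

lemma restr_inner:
  assumes U: "U \<in> sets lebesgue"
  shows "inner (restr U W) Z = inner W (restr U Z)"
proof -
  have "integral\<^sup>L lebesgue (\<lambda>x. inner (indicator U x *\<^sub>R fn W x) (fn Z x)) = integral\<^sup>L lebesgue (\<lambda>x. inner (fn W x) (indicator U x *\<^sub>R fn Z x))"
    by simp
  moreover have "inner (restr U W) Z = integral\<^sup>L lebesgue (\<lambda>x. inner (indicator U x *\<^sub>R fn W x) (fn Z x))"
    using inner_mk[OF L2_indicator[OF U L2_fn] L2_fn, of W Z] by (simp only: restr_def mk_fn)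
  moreover have "inner W (restr U Z) = integral\<^sup>L lebesgue (\<lambda>x. inner (fn W x) (indicator U x *\<^sub>R fn Z x))"
    using inner_mk[OF L2_fn L2_indicator[OF U L2_fn], of W Z] by (simp only: restr_def mk_fn)
  ultimately show ?thesis by simp
qed

lemma norm_restr_le:
  assumes U: "U \<in> sets lebesgue" shows "norm (restr U W) \<le> norm W"
proof -
  have "L2norm (\<lambda>x. indicator U x *\<^sub>R fn W x) \<le> 1 * L2norm (fn W)"
    by (rule L2norm_mono_AE[OF L2_indicator[OF U L2_fn] L2_fn]) (auto simp: indicator_def)
  then show ?thesis by (simp add: restr_def norm_mk[OF L2_indicator[OF U L2_fn]] norm_fn[of W])
qed

text \<open>The residual z of projecting \<open>restr U W\<close> onto S is orthogonal to all bump
  fields and hence vanishes on U. It is also orthogonal to its projection, so (z, z) = (z, restr U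
  W) = (restr U z, W) = 0.\<close>

lemma test_fields_dense:
  fixes S :: "('a::euclidean_space, 'a) l2 set"
  assumes U: "open U" and S: "subspace S" "closed S"
    and bumps: "\<And>a b n i. cbox a b \<subseteq> U \<Longrightarrow> n > 0 \<Longrightarrow> i \<in> Basis \<Longrightarrow> test_field (bump a b n) i \<in> S"
  shows "restr U W \<in> S"
proof -
  have U': "U \<in> sets lebesgue" using U by (simp add: borel_open)
  obtain p where p: "p \<in> S" "\<And>v. v \<in> S \<Longrightarrow> inner (restr U W - p) v = 0"
    using closed_subspace_projection[OF S, of "restr U W"] by metis
  define z where "z = restr U W - p"
  have "AE x in lebesgue. x \<in> U \<longrightarrow> fn z x = 0"
  proof (rule test_fields_orthogonal_imp_zero[OF U])
    fix a b i :: 'a and n :: real assume "cbox a b \<subseteq> U" "n > 0" "i \<in> Basis"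
    then have "inner z (test_field (bump a b n) i) = 0" unfolding z_def by (intro p(2) bumps)
    then show "inner z (mk (\<lambda>x. bump a b n x *\<^sub>R i)) = 0" by (simp add: test_field_def)
  qed
  then have "AE x in lebesgue. indicator U x *\<^sub>R fn z x = 0"
    by eventually_elim (simp add: indicator_def)
  then have "restr U z = 0"
    unfolding restr_def using mk_eq_iff[OF L2_indicator[OF U' L2_fn] L2_zero] mk_zero by metis
  have "inner z z = inner z (restr U W) - inner z p" by (simp add: z_def inner_diff_right)
  also have "inner z p = 0" unfolding z_def by (rule p(2)[OF p(1)])
  also have "inner z (restr U W) = inner (restr U z) W" by (rule restr_inner[OF U', symmetric])
  finally have "z = 0" using \<open>restr U z = 0\<close> by simp
  then show ?thesis using p(1) by (simp add: z_def)
qed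

text \<open>With \<open>test_fields_dense\<close> this reduces weak nullity of a bounded sequence to
  testing with bump fields; the uniform bound gives closedness by an epsilon/2 argument.\<close>

lemma weak_null_subspace:
  fixes G :: "nat \<Rightarrow> 'h::real_inner"
  assumes M: "\<And>m. norm (G m) \<le> M"
  shows "subspace {W. (\<lambda>m. inner (G m) W) \<longlonglongrightarrow> 0}" "closed {W. (\<lambda>m. inner (G m) W) \<longlonglongrightarrow> 0}"
proof -
  show "subspace {W. (\<lambda>m. inner (G m) W) \<longlonglongrightarrow> 0}"
    unfolding subspace_def
  proof (intro conjI ballI allI)
    fix x y c assume x: "x \<in> {W. (\<lambda>m. inner (G m) W) \<longlonglongrightarrow> 0}"
    then show "c *\<^sub>R x \<in> {W. (\<lambda>m. inner (G m) W) \<longlonglongrightarrow> 0}"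
      using tendsto_mult_right_zero[of "\<lambda>m. inner (G m) x" sequentially c] by simp
    assume y: "y \<in> {W. (\<lambda>m. inner (G m) W) \<longlonglongrightarrow> 0}"
    show "x + y \<in> {W. (\<lambda>m. inner (G m) W) \<longlonglongrightarrow> 0}"
      using tendsto_add[of "\<lambda>m. inner (G m) x" 0 sequentially "\<lambda>m. inner (G m) y" 0] x y
      by (simp add: inner_add_right)
  qed simp
  have M0: "M \<ge> 0" using M[of 0] norm_ge_zero[of "G 0"] by linarith
  show "closed {W. (\<lambda>m. inner (G m) W) \<longlonglongrightarrow> 0}"
    unfolding closed_sequential_limits
  proof (intro allI impI; elim conjE)
    fix x l assume x: "\<forall>n. x n \<in> {W. (\<lambda>m. inner (G m) W) \<longlonglongrightarrow> 0}" and l: "x \<longlonglongrightarrow> l"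
    have "\<exists>N. \<forall>m\<ge>N. norm (inner (G m) l - 0) < e" if e: "e > 0" for e
    proof -
      have "e / (2 * (M + 1)) > 0" using e M0 by simp
      then obtain k where k: "norm (x k - l) < e / (2 * (M + 1))"
        using LIMSEQ_D[OF l] by blast
      obtain N where N: "\<And>m. m \<ge> N \<Longrightarrow> norm (inner (G m) (x k) - 0) < e / 2"
        using LIMSEQ_D[of "\<lambda>m. inner (G m) (x k)" 0 "e/2"] x e by auto
      have "norm (inner (G m) l - 0) < e" if "m \<ge> N" for m
      proof -
        have "\<bar>inner (G m) (x k - l)\<bar> \<le> norm (G m) * norm (x k - l)" by (rule Cauchy_Schwarz_ineq2)
        also have "\<dots> \<le> (M + 1) * norm (x k - l)" using M[of m] by (intro mult_right_mono) auto
        also have "\<dots> < (M + 1) * (e / (2 * (M + 1)))" using k M0 by (intro mult_strict_left_mono) auto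
        also have "\<dots> = e / 2"
        proof -
          have "M + 1 \<noteq> 0" using M0 by linarith
          then have "(M + 1) * e / ((M + 1) * 2) = e / 2" by (rule mult_divide_mult_cancel_left)
          then show ?thesis by (simp only: times_divide_eq_right mult.commute[of 2])
        qed
        finally have "\<bar>inner (G m) (x k) - inner (G m) l\<bar> < e / 2" unfolding inner_diff_right .
        then show ?thesis using N[OF that] unfolding diff_0_right real_norm_def by linarith
      qed
      then show ?thesis by blast
    qed
    then have "(\<lambda>m. inner (G m) l) \<longlonglongrightarrow> 0" by (rule LIMSEQ_I)
    then show "l \<in> {W. (\<lambda>m. inner (G m) W) \<longlonglongrightarrow> 0}" by simp
  qed
qed

text \<open>The Riesz theorem supplies the adjoint of L applied to W.\<close>

lemma weak_null_bounded_linear: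
  fixes L :: "'h::{real_inner,complete_space} \<Rightarrow> 'k::{real_inner,complete_space}"
  assumes L: "bounded_linear L" and weak: "\<And>Y. (\<lambda>m. inner (G m) Y) \<longlonglongrightarrow> 0"
  shows "(\<lambda>m. inner (L (G m)) W) \<longlonglongrightarrow> 0"
proof -
  interpret bounded_linear L by (rule L)
  obtain K where K: "\<And>x. norm (L x) \<le> norm x * K" using bounded by blast
  obtain r where r: "\<And>v. inner (L v) W = inner r v"
  proof (rule riesz_representation[of UNIV "\<lambda>v. inner (L v) W" "K * norm W"])
    fix u
    have "\<bar>inner (L u) W\<bar> \<le> norm (L u) * norm W" by (rule Cauchy_Schwarz_ineq2)
    also have "\<dots> \<le> (norm u * K) * norm W" by (intro mult_right_mono K) simp
    finally show "\<bar>inner (L u) W\<bar> \<le> K * norm W * norm u" by (simp add: mult_ac)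
  qed (auto simp: add scaleR inner_add_left)
  then show ?thesis using weak[of r] by (simp add: inner_commute)
qed

section \<open>Multiplication by coefficients and by fixed vectors\<close>

definition mulop :: "('a::euclidean_space \<Rightarrow> ('a \<Rightarrow>\<^sub>L 'a)) \<Rightarrow> ('a, 'a) l2 \<Rightarrow> ('a, 'a) l2" where
  "mulop A G = mk (\<lambda>x. blinfun_apply (A x) (fn G x))"

context
  fixes \<alpha> \<beta> :: real and A :: "'a::euclidean_space \<Rightarrow> ('a \<Rightarrow>\<^sub>L 'a)"
  assumes \<alpha>\<beta>: "0 < \<alpha>" "\<alpha> \<le> \<beta>" and A: "A \<in> Mcoef \<alpha> \<beta> UNIV"
begin

text \<open>In the definition the exceptional null set depends on \<xi>. A countable dense set of
  directions and continuity in \<xi> give a common one. The bound by \<beta> follows from the second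
  inequality and Cauchy-Schwarz, and is therefore uniform over the class.\<close>

lemma Mcoef_AE:
  "AE x in lebesgue. \<forall>\<xi>. inner (blinfun_apply (A x) \<xi>) \<xi> \<ge> \<alpha> * (norm \<xi>)\<^sup>2 \<and> norm (blinfun_apply (A x) \<xi>) \<le> \<beta> * norm \<xi>"
proof -
  have \<beta>: "\<beta> > 0" using \<alpha>\<beta> by simp
  obtain D :: "'a set" where D: "countable D" "\<And>X. open X \<Longrightarrow> X \<noteq> {} \<Longrightarrow> \<exists>d\<in>D. d \<in> X"
    using countable_dense_exists by blast
  let ?P = "\<lambda>x \<xi>. \<alpha> * (norm \<xi>)\<^sup>2 \<le> inner (blinfun_apply (A x) \<xi>) \<xi> \<and> (1 / \<beta>) * (norm (blinfun_apply (A x) \<xi>))\<^sup>2 \<le> inner (blinfun_apply (A x) \<xi>) \<xi>"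
  have "AE x in lebesgue. \<forall>\<xi>\<in>D. ?P x \<xi>"
  proof (rule AE_ball_countable'[OF _ D(1)])
    fix \<xi> assume "\<xi> \<in> D"
    have "AE x in lebesgue. x \<in> UNIV \<longrightarrow> inner (blinfun_apply (A x) \<xi>) \<xi> \<ge> \<alpha> * (norm \<xi>)\<^sup>2 \<and>
          inner (blinfun_apply (A x) \<xi>) \<xi> \<ge> (1 / \<beta>) * (norm (blinfun_apply (A x) \<xi>))\<^sup>2"
      using A unfolding Mcoef_def by blast
    then show "AE x in lebesgue. ?P x \<xi>" by eventually_elim simp
  qed
  then show ?thesis
  proof eventually_elim
    case (elim x)
    have "continuous_on UNIV (blinfun_apply (A x))" by (rule linear_continuous_on[OF blinfun.bounded_linear_right])
    then have "closed {\<xi>. ?P x \<xi>}"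
      by (intro closed_Collect_conj closed_Collect_le continuous_on_mult continuous_on_const continuous_on_power
          continuous_on_norm continuous_on_inner continuous_on_id)
    then have op: "open (- {\<xi>. ?P x \<xi>})" by (rule open_Compl)
    have P: "?P x \<xi>" for \<xi>
    proof (rule ccontr)
      assume "\<not> ?P x \<xi>"
      then have "- {\<xi>. ?P x \<xi>} \<noteq> {}" by blast
      with D(2)[OF op] obtain d where "d \<in> D" "d \<in> - {\<xi>. ?P x \<xi>}" by blast
      then show False using elim by blast
    qed
    show ?case
    proof (intro allI conjI)
      fix \<xi>
      show "\<alpha> * (norm \<xi>)\<^sup>2 \<le> inner (blinfun_apply (A x) \<xi>) \<xi>" using P by blast
      let ?n = "norm (blinfun_apply (A x) \<xi>)"
      have "(1 / \<beta>) * ?n\<^sup>2 \<le> ?n * norm \<xi>"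
        using P[of \<xi>] norm_cauchy_schwarz[of "blinfun_apply (A x) \<xi>" \<xi>] by linarith
      then have "?n * ?n \<le> ?n * (\<beta> * norm \<xi>)" using \<beta> by (simp add: field_simps power2_eq_square)
      then show "?n \<le> \<beta> * norm \<xi>"
        using \<beta> by (cases "?n = 0") (auto simp: mult_le_cancel_left)
    qed
  qed
qed

lemma L2_mul:
  assumes g: "L2 g" shows "L2 (\<lambda>x. blinfun_apply (A x) (g x))"
proof (rule L2_bound[OF g, of _ \<beta>])
  have [measurable]: "g \<in> borel_measurable lebesgue" using g by (simp add: L2_def)
  have Am: "A \<in> borel_measurable lebesgue" using A by (simp add: Mcoef_def)
  \<comment> \<open>Measurability is obtained by expanding \<open>g x\<close> in the basis:
    evaluation at a fixed vector is continuous in the operator.\<close>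
  have "(\<lambda>x. blinfun_apply (A x) i) \<in> borel_measurable lebesgue" for i
  proof -
    have "(\<lambda>L. blinfun_apply L i) \<in> borel_measurable borel"
      by (intro borel_measurable_continuous_onI linear_continuous_on blinfun.bounded_linear_left)
    then show ?thesis by (rule measurable_compose[OF Am])
  qed
  then have "(\<lambda>x. \<Sum>i\<in>Basis. inner (g x) i *\<^sub>R blinfun_apply (A x) i) \<in> borel_measurable lebesgue"
    by (intro borel_measurable_sum borel_measurable_scaleR) auto
  moreover have "(\<Sum>i\<in>Basis. inner (g x) i *\<^sub>R blinfun_apply (A x) i) = blinfun_apply (A x) (g x)" for x
    by (simp only: blinfun.scaleR_right[symmetric] blinfun.sum_right[symmetric] euclidean_representation)
  ultimately show "(\<lambda>x. blinfun_apply (A x) (g x)) \<in> borel_measurable lebesgue" by simp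
  show "AE x in lebesgue. norm (blinfun_apply (A x) (g x)) \<le> \<beta> * norm (g x)"
    using Mcoef_AE by eventually_elim blast
qed

lemma mulop_mk:
  assumes g: "L2 g" shows "mulop A (mk g) = mk (\<lambda>x. blinfun_apply (A x) (g x))"
  unfolding mulop_def
proof (rule mk_AE_cong)
  show "AE x in lebesgue. blinfun_apply (A x) (fn (mk g) x) = blinfun_apply (A x) (g x)"
    using fn_mk[OF g] by eventually_elim simp
qed (simp_all add: g L2_mul)

lemma mulop_norm: "norm (mulop A G) \<le> \<beta> * norm G"
proof -
  have "L2norm (\<lambda>x. blinfun_apply (A x) (fn G x)) \<le> \<beta> * L2norm (fn G)"
  proof (rule L2norm_mono_AE[OF L2_mul[OF L2_fn] L2_fn])
    show "AE x in lebesgue. norm (blinfun_apply (A x) (fn G x)) \<le> \<beta> * norm (fn G x)"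
      using Mcoef_AE by eventually_elim blast
  qed (use \<alpha>\<beta> in linarith)
  then show ?thesis by (simp add: mulop_def norm_mk[OF L2_mul[OF L2_fn]] norm_fn[of G])
qed

lemma bounded_linear_mulop: "bounded_linear (mulop A)"
proof (rule bounded_linear_l2I[where K=\<beta>])
  fix f g :: "'a \<Rightarrow> 'a" and c :: real
  assume f: "L2 f"
  show "mulop A (mk (\<lambda>x. c *\<^sub>R f x)) = c *\<^sub>R mulop A (mk f)"
    by (simp only: mulop_mk[OF L2_scaleR[OF f]] mulop_mk[OF f] blinfun.scaleR_right mk_scaleR[OF L2_mul[OF f]])
  show "norm (mulop A (mk f)) \<le> L2norm f * \<beta>"
    using mulop_norm[of "mk f"] by (simp add: norm_mk[OF f] mult.commute)
  assume g: "L2 g"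
  show "mulop A (mk (\<lambda>x. f x + g x)) = mulop A (mk f) + mulop A (mk g)"
    by (simp only: mulop_mk[OF L2_add[OF f g]] mulop_mk[OF f] mulop_mk[OF g] blinfun.add_right
        mk_add[OF L2_mul[OF f] L2_mul[OF g]])
qed

lemma mulop_coercive: "\<alpha> * (norm G)\<^sup>2 \<le> inner (mulop A G) G"
proof -
  have "\<alpha> * (norm G)\<^sup>2 = integral\<^sup>L lebesgue (\<lambda>x. \<alpha> * (norm (fn G x))\<^sup>2)"
    by (simp add: norm_fn L2norm_def)
  also have "\<dots> \<le> integral\<^sup>L lebesgue (\<lambda>x. inner (blinfun_apply (A x) (fn G x)) (fn G x))"
  proof (rule integral_mono_AE)
    show "integrable lebesgue (\<lambda>x. \<alpha> * (norm (fn G x))\<^sup>2)"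
      by (intro integrable_mult_right L2_integrable L2_fn)
    show "integrable lebesgue (\<lambda>x. inner (blinfun_apply (A x) (fn G x)) (fn G x))"
      by (intro L2_inner_integrable L2_mul L2_fn)
    show "AE x in lebesgue. \<alpha> * (norm (fn G x))\<^sup>2 \<le> inner (blinfun_apply (A x) (fn G x)) (fn G x)"
      using Mcoef_AE by eventually_elim blast
  qed
  also have "\<dots> = inner (mulop A G) G"
    using inner_mk[OF L2_mul[OF L2_fn] L2_fn, of G G] by (simp only: mulop_def mk_fn)
  finally show ?thesis .
qed

end

definition scale_field :: "'a::euclidean_space \<Rightarrow> ('a, real) l2 \<Rightarrow> ('a, 'a) l2" where
  "scale_field b h = mk (\<lambda>x. fn h x *\<^sub>R b)"

lemma L2_scale_field: "L2 h \<Longrightarrow> L2 (\<lambda>x. h x *\<^sub>R (b::'a::euclidean_space))"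
  by (rule L2_bounded_linear[OF _ bounded_linear_scaleR_left])

lemma scale_field_mk:
  assumes h: "L2 h" shows "scale_field b (mk h) = mk (\<lambda>x. h x *\<^sub>R b)"
  unfolding scale_field_def
proof (rule mk_AE_cong)
  show "AE x in lebesgue. fn (mk h) x *\<^sub>R b = h x *\<^sub>R b"
    using fn_mk[OF h] by eventually_elim simp
qed (simp_all add: h L2_scale_field)

lemma norm_scale_field: 
  assumes b: "b \<in> Basis" shows "norm (scale_field b h) \<le> norm h"
proof -
  have "L2norm (\<lambda>x. fn h x *\<^sub>R b) \<le> 1 * L2norm (fn h)"
    by (rule L2norm_mono_AE[OF L2_scale_field[OF L2_fn] L2_fn]) (use b in auto)
  then show ?thesis by (simp add: scale_field_def norm_mk[OF L2_scale_field[OF L2_fn]] norm_fn[of h])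
qed

lemma bounded_linear_scale_field:
  assumes b: "b \<in> Basis" shows "bounded_linear (scale_field b)"
proof (rule bounded_linear_l2I[where K=1])
  fix f g :: "'a \<Rightarrow> real" and c :: real
  assume f: "L2 f"
  have "scale_field b (mk (\<lambda>x. c *\<^sub>R f x)) = mk (\<lambda>x. c *\<^sub>R (f x *\<^sub>R b))"
    using scale_field_mk[OF L2_scaleR[OF f]] by simp
  then show "scale_field b (mk (\<lambda>x. c *\<^sub>R f x)) = c *\<^sub>R scale_field b (mk f)"
    by (simp only: scale_field_mk[OF f] mk_scaleR[OF L2_scale_field[OF f]])
  show "norm (scale_field b (mk f)) \<le> L2norm f * 1"
    using norm_scale_field[OF b, of "mk f"] by (simp add: norm_mk[OF f])
  assume g: "L2 g"
  show "scale_field b (mk (\<lambda>x. f x + g x)) = scale_field b (mk f) + scale_field b (mk g)"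
    by (simp only: scale_field_mk[OF L2_add[OF f g]] scale_field_mk[OF f] scale_field_mk[OF g] scaleR_add_left
        mk_add[OF L2_scale_field[OF f] L2_scale_field[OF g]])
qed

section \<open>The weak problem\<close>

text \<open>The right-hand side is an element F of the product space acting by
  \<open>inner F\<close>; through \<open>riesz\<close> every functional in H^{-s} takes this
  form.\<close>

definition solop :: "real \<Rightarrow> 'a::euclidean_space set \<Rightarrow> ('a \<Rightarrow> ('a \<Rightarrow>\<^sub>L 'a)) \<Rightarrow> ('a, real \<times> 'a) l2 \<Rightarrow> ('a, real \<times> 'a) l2" where
  "solop s \<Omega> A F = (SOME X. X \<in> graph_space s \<Omega> \<and>
     (\<forall>Y\<in>graph_space s \<Omega>. inner (mulop A (grad X)) (grad Y) = inner F Y))"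

definition flux :: "real \<Rightarrow> 'a::euclidean_space set \<Rightarrow> ('a \<Rightarrow> ('a \<Rightarrow>\<^sub>L 'a)) \<Rightarrow> ('a, real \<times> 'a) l2 \<Rightarrow> ('a, 'a) l2" where
  "flux s \<Omega> A F = mulop A (grad (solop s \<Omega> A F))"

definition riesz :: "real \<Rightarrow> 'a::euclidean_space set \<Rightarrow> (('a \<Rightarrow> real) \<Rightarrow> real) \<Rightarrow> ('a, real \<times> 'a) l2" where
  "riesz s \<Omega> f = (SOME F. F \<in> graph_space s \<Omega> \<and> (\<forall>u\<in>H0s s \<Omega>. f u = inner F (emb s u)))"

text \<open>The Riesz representative in H^s_0 of integration over \<Omega> against the b-component
  of W. Its norm is therefore the H^{-s} norm of that component.\<close>

definition flux_rep :: "real \<Rightarrow> 'a::euclidean_space set \<Rightarrow> 'a \<Rightarrow> ('a, 'a) l2 \<Rightarrow> ('a, real \<times> 'a) l2" where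
  "flux_rep s \<Omega> b W = (SOME Y. Y \<in> graph_space s \<Omega> \<and>
     (\<forall>X\<in>graph_space s \<Omega>. inner Y X = inner (restr \<Omega> W) (scale_field b (val X))))"

definition flux_norm :: "real \<Rightarrow> 'a::euclidean_space set \<Rightarrow> ('a, 'a) l2 \<Rightarrow> real" where
  "flux_norm s \<Omega> W = L2_set (\<lambda>b. norm (flux_rep s \<Omega> b W)) Basis"

text \<open>One summand of \<open>d_s\<close> without its dyadic weight, in terms of the
  representative F of the right-hand side.\<close>

definition dist_term :: "real \<Rightarrow> 'a::euclidean_space set \<Rightarrow> ('a, real \<times> 'a) l2 \<Rightarrow> ('a \<Rightarrow> ('a \<Rightarrow>\<^sub>L 'a)) \<Rightarrow> ('a \<Rightarrow> ('a \<Rightarrow>\<^sub>L 'a)) \<Rightarrow> real" where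
  "dist_term s \<Omega> F A B = (norm (val (solop s \<Omega> A F - solop s \<Omega> B F))
     + flux_norm s \<Omega> (flux s \<Omega> A F - flux s \<Omega> B F)) / norm F"

lemma graph_space_eqI:
  assumes s: "0 < s" "s < 1" and X: "X \<in> graph_space s \<Omega>" "X' \<in> graph_space s \<Omega>"
    and eq: "\<And>Y. Y \<in> graph_space s \<Omega> \<Longrightarrow> inner X Y = inner X' Y"
  shows "X = X'"
proof -
  have "X - X' \<in> graph_space s \<Omega>" using subspace_graph_space[OF s] X by (rule subspace_diff)
  from eq[OF this] have "inner (X - X') (X - X') = 0" by (simp only: inner_diff_left diff_self)
  then show ?thesis by simp
qed

locale fractional_problem =
  fixes s \<alpha> \<beta> :: real and \<Omega> :: "'a::euclidean_space set"
  assumes s: "0 < s" "s < 1" and \<alpha>\<beta>: "0 < \<alpha>" "\<alpha> \<le> \<beta>" and \<Omega>: "open \<Omega>" "bounded \<Omega>"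
begin

abbreviation "V \<equiv> graph_space s \<Omega>"
abbreviation "M \<equiv> Mcoef \<alpha> \<beta> (UNIV :: 'a set)"

lemma subV: "subspace V" by (rule subspace_graph_space[OF s])
lemma closedV: "closed V" by (rule closed_graph_space)
lemma \<Omega>_lebesgue: "\<Omega> \<in> sets lebesgue" using \<Omega>(1) by (simp add: borel_open)

lemma energy_bilinear: "A \<in> M \<Longrightarrow> bounded_bilinear (\<lambda>X Y. inner (mulop A (grad X)) (grad Y))"
  by (rule bounded_bilinear.comp[OF bounded_bilinear_inner
        bounded_linear_compose[OF bounded_linear_mulop[OF \<alpha>\<beta>] bounded_linear_grad] bounded_linear_grad])

lemma mulop_diff: "A \<in> M \<Longrightarrow> mulop A (G - H) = mulop A G - mulop A H"
  by (rule linear_diff[OF bounded_linear.linear[OF bounded_linear_mulop[OF \<alpha>\<beta>]]])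

text \<open>The coefficient controls the gradient only; Poincare with constant C turns this into the
  full norm with constant \<alpha> / (C^2 + 1). It is the same for all coefficients, whence the
  uniform bounds that follow.\<close>

lemma energy_coercive:
  obtains c where "c > 0" "\<And>A X. A \<in> M \<Longrightarrow> X \<in> V \<Longrightarrow> c * (norm X)\<^sup>2 \<le> inner (mulop A (grad X)) (grad X)"
proof -
  obtain C where C: "C > 0" "\<And>X. X \<in> V \<Longrightarrow> norm (val X) \<le> C * norm (grad X)"
    using poincare[OF s \<Omega>] by metis
  show thesis
  proof (rule that[of "\<alpha> / (C\<^sup>2 + 1)"])
    show "\<alpha> / (C\<^sup>2 + 1) > 0" using \<alpha>\<beta> by (simp add: add_nonneg_pos)
    fix A X assume A: "A \<in> M" and X: "X \<in> V"
    have "(norm (val X))\<^sup>2 \<le> (C * norm (grad X))\<^sup>2" using C(2)[OF X] by (rule power_mono) simp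
    then have "(norm X)\<^sup>2 \<le> (C\<^sup>2 + 1) * (norm (grad X))\<^sup>2"
      unfolding graph_norm[of X] power_mult_distrib distrib_right by linarith
    then have "\<alpha> / (C\<^sup>2 + 1) * (norm X)\<^sup>2 \<le> \<alpha> / (C\<^sup>2 + 1) * ((C\<^sup>2 + 1) * (norm (grad X))\<^sup>2)"
      using \<alpha>\<beta> by (intro mult_left_mono) auto
    also have "\<dots> = \<alpha> * (norm (grad X))\<^sup>2"
    proof -
      have "C\<^sup>2 + 1 \<noteq> 0" using zero_le_power2[of C] by linarith
      then show ?thesis by simp
    qed
    also have "\<dots> \<le> inner (mulop A (grad X)) (grad X)" by (rule mulop_coercive[OF \<alpha>\<beta> A])
    finally show "\<alpha> / (C\<^sup>2 + 1) * (norm X)\<^sup>2 \<le> inner (mulop A (grad X)) (grad X)" .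
  qed
qed

lemma solop:
  assumes A: "A \<in> M"
  shows solop_in: "solop s \<Omega> A F \<in> V"
    and solop_eq: "Y \<in> V \<Longrightarrow> inner (flux s \<Omega> A F) (grad Y) = inner F Y"
proof -
  obtain c where c: "c > 0" "\<And>X. X \<in> V \<Longrightarrow> c * (norm X)\<^sup>2 \<le> inner (mulop A (grad X)) (grad X)"
    using energy_coercive A by metis
  obtain X where "X \<in> V" "\<And>Y. Y \<in> V \<Longrightarrow> inner (mulop A (grad X)) (grad Y) = inner F Y"
    using lax_milgram[OF subV closedV energy_bilinear[OF A] c, of F] by metis
  then have "\<exists>X. X \<in> V \<and> (\<forall>Y\<in>V. inner (mulop A (grad X)) (grad Y) = inner F Y)" by blast
  from someI_ex[OF this] show "solop s \<Omega> A F \<in> V"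
    "Y \<in> V \<Longrightarrow> inner (flux s \<Omega> A F) (grad Y) = inner F Y"
    unfolding flux_def solop_def by blast+
qed

lemma solop_unique:
  assumes A: "A \<in> M" and X: "X \<in> V" "\<And>Y. Y \<in> V \<Longrightarrow> inner (mulop A (grad X)) (grad Y) = inner F Y"
  shows "solop s \<Omega> A F = X"
proof -
  obtain c where c: "c > 0" "\<And>X. X \<in> V \<Longrightarrow> c * (norm X)\<^sup>2 \<le> inner (mulop A (grad X)) (grad X)"
    using energy_coercive A by metis
  define Z where "Z = solop s \<Omega> A F - X"
  have Z: "Z \<in> V" unfolding Z_def by (rule subspace_diff[OF subV solop_in[OF A] X(1)])
  have "mulop A (grad Z) = flux s \<Omega> A F - mulop A (grad X)"
    by (simp only: Z_def grad_simps(2) mulop_diff[OF A] flux_def)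
  then have "inner (mulop A (grad Z)) (grad Z) = 0"
    by (simp only: inner_diff_left solop_eq[OF A Z] X(2)[OF Z] diff_self)
  then have "c * (norm Z)\<^sup>2 \<le> 0" using c(2)[OF Z] by simp
  then have "norm Z = 0" using c(1) by (simp add: mult_le_0_iff)
  then show ?thesis by (simp add: Z_def)
qed

lemma solop_diff:
  assumes A: "A \<in> M"
  shows "solop s \<Omega> A (F - G) = solop s \<Omega> A F - solop s \<Omega> A G"
    "flux s \<Omega> A (F - G) = flux s \<Omega> A F - flux s \<Omega> A G"
proof -
  show 1: "solop s \<Omega> A (F - G) = solop s \<Omega> A F - solop s \<Omega> A G"
  proof (rule solop_unique[OF A subspace_diff[OF subV solop_in[OF A] solop_in[OF A]]])
    fix Y assume Y: "Y \<in> V"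
    have "mulop A (grad (solop s \<Omega> A F - solop s \<Omega> A G)) = flux s \<Omega> A F - flux s \<Omega> A G"
      by (simp only: grad_simps(2) mulop_diff[OF A] flux_def)
    then show "inner (mulop A (grad (solop s \<Omega> A F - solop s \<Omega> A G))) (grad Y) = inner (F - G) Y"
      by (simp only: inner_diff_left solop_eq[OF A Y])
  qed
  show "flux s \<Omega> A (F - G) = flux s \<Omega> A F - flux s \<Omega> A G"
    by (simp only: flux_def 1 grad_simps(2) mulop_diff[OF A])
qed

lemma solop_bounds:
  obtains K where "K > 0" "\<And>A F. A \<in> M \<Longrightarrow> norm (solop s \<Omega> A F) \<le> K * norm F"
    "\<And>A F. A \<in> M \<Longrightarrow> norm (flux s \<Omega> A F) \<le> K * norm F"
proof -
  obtain c where c: "c > 0" "\<And>A X. A \<in> M \<Longrightarrow> X \<in> V \<Longrightarrow> c * (norm X)\<^sup>2 \<le> inner (mulop A (grad X)) (grad X)"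
    using energy_coercive by metis
  have 1: "norm (solop s \<Omega> A F) \<le> (1 / c) * norm F" if A: "A \<in> M" for A F
  proof -
    let ?X = "solop s \<Omega> A F"
    have "c * (norm ?X)\<^sup>2 \<le> inner F ?X"
      using c(2)[OF A solop_in[OF A], of F] solop_eq[OF A solop_in[OF A], of F F] by (simp only: flux_def)
    also have "\<dots> \<le> norm F * norm ?X" by (rule norm_cauchy_schwarz)
    finally have "norm ?X * (c * norm ?X) \<le> norm ?X * norm F" by (simp add: power2_eq_square mult_ac)
    then have "c * norm ?X \<le> norm F" by (cases "norm ?X = 0") (auto simp: mult_le_cancel_left)
    then show ?thesis using c(1) by (simp add: field_simps)
  qed
  have \<beta>: "\<beta> > 0" using \<alpha>\<beta> by linarith
  have 2: "norm (flux s \<Omega> A F) \<le> \<beta> * ((1 / c) * norm F)" if A: "A \<in> M" for A F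
  proof -
    have "norm (flux s \<Omega> A F) \<le> \<beta> * norm (grad (solop s \<Omega> A F))"
      unfolding flux_def by (rule mulop_norm[OF \<alpha>\<beta> A])
    also have "\<dots> \<le> \<beta> * ((1 / c) * norm F)"
      using \<beta> order_trans[OF norm_grad_le 1[OF A]] by (intro mult_left_mono) auto
    finally show ?thesis .
  qed
  show thesis
  proof (rule that[of "(1 + \<beta>) * (1 / c)"])
    show "(1 + \<beta>) * (1 / c) > 0" using c(1) \<beta> by simp
    fix A and F :: "('a, real \<times> 'a) l2" assume A: "A \<in> M"
    have n: "0 \<le> (1 / c) * norm F" "0 \<le> \<beta> * ((1 / c) * norm F)" using c(1) \<beta> by auto
    have e: "(1 + \<beta>) * (1 / c) * norm F = (1 / c) * norm F + \<beta> * ((1 / c) * norm F)"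
      by (simp add: distrib_right mult.assoc add_divide_distrib)
    show "norm (solop s \<Omega> A F) \<le> (1 + \<beta>) * (1 / c) * norm F" unfolding e using 1[OF A, of F] n by linarith
    show "norm (flux s \<Omega> A F) \<le> (1 + \<beta>) * (1 / c) * norm F" unfolding e using 2[OF A, of F] n by linarith
  qed
qed

section \<open>Representatives of flux components\<close>

lemma riesz_ex:
  fixes f :: "('a, real \<times> 'a) l2 \<Rightarrow> real"
  assumes "bounded_linear f"
  obtains r where "r \<in> V" "\<And>v. v \<in> V \<Longrightarrow> f v = inner r v"
proof -
  interpret bounded_linear f by (rule assms)
  obtain K where K: "\<And>x. norm (f x) \<le> norm x * K" using bounded by blast
  show thesis
    by (rule riesz_representation[OF subV closedV, of f K])
      (use K in \<open>simp_all add: add scaleR mult.commute that\<close>)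
qed

lemma flux_rep:
  assumes b: "b \<in> Basis"
  shows flux_rep_in: "flux_rep s \<Omega> b W \<in> V"
    and flux_rep_eq: "X \<in> V \<Longrightarrow> inner (flux_rep s \<Omega> b W) X = inner (restr \<Omega> W) (scale_field b (val X))"
proof -
  have "bounded_linear (\<lambda>X. inner (restr \<Omega> W) (scale_field b (val X)))"
    by (rule bounded_linear_compose[OF bounded_linear_inner_right
          bounded_linear_compose[OF bounded_linear_scale_field[OF b] bounded_linear_val]])
  then obtain r where "r \<in> V" "\<And>X. X \<in> V \<Longrightarrow> inner (restr \<Omega> W) (scale_field b (val X)) = inner r X"
    using riesz_ex by metis
  then have "\<exists>Y. Y \<in> V \<and> (\<forall>X\<in>V. inner Y X = inner (restr \<Omega> W) (scale_field b (val X)))" by metis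
  from someI_ex[OF this] show "flux_rep s \<Omega> b W \<in> V"
    "X \<in> V \<Longrightarrow> inner (flux_rep s \<Omega> b W) X = inner (restr \<Omega> W) (scale_field b (val X))"
    unfolding flux_rep_def by blast+
qed

lemma flux_rep_unique:
  assumes b: "b \<in> Basis" and Y: "Y \<in> V" "\<And>X. X \<in> V \<Longrightarrow> inner Y X = inner (restr \<Omega> W) (scale_field b (val X))"
  shows "flux_rep s \<Omega> b W = Y"
  by (rule graph_space_eqI[OF s flux_rep_in[OF b] Y(1)]) (simp only: flux_rep_eq[OF b] Y(2))

lemmas restr_linear = bounded_linear.linear[OF bounded_linear_restr[OF \<Omega>_lebesgue]]

lemma flux_rep_diff:
  assumes b: "b \<in> Basis" shows "flux_rep s \<Omega> b (W - Z) = flux_rep s \<Omega> b W - flux_rep s \<Omega> b Z"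
  by (rule flux_rep_unique[OF b subspace_diff[OF subV flux_rep_in[OF b] flux_rep_in[OF b]]])
    (simp only: inner_diff_left flux_rep_eq[OF b] linear_diff[OF restr_linear])

text \<open>The defining identity is tested with the representative itself. The first inequality is
  the compactness device: it controls the H^s norm by an L^2 norm, to which Rellich applies.\<close>

lemma flux_rep_norm:
  assumes b: "b \<in> Basis"
  shows "(norm (flux_rep s \<Omega> b W))\<^sup>2 \<le> norm W * norm (val (flux_rep s \<Omega> b W))"
    and "norm (flux_rep s \<Omega> b W) \<le> norm W"
proof -
  let ?Y = "flux_rep s \<Omega> b W"
  have "(norm ?Y)\<^sup>2 = inner (restr \<Omega> W) (scale_field b (val ?Y))"
    unfolding power2_norm_eq_inner by (rule flux_rep_eq[OF b flux_rep_in[OF b]])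
  also have "\<dots> \<le> norm (restr \<Omega> W) * norm (scale_field b (val ?Y))" by (rule norm_cauchy_schwarz)
  also have "\<dots> \<le> norm W * norm (val ?Y)"
    by (intro mult_mono norm_restr_le[OF \<Omega>_lebesgue] norm_scale_field[OF b]) auto
  finally show 1: "(norm ?Y)\<^sup>2 \<le> norm W * norm (val ?Y)" .
  have "norm ?Y * norm ?Y \<le> norm W * norm ?Y"
    using 1 mult_left_mono[OF norm_val_le[of ?Y], of "norm W"] by (simp add: power2_eq_square)
  then show "norm ?Y \<le> norm W" by (cases "norm ?Y = 0") (auto simp: mult_le_cancel_right)
qed

lemma flux_norm_nonneg: "0 \<le> flux_norm s \<Omega> W"
  by (simp add: flux_norm_def L2_set_nonneg)

lemma flux_norm_le: "flux_norm s \<Omega> W \<le> real DIM('a) * norm W"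
proof -
  have "flux_norm s \<Omega> W \<le> (\<Sum>b\<in>Basis. norm (flux_rep s \<Omega> b W))"
    unfolding flux_norm_def by (rule L2_set_le_sum) simp
  also have "\<dots> \<le> (\<Sum>b\<in>(Basis::'a set). norm W)" by (rule sum_mono) (rule flux_rep_norm(2))
  finally show ?thesis by simp
qed

lemma flux_norm_commute: "flux_norm s \<Omega> (W - Z) = flux_norm s \<Omega> (Z - W)"
  unfolding flux_norm_def by (rule L2_set_cong) (simp_all add: flux_rep_diff norm_minus_commute)

lemma flux_norm_triangle: "flux_norm s \<Omega> (W - Z) \<le> flux_norm s \<Omega> (W - Y) + flux_norm s \<Omega> (Y - Z)"
proof -
  have "flux_norm s \<Omega> (W - Z) \<le> L2_set (\<lambda>b. norm (flux_rep s \<Omega> b (W - Y)) + norm (flux_rep s \<Omega> b (Y - Z))) Basis"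
    unfolding flux_norm_def
  proof (rule L2_set_mono)
    fix b :: 'a assume b: "b \<in> Basis"
    show "norm (flux_rep s \<Omega> b (W - Z)) \<le> norm (flux_rep s \<Omega> b (W - Y)) + norm (flux_rep s \<Omega> b (Y - Z))"
      unfolding flux_rep_diff[OF b]
      using norm_triangle_ineq[of "flux_rep s \<Omega> b W - flux_rep s \<Omega> b Y" "flux_rep s \<Omega> b Y - flux_rep s \<Omega> b Z"] by simp
  qed simp
  also have "\<dots> \<le> flux_norm s \<Omega> (W - Y) + flux_norm s \<Omega> (Y - Z)"
    unfolding flux_norm_def by (rule L2_set_triangle_ineq)
  finally show ?thesis .
qed

lemma norm_flux_rep_le: "b \<in> Basis \<Longrightarrow> norm (flux_rep s \<Omega> b W) \<le> flux_norm s \<Omega> W"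
  unfolding flux_norm_def by (rule member_le_L2_set) simp_all

section \<open>Terms of the metric\<close>

lemma dist_term_nonneg: "0 \<le> dist_term s \<Omega> F A B"
  unfolding dist_term_def using flux_norm_nonneg by (intro divide_nonneg_nonneg add_nonneg_nonneg) auto

lemma dist_term_commute: "dist_term s \<Omega> F A B = dist_term s \<Omega> F B A"
  unfolding dist_term_def val_simps(2) by (simp only: flux_norm_commute norm_minus_commute)

lemma dist_term_triangle: "dist_term s \<Omega> F A C \<le> dist_term s \<Omega> F A B + dist_term s \<Omega> F B C"
proof -
  have "norm (val (solop s \<Omega> A F - solop s \<Omega> C F)) \<le> norm (val (solop s \<Omega> A F - solop s \<Omega> B F)) + norm (val (solop s \<Omega> B F - solop s \<Omega> C F))"
    unfolding val_simps(2)
    using norm_triangle_ineq[of "val (solop s \<Omega> A F) - val (solop s \<Omega> B F)" "val (solop s \<Omega> B F) - val (solop s \<Omega> C F)"] by simp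
  then show ?thesis
    unfolding dist_term_def add_divide_distrib[symmetric]
    using flux_norm_triangle[of "flux s \<Omega> A F" "flux s \<Omega> C F" "flux s \<Omega> B F"]
    by (intro divide_right_mono) auto
qed

text \<open>Solutions and fluxes are bounded by the norm of F uniformly in the coefficient, and the
  division by that norm makes the bound independent of F. The weighted series is thus dominated by a
  geometric one.\<close>

lemma dist_term_bound:
  obtains K where "\<And>A B F. A \<in> M \<Longrightarrow> B \<in> M \<Longrightarrow> dist_term s \<Omega> F A B \<le> K"
proof -
  obtain K where K: "K > 0" "\<And>A F. A \<in> M \<Longrightarrow> norm (solop s \<Omega> A F) \<le> K * norm F"
    "\<And>A F. A \<in> M \<Longrightarrow> norm (flux s \<Omega> A F) \<le> K * norm F" using solop_bounds by metis
  show thesis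
  proof (rule that[of "2 * K + real DIM('a) * (2 * K)"])
    fix A B F assume A: "A \<in> M" and B: "B \<in> M"
    have 1: "norm (val (solop s \<Omega> A F - solop s \<Omega> B F)) \<le> (2 * K) * norm F"
      using norm_val_le[of "solop s \<Omega> A F - solop s \<Omega> B F"] norm_triangle_ineq4[of "solop s \<Omega> A F" "solop s \<Omega> B F"]
        K(2)[OF A, of F] K(2)[OF B, of F] by linarith
    have "norm (flux s \<Omega> A F - flux s \<Omega> B F) \<le> (2 * K) * norm F"
      using norm_triangle_ineq4[of "flux s \<Omega> A F" "flux s \<Omega> B F"] K(3)[OF A, of F] K(3)[OF B, of F] by linarith
    then have 2: "flux_norm s \<Omega> (flux s \<Omega> A F - flux s \<Omega> B F) \<le> real DIM('a) * ((2 * K) * norm F)"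
      using order_trans[OF flux_norm_le mult_left_mono] by (metis of_nat_0_le_iff)
    have "norm (val (solop s \<Omega> A F - solop s \<Omega> B F)) + flux_norm s \<Omega> (flux s \<Omega> A F - flux s \<Omega> B F)
      \<le> (2 * K + real DIM('a) * (2 * K)) * norm F"
      using 1 2 by (simp add: distrib_right mult.assoc)
    \<comment> \<open>For F = 0 the quotient is zero by convention, so the bound holds for every
      F.\<close>
    then show "dist_term s \<Omega> F A B \<le> 2 * K + real DIM('a) * (2 * K)"
      unfolding dist_term_def using K(1) by (cases "norm F = 0") (auto simp: pos_divide_le_eq)
  qed
qed

end

section \<open>Functions and functionals as Hilbert space elements\<close>

text \<open>H^s-convergence for a single right-hand side, expressed by weakly null differences so
  that the results on weakly null sequences apply directly.\<close>

definition hconv :: "real \<Rightarrow> 'a::euclidean_space set \<Rightarrow> (nat \<Rightarrow> ('a \<Rightarrow> ('a \<Rightarrow>\<^sub>L 'a))) \<Rightarrow> ('a \<Rightarrow> ('a \<Rightarrow>\<^sub>L 'a))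
    \<Rightarrow> ('a, real \<times> 'a) l2 \<Rightarrow> bool" where
  "hconv s \<Omega> Am A F \<longleftrightarrow>
     (\<forall>Y. (\<lambda>m. inner (solop s \<Omega> (Am m) F - solop s \<Omega> A F) Y) \<longlonglongrightarrow> 0) \<and>
     (\<forall>W. (\<lambda>m. inner (flux s \<Omega> (Am m) F - flux s \<Omega> A F) W) \<longlonglongrightarrow> 0)"

context fractional_problem
begin

lemma rep_H: "X \<in> V \<Longrightarrow> rep X \<in> H0s s \<Omega>" and emb_rep: "X \<in> V \<Longrightarrow> emb s (rep X) = X"
  by (rule rep_H0s[OF s]; assumption)+

lemma emb_V: "u \<in> H0s s \<Omega> \<Longrightarrow> emb s u \<in> V"
  by (rule H0s_emb(3)[OF s])

lemma Hminus_lincomb: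
  assumes f: "f \<in> Hminus s \<Omega>" and u: "u \<in> H0s s \<Omega>" and v: "v \<in> H0s s \<Omega>"
  shows "f (\<lambda>x. a * u x + b * v x) = a * f u + b * f v"
proof -
  have au: "(\<lambda>x. a * u x) \<in> H0s s \<Omega>" using H0s_lincomb(1)[OF s u u, of a 0] by simp
  have bv: "(\<lambda>x. b * v x) \<in> H0s s \<Omega>" using H0s_lincomb(1)[OF s v v, of b 0] by simp
  have add: "\<And>u v. u \<in> H0s s \<Omega> \<Longrightarrow> v \<in> H0s s \<Omega> \<Longrightarrow> f (\<lambda>x. u x + v x) = f u + f v"
    and scale: "\<And>u c. u \<in> H0s s \<Omega> \<Longrightarrow> f (\<lambda>x. c * u x) = c * f u"
    using f unfolding Hminus_def by blast+
  show ?thesis using add[OF au bv] scale[OF u, of a] scale[OF v, of b] by (simp only:)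
qed

text \<open>Elements of \<open>Hminus\<close> act on functions rather than on classes. Boundedness
  by \<open>Hs_norm\<close> forces them to ignore differences whose graph is zero.\<close>

lemma Hminus_cong:
  assumes f: "f \<in> Hminus s \<Omega>" and u: "u \<in> H0s s \<Omega>" and v: "v \<in> H0s s \<Omega>" and e: "emb s u = emb s v"
  shows "f u = f v"
proof -
  obtain C where C: "\<And>v. v \<in> H0s s \<Omega> \<Longrightarrow> \<bar>f v\<bar> \<le> C * Hs_norm s v" using f unfolding Hminus_def by blast
  let ?w = "\<lambda>x. 1 * u x + (-1) * v x"
  have w: "?w \<in> H0s s \<Omega>" by (rule H0s_lincomb(1)[OF s u v])
  have "emb s ?w = 0" unfolding H0s_lincomb(2)[OF s u v] e by simp
  then have "Hs_norm s ?w = 0" unfolding Hs_norm_emb[OF s w] by simp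
  then have "f ?w = 0" using C[OF w] by simp
  then show ?thesis using Hminus_lincomb[OF f u v, of 1 "-1"] by simp
qed

text \<open>The map from X to \<open>f (rep X)\<close> is linear on V although \<open>rep\<close> is
  not, because f does not separate functions with the same graph.\<close>

lemma riesz:
  assumes f: "f \<in> Hminus s \<Omega>"
  shows riesz_in: "riesz s \<Omega> f \<in> V" and riesz_eq: "u \<in> H0s s \<Omega> \<Longrightarrow> f u = inner (riesz s \<Omega> f) (emb s u)"
proof -
  obtain C where C: "\<And>v. v \<in> H0s s \<Omega> \<Longrightarrow> \<bar>f v\<bar> \<le> C * Hs_norm s v" using f unfolding Hminus_def by blast
  have L: "f (rep (a *\<^sub>R X + b *\<^sub>R Y)) = a * f (rep X) + b * f (rep Y)" if X: "X \<in> V" and Y: "Y \<in> V" for X Y a b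
  proof -
    have Z: "a *\<^sub>R X + b *\<^sub>R Y \<in> V" by (intro subspace_add subspace_scale subV X Y)
    have "f (rep (a *\<^sub>R X + b *\<^sub>R Y)) = f (\<lambda>x. a * rep X x + b * rep Y x)"
    proof (rule Hminus_cong[OF f rep_H[OF Z] H0s_lincomb(1)[OF s rep_H[OF X] rep_H[OF Y]]])
      show "emb s (rep (a *\<^sub>R X + b *\<^sub>R Y)) = emb s (\<lambda>x. a * rep X x + b * rep Y x)"
        by (simp only: H0s_lincomb(2)[OF s rep_H[OF X] rep_H[OF Y]] emb_rep[OF Z] emb_rep[OF X] emb_rep[OF Y])
    qed
    also have "\<dots> = a * f (rep X) + b * f (rep Y)" by (rule Hminus_lincomb[OF f rep_H[OF X] rep_H[OF Y]])
    finally show ?thesis .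
  qed
  have add: "f (rep (X + Y)) = f (rep X) + f (rep Y)" if "X \<in> V" "Y \<in> V" for X Y
    using L[OF that, of 1 1] by simp
  have scale: "f (rep (c *\<^sub>R X)) = c * f (rep X)" if "X \<in> V" for c X
    using L[OF that that, of c 0] by simp
  have bound: "\<bar>f (rep X)\<bar> \<le> C * norm X" if X: "X \<in> V" for X
    using C[OF rep_H[OF X]] by (simp only: Hs_norm_emb[OF s rep_H[OF X]] emb_rep[OF X])
  obtain r where r: "r \<in> V" "\<And>X. X \<in> V \<Longrightarrow> f (rep X) = inner r X"
    using riesz_representation[OF subV closedV, of "\<lambda>X. f (rep X)" C, OF add scale bound] by metis
  have "f u = inner r (emb s u)" if u: "u \<in> H0s s \<Omega>" for u
  proof -
    have E: "emb s u \<in> V" by (rule emb_V[OF u])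
    have "f u = f (rep (emb s u))"
      by (rule Hminus_cong[OF f u rep_H[OF E] emb_rep[OF E, symmetric]])
    then show ?thesis using r(2)[OF E] by (simp only:)
  qed
  with r(1) have "\<exists>F. F \<in> V \<and> (\<forall>u\<in>H0s s \<Omega>. f u = inner F (emb s u))" by blast
  from someI_ex[OF this] show "riesz s \<Omega> f \<in> V" "u \<in> H0s s \<Omega> \<Longrightarrow> f u = inner (riesz s \<Omega> f) (emb s u)"
    unfolding riesz_def by blast+
qed

lemma riesz_unique:
  assumes F: "F \<in> V" "\<And>u. u \<in> H0s s \<Omega> \<Longrightarrow> f u = inner F (emb s u)"
  shows "riesz s \<Omega> f = F"
proof -
  have "\<exists>F. F \<in> V \<and> (\<forall>u\<in>H0s s \<Omega>. f u = inner F (emb s u))" using F by blast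
  from someI_ex[OF this] have R: "riesz s \<Omega> f \<in> V" "\<And>u. u \<in> H0s s \<Omega> \<Longrightarrow> f u = inner (riesz s \<Omega> f) (emb s u)"
    unfolding riesz_def by blast+
  show ?thesis
  proof (rule graph_space_eqI[OF s R(1) F(1)])
    fix Y assume Y: "Y \<in> V"
    show "inner (riesz s \<Omega> f) Y = inner F Y"
      using R(2)[OF rep_H[OF Y]] F(2)[OF rep_H[OF Y]] by (simp only: emb_rep[OF Y])
  qed
qed

lemma inner_Hminus: "(\<lambda>u. inner F (emb s u)) \<in> Hminus s \<Omega>"
  unfolding Hminus_def
proof (intro CollectI conjI ballI allI exI)
  fix u v c assume u: "u \<in> H0s s \<Omega>" and v: "v \<in> H0s s \<Omega>"
  show "inner F (emb s (\<lambda>x. u x + v x)) = inner F (emb s u) + inner F (emb s v)"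
    using H0s_lincomb(2)[OF s u v, of 1 1] by (simp add: inner_add_right)
  show "inner F (emb s (\<lambda>x. c * u x)) = c * inner F (emb s u)"
    using H0s_lincomb(2)[OF s u u, of c 0] by simp
next
  fix v assume v: "v \<in> H0s s \<Omega>"
  show "\<bar>inner F (emb s v)\<bar> \<le> norm F * Hs_norm s v"
    unfolding Hs_norm_emb[OF s v] by (rule Cauchy_Schwarz_ineq2)
qed

text \<open>The supremum is attained at F divided by its norm; Cauchy-Schwarz gives the upper
  bound.\<close>

lemma dual_norm_eq:
  assumes F: "F \<in> V" "\<And>u. u \<in> H0s s \<Omega> \<Longrightarrow> f u = inner F (emb s u)"
  shows "dual_norm s \<Omega> f = norm F"
  unfolding dual_norm_def
proof (rule cSup_eq_maximum)
  \<comment> \<open>For F = 0 this is the zero vector by the convention on division, still an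
    admissible competitor.\<close>
  let ?X = "(1 / norm F) *\<^sub>R F"
  have X: "?X \<in> V" by (rule subspace_scale[OF subV F(1)])
  have "norm ?X \<le> 1" by simp
  then have 1: "Hs_norm s (rep ?X) \<le> 1" by (simp only: Hs_norm_emb[OF s rep_H[OF X]] emb_rep[OF X])
  have "f (rep ?X) = (1 / norm F) * inner F F" by (simp only: F(2)[OF rep_H[OF X]] emb_rep[OF X] inner_scaleR_right)
  then have "norm F = \<bar>f (rep ?X)\<bar>"
    by (simp add: power2_norm_eq_inner[symmetric] power2_eq_square)
  then show "norm F \<in> {\<bar>f v\<bar> |v. v \<in> H0s s \<Omega> \<and> Hs_norm s v \<le> 1}" using 1 rep_H[OF X] by blast
next
  fix y assume "y \<in> {\<bar>f v\<bar> |v. v \<in> H0s s \<Omega> \<and> Hs_norm s v \<le> 1}"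
  then obtain v where v: "y = \<bar>f v\<bar>" "v \<in> H0s s \<Omega>" "Hs_norm s v \<le> 1" by blast
  have "\<bar>f v\<bar> \<le> norm F * norm (emb s v)" unfolding F(2)[OF v(2)] by (rule Cauchy_Schwarz_ineq2)
  also have "\<dots> \<le> norm F * 1" using v(3) unfolding Hs_norm_emb[OF s v(2)] by (intro mult_left_mono) auto
  finally show "y \<le> norm F" by (simp add: v(1))
qed

lemma dual_norm_riesz: "f \<in> Hminus s \<Omega> \<Longrightarrow> dual_norm s \<Omega> f = norm (riesz s \<Omega> f)"
  by (rule dual_norm_eq[OF riesz_in riesz_eq])

lemma Hminus_diff:
  assumes f: "f \<in> Hminus s \<Omega>" and g: "g \<in> Hminus s \<Omega>"
  shows "dual_norm s \<Omega> (\<lambda>v. g v - f v) = norm (riesz s \<Omega> g - riesz s \<Omega> f)"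
  by (rule dual_norm_eq[OF subspace_diff[OF subV riesz_in[OF g] riesz_in[OF f]]])
    (simp only: riesz_eq[OF f] riesz_eq[OF g] inner_diff_left)

lemma mulop_emb:
  assumes A: "A \<in> M" and u: "u \<in> H0s s \<Omega>"
  shows "mulop A (grad (emb s u)) = mk (\<lambda>x. blinfun_apply (A x) (Grad_s s u x))"
  by (simp only: H0s_emb(5)[OF s u] mulop_mk[OF \<alpha>\<beta> A H0s_emb(2)[OF s u]])

lemma solves_iff:
  assumes A: "A \<in> M" and f: "f \<in> Hminus s \<Omega>"
  shows "solves s \<Omega> A f u \<longleftrightarrow> u \<in> H0s s \<Omega> \<and> emb s u = solop s \<Omega> A (riesz s \<Omega> f)"
proof (cases "u \<in> H0s s \<Omega>")
  case True
  have i: "integral\<^sup>L lebesgue (\<lambda>x. inner (blinfun_apply (A x) (Grad_s s u x)) (Grad_s s v x))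
      = inner (mulop A (grad (emb s u))) (grad (emb s v))" if v: "v \<in> H0s s \<Omega>" for v
    by (simp only: mulop_emb[OF A True] H0s_emb(5)[OF s v]
        inner_mk[OF L2_mul[OF \<alpha>\<beta> A H0s_emb(2)[OF s True]] H0s_emb(2)[OF s v]])
  have "solves s \<Omega> A f u \<longleftrightarrow> (\<forall>v\<in>H0s s \<Omega>. inner (mulop A (grad (emb s u))) (grad (emb s v)) = inner (riesz s \<Omega> f) (emb s v))"
    unfolding solves_def using True i riesz_eq[OF f] by auto
  also have "\<dots> \<longleftrightarrow> emb s u = solop s \<Omega> A (riesz s \<Omega> f)"
  proof
    assume L: "\<forall>v\<in>H0s s \<Omega>. inner (mulop A (grad (emb s u))) (grad (emb s v)) = inner (riesz s \<Omega> f) (emb s v)"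
    have "solop s \<Omega> A (riesz s \<Omega> f) = emb s u"
    proof (rule solop_unique[OF A emb_V[OF True]])
      fix Y assume Y: "Y \<in> V"
      show "inner (mulop A (grad (emb s u))) (grad Y) = inner (riesz s \<Omega> f) Y"
        using bspec[OF L rep_H[OF Y]] by (simp only: emb_rep[OF Y])
    qed
    then show "emb s u = solop s \<Omega> A (riesz s \<Omega> f)" by (rule sym)
  next
    assume e: "emb s u = solop s \<Omega> A (riesz s \<Omega> f)"
    show "\<forall>v\<in>H0s s \<Omega>. inner (mulop A (grad (emb s u))) (grad (emb s v)) = inner (riesz s \<Omega> f) (emb s v)"
      using solop_eq[OF A emb_V, of _ "riesz s \<Omega> f"] unfolding flux_def e by blast
  qed
  finally show ?thesis using True by blast
qed (simp add: solves_def)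

lemma sol_emb:
  assumes A: "A \<in> M" and f: "f \<in> Hminus s \<Omega>"
  shows "sol s \<Omega> A f \<in> H0s s \<Omega>" "emb s (sol s \<Omega> A f) = solop s \<Omega> A (riesz s \<Omega> f)"
proof -
  have "solves s \<Omega> A f (rep (solop s \<Omega> A (riesz s \<Omega> f)))"
    unfolding solves_iff[OF A f] using rep_H emb_rep solop_in[OF A] by blast
  then have "solves s \<Omega> A f (sol s \<Omega> A f)" unfolding sol_def by (rule someI[of "solves s \<Omega> A f"])
  then show "sol s \<Omega> A f \<in> H0s s \<Omega>" "emb s (sol s \<Omega> A f) = solop s \<Omega> A (riesz s \<Omega> f)"
    unfolding solves_iff[OF A f] by blast+
qed

lemma flux_sol:
  assumes A: "A \<in> M" and f: "f \<in> Hminus s \<Omega>"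
  shows "L2 (\<lambda>x. blinfun_apply (A x) (Grad_s s (sol s \<Omega> A f) x))"
    "mk (\<lambda>x. blinfun_apply (A x) (Grad_s s (sol s \<Omega> A f) x)) = flux s \<Omega> A (riesz s \<Omega> f)"
proof -
  note S = sol_emb[OF A f]
  show "L2 (\<lambda>x. blinfun_apply (A x) (Grad_s s (sol s \<Omega> A f) x))"
    by (rule L2_mul[OF \<alpha>\<beta> A H0s_emb(2)[OF s S(1)]])
  show "mk (\<lambda>x. blinfun_apply (A x) (Grad_s s (sol s \<Omega> A f) x)) = flux s \<Omega> A (riesz s \<Omega> f)"
    unfolding flux_def S(2)[symmetric] by (rule mulop_emb[OF A S(1), symmetric])
qed

lemma L2norm_diff_inside:
  assumes u: "u \<in> H0s s \<Omega>" and v: "v \<in> H0s s \<Omega>"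
  shows "L2norm (\<lambda>x. indicator \<Omega> x * (u x - v x)) = norm (val (emb s u - emb s v))"
proof -
  have L: "L2 (\<lambda>x. u x - v x)" by (rule L2_diff[OF H0s_emb(1)[OF s u] H0s_emb(1)[OF s v]])
  have V: "val (emb s u - emb s v) = mk (\<lambda>x. u x - v x)"
    by (simp only: val_simps(2) H0s_emb(4)[OF s u] H0s_emb(4)[OF s v] mk_diff[OF H0s_emb(1)[OF s u] H0s_emb(1)[OF s v]])
  have "val (emb s u - emb s v) = restr \<Omega> (val (emb s u - emb s v))"
    by (rule graph_space_val_outside[OF s subspace_diff[OF subV emb_V[OF u] emb_V[OF v]] \<Omega>(1), symmetric])
  also have "\<dots> = mk (\<lambda>x. indicator \<Omega> x *\<^sub>R (u x - v x))" unfolding V by (rule restr_mk[OF \<Omega>_lebesgue L])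
  finally have "norm (val (emb s u - emb s v)) = L2norm (\<lambda>x. indicator \<Omega> x *\<^sub>R (u x - v x))"
    by (simp only: norm_mk[OF L2_indicator[OF \<Omega>_lebesgue L]])
  then show ?thesis by (simp only: real_scaleR_def)
qed

lemma L2_functional_eq:
  assumes W: "L2 W" and b: "b \<in> Basis" and v: "v \<in> H0s s \<Omega>"
  shows "L2_functional \<Omega> (\<lambda>x. inner (W x) b) v = inner (flux_rep s \<Omega> b (mk W)) (emb s v)"
proof -
  note lv = H0s_emb(1)[OF s v]
  have "inner (flux_rep s \<Omega> b (mk W)) (emb s v) = inner (restr \<Omega> (mk W)) (scale_field b (val (emb s v)))"
    by (rule flux_rep_eq[OF b emb_V[OF v]])
  also have "\<dots> = integral\<^sup>L lebesgue (\<lambda>x. inner (indicator \<Omega> x *\<^sub>R W x) (v x *\<^sub>R b))"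
    by (simp only: H0s_emb(4)[OF s v] restr_mk[OF \<Omega>_lebesgue W] scale_field_mk[OF lv]
        inner_mk[OF L2_indicator[OF \<Omega>_lebesgue W] L2_scale_field[OF lv]])
  also have "\<dots> = L2_functional \<Omega> (\<lambda>x. inner (W x) b) v"
    unfolding L2_functional_def by (rule Bochner_Integration.integral_cong) (simp_all add: mult_ac)
  finally show ?thesis by (rule sym)
qed

lemma vec_dual_norm_eq:
  assumes W: "L2 W" shows "vec_dual_norm s \<Omega> W = flux_norm s \<Omega> (mk W)"
proof -
  have "dual_norm s \<Omega> (L2_functional \<Omega> (\<lambda>x. inner (W x) b)) = norm (flux_rep s \<Omega> b (mk W))" if b: "b \<in> Basis" for b
    by (rule dual_norm_eq[OF flux_rep_in[OF b] L2_functional_eq[OF W b]])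
  then show ?thesis unfolding vec_dual_norm_def flux_norm_def L2_set_def by simp
qed

lemma d_s_eq:
  assumes A: "A \<in> M" and B: "B \<in> M" and f: "\<And>n. f n \<in> Hminus s \<Omega>"
  shows "d_s s \<Omega> f A B = (\<Sum>n. (1/2) ^ (Suc n) * dist_term s \<Omega> (riesz s \<Omega> (f n)) A B)"
proof -
  have "(let u = sol s \<Omega> A (f n); v = sol s \<Omega> B (f n) in
       (L2norm (\<lambda>x. indicator \<Omega> x * (u x - v x))
        + vec_dual_norm s \<Omega> (\<lambda>x. blinfun_apply (A x) (Grad_s s u x) - blinfun_apply (B x) (Grad_s s v x)))
       / dual_norm s \<Omega> (f n)) = dist_term s \<Omega> (riesz s \<Omega> (f n)) A B" for n
    unfolding Let_def dist_term_def dual_norm_riesz[OF f]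
      L2norm_diff_inside[OF sol_emb(1)[OF A f] sol_emb(1)[OF B f]] sol_emb(2)[OF A f] sol_emb(2)[OF B f]
      vec_dual_norm_eq[OF L2_diff[OF flux_sol(1)[OF A f] flux_sol(1)[OF B f]]]
      mk_diff[OF flux_sol(1)[OF A f] flux_sol(1)[OF B f]] flux_sol(2)[OF A f] flux_sol(2)[OF B f] ..
  then show ?thesis unfolding d_s_def by (simp only:)
qed

text \<open>Functionals in H^{-s} correspond to elements of V. Testing solution differences with an
  arbitrary Y of the product space amounts to testing with the element r of V that represents Y
  there.\<close>

lemma Hs_converges_iff:
  assumes Am: "\<And>m. Am m \<in> M" and A: "A \<in> M"
  shows "Hs_converges s \<Omega> Am A \<longleftrightarrow> (\<forall>F\<in>V. hconv s \<Omega> Am A F)"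
proof -
  have sol_h: "h (sol s \<Omega> B f) = inner (riesz s \<Omega> h) (solop s \<Omega> B (riesz s \<Omega> f))"
    if "f \<in> Hminus s \<Omega>" "h \<in> Hminus s \<Omega>" "B \<in> M" for f h B
    using riesz_eq[OF that(2) sol_emb(1)[OF that(3,1)]] by (simp only: sol_emb(2)[OF that(3,1)])
  have flux_w: "integral\<^sup>L lebesgue (\<lambda>x. inner (blinfun_apply (B x) (Grad_s s (sol s \<Omega> B f) x)) (w x)) = inner (flux s \<Omega> B (riesz s \<Omega> f)) (mk w)"
    if "f \<in> Hminus s \<Omega>" "L2 w" "B \<in> M" for f w B
    by (simp only: flux_sol(2)[OF that(3,1), symmetric] inner_mk[OF flux_sol(1)[OF that(3,1)] that(2)])
  have hconv_iff: "hconv s \<Omega> Am A (riesz s \<Omega> f) \<longleftrightarrow>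
      (\<forall>h\<in>Hminus s \<Omega>. (\<lambda>m. h (sol s \<Omega> (Am m) f)) \<longlonglongrightarrow> h (sol s \<Omega> A f)) \<and>
      (\<forall>w. L2 w \<longrightarrow> (\<lambda>m. integral\<^sup>L lebesgue (\<lambda>x. inner (blinfun_apply (Am m x) (Grad_s s (sol s \<Omega> (Am m) f) x)) (w x)))
           \<longlonglongrightarrow> integral\<^sup>L lebesgue (\<lambda>x. inner (blinfun_apply (A x) (Grad_s s (sol s \<Omega> A f) x)) (w x)))"
    (is "_ \<longleftrightarrow> ?P \<and> ?Q") if f: "f \<in> Hminus s \<Omega>" for f
  proof -
    let ?F = "riesz s \<Omega> f"
    let ?X = "\<lambda>m. solop s \<Omega> (Am m) ?F - solop s \<Omega> A ?F" and ?W = "\<lambda>m. flux s \<Omega> (Am m) ?F - flux s \<Omega> A ?F"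
    have XV: "?X m \<in> V" for m by (rule subspace_diff[OF subV solop_in[OF Am] solop_in[OF A]])
    have 1: "(\<lambda>m. h (sol s \<Omega> (Am m) f)) \<longlonglongrightarrow> h (sol s \<Omega> A f) \<longleftrightarrow> (\<lambda>m. inner (?X m) (riesz s \<Omega> h)) \<longlonglongrightarrow> 0"
      if h: "h \<in> Hminus s \<Omega>" for h
      unfolding sol_h[OF f h Am] sol_h[OF f h A] inner_commute[of "riesz s \<Omega> h"] inner_diff_left
      by (rule LIM_zero_iff[symmetric])
    have 2: "(\<lambda>m. integral\<^sup>L lebesgue (\<lambda>x. inner (blinfun_apply (Am m x) (Grad_s s (sol s \<Omega> (Am m) f) x)) (w x)))
           \<longlonglongrightarrow> integral\<^sup>L lebesgue (\<lambda>x. inner (blinfun_apply (A x) (Grad_s s (sol s \<Omega> A f) x)) (w x))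
         \<longleftrightarrow> (\<lambda>m. inner (?W m) (mk w)) \<longlonglongrightarrow> 0" if w: "L2 w" for w
      unfolding flux_w[OF f w Am] flux_w[OF f w A] inner_diff_left by (rule LIM_zero_iff[symmetric])
    have "?P \<longleftrightarrow> (\<forall>Y. (\<lambda>m. inner (?X m) Y) \<longlonglongrightarrow> 0)"
    proof
      assume P: ?P
      show "\<forall>Y. (\<lambda>m. inner (?X m) Y) \<longlonglongrightarrow> 0"
      proof
        fix Y
        obtain r where r: "r \<in> V" "\<And>v. v \<in> V \<Longrightarrow> inner v Y = inner r v"
          using riesz_ex[OF bounded_linear_inner_left, of Y] by metis
        let ?h = "\<lambda>u. inner r (emb s u)"
        have h: "?h \<in> Hminus s \<Omega>" by (rule inner_Hminus)
        have "riesz s \<Omega> ?h = r" by (rule riesz_unique[OF r(1) refl])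
        then have "(\<lambda>m. inner (?X m) r) \<longlonglongrightarrow> 0" using bspec[OF P h] unfolding 1[OF h] by (simp only:)
        then show "(\<lambda>m. inner (?X m) Y) \<longlonglongrightarrow> 0" unfolding r(2)[OF XV] inner_commute[of r] .
      qed
    qed (use 1 in blast)
    moreover have "?Q \<longleftrightarrow> (\<forall>Z. (\<lambda>m. inner (?W m) Z) \<longlonglongrightarrow> 0)"
    proof
      assume Q: ?Q
      show "\<forall>Z. (\<lambda>m. inner (?W m) Z) \<longlonglongrightarrow> 0"
      proof
        fix Z
        have "(\<lambda>m. inner (?W m) (mk (fn Z))) \<longlonglongrightarrow> 0" using mp[OF spec[OF Q] L2_fn, of Z] unfolding 2[OF L2_fn] .
        then show "(\<lambda>m. inner (?W m) Z) \<longlonglongrightarrow> 0" by (simp only: mk_fn)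
      qed
    qed (use 2 in blast)
    ultimately show ?thesis unfolding hconv_def by (simp only:)
  qed
  have "Hs_converges s \<Omega> Am A \<longleftrightarrow> (\<forall>f\<in>Hminus s \<Omega>. hconv s \<Omega> Am A (riesz s \<Omega> f))"
    unfolding Hs_converges_def Let_def by (rule ball_cong[OF refl]) (simp only: hconv_iff)
  also have "\<dots> \<longleftrightarrow> (\<forall>F\<in>V. hconv s \<Omega> Am A F)"
  proof
    assume H: "\<forall>f\<in>Hminus s \<Omega>. hconv s \<Omega> Am A (riesz s \<Omega> f)"
    show "\<forall>F\<in>V. hconv s \<Omega> Am A F"
    proof
      fix F assume F: "F \<in> V"
      show "hconv s \<Omega> Am A F" using bspec[OF H inner_Hminus[of F]] unfolding riesz_unique[OF F refl] .
    qed
  next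
    assume H: "\<forall>F\<in>V. hconv s \<Omega> Am A F"
    show "\<forall>f\<in>Hminus s \<Omega>. hconv s \<Omega> Am A (riesz s \<Omega> f)" using H riesz_in by blast
  qed
  finally show ?thesis .
qed

end

section \<open>Convergence of solutions and fluxes\<close>

lemma null_comparison:
  fixes f :: "nat \<Rightarrow> 'h::real_normed_vector"
  assumes "g \<longlonglongrightarrow> 0" "\<And>m. norm (f m) \<le> g m" shows "f \<longlonglongrightarrow> 0"
proof (rule Lim_null_comparison[OF always_eventually assms(1)])
  show "\<forall>m. norm (f m) \<le> g m" using assms(2) by blast
qed

context fractional_problem
begin

lemma solop_diff_bound:
  obtains K where "\<And>A B F. A \<in> M \<Longrightarrow> B \<in> M \<Longrightarrow> norm (solop s \<Omega> A F - solop s \<Omega> B F) \<le> K * norm F"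
    "\<And>A B F. A \<in> M \<Longrightarrow> B \<in> M \<Longrightarrow> norm (flux s \<Omega> A F - flux s \<Omega> B F) \<le> K * norm F" "K > 0"
proof -
  obtain K where K: "K > 0" "\<And>A F. A \<in> M \<Longrightarrow> norm (solop s \<Omega> A F) \<le> K * norm F"
    "\<And>A F. A \<in> M \<Longrightarrow> norm (flux s \<Omega> A F) \<le> K * norm F" using solop_bounds by metis
  show thesis
  proof (rule that[of "2 * K"])
    fix A B and F :: "('a, real \<times> 'a) l2" assume A: "A \<in> M" and B: "B \<in> M"
    show "norm (solop s \<Omega> A F - solop s \<Omega> B F) \<le> 2 * K * norm F"
      using norm_triangle_ineq4[of "solop s \<Omega> A F" "solop s \<Omega> B F"] K(2)[OF A, of F] K(2)[OF B, of F] by linarith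
    show "norm (flux s \<Omega> A F - flux s \<Omega> B F) \<le> 2 * K * norm F"
      using norm_triangle_ineq4[of "flux s \<Omega> A F" "flux s \<Omega> B F"] K(3)[OF A, of F] K(3)[OF B, of F] by linarith
  qed (use K(1) in simp)
qed

text \<open>The compact embedding of L^2 into H^{-s} by duality: the representatives are weakly null
  in V, Rellich makes them null in L^2, and \<open>flux_rep_norm\<close> raises this to the H^s
  norm.\<close>

lemma flux_norm_weak_null:
  assumes B: "\<And>m. norm (W m) \<le> B" and weak: "\<And>Z. (\<lambda>m. inner (W m) Z) \<longlonglongrightarrow> 0"
  shows "(\<lambda>m. flux_norm s \<Omega> (W m)) \<longlonglongrightarrow> 0"
proof -
  have rep0: "(\<lambda>m. norm (flux_rep s \<Omega> b (W m))) \<longlonglongrightarrow> 0" if b: "b \<in> Basis" for b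
  proof -
    let ?Y = "\<lambda>m. flux_rep s \<Omega> b (W m)"
    have YV: "?Y m \<in> V" for m by (rule flux_rep_in[OF b])
    have YB: "norm (?Y m) \<le> B" for m using flux_rep_norm(2)[OF b] B order_trans by blast
    have weakY: "(\<lambda>m. inner (?Y m) Y) \<longlonglongrightarrow> 0" for Y
    proof -
      obtain r where r: "r \<in> V" "\<And>v. v \<in> V \<Longrightarrow> inner v Y = inner r v"
        using riesz_ex[OF bounded_linear_inner_left, of Y] by metis
      have "inner (?Y m) Y = inner (W m) (restr \<Omega> (scale_field b (val r)))" for m
        by (simp only: r(2)[OF YV] inner_commute[of r] flux_rep_eq[OF b r(1)] restr_inner[OF \<Omega>_lebesgue])
      then show ?thesis using weak[of "restr \<Omega> (scale_field b (val r))"] by (simp only:)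
    qed
    have v0: "(\<lambda>m. norm (val (?Y m))) \<longlonglongrightarrow> 0" by (rule rellich[OF s \<Omega> YV YB weakY])
    have "(\<lambda>m. B * norm (val (?Y m))) \<longlonglongrightarrow> 0" using tendsto_mult_right_zero[OF v0, of B] .
    then have lim: "(\<lambda>m. sqrt (B * norm (val (?Y m)))) \<longlonglongrightarrow> 0" using tendsto_real_sqrt by fastforce
    have bd: "norm (norm (?Y m)) \<le> sqrt (B * norm (val (?Y m)))" for m
    proof -
      have "norm (W m) * norm (val (?Y m)) \<le> B * norm (val (?Y m))" by (intro mult_right_mono B) simp
      then have "(norm (?Y m))\<^sup>2 \<le> B * norm (val (?Y m))" using flux_rep_norm(1)[OF b, of "W m"] by linarith
      then show ?thesis using real_le_rsqrt by (simp only: real_norm_def abs_norm_cancel)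
    qed
    show ?thesis by (rule null_comparison[OF lim bd])
  qed
  have "(\<lambda>m. \<Sum>b\<in>(Basis::'a set). norm (flux_rep s \<Omega> b (W m))) \<longlonglongrightarrow> (\<Sum>b\<in>(Basis::'a set). 0)"
    by (rule tendsto_sum) (rule rep0)
  then have lim: "(\<lambda>m. \<Sum>b\<in>(Basis::'a set). norm (flux_rep s \<Omega> b (W m))) \<longlonglongrightarrow> 0" by (simp only: sum.neutral_const)
  have bd: "norm (flux_norm s \<Omega> (W m)) \<le> (\<Sum>b\<in>(Basis::'a set). norm (flux_rep s \<Omega> b (W m)))" for m
    unfolding real_norm_def abs_of_nonneg[OF flux_norm_nonneg] unfolding flux_norm_def
    by (rule L2_set_le_sum) simp
  show ?thesis by (rule null_comparison[OF lim bd])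
qed

lemma hconv_dist_term:
  assumes Am: "\<And>m. Am m \<in> M" and A: "A \<in> M" and H: "hconv s \<Omega> Am A F"
  shows "(\<lambda>m. dist_term s \<Omega> F (Am m) A) \<longlonglongrightarrow> 0"
proof -
  obtain K where K: "\<And>A B F. A \<in> M \<Longrightarrow> B \<in> M \<Longrightarrow> norm (solop s \<Omega> A F - solop s \<Omega> B F) \<le> K * norm F"
    "\<And>A B F. A \<in> M \<Longrightarrow> B \<in> M \<Longrightarrow> norm (flux s \<Omega> A F - flux s \<Omega> B F) \<le> K * norm F" "K > 0"
    using solop_diff_bound by metis
  have H1: "\<And>Y. (\<lambda>m. inner (solop s \<Omega> (Am m) F - solop s \<Omega> A F) Y) \<longlonglongrightarrow> 0"
    and H2: "\<And>W. (\<lambda>m. inner (flux s \<Omega> (Am m) F - flux s \<Omega> A F) W) \<longlonglongrightarrow> 0"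
    using H unfolding hconv_def by blast+
  have 1: "(\<lambda>m. norm (val (solop s \<Omega> (Am m) F - solop s \<Omega> A F))) \<longlonglongrightarrow> 0"
    by (rule rellich[OF s \<Omega> subspace_diff[OF subV solop_in[OF Am] solop_in[OF A]] K(1)[OF Am A] H1])
  have 2: "(\<lambda>m. flux_norm s \<Omega> (flux s \<Omega> (Am m) F - flux s \<Omega> A F)) \<longlonglongrightarrow> 0"
    by (rule flux_norm_weak_null[OF K(2)[OF Am A] H2])
  have "(\<lambda>m. (norm (val (solop s \<Omega> (Am m) F - solop s \<Omega> A F)) + flux_norm s \<Omega> (flux s \<Omega> (Am m) F - flux s \<Omega> A F)) / norm F)
    \<longlonglongrightarrow> 0"
    by (rule tendsto_divide_zero[OF tendsto_add_zero[OF 1 2]])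
  then show ?thesis unfolding dist_term_def .
qed

text \<open>Against a bump field, integration by parts moves the gradient onto the bump and leaves a
  pairing with the null function part. Boundedness and density of the bump fields cover all test
  fields.\<close>

lemma val_null_weak_null:
  assumes XV: "\<And>m. X m \<in> V" and B: "\<And>m. norm (X m) \<le> B" and v0: "(\<lambda>m. norm (val (X m))) \<longlonglongrightarrow> 0"
  shows "(\<lambda>m. inner (grad (X m)) W) \<longlonglongrightarrow> 0" "(\<lambda>m. inner (X m) Y) \<longlonglongrightarrow> 0"
proof -
  have val0: "(\<lambda>m. inner (val (X m)) h) \<longlonglongrightarrow> 0" for h
  proof -
    have "(\<lambda>m. norm (val (X m)) * norm h) \<longlonglongrightarrow> 0" by (rule tendsto_mult_left_zero[OF v0])
    moreover have "norm (inner (val (X m)) h) \<le> norm (val (X m)) * norm h" for m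
      unfolding real_norm_def by (rule Cauchy_Schwarz_ineq2)
    ultimately show ?thesis by (rule null_comparison)
  qed
  have gB: "norm (grad (X m)) \<le> B" for m using norm_grad_le[of "X m"] B[of m] by linarith
  let ?S = "{W. (\<lambda>m. inner (grad (X m)) W) \<longlonglongrightarrow> 0}"
  have grad0: "(\<lambda>m. inner (grad (X m)) W) \<longlonglongrightarrow> 0" for W
  proof -
    have "restr UNIV W \<in> ?S"
    proof (rule test_fields_dense[OF open_UNIV weak_null_subspace[OF gB]])
      fix a b i :: 'a and n :: real assume "n > 0"
      then have l: "lipc (bump a b n)" by (rule lipc_bump)
      show "test_field (bump a b n) i \<in> ?S"
        using tendsto_minus[OF val0] unfolding mem_Collect_eq graph_space_by_parts[OF s l XV] minus_zero .
    qed
    moreover have "restr UNIV W = W" unfolding restr_def by simp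
    ultimately show ?thesis by simp
  qed
  then show "(\<lambda>m. inner (grad (X m)) W) \<longlonglongrightarrow> 0" .
  show "(\<lambda>m. inner (X m) Y) \<longlonglongrightarrow> 0"
    unfolding graph_inner by (rule tendsto_add_zero[OF val0 grad0])
qed

lemma restr_split:
  fixes W :: "('a, 'b::euclidean_space) l2"
  shows "W = restr \<Omega> W + restr (- \<Omega>) W"
proof -
  have c: "- \<Omega> \<in> sets lebesgue" using \<Omega>(1) by (simp add: borel_closed closed_def[symmetric] closed_Compl)
  have "restr \<Omega> W + restr (- \<Omega>) W = mk (\<lambda>x. indicator \<Omega> x *\<^sub>R fn W x + indicator (- \<Omega>) x *\<^sub>R fn W x)"
    unfolding restr_def by (rule mk_add[OF L2_indicator[OF \<Omega>_lebesgue L2_fn] L2_indicator[OF c L2_fn], symmetric])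
  also have "(\<lambda>x. indicator \<Omega> x *\<^sub>R fn W x + indicator (- \<Omega>) x *\<^sub>R fn W x) = fn W"
    by (rule ext) (simp add: indicator_def)
  finally show ?thesis by simp
qed

lemma restr_mulop_outside:
  assumes A: "A \<in> M" and B: "B \<in> M" and AB: "AE x in lebesgue. x \<notin> \<Omega> \<longrightarrow> A x = B x"
  shows "restr (- \<Omega>) (mulop A G) = restr (- \<Omega>) (mulop B G)"
proof -
  have c: "- \<Omega> \<in> sets lebesgue" using \<Omega>(1) by (simp add: borel_closed closed_def[symmetric] closed_Compl)
  note LA = L2_mul[OF \<alpha>\<beta> A L2_fn, of G] and LB = L2_mul[OF \<alpha>\<beta> B L2_fn, of G]
  show ?thesis
    unfolding mulop_def restr_mk[OF c LA] restr_mk[OF c LB]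
  proof (rule mk_AE_cong[OF L2_indicator[OF c LA] L2_indicator[OF c LB]])
    show "AE x in lebesgue. indicator (- \<Omega>) x *\<^sub>R blinfun_apply (A x) (fn G x) = indicator (- \<Omega>) x *\<^sub>R blinfun_apply (B x) (fn G x)"
      using AB
    proof eventually_elim
      case (elim x) then show ?case by (cases "x \<in> \<Omega>") simp_all
    qed
  qed
qed

lemma dist_term_hconv:
  assumes Am: "\<And>m. Am m \<in> M" and A: "A \<in> M" and out: "\<And>m. AE x in lebesgue. x \<notin> \<Omega> \<longrightarrow> Am m x = A x"
    and F: "F \<noteq> 0" and d0: "(\<lambda>m. dist_term s \<Omega> F (Am m) A) \<longlonglongrightarrow> 0"
  shows "hconv s \<Omega> Am A F"
proof -
  obtain K where K: "\<And>A B F. A \<in> M \<Longrightarrow> B \<in> M \<Longrightarrow> norm (solop s \<Omega> A F - solop s \<Omega> B F) \<le> K * norm F"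
    "\<And>A B F. A \<in> M \<Longrightarrow> B \<in> M \<Longrightarrow> norm (flux s \<Omega> A F - flux s \<Omega> B F) \<le> K * norm F" "K > 0"
    using solop_diff_bound by metis
  define X where "X m = solop s \<Omega> (Am m) F - solop s \<Omega> A F" for m
  define W where "W m = flux s \<Omega> (Am m) F - flux s \<Omega> A F" for m
  have XB: "norm (X m) \<le> K * norm F" and WB: "norm (W m) \<le> K * norm F" for m
    unfolding X_def W_def by (rule K(1)[OF Am A], rule K(2)[OF Am A])
  have XV: "X m \<in> V" for m unfolding X_def by (rule subspace_diff[OF subV solop_in[OF Am] solop_in[OF A]])
  have "(\<lambda>m. norm F * dist_term s \<Omega> F (Am m) A) \<longlonglongrightarrow> 0" by (rule tendsto_mult_right_zero[OF d0])
  moreover have "norm F * dist_term s \<Omega> F (Am m) A = norm (val (X m)) + flux_norm s \<Omega> (W m)" for m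
    using F by (simp add: dist_term_def X_def W_def)
  ultimately have sum0: "(\<lambda>m. norm (val (X m)) + flux_norm s \<Omega> (W m)) \<longlonglongrightarrow> 0" by (simp only:)
  have v0: "(\<lambda>m. norm (val (X m))) \<longlonglongrightarrow> 0"
  proof -
    have "norm (norm (val (X m))) \<le> norm (val (X m)) + flux_norm s \<Omega> (W m)" for m
      using flux_norm_nonneg[of "W m"] by (simp only: real_norm_def abs_norm_cancel)
    then show ?thesis by (rule null_comparison[OF sum0])
  qed
  have f0: "(\<lambda>m. norm (flux_rep s \<Omega> b (W m))) \<longlonglongrightarrow> 0" if b: "b \<in> Basis" for b
  proof -
    have "norm (norm (flux_rep s \<Omega> b (W m))) \<le> norm (val (X m)) + flux_norm s \<Omega> (W m)" for m
      using norm_flux_rep_le[OF b, of "W m"] norm_ge_zero[of "val (X m)"] by (simp only: real_norm_def abs_norm_cancel)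
    then show ?thesis by (rule null_comparison[OF sum0])
  qed
  have X0: "(\<lambda>m. inner (X m) Y) \<longlonglongrightarrow> 0" for Y by (rule val_null_weak_null(2)[OF XV XB v0])
  let ?S = "{Z. (\<lambda>m. inner (W m) Z) \<longlonglongrightarrow> 0}"
  \<comment> \<open>For a bump supported in \<Omega>, pairing the flux difference with its field is
    pairing the representative, which tends to zero in norm, with the graph of the bump.\<close>
  have inside: "restr \<Omega> Z \<in> ?S" for Z
  proof (rule test_fields_dense[OF \<Omega>(1) weak_null_subspace[OF WB]])
    fix a b i :: 'a and n :: real
    assume c: "cbox a b \<subseteq> \<Omega>" and n: "n > 0" and i: "i \<in> Basis"
    let ?\<phi> = "bump a b n"
    have \<phi>: "?\<phi> \<in> Cc_inf \<Omega>" by (rule bump_Cc_inf[OF n c])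
    note \<phi>H = Cc_inf_H0s[OF s \<phi>]
    have gV: "graph s ?\<phi> \<in> V" using emb_V[OF \<phi>H(1)] by (simp only: \<phi>H(2))
    have L: "L2 (\<lambda>x. ?\<phi> x *\<^sub>R i)" by (rule L2_scale_field[OF Cc_inf_L2(1)[OF s \<phi>]])
    have tf: "restr \<Omega> (test_field ?\<phi> i) = scale_field i (val (graph s ?\<phi>))"
    proof -
      have "(\<lambda>x. indicator \<Omega> x *\<^sub>R (?\<phi> x *\<^sub>R i)) = (\<lambda>x. ?\<phi> x *\<^sub>R i)"
      proof
        fix x show "indicator \<Omega> x *\<^sub>R (?\<phi> x *\<^sub>R i) = ?\<phi> x *\<^sub>R i"
          using Cc_inf_outside[OF \<phi>, of x] by (cases "x \<in> \<Omega>") simp_all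
      qed
      then show ?thesis
        by (simp only: test_field_def val_graph[OF s \<phi>] scale_field_mk[OF Cc_inf_L2(1)[OF s \<phi>]] restr_mk[OF \<Omega>_lebesgue L])
    qed
    have tf': "test_field ?\<phi> i = scale_field i (val (graph s ?\<phi>))"
      by (simp only: test_field_def val_graph[OF s \<phi>] scale_field_mk[OF Cc_inf_L2(1)[OF s \<phi>]])
    have "inner (W m) (test_field ?\<phi> i) = inner (flux_rep s \<Omega> i (W m)) (graph s ?\<phi>)" for m
      unfolding flux_rep_eq[OF i gV] restr_inner[OF \<Omega>_lebesgue] tf'[symmetric] tf ..
    moreover have "(\<lambda>m. inner (flux_rep s \<Omega> i (W m)) (graph s ?\<phi>)) \<longlonglongrightarrow> 0"
    proof -
      have "(\<lambda>m. norm (flux_rep s \<Omega> i (W m)) * norm (graph s ?\<phi>)) \<longlonglongrightarrow> 0" by (rule tendsto_mult_left_zero[OF f0[OF i]])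
      moreover have "norm (inner (flux_rep s \<Omega> i (W m)) (graph s ?\<phi>)) \<le> norm (flux_rep s \<Omega> i (W m)) * norm (graph s ?\<phi>)" for m
        unfolding real_norm_def by (rule Cauchy_Schwarz_ineq2)
      ultimately show ?thesis by (rule null_comparison)
    qed
    ultimately show "test_field ?\<phi> i \<in> ?S" by (simp only: mem_Collect_eq)
  qed
  have c: "- \<Omega> \<in> sets lebesgue" using \<Omega>(1) by (simp add: borel_closed closed_def[symmetric] closed_Compl)
  note lin = bounded_linear.linear[OF bounded_linear_restr[OF c]]
  have WX: "restr (- \<Omega>) (W m) = restr (- \<Omega>) (mulop A (grad (X m)))" for m
    unfolding W_def X_def flux_def grad_simps(2) mulop_diff[OF A]
    by (simp only: linear_diff[OF lin] restr_mulop_outside[OF Am A out])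
  have outside: "restr (- \<Omega>) Z \<in> ?S" for Z
  proof -
    have "inner (W m) (restr (- \<Omega>) Z) = inner (mulop A (grad (X m))) (restr (- \<Omega>) Z)" for m
      by (simp only: restr_inner[OF c, symmetric] WX)
    moreover have "(\<lambda>m. inner (mulop A (grad (X m))) (restr (- \<Omega>) Z)) \<longlonglongrightarrow> 0"
      by (rule weak_null_bounded_linear[OF bounded_linear_compose[OF bounded_linear_mulop[OF \<alpha>\<beta> A] bounded_linear_grad] X0])
    ultimately show ?thesis by (simp only: mem_Collect_eq)
  qed
  have W0: "(\<lambda>m. inner (W m) Z) \<longlonglongrightarrow> 0" for Z
  proof -
    have "restr \<Omega> Z + restr (- \<Omega>) Z \<in> ?S" by (rule subspace_add[OF weak_null_subspace(1)[OF WB] inside outside])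
    then show ?thesis by (simp only: restr_split[symmetric] mem_Collect_eq)
  qed
  show ?thesis unfolding hconv_def using X0 W0 unfolding X_def W_def by blast
qed

text \<open>Solutions and fluxes depend linearly on the right-hand side with a bound uniform in m,
  so F may be replaced by a nearby G up to an error uniform in m.\<close>

lemma hconv_dense:
  assumes Am: "\<And>m. Am m \<in> M" and A: "A \<in> M"
    and dense: "\<And>e. e > 0 \<Longrightarrow> \<exists>G. hconv s \<Omega> Am A G \<and> norm (F - G) < e"
  shows "hconv s \<Omega> Am A F"
proof -
  obtain K where K: "\<And>A B F. A \<in> M \<Longrightarrow> B \<in> M \<Longrightarrow> norm (solop s \<Omega> A F - solop s \<Omega> B F) \<le> K * norm F"
    "\<And>A B F. A \<in> M \<Longrightarrow> B \<in> M \<Longrightarrow> norm (flux s \<Omega> A F - flux s \<Omega> B F) \<le> K * norm F" "K > 0"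
    using solop_diff_bound by metis
  \<comment> \<open>Stated for an abstract T, so that it serves both for solutions and for fluxes,
    which live in different spaces.\<close>
  have approx: "(\<lambda>m. inner (T m F) Y) \<longlonglongrightarrow> 0"
    if T: "\<And>m G. norm (T m F - T m G) \<le> K * norm (F - G)"
      and lim: "\<And>G. hconv s \<Omega> Am A G \<Longrightarrow> (\<lambda>m. inner (T m G) Y) \<longlonglongrightarrow> 0"
    for T :: "nat \<Rightarrow> ('a, real \<times> 'a) l2 \<Rightarrow> 'h::real_inner" and Y
  proof (rule LIMSEQ_I)
    fix e :: real assume e: "e > 0"
    have p: "K * (norm Y + 1) > 0" using K(3) by (simp add: add_nonneg_pos)
    have "e / 2 / (K * (norm Y + 1)) > 0" by (rule divide_pos_pos[OF half_gt_zero[OF e] p])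
    then obtain G where G: "hconv s \<Omega> Am A G" "norm (F - G) < e / 2 / (K * (norm Y + 1))" using dense by blast
    obtain N where N: "\<And>m. m \<ge> N \<Longrightarrow> norm (inner (T m G) Y - 0) < e / 2"
      using LIMSEQ_D[OF lim[OF G(1)] half_gt_zero[OF e]] by blast
    have "norm (inner (T m F) Y - 0) < e" if m: "m \<ge> N" for m
    proof -
      have "\<bar>inner (T m F - T m G) Y\<bar> \<le> norm (T m F - T m G) * norm Y" by (rule Cauchy_Schwarz_ineq2)
      also have "\<dots> \<le> (K * norm (F - G)) * (norm Y + 1)"
        using K(3) by (intro mult_mono T) auto
      also have "\<dots> = norm (F - G) * (K * (norm Y + 1))" by (simp only: mult_ac)
      also have "\<dots> < e / 2" using G(2) unfolding pos_less_divide_eq[OF p] .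
      finally have "\<bar>inner (T m F) Y - inner (T m G) Y\<bar> < e / 2" unfolding inner_diff_left .
      then show ?thesis using N[OF m] unfolding diff_0_right real_norm_def by linarith
    qed
    then show "\<exists>N. \<forall>m\<ge>N. norm (inner (T m F) Y - 0) < e" by blast
  qed
  have 1: "norm ((solop s \<Omega> (Am m) F - solop s \<Omega> A F) - (solop s \<Omega> (Am m) G - solop s \<Omega> A G)) \<le> K * norm (F - G)" for m G
  proof -
    have "(solop s \<Omega> (Am m) F - solop s \<Omega> A F) - (solop s \<Omega> (Am m) G - solop s \<Omega> A G) = solop s \<Omega> (Am m) (F - G) - solop s \<Omega> A (F - G)"
      by (simp add: solop_diff(1)[OF Am] solop_diff(1)[OF A])
    then show ?thesis using K(1)[OF Am A, of m "F - G"] by (simp only:)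
  qed
  have 2: "norm ((flux s \<Omega> (Am m) F - flux s \<Omega> A F) - (flux s \<Omega> (Am m) G - flux s \<Omega> A G)) \<le> K * norm (F - G)" for m G
  proof -
    have "(flux s \<Omega> (Am m) F - flux s \<Omega> A F) - (flux s \<Omega> (Am m) G - flux s \<Omega> A G) = flux s \<Omega> (Am m) (F - G) - flux s \<Omega> A (F - G)"
      by (simp add: solop_diff(2)[OF Am] solop_diff(2)[OF A])
    then show ?thesis using K(2)[OF Am A, of m "F - G"] by (simp only:)
  qed
  show ?thesis
    unfolding hconv_def
  proof (intro conjI allI)
    fix Y
    show "(\<lambda>m. inner (solop s \<Omega> (Am m) F - solop s \<Omega> A F) Y) \<longlonglongrightarrow> 0"
      by (rule approx[of "\<lambda>m G. solop s \<Omega> (Am m) G - solop s \<Omega> A G", OF 1]) (simp add: hconv_def)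
  next
    fix Y
    show "(\<lambda>m. inner (flux s \<Omega> (Am m) F - flux s \<Omega> A F) Y) \<longlonglongrightarrow> 0"
      by (rule approx[of "\<lambda>m G. flux s \<Omega> (Am m) G - flux s \<Omega> A G", OF 2]) (simp add: hconv_def)
  qed
qed

end

section \<open>The metric\<close>

lemma countable_rational_points: "countable {a::'a::euclidean_space. \<forall>i\<in>Basis. inner a i \<in> \<rat>}"
proof (rule countable_subset)
  show "{a::'a. \<forall>i\<in>Basis. inner a i \<in> \<rat>} \<subseteq> (\<lambda>f. \<Sum>i\<in>Basis. f i *\<^sub>R i) ` (Basis \<rightarrow>\<^sub>E \<rat>)"
  proof
    fix a :: 'a assume a: "a \<in> {a. \<forall>i\<in>Basis. inner a i \<in> \<rat>}"
    have "a = (\<Sum>i\<in>Basis. (restrict (inner a) Basis) i *\<^sub>R i)"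
      using euclidean_representation[of a] by simp
    moreover have "restrict (inner a) Basis \<in> Basis \<rightarrow>\<^sub>E \<rat>" using a by auto
    ultimately show "a \<in> (\<lambda>f. \<Sum>i\<in>Basis. f i *\<^sub>R i) ` (Basis \<rightarrow>\<^sub>E \<rat>)" by (rule image_eqI)
  qed
  show "countable ((\<lambda>f. \<Sum>i\<in>Basis. f i *\<^sub>R i :: 'a) ` (Basis \<rightarrow>\<^sub>E \<rat>))"
    by (intro countable_image countable_PiE countable_rat) simp
qed

text \<open>A linear map that kills all fractional gradients at \<open>x\<close> kills the kernel, by choosing bumps
  concentrated away from \<open>x\<close>, where the gradient is an average of the kernel.\<close>

lemma frac_grad_bumps_separate:
  fixes N :: "'a::euclidean_space \<Rightarrow>\<^sub>L 'a"
  assumes s: "0 < s" "s < 1" and \<Omega>: "open \<Omega>" and x: "x \<in> \<Omega>"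
    and zero: "\<And>a b. \<forall>i\<in>Basis. inner a i \<in> \<rat> \<Longrightarrow> \<forall>i\<in>Basis. inner b i \<in> \<rat> \<Longrightarrow> cbox a b \<subseteq> \<Omega>
        \<Longrightarrow> blinfun_apply N (frac_grad s (bump a b 1) x) = 0"
  shows "blinfun_apply N e = 0"
proof (rule ccontr)
  assume Ne: "blinfun_apply N e \<noteq> 0"
  then have e: "e \<noteq> 0" by auto
  obtain r0 where r0: "r0 > 0" "ball x r0 \<subseteq> \<Omega>" using \<Omega> x open_contains_ball by metis
  \<comment> \<open>Places y0 at distance r0 / 2 from x in the direction opposite to e, hence inside
    \<Omega>; the kernel at x - y0 is then a positive multiple of e.\<close>
  define \<delta> where "\<delta> = r0 / 2 / norm e"
  have \<delta>: "\<delta> > 0" using r0 e by (simp add: \<delta>_def)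
  define y0 where "y0 = x - \<delta> *\<^sub>R e"
  have "norm (\<delta> *\<^sub>R e) = r0 / 2" using r0(1) e by (simp add: \<delta>_def)
  then have y0\<Omega>: "y0 \<in> \<Omega>" using r0 by (intro subsetD[OF r0(2)]) (simp add: y0_def dist_norm)
  \<comment> \<open>The scalar product with the image of e is positive at e itself. It reduces the
    vector identity to a sign argument for the scalar function m.\<close>
  define T where "T v = inner (blinfun_apply N v) (blinfun_apply N e)" for v
  have T: "bounded_linear T" unfolding T_def
    by (rule bounded_linear_compose[OF bounded_linear_inner_left blinfun.bounded_linear_right])
  interpret T: bounded_linear T by (rule T)
  define m where "m y = T (frac_kernel s (x - y))" for y
  have m0: "m y0 > 0"
  proof -
    have "m y0 = 1 / norm (\<delta> *\<^sub>R e) powr (real DIM('a) + s + 1) * (\<delta> * T e)"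
      unfolding m_def y0_def frac_kernel_def by (simp add: T.scaleR)
    moreover have "T e > 0" using Ne by (simp add: T_def)
    moreover have "norm (\<delta> *\<^sub>R e) powr (real DIM('a) + s + 1) > 0" using \<delta> e by simp
    ultimately show ?thesis using \<delta> by (simp add: mult_pos_pos)
  qed
  \<comment> \<open>The kernel is zero at the origin, so x lies in no box on which m is positive;
    hence the bump vanishes at x and only one term of the increment remains.\<close>
  have mx: "m x = 0" unfolding m_def frac_kernel_def by (simp add: T.zero)
  have "isCont m y0"
  proof -
    have "x - y0 \<noteq> 0" using \<delta> e by (simp add: y0_def)
    then have "isCont (\<lambda>y. frac_kernel s (x - y)) y0" unfolding frac_kernel_def
      by (intro continuous_intros) auto
    then show ?thesis unfolding m_def by (rule T.isCont)
  qed
  then have "(m \<longlongrightarrow> m y0) (nhds y0)" using isCont_def tendsto_at_iff_tendsto_nhds by blast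
  then have "\<forall>\<^sub>F y in nhds y0. 0 < m y" using m0 by (rule order_tendstoD)
  moreover have "\<forall>\<^sub>F y in nhds y0. y \<in> \<Omega>" using \<Omega> y0\<Omega> by (rule eventually_nhds_in_open)
  ultimately have "\<forall>\<^sub>F y in nhds y0. 0 < m y \<and> y \<in> \<Omega>" by (rule eventually_conj)
  then obtain r where r: "r > 0" "\<And>y. dist y y0 < r \<Longrightarrow> 0 < m y \<and> y \<in> \<Omega>"
    unfolding eventually_nhds_metric by blast
  \<comment> \<open>Rational corners, because the hypothesis holds off a common null set for
    countably many bumps only.\<close>
  obtain a b where ab: "\<forall>i\<in>Basis. inner a i \<in> \<rat> \<and> inner b i \<in> \<rat>" "y0 \<in> box a b" "box a b \<subseteq> ball y0 (r / 2)"
    using rational_boxes[of "r / 2" y0] r(1) by auto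
  have "cbox a b = closure (box a b)" using closure_box ab(2) by blast
  also have "\<dots> \<subseteq> cball y0 (r / 2)" using ab(3) ball_subset_cball by (intro closure_minimal) auto
  also have "\<dots> \<subseteq> ball y0 r" using r(1) by auto
  finally have cb: "cbox a b \<subseteq> ball y0 r" .
  have mpos: "0 < m y" "y \<in> \<Omega>" if "y \<in> cbox a b" for y
    using r(2)[of y] subsetD[OF cb that] by (simp_all add: dist_commute)
  define \<phi> where "\<phi> = bump a b 1"
  have l: "lipc \<phi>" unfolding \<phi>_def by (rule lipc_bump) simp
  have \<phi>0: "\<phi> y = 0" if "y \<notin> box a b" for y unfolding \<phi>_def using that by (intro bump_outside) auto
  have \<phi>nn: "0 \<le> \<phi> y" for y unfolding \<phi>_def by (rule bump_nonneg)
  have xbox: "x \<notin> box a b" using mpos(1)[of x] mx box_subset_cbox by force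
  have "blinfun_apply N (frac_grad s \<phi> x) = 0" unfolding \<phi>_def using ab(1) mpos(2) by (intro zero) auto
  then have "mu_s s DIM('a) * T (frac_int s \<phi> x) = 0"
    unfolding frac_grad_eq_frac_int[OF l] T_def by (auto simp: blinfun.scaleR_right)
  then have T0: "T (frac_int s \<phi> x) = 0" using mu_s_pos[OF s, where 'a='a] by simp
  have int: "integrable lborel (\<lambda>z. (\<phi> x - \<phi> (x - z)) *\<^sub>R frac_kernel s z)"
    by (rule frac_int_integrand_integrable[OF s l])
  have I0: "integral\<^sup>L lborel (\<lambda>z. T ((\<phi> x - \<phi> (x - z)) *\<^sub>R frac_kernel s z)) = 0"
    unfolding integral_bounded_linear[OF T int] using T0 unfolding frac_int_def .
  have g: "T ((\<phi> x - \<phi> (x - z)) *\<^sub>R frac_kernel s z) = - (\<phi> (x - z) * m (x - z))" for z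
    unfolding m_def \<phi>0[OF xbox] by (simp add: T.scaleR T.neg)
  have intg: "integrable lborel (\<lambda>z. \<phi> (x - z) * m (x - z))"
    using integrable_minus[OF integrable_bounded_linear[OF T int]] unfolding g by simp
  have nn: "0 \<le> \<phi> (x - z) * m (x - z)" for z
  proof (cases "x - z \<in> box a b")
    case True
    then have "0 < m (x - z)" using mpos(1) box_subset_cbox by blast
    then show ?thesis using \<phi>nn[of "x - z"] by simp
  qed (simp add: \<phi>0)
  have "integral\<^sup>L lborel (\<lambda>z. \<phi> (x - z) * m (x - z)) = 0" using I0 unfolding g by simp
  then have ae: "AE z in lborel. \<phi> (x - z) * m (x - z) = 0"
    using integral_nonneg_eq_0_iff_AE[OF intg] nn by simp
  define U where "U = (\<lambda>z. x - z) -` box a b"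
  have U: "open U" unfolding U_def by (rule open_vimage[OF open_box]) (intro continuous_intros)
  have "x - y0 \<in> U" using ab(2) by (simp add: U_def)
  have "AE z in lborel. z \<notin> U"
    using ae
  proof eventually_elim
    case (elim z)
    have "\<phi> (x - z) * m (x - z) > 0" if "x - z \<in> box a b"
    proof (rule mult_pos_pos)
      show "\<phi> (x - z) > 0" unfolding \<phi>_def by (rule bump_pos[OF zero_less_one that])
      show "m (x - z) > 0" using that mpos(1) box_subset_cbox by blast
    qed
    then show ?case using elim unfolding U_def by auto
  qed
  then have "AE z in lebesgue. z \<notin> U" by (rule AE_completion)
  moreover have "U \<in> sets lebesgue" using U by (simp add: borel_open)
  ultimately have "U \<in> null_sets lebesgue" using AE_iff_null_sets by blast
  then have "negligible U" by (simp only: negligible_iff_null_sets)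
  then show False using open_not_negligible[OF U] \<open>x - y0 \<in> U\<close> by blast
qed

context fractional_problem
begin

text \<open>Every test function is the solution for A with a suitable right-hand side, so equal
  solutions and fluxes give equality of A and B on its fractional gradient. Restricting to the
  countably many bumps with rational corners leaves one null set, off which
  \<open>frac_grad_bumps_separate\<close> applies to A x - B x.\<close>

lemma coefficients_determined:
  assumes A: "A \<in> M" and B: "B \<in> M"
    and eq: "\<And>F. F \<in> V \<Longrightarrow> solop s \<Omega> A F = solop s \<Omega> B F" "\<And>F. F \<in> V \<Longrightarrow> flux s \<Omega> A F = flux s \<Omega> B F"
  shows "AE x in lebesgue. x \<in> \<Omega> \<longrightarrow> A x = B x"
proof -
  define Q where "Q = {a::'a. \<forall>i\<in>Basis. inner a i \<in> \<rat>}"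
  define P where "P = {p \<in> Q \<times> Q. cbox (fst p) (snd p) \<subseteq> \<Omega>}"
  have "countable (Q \<times> Q)" unfolding Q_def by (intro countable_SIGMA countable_rational_points)
  then have P: "countable P" unfolding P_def by (rule countable_subset[rotated]) auto
  let ?E = "\<lambda>x p. blinfun_apply (A x) (frac_grad s (bump (fst p) (snd p) 1) x) = blinfun_apply (B x) (frac_grad s (bump (fst p) (snd p) 1) x)"
  have "AE x in lebesgue. \<forall>p\<in>P. ?E x p"
  proof (rule AE_ball_countable'[OF _ P])
    fix p assume "p \<in> P"
    then have \<phi>: "bump (fst p) (snd p) 1 \<in> Cc_inf \<Omega>" by (intro bump_Cc_inf) (auto simp: P_def)
    define \<phi> where "\<phi> = bump (fst p) (snd p) 1"
    have \<phi>C: "\<phi> \<in> Cc_inf \<Omega>" unfolding \<phi>_def by (rule \<phi>)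
    let ?X = "graph s \<phi>"
    have XV: "?X \<in> V" using emb_V[OF Cc_inf_H0s(1)[OF s \<phi>C]] by (simp only: Cc_inf_H0s(2)[OF s \<phi>C])
    have "bounded_linear (\<lambda>Y. inner (mulop A (grad ?X)) (grad Y))"
      by (rule bounded_linear_compose[OF bounded_linear_inner_right bounded_linear_grad])
    \<comment> \<open>The right-hand side is manufactured: F represents the functional for which the
      graph of \<phi> is the solution with coefficient A.\<close>
    then obtain F where F: "F \<in> V" "\<And>Y. Y \<in> V \<Longrightarrow> inner (mulop A (grad ?X)) (grad Y) = inner F Y"
      using riesz_ex by metis
    have SA: "solop s \<Omega> A F = ?X" by (rule solop_unique[OF A XV F(2)])
    then have SB: "solop s \<Omega> B F = ?X" using eq(1)[OF F(1)] by simp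
    have "mulop A (grad ?X) = mulop B (grad ?X)" using eq(2)[OF F(1)] unfolding flux_def SA SB .
    note L = Cc_inf_L2(2)[OF s \<phi>C]
    have mk: "mk (\<lambda>x. blinfun_apply (A x) (frac_grad s \<phi> x)) = mk (\<lambda>x. blinfun_apply (B x) (frac_grad s \<phi> x))"
      using \<open>mulop A (grad ?X) = mulop B (grad ?X)\<close>
      unfolding grad_graph[OF s \<phi>C] mulop_mk[OF \<alpha>\<beta> A L] mulop_mk[OF \<alpha>\<beta> B L] .
    show "AE x in lebesgue. ?E x p"
      by (rule iffD1[OF mk_eq_iff[OF L2_mul[OF \<alpha>\<beta> A L] L2_mul[OF \<alpha>\<beta> B L]] mk, unfolded \<phi>_def])
  qed
  then show ?thesis
  proof eventually_elim
    case (elim x)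
    show ?case
    proof
      assume x: "x \<in> \<Omega>"
      show "A x = B x"
      proof (rule blinfun_eqI)
        fix e
        have "blinfun_apply (A x - B x) e = 0"
        proof (rule frac_grad_bumps_separate[OF s \<Omega>(1) x])
          fix a b :: 'a
          assume "\<forall>i\<in>Basis. inner a i \<in> \<rat>" "\<forall>i\<in>Basis. inner b i \<in> \<rat>" "cbox a b \<subseteq> \<Omega>"
          then have "(a, b) \<in> P" by (simp add: P_def Q_def)
          from bspec[OF elim this] show "blinfun_apply (A x - B x) (frac_grad s (bump a b 1) x) = 0"
            by (simp add: blinfun.diff_left)
        qed
        then show "blinfun_apply (A x) e = blinfun_apply (B x) e" by (simp add: blinfun.diff_left)
      qed
    qed
  qed
qed

lemma dist_term_AE_eq:
  assumes A: "A \<in> M" and B: "B \<in> M" and AB: "AE x in lebesgue. A x = B x"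
  shows "dist_term s \<Omega> F A B = 0"
proof -
  have m: "mulop A G = mulop B G" for G
    unfolding mulop_def
  proof (rule mk_AE_cong[OF L2_mul[OF \<alpha>\<beta> A L2_fn] L2_mul[OF \<alpha>\<beta> B L2_fn]])
    show "AE x in lebesgue. blinfun_apply (A x) (fn G x) = blinfun_apply (B x) (fn G x)"
      using AB by eventually_elim simp
  qed
  have S: "solop s \<Omega> A F = solop s \<Omega> B F" unfolding solop_def m ..
  have "flux_norm s \<Omega> (0 :: ('a, 'a) l2) = 0"
    using flux_norm_le[of 0] flux_norm_nonneg[of 0] by simp
  then show ?thesis unfolding dist_term_def flux_def S m by (simp add: val_simps(4))
qed

end

section \<open>The metric for a dense sequence of right-hand sides\<close>

locale fractional_metric = fractional_problem s \<alpha> \<beta> \<Omega> for s \<alpha> \<beta> and \<Omega> :: "'a::euclidean_space set" +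
  fixes A0 :: "'a \<Rightarrow> ('a \<Rightarrow>\<^sub>L 'a)" and f :: "nat \<Rightarrow> (('a \<Rightarrow> real) \<Rightarrow> real)"
  assumes f: "\<And>n. f n \<in> Hminus s \<Omega>"
    and f_nz: "\<And>n. \<exists>v\<in>H0s s \<Omega>. f n v \<noteq> 0"
    and f_dense: "\<And>g \<epsilon>. g \<in> Hminus s \<Omega> \<Longrightarrow> \<epsilon> > 0 \<Longrightarrow> \<exists>n. dual_norm s \<Omega> (\<lambda>v. g v - f n v) < \<epsilon>"
begin

abbreviation "M0 \<equiv> Mcoef0 \<alpha> \<beta> \<Omega> A0"
abbreviation "R n \<equiv> riesz s \<Omega> (f n)"

lemma M0_M: "A \<in> M0 \<Longrightarrow> A \<in> M"
  by (simp add: Mcoef0_def)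

lemma M0_outside:
  assumes "A \<in> M0" "B \<in> M0" shows "AE x in lebesgue. x \<notin> \<Omega> \<longrightarrow> A x = B x"
proof -
  have "AE x in lebesgue. x \<notin> \<Omega> \<longrightarrow> A x = A0 x" "AE x in lebesgue. x \<notin> \<Omega> \<longrightarrow> B x = A0 x"
    using assms by (simp_all add: Mcoef0_def)
  then show ?thesis by eventually_elim simp
qed

lemma R_nz: "R n \<noteq> 0"
proof
  assume 0: "R n = 0"
  obtain v where "v \<in> H0s s \<Omega>" "f n v \<noteq> 0" using f_nz by blast
  then show False using riesz_eq[OF f, of v n] 0 by simp
qed

lemma R_dense:
  assumes F: "F \<in> V" and e: "e > 0" shows "\<exists>n. norm (F - R n) < e"
proof -
  obtain n where "dual_norm s \<Omega> (\<lambda>v. inner F (emb s v) - f n v) < e"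
    using f_dense[OF inner_Hminus e, of F] by blast
  then show ?thesis unfolding Hminus_diff[OF f inner_Hminus] riesz_unique[OF F refl] by blast
qed

lemma dist_summable:
  assumes A: "A \<in> M" and B: "B \<in> M"
  shows "summable (\<lambda>n. (1/2) ^ Suc n * dist_term s \<Omega> (R n) A B)"
proof -
  obtain K where K: "\<And>A B F. A \<in> M \<Longrightarrow> B \<in> M \<Longrightarrow> dist_term s \<Omega> F A B \<le> K" using dist_term_bound by metis
  show ?thesis
  proof (rule summable_comparison_test'[of "\<lambda>n. (1/2) ^ Suc n * K" 0])
    show "summable (\<lambda>n. (1/2::real) ^ Suc n * K)"
      by (intro summable_mult2) (simp add: summable_geometric summable_mult)
    show "norm ((1/2) ^ Suc n * dist_term s \<Omega> (R n) A B) \<le> (1/2) ^ Suc n * K" for n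
    proof -
      have "(1/2) ^ Suc n * dist_term s \<Omega> (R n) A B \<le> (1/2) ^ Suc n * K" by (intro mult_left_mono K A B) simp
      moreover have "0 \<le> (1/2) ^ Suc n * dist_term s \<Omega> (R n) A B" by (intro mult_nonneg_nonneg dist_term_nonneg) simp
      ultimately show ?thesis by (simp only: real_norm_def abs_of_nonneg)
    qed
  qed
qed

lemma dist_nonneg_term: "0 \<le> (1/2::real) ^ Suc n * dist_term s \<Omega> F A B"
  by (intro mult_nonneg_nonneg dist_term_nonneg) simp

text \<open>In a series of nonnegative terms each one is at most the sum; the exponent is
  \<open>Suc n\<close> because the family starts at index 0 with weight 1/2.\<close>

lemma dist_term_le:
  assumes A: "A \<in> M" and B: "B \<in> M"
  shows "dist_term s \<Omega> (R n) A B \<le> 2 ^ Suc n * d_s s \<Omega> f A B"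
proof -
  have "(1/2) ^ Suc n * dist_term s \<Omega> (R n) A B \<le> d_s s \<Omega> f A B"
    unfolding d_s_eq[OF A B f]
    using sum_le_suminf[OF dist_summable[OF A B], of "{n}"] dist_nonneg_term by simp
  then have "2 ^ Suc n * ((1/2) ^ Suc n * dist_term s \<Omega> (R n) A B) \<le> 2 ^ Suc n * d_s s \<Omega> f A B"
    by (intro mult_left_mono) simp_all
  moreover have "2 ^ Suc n * ((1/2::real) ^ Suc n) = 1" by (simp add: power_one_over)
  ultimately show ?thesis by (simp only: mult.assoc[symmetric] mult_1_left)
qed

lemma d_s_null_imp_hconv:
  assumes Am: "\<And>m. Am m \<in> M0" and A: "A \<in> M0" and d: "(\<lambda>m. d_s s \<Omega> f (Am m) A) \<longlonglongrightarrow> 0" and F: "F \<in> V"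
  shows "hconv s \<Omega> Am A F"
proof (rule hconv_dense[OF M0_M[OF Am] M0_M[OF A]])
  fix e :: real assume "e > 0"
  then obtain n where n: "norm (F - R n) < e" using R_dense[OF F] by blast
  have "(\<lambda>m. dist_term s \<Omega> (R n) (Am m) A) \<longlonglongrightarrow> 0"
  proof (rule null_comparison[OF tendsto_mult_right_zero[OF d, of "2 ^ Suc n"]])
    show "norm (dist_term s \<Omega> (R n) (Am m) A) \<le> 2 ^ Suc n * d_s s \<Omega> f (Am m) A" for m
      unfolding real_norm_def abs_of_nonneg[OF dist_term_nonneg] by (rule dist_term_le[OF M0_M[OF Am] M0_M[OF A]])
  qed
  then have "hconv s \<Omega> Am A (R n)" by (rule dist_term_hconv[OF M0_M[OF Am] M0_M[OF A] M0_outside[OF Am A] R_nz])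
  with n show "\<exists>G. hconv s \<Omega> Am A G \<and> norm (F - G) < e" by blast
qed

text \<open>The bound K is uniform in both indices, so the weights provide a summable majorant and
  the limit is taken term by term.\<close>

lemma hconv_imp_d_s_null:
  assumes Am: "\<And>m. Am m \<in> M" and A: "A \<in> M" and H: "\<And>F. F \<in> V \<Longrightarrow> hconv s \<Omega> Am A F"
  shows "(\<lambda>m. d_s s \<Omega> f (Am m) A) \<longlonglongrightarrow> 0"
proof -
  obtain K where K: "\<And>A B F. A \<in> M \<Longrightarrow> B \<in> M \<Longrightarrow> dist_term s \<Omega> F A B \<le> K" using dist_term_bound by metis
  let ?a = "\<lambda>n m. (1/2) ^ Suc n * dist_term s \<Omega> (R n) (Am m) A"
  have lim: "(\<lambda>m. ?a n m) \<longlonglongrightarrow> 0" for n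
    by (rule tendsto_mult_right_zero[OF hconv_dist_term[OF Am A H[OF riesz_in[OF f]]]])
  have bd: "norm (?a n m) \<le> (1/2) ^ Suc n * K" for n m
    unfolding real_norm_def abs_of_nonneg[OF dist_nonneg_term] by (intro mult_left_mono K Am A) simp
  have bound: "\<forall>\<^sub>F (n, m) in at_top \<times>\<^sub>F sequentially. norm (?a n m) \<le> (1/2) ^ Suc n * K"
    by (intro always_eventually allI) (simp only: case_prod_beta bd)
  have sK: "summable (\<lambda>n. (1/2::real) ^ Suc n * K)"
    by (intro summable_mult2) (simp add: summable_geometric summable_mult)
  have "(\<lambda>m. suminf (\<lambda>n. ?a n m)) \<longlonglongrightarrow> suminf (\<lambda>n. 0::real)"
    using tannerys_theorem[of ?a "\<lambda>n. 0", OF lim bound sK] by simp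
  then show ?thesis unfolding d_s_eq[OF Am A f] by simp
qed

text \<open>Zero distance is read as convergence of the constant sequence A to B. Convergence of a
  constant sequence is equality of solutions and of fluxes, and density has already extended it from
  the given functionals to every right-hand side.\<close>

lemma d_s_eq_0_iff:
  assumes A: "A \<in> M0" and B: "B \<in> M0"
  shows "d_s s \<Omega> f A B = 0 \<longleftrightarrow> (AE x in lebesgue. A x = B x)"
proof
  assume AB: "AE x in lebesgue. A x = B x"
  show "d_s s \<Omega> f A B = 0" unfolding d_s_eq[OF M0_M[OF A] M0_M[OF B] f] dist_term_AE_eq[OF M0_M[OF A] M0_M[OF B] AB] by simp
next
  assume d: "d_s s \<Omega> f A B = 0"
  have H: "hconv s \<Omega> (\<lambda>m. A) B F" if "F \<in> V" for F
    by (rule d_s_null_imp_hconv[OF A B _ that]) (simp only: d tendsto_const)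
  have zero: "W = 0" if "\<And>Y. (\<lambda>m::nat. inner W Y) \<longlonglongrightarrow> 0" for W :: "'h::real_inner"
  proof -
    have "inner W W = 0" using LIMSEQ_unique[OF tendsto_const that[of W]] .
    then show ?thesis by simp
  qed
  have "AE x in lebesgue. x \<in> \<Omega> \<longrightarrow> A x = B x"
  proof (rule coefficients_determined[OF M0_M[OF A] M0_M[OF B]])
    fix F assume F: "F \<in> V"
    have "solop s \<Omega> A F - solop s \<Omega> B F = 0" by (rule zero) (use H[OF F] in \<open>simp add: hconv_def\<close>)
    then show "solop s \<Omega> A F = solop s \<Omega> B F" by simp
    have "flux s \<Omega> A F - flux s \<Omega> B F = 0" by (rule zero) (use H[OF F] in \<open>simp add: hconv_def\<close>)
    then show "flux s \<Omega> A F = flux s \<Omega> B F" by simp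
  qed
  with M0_outside[OF A B] show "AE x in lebesgue. A x = B x" by eventually_elim blast
qed

lemma d_s_nonneg: "A \<in> M \<Longrightarrow> B \<in> M \<Longrightarrow> 0 \<le> d_s s \<Omega> f A B"
  unfolding d_s_eq[OF _ _ f] by (intro suminf_nonneg dist_summable dist_nonneg_term)

lemma d_s_commute: "A \<in> M \<Longrightarrow> B \<in> M \<Longrightarrow> d_s s \<Omega> f A B = d_s s \<Omega> f B A"
  by (simp only: d_s_eq[OF _ _ f] dist_term_commute[of _ A B])

lemma d_s_triangle:
  assumes A: "A \<in> M" and B: "B \<in> M" and C: "C \<in> M"
  shows "d_s s \<Omega> f A C \<le> d_s s \<Omega> f A B + d_s s \<Omega> f B C"
proof -
  have "(\<Sum>n. (1/2) ^ Suc n * dist_term s \<Omega> (R n) A C)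
    \<le> (\<Sum>n. (1/2) ^ Suc n * dist_term s \<Omega> (R n) A B + (1/2) ^ Suc n * dist_term s \<Omega> (R n) B C)"
  proof (rule suminf_le[OF _ dist_summable[OF A C] summable_add[OF dist_summable[OF A B] dist_summable[OF B C]]])
    fix n
    have "(1/2) ^ Suc n * dist_term s \<Omega> (R n) A C \<le> (1/2) ^ Suc n * (dist_term s \<Omega> (R n) A B + dist_term s \<Omega> (R n) B C)"
      by (rule mult_left_mono[OF dist_term_triangle]) simp
    then show "(1/2) ^ Suc n * dist_term s \<Omega> (R n) A C
      \<le> (1/2) ^ Suc n * dist_term s \<Omega> (R n) A B + (1/2) ^ Suc n * dist_term s \<Omega> (R n) B C"
      by (simp only: distrib_left)
  qed
  then show ?thesis
    unfolding d_s_eq[OF A B f] d_s_eq[OF A C f] d_s_eq[OF B C f]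
      suminf_add[OF dist_summable[OF A B] dist_summable[OF B C]] .
qed

lemma d_s_metrizes:
  assumes Am: "\<And>m. Am m \<in> M0" and A: "A \<in> M0"
  shows "(\<lambda>m. d_s s \<Omega> f (Am m) A) \<longlonglongrightarrow> 0 \<longleftrightarrow> Hs_converges s \<Omega> Am A"
  unfolding Hs_converges_iff[OF M0_M[OF Am] M0_M[OF A]]
proof
  assume "(\<lambda>m. d_s s \<Omega> f (Am m) A) \<longlonglongrightarrow> 0"
  from d_s_null_imp_hconv[OF Am A this] show "\<forall>F\<in>V. hconv s \<Omega> Am A F" by (rule ballI)
next
  assume "\<forall>F\<in>V. hconv s \<Omega> Am A F"
  from hconv_imp_d_s_null[OF M0_M[OF Am] M0_M[OF A] bspec[OF this]]
  show "(\<lambda>m. d_s s \<Omega> f (Am m) A) \<longlonglongrightarrow> 0" .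
qed

end

theorem theorem3p7:
  fixes s \<alpha> \<beta> :: real
    and \<Omega> :: "'a::euclidean_space set"
    and A0 :: "'a \<Rightarrow> ('a \<Rightarrow>\<^sub>L 'a)"
    and f :: "nat \<Rightarrow> (('a \<Rightarrow> real) \<Rightarrow> real)"
  assumes "0 < s" "s < 1" "0 < \<alpha>" "\<alpha> \<le> \<beta>"
    and "open \<Omega>" "bounded \<Omega>"
    and "A0 \<in> Mcoef \<alpha> \<beta> UNIV"
    and "\<And>n. f n \<in> Hminus s \<Omega>"
    and "\<And>n. \<exists>v\<in>H0s s \<Omega>. f n v \<noteq> 0"
    and "\<And>g \<epsilon>. g \<in> Hminus s \<Omega> \<Longrightarrow> \<epsilon> > 0 \<Longrightarrow> \<exists>n. dual_norm s \<Omega> (\<lambda>v. g v - f n v) < \<epsilon>"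
  shows "(\<forall>A\<in>Mcoef0 \<alpha> \<beta> \<Omega> A0. \<forall>B\<in>Mcoef0 \<alpha> \<beta> \<Omega> A0.
            0 \<le> d_s s \<Omega> f A B \<and>
            d_s s \<Omega> f A B = d_s s \<Omega> f B A \<and>
            (d_s s \<Omega> f A B = 0 \<longleftrightarrow> (AE x in lebesgue. A x = B x)) \<and>
            (\<forall>C\<in>Mcoef0 \<alpha> \<beta> \<Omega> A0. d_s s \<Omega> f A C \<le> d_s s \<Omega> f A B + d_s s \<Omega> f B C))
       \<and> (\<forall>Am A. (\<forall>m. Am m \<in> Mcoef0 \<alpha> \<beta> \<Omega> A0) \<longrightarrow> A \<in> Mcoef0 \<alpha> \<beta> \<Omega> A0 \<longrightarrow>
            (((\<lambda>m. d_s s \<Omega> f (Am m) A) \<longlonglongrightarrow> 0) \<longleftrightarrow> Hs_converges s \<Omega> Am A))"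
proof -
  interpret fractional_metric s \<alpha> \<beta> \<Omega> A0 f
    by unfold_locales (rule assms; assumption?)+
  show ?thesis
  proof (intro conjI ballI allI impI)
    fix A B assume "A \<in> M0" "B \<in> M0"
    note A = M0_M[OF \<open>A \<in> M0\<close>] and B = M0_M[OF \<open>B \<in> M0\<close>]
    show "0 \<le> d_s s \<Omega> f A B" by (rule d_s_nonneg[OF A B])
    show "d_s s \<Omega> f A B = d_s s \<Omega> f B A" by (rule d_s_commute[OF A B])
    show "d_s s \<Omega> f A B = 0 \<longleftrightarrow> (AE x in lebesgue. A x = B x)" by (rule d_s_eq_0_iff) fact+
    show "d_s s \<Omega> f A C \<le> d_s s \<Omega> f A B + d_s s \<Omega> f B C" if "C \<in> M0" for C
      by (rule d_s_triangle[OF A B M0_M[OF that]])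
  next
    fix Am :: "nat \<Rightarrow> 'a \<Rightarrow> ('a \<Rightarrow>\<^sub>L 'a)" and A assume "\<forall>m. Am m \<in> M0" and A: "A \<in> M0"
    then show "((\<lambda>m. d_s s \<Omega> f (Am m) A) \<longlonglongrightarrow> 0) \<longleftrightarrow> Hs_converges s \<Omega> Am A"
      by (intro d_s_metrizes A) blast
  qed
qed

end
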